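(* Let $M_N=\frac1{\sqrt N}W_N+A_N$ be the deformed Wigner model described in the context, let $g_N(z)=\mathbb{E}\big[\frac1N\mathrm{Tr}\,(zI_N-M_N)^{-1}\big]$, and let $\tilde g_N$ be the Stieltjes transform of $\mu_\sigma\boxplus\mu_{A_N}$. For $z\in\mathbb{C}^+$, $$g_N(z)-\tilde g_N(z)+\frac{\tilde E_N(z)}{N}=O\Big(\frac1{N^2}\Big),$$ where $\tilde E_N(z)=\{\sigma^2\tilde g_N'(z)-1\}\tilde L_N(z)$ with $$\tilde L_N(z)=\frac{\kappa_4}{2N^2}\sum_{i,l=1}^N\big[(G_{A_N}(w))^2\big]_{ii}\,\big[G_{A_N}(w)\big]_{ii}\,\big(\big[G_{A_N}(w)\big]_{ll}\big)^2,\qquad w=z-\sigma^2\tilde g_N(z).$$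
   Context: Model. $\sigma>0$. $W_N$ is an $N\times N$ random Hermitian matrix such that the random variables $(W_N)_{ii}$ ($1\le i\le N$), $\sqrt2\,\Re((W_N)_{ij})_{i<j}$, $\sqrt2\,\Im((W_N)_{ij})_{i<j}$ are i.i.d. with distribution $\mu$; $\mu$ is a symmetric probability measure on $\mathbb{R}$ of mean zero and variance $\sigma^2$ satisfying a Poincaré inequality: there is $C>0$ such that for every $C^1$ function $f:\mathbb{R}\to\mathbb{C}$ with $f,f'\in L^2(\mu)$, $\int|f-\int f\,d\mu|^2d\mu\le C\int|f'|^2d\mu$. $\kappa_4$ is the fourth cumulant of $\mu$. $A_N$ is a deterministic $N\times N$ Hermitian matrix whose spectral measure $\mu_{A_N}=\frac1N\sum_{i=1}^N\delta_{\gamma_i}$ ($\gamma_i=\gamma_i^{(N)}$ the eigenvalues of $A_N$) converges weakly to a compactly supported probability measure $\nu$. There is a fixed integer $r\ge0$ such that $A_N$ has $N-r$ eigenvalues $\beta_j(N)$ with $\max_{1\le j\le N-r}\mathrm{dist}(\beta_j(N),\mathrm{supp}(\nu))\to0$; the other $r$ eigenvalues are given by fixed real numbers $\theta_1>\dots>\theta_J$, independent of $N$, outside $\mathrm{supp}(\nu)$, each $\theta_j$ being an eigenvalue of $A_N$ with fixed multiplicity $k_j$, $\sum_{j=1}^Jk_j=r$. $\mathbb{C}^+=\{z:\Im z>0\}$. $G_{A_N}(w)=(wI_N-A_N)^{-1}$. The Stieltjes transform of a probability measure $\tau$ is $g_\tau(z)=\int\frac{d\tau(x)}{z-x}$. $\mu_\sigma$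 is the semicircle distribution with density $\frac{1}{2\pi\sigma^2}\sqrt{4\sigma^2-x^2}\,\mathbf 1_{[-2\sigma,2\sigma]}(x)$; $\boxplus$ is free additive convolution. A quantity $\Delta_N(z)$ is $O(N^{-p})$ if $|\Delta_N(z)|\le P(|\Im z|^{-1})/N^p$ for some polynomial $P$ with nonnegative coefficients independent of $N$ (and of $z$). *)

theory Defs
  imports
    "HOL-Probability.Probability"
    "HOL-Computational_Algebra.Computational_Algebra"
    "Jordan_Normal_Form.Char_Poly"
    "Jordan_Normal_Form.Gauss_Jordan_Elimination"
    "Jordan_Normal_Form.Schur_Decomposition"
begin

definition hermitian_mat :: "complex mat \<Rightarrow> bool" where
  "hermitian_mat A \<longleftrightarrow> square_mat A \<and> mat_adjoint A = A"

definition mat_trace :: "'a::comm_monoid_add mat \<Rightarrow> 'a" where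
  "mat_trace A = (\<Sum>i<dim_row A. A $$ (i, i))"

text \<open>
  \<^term>\<open>mat_inverse\<close> is partial. The resolvent is only used where \<^term>\<open>z\<close> is not an
  eigenvalue (Hermitian matrix, non-real \<^term>\<open>z\<close>), so that the inverse exists.
\<close>
definition resolvent :: "complex mat \<Rightarrow> complex \<Rightarrow> complex mat" where
  "resolvent A z = the (mat_inverse (z \<cdot>\<^sub>m 1\<^sub>m (dim_row A) - A))"

text \<open>
  The uniform probability measure on the eigenvalues of a Hermitian matrix, counted with their
  multiplicity as roots of the characteristic polynomial; \<^term>\<open>Re\<close> only changes the type, since
  these eigenvalues are real.
\<close>
definition spectral_measure :: "complex mat \<Rightarrow> real measure" where
  "spectral_measure A =
     distr (measure_pmf (pmf_of_multiset (image_mset Re (proots (char_poly A))))) borel (\<lambda>x. x)"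

definition msupport :: "real measure \<Rightarrow> real set" where
  "msupport \<mu> = {x. \<forall>e>0. measure \<mu> (ball x e) > 0}"

definition satisfies_poincare :: "real measure \<Rightarrow> bool" where
  "satisfies_poincare \<mu> \<longleftrightarrow>
     (\<exists>C>0. \<forall>(f :: real \<Rightarrow> complex) f'.
        (\<forall>x. (f has_vector_derivative f' x) (at x)) \<longrightarrow> continuous_on UNIV f' \<longrightarrow>
        integrable \<mu> (\<lambda>x. (cmod (f x))\<^sup>2) \<longrightarrow> integrable \<mu> (\<lambda>x. (cmod (f' x))\<^sup>2) \<longrightarrow>
        (LINT x|\<mu>. (cmod (f x - (LINT y|\<mu>. f y)))\<^sup>2) \<le> C * (LINT x|\<mu>. (cmod (f' x))\<^sup>2))"

text \<open>
  The cumulant generating series is the formal logarithm of the moment generating series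
  \<open>1 + m\<^sub>1 t + m\<^sub>2 t\<^sup>2 / 2! + \<dots>\<close>; the \<open>n\<close>-th cumulant is \<open>n!\<close> times its \<open>n\<close>-th coefficient.
\<close>
definition moment_series :: "real measure \<Rightarrow> real fps" where
  "moment_series \<mu> = Abs_fps (\<lambda>n. (LINT x|\<mu>. x ^ n) / fact n)"

definition cumulant :: "real measure \<Rightarrow> nat \<Rightarrow> real" where
  "cumulant \<mu> n = fact n * fps_nth (fps_compose (fps_ln 1) (moment_series \<mu> - 1)) n"

definition semicircle :: "real \<Rightarrow> real measure" where
  "semicircle \<sigma> = density lborel (\<lambda>x. ennreal
     (indicator {-2 * \<sigma>..2 * \<sigma>} x * sqrt (4 * \<sigma>\<^sup>2 - x\<^sup>2) / (2 * pi * \<sigma>\<^sup>2)))"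

definition stieltjes :: "real measure \<Rightarrow> complex \<Rightarrow> complex" where
  "stieltjes \<tau> z = (LINT x|\<tau>. 1 / (z - complex_of_real x))"

definition trunc_cone :: "real \<Rightarrow> real \<Rightarrow> complex set" where
  "trunc_cone a b = {z. \<bar>Re z\<bar> < a * Im z \<and> b < Im z}"

text \<open>
  The R-transform \<open>R(u) = K(u) - 1/u\<close>, where \<open>K\<close> is the inverse of the Stieltjes transform on a
  truncated cone. It is meaningful if the Stieltjes transform is injective on that cone and
  \<open>u\<close> lies in its image; both are required in the definition of free convolution below.
\<close>
definition R_transform :: "real measure \<Rightarrow> real \<Rightarrow> real \<Rightarrow> complex \<Rightarrow> complex" where
  "R_transform \<tau> a b u = inv_into (trunc_cone a b) (stieltjes \<tau>) u - 1 / u"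

text \<open>
  Voiculescu's analytic definition: \<open>\<rho> = \<mu> \<boxplus> \<nu>\<close> iff \<open>R\<^bsub>\<rho>\<^esub> = R\<^bsub>\<mu>\<^esub> + R\<^bsub>\<nu>\<^esub>\<close> on a common domain, here
  the set of inverses of a truncated cone \<open>trunc_cone c d\<close>. It is open, connected and has 0 as a
  boundary point, so the relation does not depend on the choice of cones.
\<close>
definition is_free_convolution ::
    "real measure \<Rightarrow> real measure \<Rightarrow> real measure \<Rightarrow> bool" where
  "is_free_convolution \<mu> \<nu> \<rho> \<longleftrightarrow>
     real_distribution \<rho> \<and>
     (\<exists>a>0. \<exists>b>0. \<exists>c>0. \<exists>d>0.
        (\<forall>\<tau>\<in>{\<mu>, \<nu>, \<rho>}. inj_on (stieltjes \<tau>) (trunc_cone a b) \<and>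
           inverse ` trunc_cone c d \<subseteq> stieltjes \<tau> ` trunc_cone a b) \<and>
        (\<forall>u \<in> inverse ` trunc_cone c d.
           R_transform \<rho> a b u = R_transform \<mu> a b u + R_transform \<nu> a b u))"

text \<open>The measure below exists and is unique for all probability measures on the real line.\<close>
definition free_convolution :: "real measure \<Rightarrow> real measure \<Rightarrow> real measure"
    (infixl \<open>\<boxplus>\<close> 65) where
  "\<mu> \<boxplus> \<nu> = (SOME \<rho>. is_free_convolution \<mu> \<nu> \<rho>)"

text \<open>
  One real variable for each pair \<open>(i, j)\<close>: the diagonal entry, the (scaled) real part above the
  diagonal and, below the diagonal, the (scaled) imaginary part of the mirrored entry.
\<close>
definition wigner_var :: "complex mat \<Rightarrow> nat \<times> nat \<Rightarrow> real" where
  "wigner_var X = (\<lambda>(i, j).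
     if i = j then Re (X $$ (i, i))
     else if i < j then sqrt 2 * Re (X $$ (i, j))
     else sqrt 2 * Im (X $$ (j, i)))"

definition wigner :: "'a measure \<Rightarrow> real measure \<Rightarrow> nat \<Rightarrow> ('a \<Rightarrow> complex mat) \<Rightarrow> bool" where
  "wigner \<Omega> \<mu> N W \<longleftrightarrow>
     prob_space \<Omega> \<and>
     (\<forall>\<omega>\<in>space \<Omega>. W \<omega> \<in> carrier_mat N N \<and> hermitian_mat (W \<omega>)) \<and>
     prob_space.indep_vars \<Omega> (\<lambda>_. borel) (\<lambda>p \<omega>. wigner_var (W \<omega>) p) ({..<N} \<times> {..<N}) \<and>
     (\<forall>p \<in> {..<N} \<times> {..<N}. distr \<Omega> borel (\<lambda>\<omega>. wigner_var (W \<omega>) p) = \<mu>)"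

definition deformed_wigner :: "nat \<Rightarrow> complex mat \<Rightarrow> complex mat \<Rightarrow> complex mat" where
  "deformed_wigner N X A = complex_of_real (1 / sqrt (real N)) \<cdot>\<^sub>m X + A"

definition mean_stieltjes :: "'a measure \<Rightarrow> nat \<Rightarrow> ('a \<Rightarrow> complex mat) \<Rightarrow> complex \<Rightarrow> complex" where
  "mean_stieltjes \<Omega> N M z = (LINT \<omega>|\<Omega>. 1 / of_nat N * mat_trace (resolvent (M \<omega>) z))"

definition g_tilde :: "real \<Rightarrow> complex mat \<Rightarrow> complex \<Rightarrow> complex" where
  "g_tilde \<sigma> A = stieltjes (semicircle \<sigma> \<boxplus> spectral_measure A)"

definition L_tilde :: "real \<Rightarrow> real \<Rightarrow> nat \<Rightarrow> complex mat \<Rightarrow> complex \<Rightarrow> complex" where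
  "L_tilde \<sigma> \<kappa>\<^sub>4 N A z =
     (let w = z - (complex_of_real \<sigma>)\<^sup>2 * g_tilde \<sigma> A z; G = resolvent A w in
      complex_of_real \<kappa>\<^sub>4 / (2 * of_nat N ^ 2) *
        (\<Sum>i<N. \<Sum>l<N. (G * G) $$ (i, i) * G $$ (i, i) * (G $$ (l, l))\<^sup>2))"

definition E_tilde :: "real \<Rightarrow> real \<Rightarrow> nat \<Rightarrow> complex mat \<Rightarrow> complex \<Rightarrow> complex" where
  "E_tilde \<sigma> \<kappa>\<^sub>4 N A z =
     ((complex_of_real \<sigma>)\<^sup>2 * deriv (g_tilde \<sigma> A) z - 1) * L_tilde \<sigma> \<kappa>\<^sub>4 N A z"

text \<open>\<open>\<Delta>\<^sub>N(z) = O(N\<^sup>-\<^sup>p)\<close> on the upper half-plane, with polynomial control in \<open>1 / \<bar>Im z\<bar>\<close>.\<close>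
definition bigO_upper :: "nat \<Rightarrow> (nat \<Rightarrow> complex \<Rightarrow> complex) \<Rightarrow> bool" where
  "bigO_upper p \<Delta> \<longleftrightarrow>
     (\<exists>P :: real poly. (\<forall>i. 0 \<le> coeff P i) \<and>
        (\<forall>N\<ge>1. \<forall>z. 0 < Im z \<longrightarrow> cmod (\<Delta> N z) \<le> poly P (1 / \<bar>Im z\<bar>) / real N ^ p))"

end

theory Submission
  imports Defs "HOL-Complex_Analysis.Complex_Analysis"
begin

text \<open>
  Let \<open>G\<close> be the resolvent of \<open>M\<^sub>N\<close> at \<open>z\<close>, let \<open>w = z - \<sigma>\<^sup>2 g\<^sub>N(z)\<close> and \<open>R = (w - A\<^sub>N)\<^sup>-\<^sup>1\<close>. The resolvent
  identity and a cumulant expansion of fourth order in the entries of \<open>W\<^sub>N\<close> give, for deterministic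
  \<open>D\<close> and \<open>C = D R\<close>,
  \<open>E Tr(G D) = Tr(R D) + \<sigma>\<^sup>2 Cov(Tr G / N, Tr(G C)) + \<kappa>\<^sub>4 / (2 N\<^sup>2) E \<Sum> G\<^sub>j\<^sub>j\<^sup>2 G\<^sub>i\<^sub>i (G C)\<^sub>i\<^sub>i\<close>
  up to smaller terms, and the covariance is estimated by the Poincare inequality. Taking \<open>D\<close> of rank one
  shows that the diagonal entries of \<open>G\<close> and \<open>G R\<close> concentrate at those of \<open>R\<close> and \<open>R\<^sup>2\<close>; taking \<open>D = 1\<close>
  then gives \<open>g\<^sub>N(z) = g\<^sub>A(w) + L(w) / N + O(N\<^sup>-\<^sup>2)\<close>, where \<open>g\<^sub>A\<close> is the Stieltjes transform of the spectral
  measure of \<open>A\<^sub>N\<close> and \<open>L(w)\<close> is \<open>\<kappa>\<^sub>4 / (2 N\<^sup>2)\<close> times the sum over \<open>R\<close>.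

  Put \<open>\<epsilon> = g\<^sub>N(z) - g\<^sub>A(w)\<close>. Then \<open>w + \<sigma>\<^sup>2 g\<^sub>A(w) = z - \<sigma>\<^sup>2 \<epsilon>\<close>, so \<open>w\<close> is the subordination point of
  \<open>\<mu>\<^sub>\<sigma> \<boxplus> \<mu>\<^sub>A\<close> at the nearby point \<open>z - \<sigma>\<^sup>2 \<epsilon>\<close>, and \<open>g\<^sub>A(w)\<close> is the value there of the Stieltjes transform of
  \<open>\<mu>\<^sub>\<sigma> \<boxplus> \<mu>\<^sub>A\<close>. Its Taylor expansion at \<open>z\<close> produces the factor \<open>1 - \<sigma>\<^sup>2 g'\<close>. If \<open>z - \<sigma>\<^sup>2 \<epsilon>\<close> is not close
  to \<open>z\<close>, then \<open>N\<close> is at most a polynomial in \<open>1 / Im z\<close>, and trivial bounds suffice.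
\<close>

section \<open>Resolvents of Hermitian matrices\<close>

text \<open>The point w is built from the expected g_N and not from the free convolution: the
  product of means E Tr G E Tr (G C) then cancels exactly in the resolvent identity, and what is
  left is a covariance, of order 1 for D = 1 although both traces have size N. Symmetry of \<mu>
  kills the odd cumulants, so the first correction is the one with \<open>\<kappa>\<close>; the
  sixth moment in the remainder has to be extracted from the Poincare inequality. Since A is not
  diagonal, words with off-diagonal resolvent entries must be shown to be negligible. This is done
  with Frobenius, row and column norms, because entrywise bounds would cost powers of N. The free
  convolution is a choice among the measures with a certain R-transform relation, so nothing is
  known about it before such a measure is constructed; a fixed point iteration does this for the
  semicircle law and the spectral measure of a matrix. Polynomial control in 1 / Im z forces every
  estimate to be explicit.\<close>

lemma mat_mult_entry:
  assumes "A \<in> carrier_mat n m" "B \<in> carrier_mat m l" "i < n" "j < l"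
  shows "(A * B) $$ (i, j) = (\<Sum>k<m. A $$ (i, k) * B $$ (k, j))"
  using assms by (auto simp: scalar_prod_def lessThan_atLeast0)

declare index_mult_mat(1) [simp del] assoc_mult_mat [simp del]

lemma mat_mult3_entry':
  fixes A B C :: "'a::semiring_0 mat"
  assumes "A \<in> carrier_mat n m" "B \<in> carrier_mat m l" "C \<in> carrier_mat l k" "i < n" "j < k"
  shows "(A * B * C) $$ (i, j) = (\<Sum>a<l. (\<Sum>b<m. A $$ (i, b) * B $$ (b, a)) * C $$ (a, j))"
  using assms by (simp add: mat_mult_entry[of "A * B" n l C k] mat_mult_entry[of A n m B l])

lemma mat_mult3_entry:
  fixes A B C :: "'a::semiring_0 mat"
  assumes "A \<in> carrier_mat N N" "B \<in> carrier_mat N N" "C \<in> carrier_mat N N" "i < N" "j < N"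
  shows "(A * B * C) $$ (i, j) = (\<Sum>a<N. \<Sum>b<N. A $$ (i, b) * B $$ (b, a) * C $$ (a, j))"
  by (simp add: mat_mult3_entry'[OF assms] sum_distrib_right)

lemma mat_trace_mult:
  assumes "A \<in> carrier_mat n m" "B \<in> carrier_mat m n"
  shows "mat_trace (A * B) = (\<Sum>i<n. \<Sum>k<m. A $$ (i, k) * B $$ (k, i))"
  using assms unfolding mat_trace_def by (auto simp: mat_mult_entry[OF assms] intro!: sum.cong)

lemma mat_trace_comm:
  fixes A :: "'a::comm_semiring_0 mat"
  assumes "A \<in> carrier_mat n m" "B \<in> carrier_mat m n"
  shows "mat_trace (A * B) = mat_trace (B * A)"
  unfolding mat_trace_mult[OF assms] mat_trace_mult[OF assms(2,1)]
  by (subst sum.swap) (simp add: mult.commute)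

definition herm_mats :: "nat \<Rightarrow> complex mat set" where
  "herm_mats N = {M \<in> carrier_mat N N. hermitian_mat M}"

lemma mat_adjoint_entry:
  assumes "A \<in> carrier_mat N N" "i < N" "j < N"
  shows "mat_adjoint A $$ (i, j) = cnj (A $$ (j, i))"
  using assms unfolding mat_adjoint_def by (auto simp: mat_of_rows_def)

lemma herm_mats_iff:
  "M \<in> herm_mats N \<longleftrightarrow> M \<in> carrier_mat N N \<and> (\<forall>i<N. \<forall>j<N. M $$ (i, j) = cnj (M $$ (j, i)))"
  (is "?L = ?R")
proof
  assume ?L
  then have M: "M \<in> carrier_mat N N" "mat_adjoint M = M"
    by (auto simp: herm_mats_def hermitian_mat_def)
  then show ?R
    using mat_adjoint_entry[OF M(1)] by metis
next
  assume R: ?R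
  then have M: "M \<in> carrier_mat N N" by simp
  have "mat_adjoint M = M"
  proof (rule eq_matI)
    fix i j assume "i < dim_row M" "j < dim_col M"
    then have ij: "i < N" "j < N" using M by auto
    then have "M $$ (i, j) = cnj (M $$ (j, i))" using R by blast
    then show "mat_adjoint M $$ (i, j) = M $$ (i, j)" by (simp add: mat_adjoint_entry[OF M ij])
  qed (use M in \<open>auto simp: mat_adjoint_def\<close>)
  then show ?L
    using M by (simp add: herm_mats_def hermitian_mat_def)
qed

lemma herm_mats_carrier [simp]: "M \<in> herm_mats N \<Longrightarrow> M \<in> carrier_mat N N"
  by (simp add: herm_mats_iff)

lemma herm_entry: "M \<in> herm_mats N \<Longrightarrow> i < N \<Longrightarrow> j < N \<Longrightarrow> cnj (M $$ (i, j)) = M $$ (j, i)"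
  by (metis herm_mats_iff)

section \<open>Norm bounds for the resolvent without diagonalization\<close>

text \<open>The form \<open>S\<close> = <v, M v> is real for Hermitian M, so Im <v, (z - M) v> = Im
  z |v|^2, and Cauchy-Schwarz gives |Im z| |v| \<le> |(z - M) v|. All norm bounds on resolvents come
  from this inequality.\<close>

lemma herm_lower_bound:
  assumes M: "M \<in> herm_mats N"
  defines "u \<equiv> \<lambda>z v i. z * v i - (\<Sum>j<N. M $$ (i, j) * v j)"
  shows "(Im z)\<^sup>2 * (\<Sum>i<N. (cmod (v i))\<^sup>2) \<le> (\<Sum>i<N. (cmod (u z v i))\<^sup>2)"
proof -
  define S where "S = (\<Sum>i<N. \<Sum>j<N. cnj (v i) * M $$ (i, j) * v j)"
  have "cnj S = (\<Sum>i<N. \<Sum>j<N. v i * M $$ (j, i) * cnj (v j))"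
    unfolding S_def using M by (auto simp: herm_entry intro!: sum.cong)
  also have "\<dots> = S"
    unfolding S_def by (subst sum.swap) (simp add: mult_ac)
  finally have imS: "Im S = 0"
    by (metis Reals_cnj_iff complex_is_Real_iff)
  define a where "a = (\<Sum>i<N. (cmod (v i))\<^sup>2)"
  define b where "b = (\<Sum>i<N. (cmod (u z v i))\<^sup>2)"
  have a: "complex_of_real a = (\<Sum>i<N. cnj (v i) * v i)"
    unfolding a_def by (simp add: complex_norm_square mult.commute del: of_real_power)
  have "(\<Sum>i<N. cnj (v i) * u z v i) = z * complex_of_real a - S"
    unfolding a S_def u_def by (simp add: algebra_simps sum_subtractf sum_distrib_left)
  then have "Im (\<Sum>i<N. cnj (v i) * u z v i) = Im z * a"
    using imS by simp
  then have "\<bar>Im z\<bar> * a \<le> cmod (\<Sum>i<N. cnj (v i) * u z v i)"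
    using abs_Im_le_cmod[of "\<Sum>i<N. cnj (v i) * u z v i"]
    by (simp add: abs_mult a_def sum_nonneg)
  also have "\<dots> \<le> (\<Sum>i<N. cmod (v i) * cmod (u z v i))"
    by (rule order_trans[OF norm_sum]) (simp add: norm_mult)
  finally have "(\<bar>Im z\<bar> * a)\<^sup>2 \<le> (\<Sum>i<N. cmod (v i) * cmod (u z v i))\<^sup>2"
    by (intro power_mono) (auto simp: a_def sum_nonneg)
  also have "\<dots> \<le> a * b"
    unfolding a_def b_def by (rule Cauchy_Schwarz_ineq_sum)
  finally have le: "a * ((Im z)\<^sup>2 * a) \<le> a * b"
    by (simp add: power_mult_distrib power2_eq_square mult_ac)
  have "a \<ge> 0" "b \<ge> 0" by (auto simp: a_def b_def sum_nonneg)
  then have "(Im z)\<^sup>2 * a \<le> b"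
    using le by (cases "a = 0") (auto simp: mult_le_cancel_left)
  then show ?thesis unfolding a_def b_def .
qed

definition shifted :: "complex mat \<Rightarrow> complex \<Rightarrow> complex mat" where
  "shifted M z = z \<cdot>\<^sub>m 1\<^sub>m (dim_row M) - M"

lemma shifted_carrier [simp]: "M \<in> carrier_mat N N \<Longrightarrow> shifted M z \<in> carrier_mat N N"
  by (auto simp: shifted_def)

lemma shifted_entry:
  "M \<in> carrier_mat N N \<Longrightarrow> i < N \<Longrightarrow> j < N \<Longrightarrow>
     shifted M z $$ (i, j) = (if i = j then z else 0) - M $$ (i, j)"
  by (auto simp: shifted_def)

lemma shifted_apply:
  assumes "M \<in> carrier_mat N N" "i < N"
  shows "(\<Sum>j<N. shifted M z $$ (i, j) * v j) = z * v i - (\<Sum>j<N. M $$ (i, j) * v j)"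
proof -
  have "(\<Sum>j<N. shifted M z $$ (i, j) * v j) = (\<Sum>j<N. (if i = j then z * v i else 0) - M $$ (i, j) * v j)"
    using assms by (intro sum.cong) (auto simp: shifted_entry algebra_simps)
  then show ?thesis using assms(2) by (simp add: sum_subtractf)
qed

lemma det_shifted_nonzero:
  assumes M: "M \<in> herm_mats N" and z: "Im z \<noteq> 0"
  shows "det (shifted M z) \<noteq> 0"
proof
  assume "det (shifted M z) = 0"
  then obtain v where v: "v \<in> carrier_vec N" "v \<noteq> 0\<^sub>v N" "shifted M z *\<^sub>v v = 0\<^sub>v N"
    using det_0_iff_vec_prod_zero[of "shifted M z" N] M by auto
  have "z * v $ i - (\<Sum>j<N. M $$ (i, j) * v $ j) = 0" if i: "i < N" for i
  proof -
    have "0 = (shifted M z *\<^sub>v v) $ i" using v i by simp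
    also have "\<dots> = (\<Sum>j<N. shifted M z $$ (i, j) * v $ j)"
      using i v(1) shifted_carrier[OF herm_mats_carrier[OF M], of z]
      by (auto simp: scalar_prod_def lessThan_atLeast0)
    finally show ?thesis using shifted_apply[OF herm_mats_carrier[OF M] i, of z "($) v"] by simp
  qed
  then have "(Im z)\<^sup>2 * (\<Sum>i<N. (cmod (v $ i))\<^sup>2) \<le> 0"
    using herm_lower_bound[OF M, of z "($) v"] by simp
  then have "(\<Sum>i<N. (cmod (v $ i))\<^sup>2) = 0"
    using z by (metis mult_le_0_iff not_sum_power2_lt_zero order_antisym_conv power2_less_0
        sum_nonneg zero_le_power2 zero_less_power2 not_le)
  then have "v $ i = 0" if "i < N" for i
    using that by (subst (asm) sum_nonneg_eq_0_iff) auto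
  then show False using v by auto
qed

lemma resolvent_inverse:
  assumes M: "M \<in> herm_mats N" and z: "Im z \<noteq> 0"
  shows resolvent_carrier: "resolvent M z \<in> carrier_mat N N"
    and shifted_resolvent: "shifted M z * resolvent M z = 1\<^sub>m N"
    and resolvent_shifted: "resolvent M z * shifted M z = 1\<^sub>m N"
proof -
  have S: "shifted M z \<in> carrier_mat N N" using M by simp
  have "shifted M z \<in> Units (ring_mat TYPE(complex) N ())"
    by (rule det_non_zero_imp_unit[OF S det_shifted_nonzero[OF M z]])
  then obtain B where B: "mat_inverse (shifted M z) = Some B"
    using mat_inverse(1)[OF S, where b = "()"] by (cases "mat_inverse (shifted M z)") auto
  moreover have "resolvent M z = the (mat_inverse (shifted M z))"
    by (simp add: resolvent_def shifted_def)
  ultimately have "resolvent M z = B" by simp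
  then show "resolvent M z \<in> carrier_mat N N" "shifted M z * resolvent M z = 1\<^sub>m N"
    "resolvent M z * shifted M z = 1\<^sub>m N"
    using mat_inverse(2)[OF S B] by auto
qed

lemma resolvent_unique:
  assumes M: "M \<in> herm_mats N" and z: "Im z \<noteq> 0"
    and B: "B \<in> carrier_mat N N" "shifted M z * B = 1\<^sub>m N"
  shows "resolvent M z = B"
proof -
  note R = resolvent_inverse[OF M z]
  have "resolvent M z = resolvent M z * (shifted M z * B)"
    using R B by simp
  also have "\<dots> = (resolvent M z * shifted M z) * B"
    using R B M by (subst assoc_mult_mat[of _ N N _ N _ N]) auto
  finally show ?thesis using R B by simp
qed

text \<open>Cramer's rule. It makes the entries rational in the entries of M, which gives
  measurability, and it exposes the diagonal cofactors for
  \<open>trace_resolvent_eq\<close>.\<close>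

lemma resolvent_adj:
  assumes M: "M \<in> herm_mats N" and z: "Im z \<noteq> 0" and ij: "i < N" "j < N"
  shows "resolvent M z $$ (i, j) = cofactor (shifted M z) j i / det (shifted M z)"
proof -
  have S: "shifted M z \<in> carrier_mat N N" using M by simp
  define B where "B = (1 / det (shifted M z)) \<cdot>\<^sub>m adj_mat (shifted M z)"
  have B: "B \<in> carrier_mat N N" using adj_mat(1)[OF S] by (simp add: B_def)
  have "shifted M z * B = 1\<^sub>m N"
    unfolding B_def using adj_mat[OF S] det_shifted_nonzero[OF M z] S
    by (subst mult_smult_distrib[of _ N N _ N]) auto
  then have "resolvent M z = B" by (rule resolvent_unique[OF M z B])
  then show ?thesis
    using S ij by (auto simp: B_def adj_mat_def)
qed

lemma transpose_herm [simp]: "M \<in> herm_mats N \<Longrightarrow> transpose_mat M \<in> herm_mats N"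
  by (auto simp: herm_mats_iff[of "transpose_mat M"] herm_entry carrier_matD[OF herm_mats_carrier])

text \<open>Turns bounds on columns into bounds on rows.\<close>

lemma transpose_resolvent:
  assumes M: "M \<in> herm_mats N" and z: "Im z \<noteq> 0"
  shows "resolvent (transpose_mat M) z = transpose_mat (resolvent M z)"
proof (rule resolvent_unique[OF transpose_herm[OF M] z])
  note R = resolvent_inverse[OF M z]
  show "transpose_mat (resolvent M z) \<in> carrier_mat N N" using R by simp
  have S: "shifted (transpose_mat M) z = transpose_mat (shifted M z)"
    using herm_mats_carrier[OF M] by (intro eq_matI) (auto simp: shifted_def)
  have "transpose_mat (shifted M z) * transpose_mat (resolvent M z)
      = transpose_mat (resolvent M z * shifted M z)"
    using R M by (subst transpose_mult[of _ N N _ N]) auto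
  then show "shifted (transpose_mat M) z * transpose_mat (resolvent M z) = 1\<^sub>m N"
    using R by (simp add: S)
qed

text \<open>The operator norm bound 1 / Im z: \<open>herm_lower_bound\<close> is applied to v = (z -
  M)^-1 b.\<close>

lemma resolvent_contracts:
  assumes M: "M \<in> herm_mats N" and z: "Im z > 0"
  shows "(\<Sum>i<N. (cmod (\<Sum>j<N. resolvent M z $$ (i, j) * b j))\<^sup>2) \<le> (\<Sum>i<N. (cmod (b i))\<^sup>2) / (Im z)\<^sup>2"
proof -
  have z': "Im z \<noteq> 0" using z by simp
  note R = resolvent_inverse[OF M z']
  define v where "v i = (\<Sum>j<N. resolvent M z $$ (i, j) * b j)" for i
  have "z * v i - (\<Sum>j<N. M $$ (i, j) * v j) = b i" if i: "i < N" for i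
  proof -
    have "z * v i - (\<Sum>j<N. M $$ (i, j) * v j) = (\<Sum>j<N. shifted M z $$ (i, j) * v j)"
      by (rule shifted_apply[symmetric]) (use M i in auto)
    also have "\<dots> = (\<Sum>k<N. \<Sum>j<N. shifted M z $$ (i, j) * resolvent M z $$ (j, k) * b k)"
      unfolding v_def sum_distrib_left by (subst sum.swap) (simp add: mult.assoc)
    also have "\<dots> = (\<Sum>k<N. (shifted M z * resolvent M z) $$ (i, k) * b k)"
      using i mat_mult_entry[OF shifted_carrier[OF herm_mats_carrier[OF M]] R(1)]
      by (intro sum.cong) (auto simp: sum_distrib_right)
    also have "\<dots> = (\<Sum>k<N. if k = i then b i else 0)"
      unfolding R using i by (intro sum.cong) auto
    finally show ?thesis using i by simp
  qed
  then have "(Im z)\<^sup>2 * (\<Sum>i<N. (cmod (v i))\<^sup>2) \<le> (\<Sum>i<N. (cmod (b i))\<^sup>2)"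
    using herm_lower_bound[OF M, of z v] by simp
  then show ?thesis unfolding v_def using z by (simp add: field_simps)
qed

lemma resolvent_mult_col:
  assumes M: "M \<in> herm_mats N" and z: "Im z > 0" and B: "B \<in> carrier_mat N m" "j < m"
  shows "(\<Sum>i<N. (cmod ((resolvent M z * B) $$ (i, j)))\<^sup>2) \<le> (\<Sum>i<N. (cmod (B $$ (i, j)))\<^sup>2) / (Im z)\<^sup>2"
proof -
  have R: "resolvent M z \<in> carrier_mat N N" using resolvent_carrier[OF M] z by simp
  show ?thesis
    using resolvent_contracts[OF M z, of "\<lambda>i. B $$ (i, j)"] by (simp add: mat_mult_entry[OF R B(1) _ B(2)])
qed

lemma mult_resolvent_row:
  assumes M: "M \<in> herm_mats N" and z: "Im z > 0" and B: "B \<in> carrier_mat m N" "i < m"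
  shows "(\<Sum>j<N. (cmod ((B * resolvent M z) $$ (i, j)))\<^sup>2) \<le> (\<Sum>j<N. (cmod (B $$ (i, j)))\<^sup>2) / (Im z)\<^sup>2"
proof -
  have z': "Im z \<noteq> 0" using z by simp
  have R: "resolvent M z \<in> carrier_mat N N" using resolvent_carrier[OF M] z by simp
  have "(resolvent (transpose_mat M) z * transpose_mat B) = transpose_mat (B * resolvent M z)"
    unfolding transpose_resolvent[OF M z'] using transpose_mult[OF B(1) R] by simp
  then show ?thesis
    using resolvent_mult_col[OF transpose_herm[OF M] z, of "transpose_mat B" m i] B R by simp
qed

text \<open>The squared Frobenius norm. Multiplication by a resolvent on either side costs 1 / (Im
  z)^2, whatever the dimension.\<close>

definition fro2 :: "complex mat \<Rightarrow> real" where
  "fro2 A = (\<Sum>i<dim_row A. \<Sum>j<dim_col A. (cmod (A $$ (i, j)))\<^sup>2)"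

lemma fro2_nonneg: "fro2 A \<ge> 0"
  by (simp add: fro2_def sum_nonneg)

lemma fro2_resolvent_mult:
  assumes M: "M \<in> herm_mats N" and z: "Im z > 0" and B: "B \<in> carrier_mat N m"
  shows "fro2 (resolvent M z * B) \<le> fro2 B / (Im z)\<^sup>2"
proof -
  have R: "resolvent M z \<in> carrier_mat N N" using resolvent_carrier[OF M] z by simp
  have "fro2 (resolvent M z * B) = (\<Sum>j<m. \<Sum>i<N. (cmod ((resolvent M z * B) $$ (i, j)))\<^sup>2)"
    unfolding fro2_def using R B by (subst sum.swap) simp
  also have "\<dots> \<le> (\<Sum>j<m. (\<Sum>i<N. (cmod (B $$ (i, j)))\<^sup>2) / (Im z)\<^sup>2)"
    by (intro sum_mono resolvent_mult_col[OF M z B]) auto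
  also have "\<dots> = fro2 B / (Im z)\<^sup>2"
    unfolding fro2_def using B by (subst sum.swap) (simp add: sum_divide_distrib)
  finally show ?thesis .
qed

lemma fro2_mult_resolvent:
  assumes M: "M \<in> herm_mats N" and z: "Im z > 0" and B: "B \<in> carrier_mat m N"
  shows "fro2 (B * resolvent M z) \<le> fro2 B / (Im z)\<^sup>2"
proof -
  have R: "resolvent M z \<in> carrier_mat N N" using resolvent_carrier[OF M] z by simp
  have "fro2 (B * resolvent M z) = (\<Sum>i<m. \<Sum>j<N. (cmod ((B * resolvent M z) $$ (i, j)))\<^sup>2)"
    unfolding fro2_def using R B by simp
  also have "\<dots> \<le> (\<Sum>i<m. (\<Sum>j<N. (cmod (B $$ (i, j)))\<^sup>2) / (Im z)\<^sup>2)"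
    by (intro sum_mono mult_resolvent_row[OF M z B]) auto
  also have "\<dots> = fro2 B / (Im z)\<^sup>2"
    unfolding fro2_def using B by (simp add: sum_divide_distrib)
  finally show ?thesis .
qed

lemma resolvent_mult_entry:
  assumes M: "M \<in> herm_mats N" and z: "Im z > 0" and B: "B \<in> carrier_mat N m" "j < m" and i: "i < N"
  shows "cmod ((resolvent M z * B) $$ (i, j)) \<le> sqrt (\<Sum>i<N. (cmod (B $$ (i, j)))\<^sup>2) / Im z"
proof -
  have "(cmod ((resolvent M z * B) $$ (i, j)))\<^sup>2 \<le> (\<Sum>i<N. (cmod ((resolvent M z * B) $$ (i, j)))\<^sup>2)"
    using i by (intro member_le_sum) auto
  also note resolvent_mult_col[OF M z B]
  finally have "sqrt ((cmod ((resolvent M z * B) $$ (i, j)))\<^sup>2) \<le> sqrt ((\<Sum>i<N. (cmod (B $$ (i, j)))\<^sup>2) / (Im z)\<^sup>2)"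
    by (rule real_sqrt_le_mono)
  then show ?thesis using z by (simp add: real_sqrt_divide)
qed

lemma sum_delta_entry: "j < N \<Longrightarrow> (\<Sum>i<N. (cmod (1\<^sub>m N $$ (i, j)))\<^sup>2) = 1"
proof -
  assume j: "j < N"
  have "(\<Sum>i<N. (cmod (1\<^sub>m N $$ (i, j)))\<^sup>2) = (\<Sum>i<N. if i = j then 1 else 0)"
    using j by (intro sum.cong) auto
  then show ?thesis using j by simp
qed

lemma resolvent_col:
  assumes M: "M \<in> herm_mats N" and z: "Im z > 0" and j: "j < N"
  shows "(\<Sum>i<N. (cmod (resolvent M z $$ (i, j)))\<^sup>2) \<le> 1 / (Im z)\<^sup>2"
proof -
  have R: "resolvent M z \<in> carrier_mat N N" using resolvent_carrier[OF M] z by simp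
  show ?thesis
    using resolvent_mult_col[OF M z one_carrier_mat j] R sum_delta_entry[OF j] by simp
qed

lemma resolvent_row:
  assumes M: "M \<in> herm_mats N" and z: "Im z > 0" and j: "i < N"
  shows "(\<Sum>j<N. (cmod (resolvent M z $$ (i, j)))\<^sup>2) \<le> 1 / (Im z)\<^sup>2"
  using resolvent_col[OF transpose_herm[OF M] z j] resolvent_carrier[OF M, of z] z j
  by (simp add: transpose_resolvent[OF M])

lemma resolvent_entry:
  assumes M: "M \<in> herm_mats N" and z: "Im z > 0" and "i < N" "j < N"
  shows "cmod (resolvent M z $$ (i, j)) \<le> 1 / Im z"
proof -
  have "(cmod (resolvent M z $$ (i, j)))\<^sup>2 \<le> (\<Sum>i<N. (cmod (resolvent M z $$ (i, j)))\<^sup>2)"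
    using assms by (intro member_le_sum) auto
  also note resolvent_col[OF M z \<open>j < N\<close>]
  finally have "(cmod (resolvent M z $$ (i, j)))\<^sup>2 \<le> (1 / Im z)\<^sup>2" by (simp add: power_divide)
  then show ?thesis by (rule power2_le_imp_le) (use z in simp)
qed

lemma fro2_resolvent:
  assumes M: "M \<in> herm_mats N" and z: "Im z > 0"
  shows "fro2 (resolvent M z) \<le> real N / (Im z)\<^sup>2"
proof -
  have R: "resolvent M z \<in> carrier_mat N N" using resolvent_carrier[OF M] z by simp
  have "fro2 (resolvent M z) = (\<Sum>i<N. \<Sum>j<N. (cmod (resolvent M z $$ (i, j)))\<^sup>2)"
    unfolding fro2_def using R by simp
  also have "\<dots> \<le> (\<Sum>i<N. 1 / (Im z)\<^sup>2)"
    by (intro sum_mono resolvent_row[OF M z]) auto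
  finally have "fro2 (resolvent M z) \<le> (\<Sum>i<N. 1 / (Im z)\<^sup>2)" .
  then show ?thesis by simp
qed

text \<open>For v the i-th column of the resolvent, pairing v with (z - M) v = e_i gives
  \<open>cnj (v i)\<close> = z |v|^2 - <v, M v>, whose imaginary part is nonnegative.\<close>

lemma resolvent_trace_Im:
  assumes M: "M \<in> herm_mats N" and z: "Im z > 0" and i: "i < N"
  shows "Im (resolvent M z $$ (i, i)) \<le> 0"
proof -
  have z': "Im z \<noteq> 0" using z by simp
  note R = resolvent_inverse[OF M z']
  let ?G = "resolvent M z"
  define v where "v j = ?G $$ (j, i)" for j
  have e: "z * v k - (\<Sum>j<N. M $$ (k, j) * v j) = (if k = i then 1 else 0)" if k: "k < N" for k
  proof -
    have "z * v k - (\<Sum>j<N. M $$ (k, j) * v j) = (\<Sum>j<N. shifted M z $$ (k, j) * v j)"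
      by (rule shifted_apply[symmetric]) (use M k in auto)
    also have "\<dots> = (shifted M z * ?G) $$ (k, i)"
      unfolding v_def using mat_mult_entry[OF shifted_carrier[OF herm_mats_carrier[OF M]] R(1) k i] by simp
    finally show ?thesis using R k i by simp
  qed
  define S where "S = (\<Sum>k<N. \<Sum>j<N. cnj (v k) * M $$ (k, j) * v j)"
  have "cnj S = (\<Sum>i<N. \<Sum>j<N. v i * M $$ (j, i) * cnj (v j))"
    unfolding S_def using M by (auto simp: herm_entry intro!: sum.cong)
  also have "\<dots> = S"
    unfolding S_def by (subst sum.swap) (simp add: mult_ac)
  finally have imS: "Im S = 0"
    by (metis Reals_cnj_iff complex_is_Real_iff)
  have "(\<Sum>k<N. cnj (v k) * (z * v k - (\<Sum>j<N. M $$ (k, j) * v j))) = (\<Sum>k<N. if k = i then cnj (v i) else 0)"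
    using e by (intro sum.cong) auto
  then have "cnj (v i) = (\<Sum>k<N. cnj (v k) * (z * v k - (\<Sum>j<N. M $$ (k, j) * v j)))"
    using i by simp
  also have "\<dots> = z * (\<Sum>k<N. cnj (v k) * v k) - S"
    unfolding S_def by (simp add: algebra_simps sum_subtractf sum_distrib_left)
  also have "(\<Sum>k<N. cnj (v k) * v k) = complex_of_real (\<Sum>k<N. (cmod (v k))\<^sup>2)"
    by (simp add: complex_norm_square mult.commute del: of_real_power)
  finally have "Im (cnj (v i)) = Im z * (\<Sum>k<N. (cmod (v k))\<^sup>2)"
    using imS by simp
  then have "Im (v i) = - (Im z * (\<Sum>k<N. (cmod (v k))\<^sup>2))" by simp
  moreover have "Im z * (\<Sum>k<N. (cmod (v k))\<^sup>2) \<ge> 0" using z by (simp add: sum_nonneg)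
  ultimately show ?thesis by (simp add: v_def)
qed

text \<open>Both the matrix and the spectral parameter vary: derivatives along a line of matrices
  use the former, the comparison of two subordination points the latter.\<close>

lemma resolvent_identity:
  assumes M: "M \<in> herm_mats N" "M' \<in> herm_mats N" and z: "Im z \<noteq> 0" "Im z' \<noteq> 0"
  shows "resolvent M z - resolvent M' z' = resolvent M z * (shifted M' z' - shifted M z) * resolvent M' z'"
proof -
  note R = resolvent_inverse[OF M(1) z(1)] and R' = resolvent_inverse[OF M(2) z(2)]
  have S: "shifted M z \<in> carrier_mat N N" "shifted M' z' \<in> carrier_mat N N" using M by auto
  have "resolvent M z * (shifted M' z' - shifted M z) * resolvent M' z'
     = resolvent M z * shifted M' z' * resolvent M' z' - resolvent M z * shifted M z * resolvent M' z'"
    unfolding mult_minus_distrib_mat[OF R(1) S(2,1)]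
    by (rule minus_mult_distrib_mat[of _ N N _ _ N]) (use R(1) R'(1) S in auto)
  also have "resolvent M z * shifted M' z' * resolvent M' z' = resolvent M z"
    unfolding assoc_mult_mat[OF R(1) S(2) R'(1)] R'(2) using R(1) by simp
  finally show ?thesis using R(1,3) R'(1) by simp
qed

text \<open>The diagonal cofactors of z - M are the characteristic polynomials of the principal
  submatrices, and these sum to the derivative of \<open>char_poly M\<close>. The trace becomes a
  logarithmic derivative, hence a sum over the eigenvalues.\<close>

lemma trace_resolvent_eq:
  assumes M: "M \<in> herm_mats N" and z: "Im z \<noteq> 0"
  shows "mat_trace (resolvent M z) = poly (pderiv (char_poly M)) z / poly (char_poly M) z"
proof -
  have MC: "M \<in> carrier_mat N N" using M by simp
  have cp: "poly (char_poly B) z = det (shifted B z)" if "B \<in> carrier_mat m m" for B :: "complex mat" and m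
  proof -
    have "poly (char_poly B) z = det (map_mat (\<lambda>p. poly p z) (char_poly_matrix B))"
      unfolding char_poly_def by (rule comm_ring_hom.hom_det[symmetric]) (unfold_locales, auto)
    also have "map_mat (\<lambda>p. poly p z) (char_poly_matrix B) = shifted B z"
      using that by (intro eq_matI) (auto simp: char_poly_matrix_def shifted_def)
    finally show ?thesis .
  qed
  have "cofactor (shifted M z) i i = poly (char_poly (mat_delete M i i)) z" if i: "i < N" for i
  proof -
    have "mat_delete (shifted M z) i i = shifted (mat_delete M i i) z"
      using MC i by (intro eq_matI) (auto simp: mat_delete_def shifted_def)
    moreover have "mat_delete M i i \<in> carrier_mat (N - 1) (N - 1)"
      using MC by (rule mat_delete_carrier)
    ultimately show ?thesis
      by (simp add: cofactor_def cp)
  qed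
  moreover have "mat_trace (resolvent M z) = (\<Sum>i<N. resolvent M z $$ (i, i))"
    using resolvent_carrier[OF M z] by (simp add: mat_trace_def)
  ultimately have "mat_trace (resolvent M z) = (\<Sum>i<N. poly (char_poly (mat_delete M i i)) z / det (shifted M z))"
    by (simp add: resolvent_adj[OF M z])
  then show ?thesis
    using cp[OF MC] by (simp add: pderiv_char_poly[OF MC] poly_sum sum_divide_distrib)
qed

lemma char_poly_root_real:
  assumes M: "M \<in> herm_mats N" and r: "poly (char_poly M) x = 0"
  shows "Im x = 0"
proof (rule ccontr)
  assume x: "Im x \<noteq> 0"
  have MC: "M \<in> carrier_mat N N" using M by simp
  have "poly (char_poly M) x = det (map_mat (\<lambda>p. poly p x) (char_poly_matrix M))"
    unfolding char_poly_def by (rule comm_ring_hom.hom_det[symmetric]) (unfold_locales, auto)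
  also have "map_mat (\<lambda>p. poly p x) (char_poly_matrix M) = shifted M x"
    using MC by (intro eq_matI) (auto simp: char_poly_matrix_def shifted_def)
  finally show False using det_shifted_nonzero[OF M x] r by simp
qed

section \<open>The resolvent along an affine line of matrices\<close>

definition mat_line :: "complex mat \<Rightarrow> complex mat \<Rightarrow> real \<Rightarrow> complex mat" where
  "mat_line M E s = M + complex_of_real s \<cdot>\<^sub>m E"

lemma mat_line_entry:
  "E \<in> carrier_mat N N \<Longrightarrow> i < N \<Longrightarrow> j < N \<Longrightarrow> M \<in> carrier_mat N N \<Longrightarrow>
    mat_line M E s $$ (i, j) = M $$ (i, j) + s * E $$ (i, j)"
  by (auto simp: mat_line_def)

lemma mat_line_herm [simp]: "M \<in> herm_mats N \<Longrightarrow> E \<in> herm_mats N \<Longrightarrow> mat_line M E s \<in> herm_mats N"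
proof -
  assume M: "M \<in> herm_mats N" and E: "E \<in> herm_mats N"
  have "mat_line M E s $$ (i, j) = cnj (mat_line M E s $$ (j, i))" if "i < N" "j < N" for i j
    using that herm_entry[OF M that(2,1)] herm_entry[OF E that(2,1)] M E
    by (simp add: mat_line_entry[of _ N])
  moreover have "mat_line M E s \<in> carrier_mat N N"
    using M E by (simp add: mat_line_def)
  ultimately show ?thesis by (simp only: herm_mats_iff) blast
qed

text \<open>The product G E G ... E G with k factors E: the k-th derivative in s of the resolvent of
  M + s E, divided by k!.\<close>

fun res_pow :: "complex mat \<Rightarrow> complex mat \<Rightarrow> nat \<Rightarrow> complex mat" where
  "res_pow G E 0 = G"
| "res_pow G E (Suc k) = res_pow G E k * E * G"

lemma res_pow_carrier [simp]:
  "G \<in> carrier_mat N N \<Longrightarrow> E \<in> carrier_mat N N \<Longrightarrow> res_pow G E k \<in> carrier_mat N N"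
  by (induction k) auto

context
  fixes N :: nat and M E :: "complex mat" and z :: complex
  assumes M: "M \<in> herm_mats N" and E: "E \<in> herm_mats N" and z: "Im z > 0"
begin

definition "line_res s = resolvent (mat_line M E s) z"

lemma line_res_carrier: "line_res s \<in> carrier_mat N N"
  unfolding line_res_def by (rule resolvent_carrier) (use M E z in auto)

text \<open>An exact difference quotient. Together with the uniform bound \<open>GEG_bound\<close>
  it gives continuity of the entries, and then their derivative.\<close>

lemma line_res_diff: "line_res s - line_res u = complex_of_real (s - u) \<cdot>\<^sub>m (line_res s * E * line_res u)"
proof -
  have z': "Im z \<noteq> 0" using z by simp
  have "shifted (mat_line M E u) z - shifted (mat_line M E s) z = complex_of_real (s - u) \<cdot>\<^sub>m E"
    using M E by (intro eq_matI) (auto simp: shifted_def mat_line_def algebra_simps carrier_matD[OF herm_mats_carrier])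
  then have "line_res s - line_res u = line_res s * (complex_of_real (s - u) \<cdot>\<^sub>m E) * line_res u"
    unfolding line_res_def by (subst resolvent_identity[of _ N]) (use M E z' in auto)
  then show ?thesis
    using line_res_carrier[of s] line_res_carrier[of u] E
    by (simp add: mult_smult_distrib[of _ N N _ N] mult_smult_assoc_mat[of _ N N _ N])
qed

lemma GEG_bound:
  assumes "i < N" "j < N"
  shows "cmod ((line_res s * E * line_res u) $$ (i, j)) \<le> (\<Sum>a<N. \<Sum>b<N. cmod (E $$ (b, a))) / (Im z)\<^sup>2"
proof -
  have ge: "cmod (line_res s $$ (a, b)) \<le> 1 / Im z" if "a < N" "b < N" for s a b
    unfolding line_res_def by (rule resolvent_entry[of _ N]) (use M E z that in auto)
  have "(line_res s * E * line_res u) $$ (i, j) = (\<Sum>a<N. \<Sum>b<N. line_res s $$ (i, b) * E $$ (b, a) * line_res u $$ (a, j))"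
    by (rule mat_mult3_entry[OF line_res_carrier herm_mats_carrier[OF E] line_res_carrier assms])
  also have "cmod \<dots> \<le> (\<Sum>a<N. \<Sum>b<N. cmod (line_res s $$ (i, b) * E $$ (b, a) * line_res u $$ (a, j)))"
    by (intro order_trans[OF norm_sum] sum_mono norm_sum)
  also have "\<dots> \<le> (\<Sum>a<N. \<Sum>b<N. (1 / Im z) * cmod (E $$ (b, a)) * (1 / Im z))"
    unfolding norm_mult using assms z by (intro sum_mono mult_mono ge) auto
  also have "\<dots> = (\<Sum>a<N. \<Sum>b<N. cmod (E $$ (b, a))) / (Im z)\<^sup>2"
    by (simp add: sum_divide_distrib power2_eq_square)
  finally show ?thesis .
qed

lemma line_res_entry_tendsto:
  assumes "i < N" "j < N"
  shows "((\<lambda>s. line_res s $$ (i, j)) \<longlongrightarrow> line_res u $$ (i, j)) (at u)"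
proof -
  define K where "K = (\<Sum>a<N. \<Sum>b<N. cmod (E $$ (b, a))) / (Im z)\<^sup>2"
  have "cmod (line_res s $$ (i, j) - line_res u $$ (i, j)) \<le> \<bar>s - u\<bar> * K" for s
  proof -
    have "line_res s $$ (i, j) - line_res u $$ (i, j) = (line_res s - line_res u) $$ (i, j)"
      using assms line_res_carrier[of s] line_res_carrier[of u] by simp
    also have "\<dots> = complex_of_real (s - u) * (line_res s * E * line_res u) $$ (i, j)"
      unfolding line_res_diff using assms line_res_carrier[of s] line_res_carrier[of u] E by simp
    finally have "cmod (line_res s $$ (i, j) - line_res u $$ (i, j)) = \<bar>s - u\<bar> * cmod ((line_res s * E * line_res u) $$ (i, j))"
      by (simp only: norm_mult norm_of_real)
    then show ?thesis
      using mult_left_mono[OF GEG_bound[OF assms, of s u], of "\<bar>s - u\<bar>"] by (simp add: K_def)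
  qed
  then have le: "\<forall>s. cmod (line_res s $$ (i, j) - line_res u $$ (i, j)) \<le> \<bar>s - u\<bar> * K" by blast
  have "((\<lambda>s. \<bar>s - u\<bar> * K) \<longlongrightarrow> \<bar>u - u\<bar> * K) (at u)"
    by (intro tendsto_intros)
  then have lim: "((\<lambda>s. \<bar>s - u\<bar> * K) \<longlongrightarrow> 0) (at u)" by simp
  show ?thesis
    by (rule LIM_zero_cancel) (rule Lim_null_comparison[OF always_eventually[OF le] lim])
qed

lemma line_res_entry_deriv:
  assumes "i < N" "j < N"
  shows "((\<lambda>s. line_res s $$ (i, j)) has_vector_derivative (line_res u * E * line_res u) $$ (i, j)) (at u)"
proof -
  have e: "(line_res s * E * line_res u) $$ (i, j) = (\<Sum>a<N. \<Sum>b<N. line_res s $$ (i, b) * E $$ (b, a) * line_res u $$ (a, j))" for s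
    by (rule mat_mult3_entry[OF line_res_carrier herm_mats_carrier[OF E] line_res_carrier assms])
  have "((\<lambda>s. (line_res s * E * line_res u) $$ (i, j)) \<longlongrightarrow> (line_res u * E * line_res u) $$ (i, j)) (at u)"
    unfolding e using assms by (intro tendsto_intros line_res_entry_tendsto) auto
  moreover have "(line_res s $$ (i, j) - line_res u $$ (i, j)) /\<^sub>R (s - u) = (line_res s * E * line_res u) $$ (i, j)" if "s \<noteq> u" for s
  proof -
    have "line_res s $$ (i, j) - line_res u $$ (i, j) = (line_res s - line_res u) $$ (i, j)"
      using assms line_res_carrier[of s] line_res_carrier[of u] by simp
    also have "\<dots> = complex_of_real (s - u) * (line_res s * E * line_res u) $$ (i, j)"
      unfolding line_res_diff using assms line_res_carrier[of s] line_res_carrier[of u] E by simp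
    finally have "(line_res s $$ (i, j) - line_res u $$ (i, j)) /\<^sub>R (s - u) = (complex_of_real (s - u) * (line_res s * E * line_res u) $$ (i, j)) /\<^sub>R (s - u)"
      by simp
    then show ?thesis using that by (simp add: scaleR_conv_of_real del: of_real_diff)
  qed
  ultimately have "((\<lambda>s. (line_res s $$ (i, j) - line_res u $$ (i, j)) /\<^sub>R (s - u)) \<longlongrightarrow> (line_res u * E * line_res u) $$ (i, j)) (at u)"
    by (subst tendsto_cong[where g = "\<lambda>s. (line_res s * E * line_res u) $$ (i, j)"]) (auto simp: eventually_at_filter)
  then have lim: "((\<lambda>s. norm ((line_res s $$ (i, j) - line_res u $$ (i, j)) /\<^sub>R (s - u) - (line_res u * E * line_res u) $$ (i, j))) \<longlongrightarrow> 0) (at u)"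
    using LIM_zero tendsto_norm_zero by blast
  have "((\<lambda>s. norm ((line_res s $$ (i, j) - line_res u $$ (i, j) - (s - u) *\<^sub>R (line_res u * E * line_res u) $$ (i, j)) /\<^sub>R norm (s - u))) \<longlongrightarrow> 0) (at u)"
  proof (rule Lim_transform_eventually[OF lim])
    show "\<forall>\<^sub>F s in at u. norm ((line_res s $$ (i, j) - line_res u $$ (i, j)) /\<^sub>R (s - u) - (line_res u * E * line_res u) $$ (i, j))
      = norm ((line_res s $$ (i, j) - line_res u $$ (i, j) - (s - u) *\<^sub>R (line_res u * E * line_res u) $$ (i, j)) /\<^sub>R norm (s - u))"
    proof (unfold eventually_at_filter, intro always_eventually allI impI)
      fix s assume s: "s \<noteq> u"
      have "(line_res s $$ (i, j) - line_res u $$ (i, j)) /\<^sub>R (s - u) - (line_res u * E * line_res u) $$ (i, j)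
        = (line_res s $$ (i, j) - line_res u $$ (i, j) - (s - u) *\<^sub>R (line_res u * E * line_res u) $$ (i, j)) /\<^sub>R (s - u)"
        using s by (simp add: scaleR_diff_right)
      then show "norm ((line_res s $$ (i, j) - line_res u $$ (i, j)) /\<^sub>R (s - u) - (line_res u * E * line_res u) $$ (i, j))
        = norm ((line_res s $$ (i, j) - line_res u $$ (i, j) - (s - u) *\<^sub>R (line_res u * E * line_res u) $$ (i, j)) /\<^sub>R norm (s - u))"
        by (simp only: norm_scaleR) simp
    qed
  qed
  then have "((\<lambda>s. (line_res s $$ (i, j) - line_res u $$ (i, j) - (s - u) *\<^sub>R (line_res u * E * line_res u) $$ (i, j)) /\<^sub>R norm (s - u)) \<longlongrightarrow> 0) (at u)"
    by (rule tendsto_norm_zero_cancel)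
  then show ?thesis
    unfolding has_vector_derivative_def has_derivative_within
    by (simp add: bounded_linear_scaleR_left diff_diff_eq inverse_eq_divide)
qed

text \<open>Product rule for T_(k+1) = T_k E G: the last factor contributes T_(k+2) once, the factor
  T_k contributes it k + 1 times by induction.\<close>

lemma res_pow_deriv:
  assumes "i < N" "j < N"
  shows "((\<lambda>s. res_pow (line_res s) E k $$ (i, j)) has_vector_derivative
    of_nat (Suc k) * res_pow (line_res u) E (Suc k) $$ (i, j)) (at u)"
  using assms
proof (induction k arbitrary: i j)
  case 0
  then show ?case using line_res_entry_deriv[of i j u] by simp
next
  case (Suc k)
  define T :: "nat \<Rightarrow> real \<Rightarrow> complex mat" where "T = (\<lambda>k s. res_pow (line_res s) E k)"
  have TS: "T (Suc k) s = T k s * E * line_res s" for k s by (simp add: T_def)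
  have Ec: "E \<in> carrier_mat N N" using E by simp
  have T: "T k s \<in> carrier_mat N N" for k s
    using res_pow_carrier[OF line_res_carrier Ec] by (simp add: T_def)
  have ex: "res_pow (line_res s) E (Suc k) $$ (i, j) = (\<Sum>a<N. (\<Sum>b<N. T k s $$ (i, b) * E $$ (b, a)) * line_res s $$ (a, j))" for s
    using mat_mult3_entry'[OF T Ec line_res_carrier Suc.prems] by (simp add: T_def)
  have IH: "((\<lambda>s. T k s $$ (i, b)) has_vector_derivative of_nat (Suc k) * T (Suc k) u $$ (i, b)) (at u)"
    if "b < N" for b
    using Suc.IH[of i b] Suc.prems that unfolding T_def by (simp del: res_pow.simps of_nat_Suc)
  have "((\<lambda>s. \<Sum>a<N. (\<Sum>b<N. T k s $$ (i, b) * E $$ (b, a)) * line_res s $$ (a, j)) has_vector_derivative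
     (\<Sum>a<N. (\<Sum>b<N. T k u $$ (i, b) * E $$ (b, a)) * (line_res u * E * line_res u) $$ (a, j)
        + (\<Sum>b<N. (of_nat (Suc k) * T (Suc k) u $$ (i, b)) * E $$ (b, a)) * line_res u $$ (a, j))) (at u)"
    using Suc.prems
    by (intro has_vector_derivative_sum has_vector_derivative_mult has_vector_derivative_mult_left line_res_entry_deriv IH) auto
  moreover have "(\<Sum>a<N. (\<Sum>b<N. T k u $$ (i, b) * E $$ (b, a)) * (line_res u * E * line_res u) $$ (a, j)) = T (Suc (Suc k)) u $$ (i, j)"
  proof -
    have "(\<Sum>a<N. (\<Sum>b<N. T k u $$ (i, b) * E $$ (b, a)) * (line_res u * E * line_res u) $$ (a, j)) = (T k u * E * (line_res u * E * line_res u)) $$ (i, j)"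
      by (rule mat_mult3_entry'[symmetric])
        (use T Ec line_res_carrier Suc.prems in \<open>auto intro!: mult_carrier_mat[of _ N N _ N]\<close>)
    also have "T k u * E * (line_res u * E * line_res u) = T (Suc (Suc k)) u"
      using T[of k u] line_res_carrier[of u] Ec by (simp add: TS assoc_mult_mat[of _ N N _ N _ N])
    finally show ?thesis .
  qed
  moreover have "(\<Sum>a<N. (\<Sum>b<N. (of_nat (Suc k) * T (Suc k) u $$ (i, b)) * E $$ (b, a)) * line_res u $$ (a, j))
     = of_nat (Suc k) * T (Suc (Suc k)) u $$ (i, j)"
  proof -
    have "T (Suc (Suc k)) u $$ (i, j) = (\<Sum>a<N. (\<Sum>b<N. T (Suc k) u $$ (i, b) * E $$ (b, a)) * line_res u $$ (a, j))"
      unfolding TS[of "Suc k"] by (rule mat_mult3_entry'[OF T Ec line_res_carrier Suc.prems])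
    then show ?thesis by (simp add: sum_distrib_left sum_distrib_right mult.assoc)
  qed
  ultimately show ?case
    unfolding ex by (simp add: T_def sum.distrib algebra_simps del: res_pow.simps)
qed

lemma trace_res_pow_deriv:
  assumes D: "D \<in> carrier_mat N N"
  shows "((\<lambda>s. mat_trace (D * res_pow (line_res s) E k)) has_vector_derivative
    of_nat (Suc k) * mat_trace (D * res_pow (line_res u) E (Suc k))) (at u)"
proof -
  have T: "res_pow (line_res s) E k \<in> carrier_mat N N" for k s
    using res_pow_carrier[OF line_res_carrier] E by simp
  have "((\<lambda>s. \<Sum>a<N. \<Sum>b<N. D $$ (a, b) * res_pow (line_res s) E k $$ (b, a)) has_vector_derivative
    (\<Sum>a<N. \<Sum>b<N. D $$ (a, b) * (of_nat (Suc k) * res_pow (line_res u) E (Suc k) $$ (b, a)))) (at u)"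
    by (intro has_vector_derivative_sum has_vector_derivative_mult_right res_pow_deriv) auto
  then show ?thesis
    unfolding mat_trace_mult[OF D T] by (simp add: sum_distrib_left mult_ac del: res_pow.simps)
qed

end

section \<open>Measurability of resolvent entries\<close>

lemma borel_measurable_det:
  assumes "\<And>x. x \<in> space P \<Longrightarrow> H x \<in> carrier_mat n n"
    and "\<And>i j. i < n \<Longrightarrow> j < n \<Longrightarrow> (\<lambda>x. H x $$ (i, j)) \<in> borel_measurable P"
  shows "(\<lambda>x. det (H x) :: complex) \<in> borel_measurable P"
proof -
  have "(\<lambda>x. \<Sum>p\<in>{p. p permutes {0..<n}}. signof p * (\<Prod>i = 0..<n. H x $$ (i, p i))) \<in> borel_measurable P"
    using assms(2)
    by (intro borel_measurable_sum borel_measurable_times borel_measurable_const borel_measurable_prod)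
      (auto dest: permutes_in_image)
  then show ?thesis
    by (subst measurable_cong[OF det_def'[OF assms(1)]])
qed

lemma borel_measurable_resolvent:
  assumes H: "\<And>x. x \<in> space P \<Longrightarrow> H x \<in> herm_mats N"
    and Hm: "\<And>i j. i < N \<Longrightarrow> j < N \<Longrightarrow> (\<lambda>x. H x $$ (i, j)) \<in> borel_measurable P"
    and z: "Im z \<noteq> 0" and ij: "i < N" "j < N"
  shows "(\<lambda>x. resolvent (H x) z $$ (i, j)) \<in> borel_measurable P"
proof -
  have S: "shifted (H x) z \<in> carrier_mat N N" if "x \<in> space P" for x
    using H[OF that] by simp
  have Sm: "(\<lambda>x. shifted (H x) z $$ (i, j)) \<in> borel_measurable P" if "i < N" "j < N" for i j
    by (subst measurable_cong[OF shifted_entry[OF herm_mats_carrier[OF H]]])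
      (use Hm that in \<open>auto intro!: borel_measurable_diff\<close>)
  have D: "(\<lambda>x. det (mat_delete (shifted (H x) z) j i)) \<in> borel_measurable P"
  proof (rule borel_measurable_det)
    fix a b assume ab: "a < N - 1" "b < N - 1"
    have "mat_delete (shifted (H x) z) j i $$ (a, b)
      = shifted (H x) z $$ (if a < j then a else Suc a, if b < i then b else Suc b)" if "x \<in> space P" for x
      using S[OF that] ab by (auto simp: mat_delete_def)
    then show "(\<lambda>x. mat_delete (shifted (H x) z) j i $$ (a, b)) \<in> borel_measurable P"
      using ab by (subst measurable_cong) (auto intro!: Sm)
  qed (rule mat_delete_carrier[OF S])
  have "(\<lambda>x. cofactor (shifted (H x) z) j i / det (shifted (H x) z)) \<in> borel_measurable P"
    unfolding cofactor_def
    by (intro borel_measurable_divide borel_measurable_times borel_measurable_const D borel_measurable_det[OF S Sm])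
  then show ?thesis
    by (subst measurable_cong[OF resolvent_adj[OF H z ij]])
qed

section \<open>Eigenvalues and the spectral measure\<close>

text \<open>One enumeration \<gamma> of the eigenvalues serves both claims: the measure is the image
  of the uniform law on indices, and the trace is the logarithmic derivative of the factored
  characteristic polynomial.\<close>

lemma spectral_measure_pmf:
  assumes A: "A \<in> herm_mats N" and N: "N \<ge> 1"
  obtains \<gamma> :: "nat \<Rightarrow> real" where
    "spectral_measure A = distr (measure_pmf (map_pmf \<gamma> (pmf_of_set {..<N}))) borel (\<lambda>x. x)"
    "\<And>z. Im z \<noteq> 0 \<Longrightarrow> mat_trace (resolvent A z) = (\<Sum>i<N. 1 / (z - complex_of_real (\<gamma> i)))"
proof -
  obtain as where as: "char_poly A = (\<Prod>a\<leftarrow>as. [:- a, 1:])" "length as = N"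
    using char_poly_factorized[OF herm_mats_carrier[OF A]] by auto
  define \<gamma> where "\<gamma> i = Re (as ! i)" for i
  have real: "complex_of_real (\<gamma> i) = as ! i" if "i < N" for i
  proof -
    have "poly (char_poly A) (as ! i) = 0"
      unfolding as(1) poly_prod_list using that as(2) by (force simp: prod_list_zero_iff)
    then have "Im (as ! i) = 0" by (rule char_poly_root_real[OF A])
    then show ?thesis by (simp add: \<gamma>_def complex_eq_iff)
  qed
  have "proots (char_poly A) = mset as"
  proof (unfold as(1), induction as)
    case (Cons a as)
    have "(\<Prod>a\<leftarrow>as. [:- a, 1:]) \<noteq> 0" for as :: "complex list"
      by (auto simp: prod_list_zero_iff)
    then have "proots ([:- a, 1:] * (\<Prod>a\<leftarrow>as. [:- a, 1:])) = proots [:- a, 1:] + proots (\<Prod>a\<leftarrow>as. [:- a, 1:])"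
      by (intro proots_mult) auto
    then show ?case using Cons by (simp only: list.map prod_list.Cons proots_linear_factor) simp
  qed simp
  also have "mset as = image_mset ((!) as) (mset_set {..<N})"
    by (metis as(2) lessThan_atLeast0 map_nth mset_map mset_upt)
  finally have "image_mset Re (proots (char_poly A)) = image_mset \<gamma> (mset_set {..<N})"
    by (simp add: image_mset.compositionality \<gamma>_def[abs_def] comp_def)
  then have 1: "spectral_measure A = distr (measure_pmf (map_pmf \<gamma> (pmf_of_set {..<N}))) borel (\<lambda>x. x)"
    unfolding spectral_measure_def using N by (subst map_pmf_of_set) (auto simp: lessThan_empty_iff)
  have "poly (pderiv (\<Prod>a\<leftarrow>as. [:- a, 1:])) z / poly (\<Prod>a\<leftarrow>as. [:- a, 1:]) z = (\<Sum>a\<leftarrow>as. 1 / (z - a))"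
    if "z \<notin> set as" for z and as :: "complex list"
    using that
  proof (induction as)
    case (Cons a as)
    have nz: "poly (\<Prod>a\<leftarrow>as. [:- a, 1:]) z \<noteq> 0"
      using Cons.prems by (auto simp: poly_prod_list prod_list_zero_iff)
    have "z \<noteq> a" using Cons.prems by auto
    define Q where "Q = (\<Prod>a\<leftarrow>as. [:- a, 1:])"
    have "poly (pderiv ([:- a, 1:] * Q)) z / poly ([:- a, 1:] * Q) z
      = 1 / (z - a) + poly (pderiv Q) z / poly Q z"
      using \<open>z \<noteq> a\<close> nz unfolding Q_def[symmetric] pderiv_mult
      by (simp add: pderiv_pCons field_simps del: mult_pCons_left)
    then show ?case
      using Cons by (simp add: Q_def del: mult_pCons_left)
  qed simp
  moreover have "z \<notin> set as" if "Im z \<noteq> 0" for z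
    using real as(2) that by (metis Im_complex_of_real in_set_conv_nth)
  ultimately have "mat_trace (resolvent A z) = (\<Sum>a\<leftarrow>as. 1 / (z - a))" if "Im z \<noteq> 0" for z
    using trace_resolvent_eq[OF A that] that unfolding as(1) by simp
  moreover have "(\<Sum>a\<leftarrow>as. 1 / (z - a)) = (\<Sum>i<N. 1 / (z - complex_of_real (\<gamma> i)))" for z
    using real as(2) by (simp add: sum_list_sum_nth lessThan_atLeast0)
  ultimately show ?thesis using 1 that by simp
qed

lemma stieltjes_spectral_measure:
  assumes A: "A \<in> herm_mats N" and N: "N \<ge> 1" and z: "Im z \<noteq> 0"
  shows "stieltjes (spectral_measure A) z = mat_trace (resolvent A z) / of_nat N"
proof -
  obtain \<gamma> where \<gamma>: "spectral_measure A = distr (measure_pmf (map_pmf \<gamma> (pmf_of_set {..<N}))) borel (\<lambda>x. x)"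
    "mat_trace (resolvent A z) = (\<Sum>i<N. 1 / (z - complex_of_real (\<gamma> i)))"
    using spectral_measure_pmf[OF A N] z by metis
  have "stieltjes (spectral_measure A) z = measure_pmf.expectation (pmf_of_set {..<N}) (\<lambda>i. 1 / (z - complex_of_real (\<gamma> i)))"
    unfolding stieltjes_def \<gamma>(1) by (simp add: integral_distr)
  also have "\<dots> = (\<Sum>i<N. 1 / (z - complex_of_real (\<gamma> i))) / of_nat N"
    using N by (subst integral_measure_pmf[of "{..<N}"])
      (auto simp: lessThan_empty_iff scaleR_conv_of_real divide_inverse sum_distrib_left mult.commute)
  finally show ?thesis using \<gamma>(2) by simp
qed

section \<open>Tensorization of the Poincare inequality\<close>

lemma (in prob_space) integrable_bounded:
  fixes f :: "'a \<Rightarrow> 'b::{banach, second_countable_topology}"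
  assumes "f \<in> borel_measurable M" "\<And>x. norm (f x) \<le> B"
  shows "integrable M f"
  by (rule integrable_const_bound[where B = B]) (use assms in auto)

lemma (in prob_space) norm_integral_bounded:
  fixes f :: "'a \<Rightarrow> 'b::{banach, second_countable_topology}"
  assumes "\<And>x. norm (f x) \<le> B"
  shows "norm (LINT x|M. f x) \<le> B"
proof (cases "integrable M f")
  case True
  have "norm (LINT x|M. f x) \<le> (LINT x|M. norm (f x))" by (rule integral_norm_bound)
  also have "\<dots> \<le> (LINT x|M. B)"
    by (intro integral_mono integrable_norm True) (use assms in auto)
  finally show ?thesis by (simp add: prob_space)
next
  case False
  moreover have "0 \<le> B" using assms[of undefined] norm_ge_zero[of "f undefined"] by linarith
  ultimately show ?thesis by (simp add: not_integrable_integral_eq)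
qed

lemma cmod_diff_sq_le: "cmod a \<le> B \<Longrightarrow> cmod b \<le> B \<Longrightarrow> norm ((cmod (a - b))\<^sup>2) \<le> (2 * B)\<^sup>2"
proof -
  assume "cmod a \<le> B" "cmod b \<le> B"
  then have "cmod (a - b) \<le> 2 * B" using norm_triangle_ineq4[of a b] by linarith
  from power_mono[OF this, of 2] show ?thesis by simp
qed

text \<open>Mean square around c as variance plus squared bias. It serves the conditional variances
  below, the moment step and the concentration of resolvent entries.\<close>

lemma (in prob_space) second_moment_shift:
  fixes g :: "'a \<Rightarrow> complex"
  assumes g [measurable]: "g \<in> borel_measurable M" and B: "\<And>x. cmod (g x) \<le> B"
  shows "(LINT x|M. (cmod (g x - c))\<^sup>2)
    = (LINT x|M. (cmod (g x - (LINT y|M. g y)))\<^sup>2) + (cmod ((LINT y|M. g y) - c))\<^sup>2"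
proof -
  define m where "m = (LINT y|M. g y)"
  have ig: "integrable M g" by (rule integrable_bounded[OF g B])
  have sq: "integrable M (\<lambda>x. (cmod (g x - c))\<^sup>2)" for c
  proof (rule integrable_bounded[where B = "(B + cmod c)\<^sup>2"])
    show "norm ((cmod (g x - c))\<^sup>2) \<le> (B + cmod c)\<^sup>2" for x
      using norm_triangle_ineq4[of "g x" c] B[of x] by (auto intro!: power_mono)
  qed measurable
  have "(cmod (g x - c))\<^sup>2 = (cmod (g x - m))\<^sup>2 + (2 * Re ((g x - m) * cnj (m - c)) + (cmod (m - c))\<^sup>2)" for x
    unfolding cmod_power2 by (simp add: power2_eq_square algebra_simps)
  then have "(LINT x|M. (cmod (g x - c))\<^sup>2)
    = (LINT x|M. (cmod (g x - m))\<^sup>2 + (2 * Re ((g x - m) * cnj (m - c)) + (cmod (m - c))\<^sup>2))"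
    by simp
  also have "\<dots> = (LINT x|M. (cmod (g x - m))\<^sup>2) + (2 * (LINT x|M. Re ((g x - m) * cnj (m - c))) + (cmod (m - c))\<^sup>2)"
    using ig sq by (simp add: prob_space)
  also have "(LINT x|M. Re ((g x - m) * cnj (m - c))) = Re ((LINT x|M. g x - m) * cnj (m - c))"
    using ig by (subst integral_Re) auto
  also have "(LINT x|M. g x - m) = 0" using ig by (simp add: prob_space m_def)
  finally show ?thesis by (simp add: m_def)
qed

lemma (in prob_space) cmod_integral_sq_le:
  fixes g :: "'a \<Rightarrow> complex"
  assumes "g \<in> borel_measurable M" "\<And>x. cmod (g x) \<le> B"
  shows "(cmod (LINT x|M. g x))\<^sup>2 \<le> (LINT x|M. (cmod (g x))\<^sup>2)"
  using second_moment_shift[OF assms, of 0] by simp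

text \<open>Efron-Stein inequality for two blocks. The variance is the mean of the conditional
  variance given x plus the variance of \<open>F2\<close>; the deviation of \<open>F2\<close> is an
  average over y of f - \<open>F1\<close>, so Jensen bounds its square by the first summand of the
  claim.\<close>

lemma (in pair_prob_space) variance_pair:
  fixes f :: "'a \<Rightarrow> 'b \<Rightarrow> complex"
  assumes f [measurable]: "case_prod f \<in> borel_measurable (M1 \<Otimes>\<^sub>M M2)" and B: "\<And>x y. cmod (f x y) \<le> B"
  shows "(LINT x|M1. LINT y|M2. (cmod (f x y - (LINT x|M1. LINT y|M2. f x y)))\<^sup>2)
    \<le> (LINT y|M2. LINT x|M1. (cmod (f x y - (LINT x|M1. f x y)))\<^sup>2)
     + (LINT x|M1. LINT y|M2. (cmod (f x y - (LINT y|M2. f x y)))\<^sup>2)"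
proof -
  define E where "E = (LINT x|M1. LINT y|M2. f x y)"
  define F1 where "F1 y = (LINT x|M1. f x y)" for y
  define F2 where "F2 x = (LINT y|M2. f x y)" for x
  have F1B: "cmod (F1 y) \<le> B" for y
    unfolding F1_def by (rule M1.norm_integral_bounded) (rule B)
  have F2B: "cmod (F2 x) \<le> B" for x
    unfolding F2_def by (rule M2.norm_integral_bounded) (rule B)
  have EB: "cmod E \<le> B"
    using M1.norm_integral_bounded[OF F2B] by (simp add: E_def F2_def)
  have sw: "(\<lambda>(y, x). f x y) \<in> borel_measurable (M2 \<Otimes>\<^sub>M M1)"
    using measurable_pair_swap[OF f] by (simp add: case_prod_beta')
  have F1m [measurable]: "F1 \<in> borel_measurable M2"
    unfolding F1_def using sw by (rule M1.borel_measurable_lebesgue_integral)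
  have F2m [measurable]: "F2 \<in> borel_measurable M1"
    unfolding F2_def using f by (rule M2.borel_measurable_lebesgue_integral)
  note bd = cmod_diff_sq_le[where B = B]
  have fx [measurable]: "f x \<in> borel_measurable M2" if "x \<in> space M1" for x
    using measurable_compose[OF measurable_Pair1'[OF that] f] by simp
  have fy [measurable]: "(\<lambda>x. f x y) \<in> borel_measurable M1" if "y \<in> space M2" for y
    using measurable_compose[OF measurable_Pair2'[OF that] f] by simp
  have intE: "E = (LINT y|M2. F1 y)"
    unfolding E_def F1_def
    by (rule Fubini_integral[symmetric]) (rule P.integrable_bounded[where B = B], use B in \<open>auto\<close>)
  have i2: "integrable M1 (\<lambda>x. LINT y|M2. (cmod (f x y - F2 x))\<^sup>2)"
  proof (rule M1.integrable_bounded[where B = "(2 * B)\<^sup>2"])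
    show "norm (LINT y|M2. (cmod (f x y - F2 x))\<^sup>2) \<le> (2 * B)\<^sup>2" for x
      by (rule M2.norm_integral_bounded) (rule bd[OF B F2B])
  qed (rule M2.borel_measurable_lebesgue_integral, measurable)
  have i3: "integrable M1 (\<lambda>x. (cmod (F2 x - E))\<^sup>2)"
    by (rule M1.integrable_bounded[where B = "(2 * B)\<^sup>2"]) (use bd[OF F2B EB] in auto)
  have i1: "integrable (M1 \<Otimes>\<^sub>M M2) (\<lambda>(x, y). (cmod (f x y - F1 y))\<^sup>2)"
    by (rule P.integrable_bounded[where B = "(2 * B)\<^sup>2"]) (use bd[OF B F1B] in auto)
  have "(LINT x|M1. LINT y|M2. (cmod (f x y - E))\<^sup>2)
     = (LINT x|M1. (LINT y|M2. (cmod (f x y - F2 x))\<^sup>2) + (cmod (F2 x - E))\<^sup>2)"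
    by (intro Bochner_Integration.integral_cong refl)
      (simp add: F2_def M2.second_moment_shift[OF fx B, of _ E])
  also have "\<dots> = (LINT x|M1. LINT y|M2. (cmod (f x y - F2 x))\<^sup>2) + (LINT x|M1. (cmod (F2 x - E))\<^sup>2)"
    using i2 i3 by simp
  also have "(LINT x|M1. (cmod (F2 x - E))\<^sup>2) \<le> (LINT x|M1. LINT y|M2. (cmod (f x y - F1 y))\<^sup>2)"
  proof (intro integral_mono i3)
    show "integrable M1 (\<lambda>x. LINT y|M2. (cmod (f x y - F1 y))\<^sup>2)"
      using integrable_fst'[OF i1] by simp
    fix x assume x: "x \<in> space M1"
    have "F2 x - E = (LINT y|M2. f x y - F1 y)"
      unfolding F2_def intE
      by (rule Bochner_Integration.integral_diff[symmetric])
        (rule M2.integrable_bounded[where B = B], use x B F1B in auto)+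
    moreover have "cmod (f x y - F1 y) \<le> 2 * B" for y
      using norm_triangle_ineq4[of "f x y" "F1 y"] B[of x y] F1B[of y] by linarith
    ultimately show "(cmod (F2 x - E))\<^sup>2 \<le> (LINT y|M2. (cmod (f x y - F1 y))\<^sup>2)"
      using M2.cmod_integral_sq_le[of "\<lambda>y. f x y - F1 y" "2 * B"] x by simp
  qed
  also have "(LINT x|M1. LINT y|M2. (cmod (f x y - F1 y))\<^sup>2) = (LINT y|M2. LINT x|M1. (cmod (f x y - F1 y))\<^sup>2)"
    by (rule Fubini_integral[symmetric]) (use i1 in simp)
  finally show ?thesis by (simp add: E_def F1_def F2_def)
qed

section \<open>The Poincare inequality for product measures\<close>

text \<open>Restricted to functions that are bounded together with their derivative, so that one
  pointwise bound \<open>B\<close> settles all integrability questions.\<close>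

definition poincare_const :: "real measure \<Rightarrow> real \<Rightarrow> bool" where
  "poincare_const \<mu> C \<longleftrightarrow> C > 0 \<and> (\<forall>f f' B. (\<forall>x. (f has_vector_derivative f' x) (at x)) \<longrightarrow>
     continuous_on UNIV f' \<longrightarrow> (\<forall>x. cmod (f x) \<le> B) \<longrightarrow> (\<forall>x. cmod (f' x) \<le> B) \<longrightarrow>
     (LINT x|\<mu>. (cmod (f x - (LINT y|\<mu>. f y)))\<^sup>2) \<le> C * (LINT x|\<mu>. (cmod (f' x))\<^sup>2))"

lemma satisfies_poincare_const:
  assumes \<mu>: "real_distribution \<mu>" and P: "satisfies_poincare \<mu>"
  obtains C where "poincare_const \<mu> C"
proof -
  interpret real_distribution \<mu> by fact
  obtain C where C: "C > 0" and *: "\<And>(f :: real \<Rightarrow> complex) f'.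
        (\<forall>x. (f has_vector_derivative f' x) (at x)) \<Longrightarrow> continuous_on UNIV f' \<Longrightarrow>
        integrable \<mu> (\<lambda>x. (cmod (f x))\<^sup>2) \<Longrightarrow> integrable \<mu> (\<lambda>x. (cmod (f' x))\<^sup>2) \<Longrightarrow>
        (LINT x|\<mu>. (cmod (f x - (LINT y|\<mu>. f y)))\<^sup>2) \<le> C * (LINT x|\<mu>. (cmod (f' x))\<^sup>2)"
    using P unfolding satisfies_poincare_def by blast
  have "poincare_const \<mu> C"
    unfolding poincare_const_def
  proof (intro conjI allI impI C)
    fix f f' :: "real \<Rightarrow> complex" and B
    assume d: "\<forall>x. (f has_vector_derivative f' x) (at x)" and c: "continuous_on UNIV f'"
      and b: "\<forall>x. cmod (f x) \<le> B" "\<forall>x. cmod (f' x) \<le> B"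
    have "continuous_on UNIV f"
      using d by (intro continuous_at_imp_continuous_on) (auto intro: has_vector_derivative_continuous)
    then have [measurable]: "f \<in> borel_measurable borel" by (rule borel_measurable_continuous_onI)
    have [measurable]: "f' \<in> borel_measurable borel" using c by (rule borel_measurable_continuous_onI)
    show "(LINT x|\<mu>. (cmod (f x - (LINT y|\<mu>. f y)))\<^sup>2) \<le> C * (LINT x|\<mu>. (cmod (f' x))\<^sup>2)"
    proof (rule *[OF d c])
      show "integrable \<mu> (\<lambda>x. (cmod (f x))\<^sup>2)"
        by (rule integrable_bounded[where B = "B\<^sup>2"]) (use b in \<open>auto intro!: power_mono\<close>)
      show "integrable \<mu> (\<lambda>x. (cmod (f' x))\<^sup>2)"
        by (rule integrable_bounded[where B = "B\<^sup>2"]) (use b in \<open>auto intro!: power_mono\<close>)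
    qed
  qed
  then show ?thesis by (rule that)
qed

text \<open>Induction on the coordinates: \<open>variance_pair\<close> splits off p, the induction
  hypothesis handles the sections at fixed s, and \<open>poincare_const\<close> those at fixed x.
  The constant stays C because the squared derivatives add up over the coordinates. Bounds and
  derivatives are required at every function x, so they pass to \<open>x(p := s)\<close>
  directly.\<close>

lemma tensor_poincare:
  fixes F :: "('i \<Rightarrow> real) \<Rightarrow> complex" and D :: "'i \<Rightarrow> ('i \<Rightarrow> real) \<Rightarrow> complex"
  assumes \<mu>: "real_distribution \<mu>" and C: "poincare_const \<mu> C" and J: "finite J"
    and Fm: "F \<in> borel_measurable (PiM J (\<lambda>_. \<mu>))"
    and Dm: "\<And>q. q \<in> J \<Longrightarrow> D q \<in> borel_measurable (PiM J (\<lambda>_. \<mu>))"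
    and FB: "\<And>x. cmod (F x) \<le> B" and DB: "\<And>q x. q \<in> J \<Longrightarrow> cmod (D q x) \<le> B"
    and FD: "\<And>q x s. q \<in> J \<Longrightarrow> ((\<lambda>s. F (x(q := s))) has_vector_derivative D q (x(q := s))) (at s)"
    and DC: "\<And>q x. q \<in> J \<Longrightarrow> continuous_on UNIV (\<lambda>s. D q (x(q := s)))"
  shows "(LINT x|PiM J (\<lambda>_. \<mu>). (cmod (F x - (LINT x|PiM J (\<lambda>_. \<mu>). F x)))\<^sup>2)
    \<le> C * (\<Sum>q\<in>J. LINT x|PiM J (\<lambda>_. \<mu>). (cmod (D q x))\<^sup>2)"
  using J Fm Dm FB DB FD DC
proof (induction J arbitrary: F D)
  case empty
  \<comment> \<open>Over the empty index set the product is the point mass at the everywhere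
    undefined function, so the variance is 0.\<close>
  have "(LINT x|PiM {} (\<lambda>_. \<mu>). F x) = F (\<lambda>_. undefined)" 
    for F :: "('i \<Rightarrow> real) \<Rightarrow> 'b::{banach, second_countable_topology}"
    unfolding PiM_empty by (subst lebesgue_integral_count_space_finite) auto
  from this[of F] this[of "\<lambda>x. (cmod (F x - F (\<lambda>_. undefined)))\<^sup>2"] show ?case by simp
next
  case (insert p J)
  have C0: "C \<ge> 0" using C by (simp add: poincare_const_def)
  interpret \<mu>: real_distribution \<mu> by fact
  interpret product_prob_space "\<lambda>_. \<mu>" J ..
  let ?J = "PiM J (\<lambda>_. \<mu>)" and ?I = "PiM (insert p J) (\<lambda>_. \<mu>)"
  have JP: "prob_space ?J" by (rule prob_space_PiM) (rule \<mu>.prob_space_axioms)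
  interpret J: prob_space ?J by (rule prob_space_PiM) (rule \<mu>.prob_space_axioms)
  interpret I: prob_space ?I by (rule prob_space_PiM) (rule \<mu>.prob_space_axioms)
  interpret PP: pair_prob_space ?J \<mu> ..
  have upd [measurable]: "(\<lambda>(x, s). x(p := s)) \<in> measurable (?J \<Otimes>\<^sub>M \<mu>) ?I"
    using measurable_add_dim[of p J "\<lambda>_. \<mu>"] by simp
  have [measurable]: "F \<in> borel_measurable ?I" "\<And>q. q \<in> insert p J \<Longrightarrow> D q \<in> borel_measurable ?I"
    using insert.prems by auto
  have fold: "(LINT x|?I. g x) = (LINT x|?J. LINT s|\<mu>. g (x(p := s)))"
    "(LINT x|?I. g x) = (LINT s|\<mu>. LINT x|?J. g (x(p := s)))"
    if g: "g \<in> borel_measurable ?I" "\<And>x. norm (g x) \<le> B'"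
    for g :: "('i \<Rightarrow> real) \<Rightarrow> 'b::{banach, second_countable_topology}" and B' :: real
  proof -
    have "(\<lambda>(x, s). g (x(p := s))) \<in> borel_measurable (?J \<Otimes>\<^sub>M \<mu>)"
      using measurable_compose[OF upd g(1)] by (simp add: case_prod_beta')
    then have "integrable (?J \<Otimes>\<^sub>M \<mu>) (\<lambda>(x, s). g (x(p := s)))"
      by (rule PP.integrable_bounded[where B = B']) (use g in auto)
    from PP.Fubini_integral[OF this]
    show "(LINT x|?I. g x) = (LINT x|?J. LINT s|\<mu>. g (x(p := s)))"
      "(LINT x|?I. g x) = (LINT s|\<mu>. LINT x|?J. g (x(p := s)))"
      using product_integral_insert[OF insert.hyps I.integrable_bounded[OF g]] by auto
  qed
  define f where "f x s = F (x(p := s))" for x s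
  have fm: "case_prod f \<in> borel_measurable (?J \<Otimes>\<^sub>M \<mu>)"
    using measurable_compose[OF upd insert.prems(1)] by (simp add: case_prod_beta' f_def)
  define E where "E = (LINT x|?I. F x)"
  have E: "E = (LINT x|?J. LINT s|\<mu>. f x s)"
    unfolding E_def f_def using insert.prems(3) by (intro fold) auto
  note bd = cmod_diff_sq_le[where B = B]
  have EB: "cmod E \<le> B" unfolding E_def by (rule I.norm_integral_bounded) (rule insert.prems)
  have sqb: "norm ((cmod (D q x))\<^sup>2) \<le> B\<^sup>2" if "q \<in> insert p J" for q x
    using power_mono[OF insert.prems(4)[OF that, of x], of 2] by simp
  have sqm: "(\<lambda>x. (cmod (D q x))\<^sup>2) \<in> borel_measurable ?I" if "q \<in> insert p J" for q
    using that by measurable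
  note sq = fold(1)[OF sqm sqb] fold(2)[OF sqm sqb] sqb
  have Dm: "(\<lambda>(x, s). (cmod (D q (x(p := s))))\<^sup>2) \<in> borel_measurable (?J \<Otimes>\<^sub>M \<mu>)" if "q \<in> insert p J" for q
  proof -
    have "(\<lambda>x. (cmod (D q x))\<^sup>2) \<in> borel_measurable ?I" using that by measurable
    from measurable_compose[OF upd this] show ?thesis by (simp add: case_prod_beta')
  qed
  have Dm2: "(\<lambda>(s, x). (cmod (D q (x(p := s))))\<^sup>2) \<in> borel_measurable (\<mu> \<Otimes>\<^sub>M ?J)" if "q \<in> insert p J" for q
    using measurable_pair_swap[OF Dm[OF that]] by (simp add: case_prod_beta')
  have iD: "integrable \<mu> (\<lambda>s. LINT x|?J. (cmod (D q (x(p := s))))\<^sup>2)" if "q \<in> insert p J" for q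
    by (rule \<mu>.integrable_bounded[where B = "B\<^sup>2"], rule sigma_finite_measure.borel_measurable_lebesgue_integral[OF prob_space_imp_sigma_finite[OF JP] Dm2[OF that]],
        rule prob_space.norm_integral_bounded[OF JP], rule sq(3)[OF that])
  have "(LINT x|?I. (cmod (F x - E))\<^sup>2) = (LINT x|?J. LINT s|\<mu>. (cmod (f x s - E))\<^sup>2)"
    unfolding f_def by (rule fold(1)[OF _ bd[OF insert.prems(3) EB]]) measurable
  also have "\<dots> \<le> (LINT s|\<mu>. LINT x|?J. (cmod (f x s - (LINT x|?J. f x s)))\<^sup>2)
     + (LINT x|?J. LINT s|\<mu>. (cmod (f x s - (LINT s|\<mu>. f x s)))\<^sup>2)"
    unfolding E by (rule PP.variance_pair[OF fm, of B]) (simp add: f_def insert.prems)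
  also have "(LINT s|\<mu>. LINT x|?J. (cmod (f x s - (LINT x|?J. f x s)))\<^sup>2)
     \<le> (LINT s|\<mu>. C * (\<Sum>q\<in>J. LINT x|?J. (cmod (D q (x(p := s))))\<^sup>2))"
  proof (rule integral_mono')
    show "integrable \<mu> (\<lambda>s. C * (\<Sum>q\<in>J. LINT x|?J. (cmod (D q (x(p := s))))\<^sup>2))"
      using iD by auto
    fix s assume s: "s \<in> space \<mu>"
    have us: "(\<lambda>x. x(p := s)) \<in> measurable ?J ?I"
      using measurable_compose[OF measurable_Pair2'[OF s] upd] by simp
    \<comment> \<open>Since q differs from p, the derivative of a section in q is the section of the
      derivative.\<close>
    have tw: "x(q := t, p := s) = x(p := s, q := t)" if "q \<in> J" for x :: "'i \<Rightarrow> real" and q t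
      using that insert.hyps by (auto simp: fun_upd_twist)
    show "(LINT x|?J. (cmod (f x s - (LINT x|?J. f x s)))\<^sup>2)
      \<le> C * (\<Sum>q\<in>J. LINT x|?J. (cmod (D q (x(p := s))))\<^sup>2)"
      unfolding f_def
    proof (rule insert.IH)
      show "(\<lambda>x. F (x(p := s))) \<in> borel_measurable ?J"
        using measurable_compose[OF us insert.prems(1)] .
      show "(\<lambda>x. D q (x(p := s))) \<in> borel_measurable ?J" if "q \<in> J" for q
        using measurable_compose[OF us insert.prems(2)[of q]] that by simp
      show "((\<lambda>t. F (x(q := t, p := s))) has_vector_derivative D q (x(q := t, p := s))) (at t)" if "q \<in> J" for q x t
        unfolding tw[OF that] by (rule insert.prems(5)) (use that in simp)
      show "continuous_on UNIV (\<lambda>t. D q (x(q := t, p := s)))" if "q \<in> J" for q x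
        unfolding tw[OF that] by (rule insert.prems(6)) (use that in simp)
    qed (use insert.prems in auto)
  qed (use C0 in \<open>auto intro!: mult_nonneg_nonneg sum_nonneg\<close>)
  also have "(LINT s|\<mu>. C * (\<Sum>q\<in>J. LINT x|?J. (cmod (D q (x(p := s))))\<^sup>2))
     = C * (\<Sum>q\<in>J. LINT x|?I. (cmod (D q x))\<^sup>2)"
    using iD sq(2) by simp
  also have "(LINT x|?J. LINT s|\<mu>. (cmod (f x s - (LINT s|\<mu>. f x s)))\<^sup>2)
     \<le> (LINT x|?J. C * (LINT s|\<mu>. (cmod (D p (x(p := s))))\<^sup>2))"
  proof (rule integral_mono')
    have "integrable (?J \<Otimes>\<^sub>M \<mu>) (\<lambda>(x, s). (cmod (D p (x(p := s))))\<^sup>2)"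
      by (rule PP.integrable_bounded[OF Dm, where B = "B\<^sup>2"]) (use sq(3)[of p] in auto)
    from PP.integrable_fst'[OF this]
    show "integrable ?J (\<lambda>x. C * (LINT s|\<mu>. (cmod (D p (x(p := s))))\<^sup>2))"
      by simp
    show "(LINT s|\<mu>. (cmod (f x s - (LINT s|\<mu>. f x s)))\<^sup>2) \<le> C * (LINT s|\<mu>. (cmod (D p (x(p := s))))\<^sup>2)" for x
      unfolding f_def
      by (rule C[unfolded poincare_const_def, THEN conjunct2, rule_format, where B = B])
        ((rule insert.prems, simp) | rule insert.prems)+
  qed (use C0 in auto)
  also have "(LINT x|?J. C * (LINT s|\<mu>. (cmod (D p (x(p := s))))\<^sup>2)) = C * (LINT x|?I. (cmod (D p x))\<^sup>2)"
    using sq(1)[of p] by simp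
  finally show ?case
    using insert.hyps by (simp add: E_def algebra_simps)
qed

section \<open>Moments and the cumulant expansion\<close>

lemma abs_arctan_le: "\<bar>arctan x\<bar> \<le> \<bar>x\<bar>"
proof -
  have "arctan y \<le> y" if "y \<ge> 0" for y :: real
  proof -
    have "(\<lambda>y. y - arctan y) 0 \<le> (\<lambda>y. y - arctan y) y"
    proof (rule DERIV_nonneg_imp_nondecreasing[OF that])
      fix x :: real
      have "((\<lambda>y. y - arctan y) has_real_derivative (1 - inverse (1 + x\<^sup>2))) (at x)"
        by (auto intro!: derivative_eq_intros)
      moreover have "0 \<le> 1 - inverse (1 + x\<^sup>2)"
        by (simp add: inverse_le_1_iff)
      ultimately show "\<exists>y. ((\<lambda>y. y - arctan y) has_real_derivative y) (at x) \<and> 0 \<le> y" by blast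
    qed
    then show ?thesis by simp
  qed
  from this[of "\<bar>x\<bar>"] show ?thesis
    by (cases "x \<ge> 0") (auto simp: arctan_minus)
qed

lemma scaled_arctan_tendsto: "(\<lambda>n. real (Suc n) * arctan (x / real (Suc n))) \<longlonglongrightarrow> x"
proof (cases "x = 0")
  case False
  have "((\<lambda>h. (arctan (0 + h) - arctan 0) / h) \<longlongrightarrow> inverse (1 + 0\<^sup>2)) (at 0)"
    using DERIV_arctan[of 0] by (simp add: DERIV_def)
  then have l: "((\<lambda>h. arctan h / h) \<longlongrightarrow> 1) (at 0)" by simp
  have "(\<lambda>n. x * inverse (real (Suc n))) \<longlonglongrightarrow> x * 0"
    by (intro tendsto_mult tendsto_const LIMSEQ_inverse_real_of_nat)
  then have "filterlim (\<lambda>n. x / real (Suc n)) (at 0) sequentially"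
    using False by (simp add: filterlim_at divide_inverse)
  from filterlim_compose[OF l this]
  have "(\<lambda>n. x * (arctan (x / real (Suc n)) / (x / real (Suc n)))) \<longlonglongrightarrow> x * 1"
    by (intro tendsto_intros)
  moreover have "x * (arctan (x / real (Suc n)) / (x / real (Suc n))) = real (Suc n) * arctan (x / real (Suc n))" for n
    using False by (simp del: of_nat_Suc)
  ultimately show ?thesis by simp
qed simp

text \<open>The Poincare inequality for the \<open>(k+1)\<close>-st power of \<open>n arctan(x / n)\<close>, a smooth bounded truncation of \<open>x\<close>.\<close>
lemma poincare_moment_step:
  assumes \<mu>: "real_distribution \<mu>" and C: "poincare_const \<mu> C"
    and i1: "integrable \<mu> (\<lambda>x. x ^ (2 * k))" and i2: "integrable \<mu> (\<lambda>x. \<bar>x\<bar> ^ Suc k)"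
  shows "integrable \<mu> (\<lambda>x. x ^ (2 * Suc k))"
proof -
  interpret real_distribution \<mu> by fact
  define \<phi> where "\<phi> n x = real (Suc n) * arctan (x / real (Suc n))" for n x
  have \<phi>d: "((\<phi> n) has_real_derivative inverse (1 + (x / real (Suc n))\<^sup>2)) (at x)" for n x
    unfolding \<phi>_def by (auto intro!: derivative_eq_intros simp del: of_nat_Suc)
  have \<phi>le: "\<bar>\<phi> n x\<bar> \<le> \<bar>x\<bar>" for n x
  proof -
    have "\<bar>\<phi> n x\<bar> = real (Suc n) * \<bar>arctan (x / real (Suc n))\<bar>"
      by (simp add: \<phi>_def abs_mult)
    also have "\<dots> \<le> real (Suc n) * \<bar>x / real (Suc n)\<bar>"
      by (intro mult_left_mono abs_arctan_le) simp
    finally show ?thesis by simp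
  qed
  have \<phi>B: "\<bar>\<phi> n x\<bar> \<le> real (Suc n) * pi" for n x
  proof -
    have "\<bar>arctan y\<bar> \<le> pi" for y using arctan_bounded[of y] pi_gt_zero by linarith
    then show ?thesis unfolding \<phi>_def by (simp add: abs_mult del: of_nat_Suc)
  qed
  have inv1: "inverse (1 + y\<^sup>2) \<le> 1" "0 \<le> inverse (1 + y\<^sup>2)" for y :: real
    by (auto simp: inverse_le_1_iff)
  have \<phi>c: "continuous_on UNIV (\<phi> n)" for n
    using \<phi>d by (meson DERIV_continuous continuous_at_imp_continuous_on)
  have \<phi>m [measurable]: "\<phi> n \<in> borel_measurable borel" for n
    by (rule borel_measurable_continuous_onI[OF \<phi>c])
  \<comment> \<open>Independent of n: C times the mean square of the derivative of x^(k+1), plus the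
    square of E |x|^(k+1), which dominates the squared mean.\<close>
  define m where "m = C * (real (Suc k))\<^sup>2 * (LINT x|\<mu>. x ^ (2 * k)) + (LINT x|\<mu>. \<bar>x\<bar> ^ Suc k)\<^sup>2"
  have bound: "(LINT x|\<mu>. \<phi> n x ^ (2 * Suc k)) \<le> m" for n
  proof -
    define f where "f x = complex_of_real (\<phi> n x ^ Suc k)" for x
    define f' where "f' x = complex_of_real (real (Suc k) * \<phi> n x ^ k * inverse (1 + (x / real (Suc n))\<^sup>2))" for x
    define B where "B = (real (Suc k)) * (1 + real (Suc n) * pi) ^ Suc k"
    have pB: "\<bar>\<phi> n x\<bar> ^ j \<le> (1 + real (Suc n) * pi) ^ Suc k" if "j \<le> Suc k" for x j
    proof -
      have "\<bar>\<phi> n x\<bar> ^ j \<le> (1 + real (Suc n) * pi) ^ j"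
        using \<phi>B[of n x] by (intro power_mono) auto
      also have "\<dots> \<le> (1 + real (Suc n) * pi) ^ Suc k"
        using that by (intro power_increasing) auto
      finally show ?thesis .
    qed
    have fB: "cmod (f x) \<le> B" for x
    proof -
      have "cmod (f x) \<le> 1 * (1 + real (Suc n) * pi) ^ Suc k"
        using pB[of "Suc k" x] unfolding f_def norm_of_real power_abs by simp
      also have "\<dots> \<le> B" unfolding B_def by (intro mult_right_mono) auto
      finally show ?thesis .
    qed
    have f'B: "cmod (f' x) \<le> B" for x
    proof -
      have "cmod (f' x) = real (Suc k) * \<bar>\<phi> n x\<bar> ^ k * inverse (1 + (x / real (Suc n))\<^sup>2)"
        unfolding f'_def norm_of_real abs_mult power_abs using inv1(2) by simp
      also have "\<dots> \<le> real (Suc k) * (1 + real (Suc n) * pi) ^ Suc k * 1"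
        using pB[of k x] inv1 by (intro mult_mono) auto
      finally show ?thesis by (simp add: B_def)
    qed
    have "(f has_vector_derivative f' x) (at x)" for x
      unfolding f_def f'_def
      by (rule has_vector_derivative_of_real)
        (use DERIV_power[OF \<phi>d[of n x], of "Suc k"] in \<open>simp add: mult_ac has_real_derivative_iff_has_vector_derivative del: of_nat_Suc power_Suc\<close>)
    moreover have "continuous_on UNIV f'"
      unfolding f'_def using \<phi>c[of n]
      by (intro continuous_intros) (auto simp: add_nonneg_eq_0_iff)
    ultimately have P: "(LINT x|\<mu>. (cmod (f x - (LINT y|\<mu>. f y)))\<^sup>2) \<le> C * (LINT x|\<mu>. (cmod (f' x))\<^sup>2)"
      using C fB f'B unfolding poincare_const_def by blast
    have fm [measurable]: "f \<in> borel_measurable borel" unfolding f_def by measurable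
    have "(cmod (f x - 0))\<^sup>2 = \<phi> n x ^ (2 * Suc k)" for x
    proof -
      have "(cmod (f x - 0))\<^sup>2 = (\<phi> n x ^ Suc k)\<^sup>2" unfolding f_def diff_zero norm_of_real by simp
      then show ?thesis by (simp only: power_mult[symmetric] mult.commute)
    qed
    then have "(LINT x|\<mu>. \<phi> n x ^ (2 * Suc k)) = (LINT x|\<mu>. (cmod (f x - 0))\<^sup>2)"
      by simp
    also have "\<dots> = (LINT x|\<mu>. (cmod (f x - (LINT y|\<mu>. f y)))\<^sup>2) + (cmod ((LINT y|\<mu>. f y) - 0))\<^sup>2"
      by (rule second_moment_shift[where B = B]) (use fB in auto)
    finally have 0: "(LINT x|\<mu>. \<phi> n x ^ (2 * Suc k)) = (LINT x|\<mu>. (cmod (f x - (LINT y|\<mu>. f y)))\<^sup>2) + (cmod ((LINT y|\<mu>. f y) - 0))\<^sup>2" .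
    have "(LINT x|\<mu>. (cmod (f' x))\<^sup>2) \<le> (LINT x|\<mu>. (real (Suc k))\<^sup>2 * x ^ (2 * k))"
    proof (rule integral_mono)
      show "integrable \<mu> (\<lambda>x. (real (Suc k))\<^sup>2 * x ^ (2 * k))" using i1 by simp
      have [measurable]: "f' \<in> borel_measurable borel" unfolding f'_def by measurable
      show "integrable \<mu> (\<lambda>x. (cmod (f' x))\<^sup>2)"
        by (rule integrable_bounded[where B = "B\<^sup>2"]) (use f'B in \<open>auto intro!: power_mono\<close>)
      fix x
      have "cmod (f' x) = real (Suc k) * \<bar>\<phi> n x\<bar> ^ k * inverse (1 + (x / real (Suc n))\<^sup>2)"
        unfolding f'_def norm_of_real abs_mult power_abs using inv1(2) by simp
      also have "\<dots> \<le> real (Suc k) * \<bar>x\<bar> ^ k * 1"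
        using inv1 \<phi>le[of n x] by (intro mult_mono power_mono) auto
      finally have "(cmod (f' x))\<^sup>2 \<le> (real (Suc k) * \<bar>x\<bar> ^ k * 1)\<^sup>2" by (intro power_mono) auto
      also have "\<dots> = (real (Suc k))\<^sup>2 * x ^ (2 * k)"
        by (simp add: power_mult_distrib power_even_abs mult.commute[of 2] flip: power_mult)
      finally show "(cmod (f' x))\<^sup>2 \<le> (real (Suc k))\<^sup>2 * x ^ (2 * k)" .
    qed
    also have "(LINT x|\<mu>. (real (Suc k))\<^sup>2 * x ^ (2 * k)) = (real (Suc k))\<^sup>2 * (LINT x|\<mu>. x ^ (2 * k))" by simp
    finally have "C * (LINT x|\<mu>. (cmod (f' x))\<^sup>2) \<le> C * ((real (Suc k))\<^sup>2 * (LINT x|\<mu>. x ^ (2 * k)))"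
      using C by (intro mult_left_mono) (auto simp: poincare_const_def)
    then have 1: "(LINT x|\<mu>. \<phi> n x ^ (2 * Suc k)) \<le> C * ((real (Suc k))\<^sup>2 * (LINT x|\<mu>. x ^ (2 * k))) + (cmod (LINT y|\<mu>. f y))\<^sup>2"
      using 0 P by (simp del: power_Suc of_nat_Suc)
    have 2: "cmod (LINT y|\<mu>. f y) \<le> (LINT x|\<mu>. \<bar>x\<bar> ^ Suc k)"
    proof -
      have "cmod (LINT y|\<mu>. f y) \<le> (LINT x|\<mu>. cmod (f x))" by (rule integral_norm_bound)
      also have "\<dots> \<le> (LINT x|\<mu>. \<bar>x\<bar> ^ Suc k)"
      proof (rule integral_mono[OF _ i2])
        show "integrable \<mu> (\<lambda>x. cmod (f x))"
          by (rule integrable_bounded[where B = B]) (use fB in auto)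
        show "cmod (f x) \<le> \<bar>x\<bar> ^ Suc k" for x
          unfolding f_def norm_of_real power_abs by (intro power_mono \<phi>le) auto
      qed
      finally show ?thesis .
    qed
    show ?thesis
      using 1 power_mono[OF 2 norm_ge_zero, of 2] unfolding m_def mult.assoc by linarith
  qed
  have lim: "(\<lambda>n. \<phi> n x) \<longlonglongrightarrow> x" for x
    unfolding \<phi>_def by (rule scaled_arctan_tendsto)
  \<comment> \<open>Fatou's lemma along the truncations carries the uniform bound over to the full
    moment.\<close>
  have "(\<integral>\<^sup>+ x. ennreal (x ^ (2 * Suc k)) \<partial>\<mu>) = (\<integral>\<^sup>+ x. liminf (\<lambda>n. ennreal (\<phi> n x ^ (2 * Suc k))) \<partial>\<mu>)"
    by (intro nn_integral_cong lim_imp_Liminf[symmetric] tendsto_ennrealI tendsto_power lim) auto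
  also have "\<dots> \<le> liminf (\<lambda>n. \<integral>\<^sup>+ x. ennreal (\<phi> n x ^ (2 * Suc k)) \<partial>\<mu>)"
    by (rule nn_integral_liminf) measurable
  also have "\<dots> \<le> limsup (\<lambda>n. \<integral>\<^sup>+ x. ennreal (\<phi> n x ^ (2 * Suc k)) \<partial>\<mu>)"
    by (rule Liminf_le_Limsup) simp
  also have "\<dots> \<le> ennreal m"
  proof (rule Limsup_bounded, rule always_eventually, rule allI)
    fix n
    have "integrable \<mu> (\<lambda>x. \<phi> n x ^ (2 * Suc k))"
    proof (rule integrable_bounded[where B = "(real (Suc n) * pi) ^ (2 * Suc k)"])
      show "norm (\<phi> n x ^ (2 * Suc k)) \<le> (real (Suc n) * pi) ^ (2 * Suc k)" for x
        unfolding real_norm_def power_abs by (intro power_mono \<phi>B) auto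
    qed measurable
    then have "(\<integral>\<^sup>+ x. ennreal (\<phi> n x ^ (2 * Suc k)) \<partial>\<mu>) = ennreal (LINT x|\<mu>. \<phi> n x ^ (2 * Suc k))"
      by (rule nn_integral_eq_integral) (intro AE_I2, unfold power_mult, intro zero_le_power zero_le_power2)
    also have "\<dots> \<le> ennreal m" by (rule ennreal_leI[OF bound])
    finally show "(\<integral>\<^sup>+ x. ennreal (\<phi> n x ^ (2 * Suc k)) \<partial>\<mu>) \<le> ennreal m" .
  qed
  finally have "(\<integral>\<^sup>+ x. ennreal (x ^ (2 * Suc k)) \<partial>\<mu>) < \<infinity>"
    by (auto simp: top_unique less_top[symmetric])
  moreover have "norm (x ^ (2 * Suc k)) = x ^ (2 * Suc k)" for x :: real
    unfolding real_norm_def power_mult by (rule abs_of_nonneg) (intro zero_le_power zero_le_power2)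
  ultimately show ?thesis
    by (intro integrableI_bounded) (auto simp del: power_Suc)
qed

lemma integrable_abs_power_le:
  fixes \<mu> :: "real measure"
  assumes \<mu>: "real_distribution \<mu>" and "integrable \<mu> (\<lambda>x. x ^ (2 * m))" and "k \<le> 2 * m"
  shows "integrable \<mu> (\<lambda>x. \<bar>x\<bar> ^ k)" "integrable \<mu> (\<lambda>x. x ^ k)"
proof -
  interpret real_distribution \<mu> by fact
  have i: "integrable \<mu> (\<lambda>x. 1 + x ^ (2 * m))" using assms(2) by simp
  have le: "\<bar>x\<bar> ^ k \<le> 1 + x ^ (2 * m)" for x :: real
  proof (cases "\<bar>x\<bar> \<le> 1")
    case True
    then have "\<bar>x\<bar> ^ k \<le> 1" by (simp add: power_le_one)
    moreover have "x ^ (2 * m) \<ge> 0" by (simp add: power_mult)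
    ultimately show ?thesis by linarith
  next
    case False
    then have "\<bar>x\<bar> ^ k \<le> \<bar>x\<bar> ^ (2 * m)" using assms(3) by (intro power_increasing) auto
    also have "\<dots> = x ^ (2 * m)" by (simp add: power_even_abs)
    finally show ?thesis by simp
  qed
  have "norm (1 + x ^ (2 * m)) = 1 + x ^ (2 * m)" for x :: real
  proof -
    have "x ^ (2 * m) \<ge> 0" by (simp add: power_mult)
    then show ?thesis by simp
  qed
  then show "integrable \<mu> (\<lambda>x. \<bar>x\<bar> ^ k)" "integrable \<mu> (\<lambda>x. x ^ k)"
    using le by (auto intro!: Bochner_Integration.integrable_bound[OF i] simp: power_abs)
qed

text \<open>Two steps, with k = 1 and k = 2; the moment of order k + 1 that each of them requires is
  available because k + 1 \<le> 2k. Order 6 is what the Taylor remainder s * s^5 asks for.\<close>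

lemma poincare_moments:
  assumes \<mu>: "real_distribution \<mu>" and C: "poincare_const \<mu> C" and i: "integrable \<mu> (\<lambda>x. x\<^sup>2)"
  shows "integrable \<mu> (\<lambda>x. x ^ 6)"
proof -
  have i2: "integrable \<mu> (\<lambda>x. x ^ (2 * 1))" using i by simp
  have "integrable \<mu> (\<lambda>x. x ^ (2 * Suc 1))"
    by (rule poincare_moment_step[OF \<mu> C i2 integrable_abs_power_le(1)[OF \<mu> i2]]) simp
  then have i4: "integrable \<mu> (\<lambda>x. x ^ (2 * 2))" by (simp add: numeral_eq_Suc)
  have "integrable \<mu> (\<lambda>x. x ^ (2 * Suc 2))"
    by (rule poincare_moment_step[OF \<mu> C i4 integrable_abs_power_le(1)[OF \<mu> i4]]) simp
  then show ?thesis by simp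
qed

lemma odd_moment_zero:
  fixes \<mu> :: "real measure"
  assumes \<mu>: "real_distribution \<mu>" and sym: "distr \<mu> borel uminus = \<mu>" and "odd k"
  shows "(LINT x|\<mu>. x ^ k) = 0"
proof -
  interpret real_distribution \<mu> by fact
  have "(LINT x|\<mu>. x ^ k) = (LINT x|distr \<mu> borel uminus. x ^ k)" by (simp add: sym)
  also have "\<dots> = (LINT x|\<mu>. (- x) ^ k)" by (subst integral_distr) auto
  also have "\<dots> = - (LINT x|\<mu>. x ^ k)" using \<open>odd k\<close> by (simp add: power_minus_odd)
  finally show ?thesis by simp
qed

section \<open>The fourth cumulant and the cumulant expansion\<close>

text \<open>For mean 0 the series a = moments - 1 starts in degree 2, so in log (1 + a) only a and -
  a^2 / 2 reach degree 4. The coefficient m4 / 24 - m2^2 / 8 is multiplied by 4!.\<close>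

lemma cumulant_4:
  assumes \<mu>: "real_distribution \<mu>" and "(LINT x|\<mu>. x) = 0" "(LINT x|\<mu>. x ^ 3) = 0"
  shows "cumulant \<mu> 4 = (LINT x|\<mu>. x ^ 4) - 3 * (LINT x|\<mu>. x\<^sup>2)\<^sup>2"
proof -
  interpret real_distribution \<mu> by fact
  define a where "a = moment_series \<mu> - 1"
  have a: "fps_nth a 0 = 0" "fps_nth a (Suc 0) = 0" "fps_nth a 2 = (LINT x|\<mu>. x\<^sup>2) / 2" "fps_nth a 3 = 0"
    "fps_nth a 4 = (LINT x|\<mu>. x ^ 4) / 24"
    using assms prob_space by (simp_all add: a_def moment_series_def fact_numeral)
  have s: "{0..4} = {0, Suc 0, 2, 3, 4 :: nat}" by auto
  have s3: "{0..3} = {0, Suc 0, 2, 3 :: nat}" by auto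
  have s2: "{0..2} = {0, Suc 0, 2 :: nat}" by auto
  have p2: "fps_nth (a ^ 2) 0 = 0" "fps_nth (a ^ 2) (Suc 0) = 0" "fps_nth (a ^ 2) 2 = 0" "fps_nth (a ^ 2) 3 = 0"
    "fps_nth (a ^ 2) 4 = ((LINT x|\<mu>. x\<^sup>2) / 2)\<^sup>2"
    unfolding power2_eq_square[of a] fps_mult_nth s s3 s2 by (simp_all add: a power2_eq_square)
  have p3: "fps_nth (a ^ 3) 2 = 0" "fps_nth (a ^ 3) 4 = 0"
    unfolding power3_eq_cube[of a] power2_eq_square[symmetric] fps_mult_nth s s2 by (simp_all add: a p2)
  have e4: "a ^ 4 = a ^ 2 * a ^ 2" by (simp flip: power_add)
  have p4: "fps_nth (a ^ 4) 4 = 0"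
    unfolding e4 fps_mult_nth s by (simp add: p2)
  have "fps_nth (fps_compose (fps_ln 1) a) 4 = (LINT x|\<mu>. x ^ 4) / 24 - ((LINT x|\<mu>. x\<^sup>2) / 2)\<^sup>2 / 2"
    unfolding fps_compose_nth s by (simp add: fps_ln_nth a p2 p3 p4)
  then show ?thesis
    unfolding cumulant_def a_def[symmetric] by (simp add: fact_numeral power2_eq_square field_simps)
qed

text \<open>\<open>\<psi> 0\<close>, \<open>\<psi> 1\<close> and \<open>\<psi> 3\<close> are
  expanded at 0 to the orders that leave only \<open>\<psi> 5\<close> in the remainders. The
  polynomial parts integrate to 0: derivatives of even order meet odd moments,
  \<open>\<psi> 1\<close> cancels through the factor m2, and \<open>\<psi> 3\<close> through m4 / 6
  - m2^2 / 2 = (m4 - 3 m2^2) / 6. Values are real because the Lagrange form of the remainder is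
  used.\<close>

lemma cumulant_expansion_real:
  fixes \<psi> :: "nat \<Rightarrow> real \<Rightarrow> real"
  assumes \<mu>: "real_distribution \<mu>" and sym: "distr \<mu> borel uminus = \<mu>" and i6: "integrable \<mu> (\<lambda>x. x ^ 6)"
    and d: "\<And>k s. (\<psi> k has_real_derivative \<psi> (Suc k) s) (at s)"
    and b: "\<And>k s. \<bar>\<psi> k s\<bar> \<le> B k"
  defines "m \<equiv> \<lambda>k. LINT x|\<mu>. x ^ k"
  shows "\<bar>LINT s|\<mu>. s * \<psi> 0 s - m 2 * \<psi> 1 s - (m 4 - 3 * (m 2)\<^sup>2) / 6 * \<psi> 3 s\<bar>
    \<le> (m 6 / 120 + \<bar>m 2\<bar> * m 4 / 24 + \<bar>(m 4 - 3 * (m 2)\<^sup>2) / 6\<bar> * m 2 / 2) * B 5"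
proof -
  interpret real_distribution \<mu> by fact
  define c where "c = (m 4 - 3 * (m 2)\<^sup>2) / 6"
  have ik: "integrable \<mu> (\<lambda>x. x ^ k)" if "k \<le> 6" for k
    using integrable_abs_power_le(2)[OF \<mu>, of 3 k] i6 that by simp
  have odd: "m k = 0" if "odd k" for k unfolding m_def by (rule odd_moment_zero[OF \<mu> sym that])
  have dk: "\<forall>j x. (\<psi> (k + j) has_real_derivative \<psi> (k + Suc j) x) (at x)" for k using d by simp
  have tay: "\<exists>t. \<psi> k s = (\<Sum>j<n. \<psi> (k + j) 0 / fact j * s ^ j) + \<psi> (k + n) t / fact n * s ^ n" for k n s
    using Maclaurin_all_le[of "\<lambda>j. \<psi> (k + j)" "\<psi> k" s n, OF _ dk] by auto
  have rem: "\<bar>\<psi> k s - (\<Sum>j<n. \<psi> (k + j) 0 / fact j * s ^ j)\<bar> \<le> B (k + n) / fact n * \<bar>s\<bar> ^ n" for k n s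
  proof -
    obtain t where "\<psi> k s = (\<Sum>j<n. \<psi> (k + j) 0 / fact j * s ^ j) + \<psi> (k + n) t / fact n * s ^ n"
      using tay by blast
    then have "\<bar>\<psi> k s - (\<Sum>j<n. \<psi> (k + j) 0 / fact j * s ^ j)\<bar> = \<bar>\<psi> (k + n) t\<bar> / fact n * \<bar>s\<bar> ^ n"
      by (simp add: abs_mult power_abs)
    also have "\<dots> \<le> B (k + n) / fact n * \<bar>s\<bar> ^ n"
      by (intro mult_right_mono divide_right_mono b) auto
    finally show ?thesis .
  qed
  define q where "q s = s * \<psi> 0 s - m 2 * \<psi> 1 s - c * \<psi> 3 s" for s
  define p where "p s = s * (\<Sum>j<5. \<psi> (0 + j) 0 / fact j * s ^ j)
     - m 2 * (\<Sum>j<4. \<psi> (1 + j) 0 / fact j * s ^ j) - c * (\<Sum>j<2. \<psi> (3 + j) 0 / fact j * s ^ j)" for s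
  have p: "p s = (- m 2 * \<psi> 1 0 - c * \<psi> 3 0) + (\<psi> 0 0 - m 2 * \<psi> 2 0 - c * \<psi> 4 0) * s ^ 1
     + (\<psi> 1 0 - m 2 * \<psi> 3 0 / 2) * s ^ 2 + (\<psi> 2 0 / 2 - m 2 * \<psi> 4 0 / 6) * s ^ 3 + \<psi> 3 0 / 6 * s ^ 4 + \<psi> 4 0 / 24 * s ^ 5" for s
    unfolding p_def by (simp add: eval_nat_numeral fact_numeral algebra_simps)
  have ip: "integrable \<mu> p"
    unfolding p by (intro Bochner_Integration.integrable_add integrable_mult_right ik) auto
  have p0: "(LINT s|\<mu>. p s) = 0"
  proof -
    have "(LINT s|\<mu>. p s) = (- m 2 * \<psi> 1 0 - c * \<psi> 3 0) + (\<psi> 0 0 - m 2 * \<psi> 2 0 - c * \<psi> 4 0) * m 1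
     + (\<psi> 1 0 - m 2 * \<psi> 3 0 / 2) * m 2 + (\<psi> 2 0 / 2 - m 2 * \<psi> 4 0 / 6) * m 3 + \<psi> 3 0 / 6 * m 4 + \<psi> 4 0 / 24 * m 5"
      unfolding p m_def using ik[of 1] ik[of 2] ik[of 3] ik[of 4] ik[of 5]
      by (simp add: prob_space[unfolded space_eq_univ] del: One_nat_def)
    then show ?thesis by (simp add: odd c_def power2_eq_square field_simps)
  qed
  have le: "\<bar>q s - p s\<bar> \<le> (s ^ 6 / 120 + \<bar>m 2\<bar> * s ^ 4 / 24 + \<bar>c\<bar> * s ^ 2 / 2) * B 5" for s
  proof -
    have "q s - p s = s * (\<psi> 0 s - (\<Sum>j<5. \<psi> (0 + j) 0 / fact j * s ^ j))
       - m 2 * (\<psi> 1 s - (\<Sum>j<4. \<psi> (1 + j) 0 / fact j * s ^ j)) - c * (\<psi> 3 s - (\<Sum>j<2. \<psi> (3 + j) 0 / fact j * s ^ j))"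
      unfolding q_def p_def by (simp only: right_diff_distrib)
    also have "\<bar>\<dots>\<bar> \<le> \<bar>s\<bar> * (B (0 + 5) / fact 5 * \<bar>s\<bar> ^ 5) + \<bar>m 2\<bar> * (B (1 + 4) / fact 4 * \<bar>s\<bar> ^ 4)
       + \<bar>c\<bar> * (B (3 + 2) / fact 2 * \<bar>s\<bar> ^ 2)"
      unfolding abs_mult[symmetric]
      by (intro order_trans[OF abs_triangle_ineq4] add_mono; unfold abs_mult; intro mult_left_mono rem abs_ge_zero)
    also have "\<dots> = (s ^ 6 / 120 + \<bar>m 2\<bar> * s ^ 4 / 24 + \<bar>c\<bar> * s ^ 2 / 2) * B 5"
    proof -
      have "\<bar>s\<bar> * \<bar>s\<bar> ^ 5 = s ^ 6" by (simp add: power_even_abs flip: power_Suc)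
      then show ?thesis by (simp add: fact_numeral power_even_abs algebra_simps)
    qed
    finally show ?thesis .
  qed
  have \<psi>m [measurable]: "\<psi> k \<in> borel_measurable borel" for k
    using d by (intro borel_measurable_continuous_onI continuous_at_imp_continuous_on) (auto intro: DERIV_continuous)
  have ib: "integrable \<mu> (\<psi> k)" for k
    by (rule integrable_bounded[where B = "B k"]) (use b in auto)
  have isp: "integrable \<mu> (\<lambda>s. s * \<psi> 0 s)"
  proof (rule Bochner_Integration.integrable_bound)
    show "integrable \<mu> (\<lambda>s. B 0 * s)" using ik[of 1] by simp
    show "AE s in \<mu>. norm (s * \<psi> 0 s) \<le> norm (B 0 * s)"
    proof (rule AE_I2)
      fix s
      have "\<bar>\<psi> 0 s\<bar> * \<bar>s\<bar> \<le> \<bar>B 0\<bar> * \<bar>s\<bar>"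
        by (intro mult_right_mono order_trans[OF b abs_ge_self]) auto
      then show "norm (s * \<psi> 0 s) \<le> norm (B 0 * s)" by (simp add: abs_mult mult.commute)
    qed
  qed measurable
  have iq: "integrable \<mu> q" unfolding q_def using isp ib by auto
  have "\<bar>LINT s|\<mu>. q s\<bar> = \<bar>LINT s|\<mu>. q s - p s\<bar>" using iq ip p0 by simp
  also have "\<dots> \<le> (LINT s|\<mu>. \<bar>q s - p s\<bar>)" by (rule integral_abs_bound)
  also have "\<dots> \<le> (LINT s|\<mu>. (s ^ 6 / 120 + \<bar>m 2\<bar> * s ^ 4 / 24 + \<bar>c\<bar> * s ^ 2 / 2) * B 5)"
    using iq ip ik[of 6] ik[of 4] ik[of 2] le by (intro integral_mono) auto
  also have "\<dots> = (m 6 / 120 + \<bar>m 2\<bar> * m 4 / 24 + \<bar>c\<bar> * m 2 / 2) * B 5"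
    unfolding m_def using ik[of 6] ik[of 4] ik[of 2] by simp
  finally show ?thesis unfolding q_def c_def .
qed

text \<open>The constant of the real expansion, doubled because real and imaginary part are treated
  separately.\<close>

definition cumulant_const :: "real measure \<Rightarrow> real" where
  "cumulant_const \<mu> = 2 * ((LINT x|\<mu>. x ^ 6) / 120 + \<bar>LINT x|\<mu>. x\<^sup>2\<bar> * (LINT x|\<mu>. x ^ 4) / 24
     + \<bar>((LINT x|\<mu>. x ^ 4) - 3 * (LINT x|\<mu>. x\<^sup>2)\<^sup>2) / 6\<bar> * (LINT x|\<mu>. x\<^sup>2) / 2)"

lemma cumulant_expansion:
  fixes \<psi> :: "nat \<Rightarrow> real \<Rightarrow> complex"
  assumes \<mu>: "real_distribution \<mu>" and sym: "distr \<mu> borel uminus = \<mu>" and i6: "integrable \<mu> (\<lambda>x. x ^ 6)"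
    and d: "\<And>k s. (\<psi> k has_vector_derivative \<psi> (Suc k) s) (at s)"
    and b: "\<And>k s. cmod (\<psi> k s) \<le> B k"
  shows "cmod (LINT s|\<mu>. complex_of_real s * \<psi> 0 s - complex_of_real (LINT x|\<mu>. x\<^sup>2) * \<psi> 1 s
      - complex_of_real (((LINT x|\<mu>. x ^ 4) - 3 * (LINT x|\<mu>. x\<^sup>2)\<^sup>2) / 6) * \<psi> 3 s) \<le> cumulant_const \<mu> * B 5"
    (is "cmod (LINT s|\<mu>. ?q s) \<le> _")
proof -
  interpret real_distribution \<mu> by fact
  have \<psi>m [measurable]: "\<psi> k \<in> borel_measurable borel" for k
    using d by (intro borel_measurable_continuous_onI continuous_at_imp_continuous_on) (auto intro: has_vector_derivative_continuous)
  have dRe: "((\<lambda>s. Re (\<psi> k s)) has_real_derivative Re (\<psi> (Suc k) s)) (at s)"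
    and dIm: "((\<lambda>s. Im (\<psi> k s)) has_real_derivative Im (\<psi> (Suc k) s)) (at s)" for k s
    unfolding has_real_derivative_iff_has_vector_derivative
    by (rule bounded_linear.has_vector_derivative[OF bounded_linear_Re d] bounded_linear.has_vector_derivative[OF bounded_linear_Im d])+
  have bRe: "\<bar>Re (\<psi> k s)\<bar> \<le> B k" and bIm: "\<bar>Im (\<psi> k s)\<bar> \<le> B k" for k s
    using abs_Re_le_cmod[of "\<psi> k s"] abs_Im_le_cmod[of "\<psi> k s"] b[of k s] by linarith+
  have ib: "integrable \<mu> (\<psi> k)" for k
    by (rule integrable_bounded[where B = "B k"]) (use b in auto)
  have isp: "integrable \<mu> (\<lambda>s. complex_of_real s * \<psi> 0 s)"
  proof (rule Bochner_Integration.integrable_bound)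
    show "integrable \<mu> (\<lambda>s. B 0 * s)"
      using integrable_abs_power_le(2)[OF \<mu>, of 3 1] i6 by simp
    show "AE s in \<mu>. norm (complex_of_real s * \<psi> 0 s) \<le> norm (B 0 * s)"
    proof (rule AE_I2)
      fix s
      have "cmod (\<psi> 0 s) * \<bar>s\<bar> \<le> \<bar>B 0\<bar> * \<bar>s\<bar>"
        by (intro mult_right_mono order_trans[OF b abs_ge_self]) auto
      then show "norm (complex_of_real s * \<psi> 0 s) \<le> norm (B 0 * s)"
        by (simp add: norm_mult abs_mult mult.commute)
    qed
  qed measurable
  have iq: "integrable \<mu> ?q" using ib isp by (intro Bochner_Integration.integrable_diff integrable_mult_right) auto
  have "cmod (LINT s|\<mu>. ?q s) \<le> \<bar>Re (LINT s|\<mu>. ?q s)\<bar> + \<bar>Im (LINT s|\<mu>. ?q s)\<bar>" by (rule cmod_le)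
  also have "Re (LINT s|\<mu>. ?q s) = (LINT s|\<mu>. Re (?q s))" using iq by (rule integral_Re[symmetric])
  also have "Im (LINT s|\<mu>. ?q s) = (LINT s|\<mu>. Im (?q s))" using iq by (rule integral_Im[symmetric])
  also have "\<bar>LINT s|\<mu>. Re (?q s)\<bar> + \<bar>LINT s|\<mu>. Im (?q s)\<bar> \<le> cumulant_const \<mu> * B 5"
  proof -
    have e: "Re (?q s) = s * Re (\<psi> 0 s) - (LINT x|\<mu>. x\<^sup>2) * Re (\<psi> 1 s) - ((LINT x|\<mu>. x ^ 4) - 3 * (LINT x|\<mu>. x\<^sup>2)\<^sup>2) / 6 * Re (\<psi> 3 s)"
      "Im (?q s) = s * Im (\<psi> 0 s) - (LINT x|\<mu>. x\<^sup>2) * Im (\<psi> 1 s) - ((LINT x|\<mu>. x ^ 4) - 3 * (LINT x|\<mu>. x\<^sup>2)\<^sup>2) / 6 * Im (\<psi> 3 s)" for s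
      by (simp_all only: minus_complex.sel Re_complex_of_real Im_complex_of_real times_complex.sel mult_zero_left diff_zero add_0_right)
    show ?thesis
      unfolding e cumulant_const_def
      by (rule order_trans[OF add_mono]) (rule cumulant_expansion_real[OF \<mu> sym i6, where \<psi> = "\<lambda>k s. Re (\<psi> k s)", OF dRe bRe],
        rule cumulant_expansion_real[OF \<mu> sym i6, where \<psi> = "\<lambda>k s. Im (\<psi> k s)", OF dIm bIm], simp only: mult_2 distrib_right order_refl)
  qed
  finally show ?thesis by simp
qed

lemma cumulant_expansion_PiM:
  fixes \<Phi> :: "nat \<Rightarrow> ('i \<Rightarrow> real) \<Rightarrow> complex"
  assumes \<mu>: "real_distribution \<mu>" and sym: "distr \<mu> borel uminus = \<mu>" and i6: "integrable \<mu> (\<lambda>x. x ^ 6)"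
    and I: "finite I" "p \<in> I"
    and d: "\<And>k x s. ((\<lambda>s. \<Phi> k (x(p := s))) has_vector_derivative \<Phi> (Suc k) (x(p := s))) (at s)"
    and b: "\<And>k x. cmod (\<Phi> k x) \<le> B k"
    and m: "\<And>k. \<Phi> k \<in> borel_measurable (PiM I (\<lambda>_. \<mu>))"
  defines "P \<equiv> PiM I (\<lambda>_. \<mu>)"
  shows "integrable P (\<lambda>x. complex_of_real (x p) * \<Phi> 0 x)"
    and "cmod ((LINT x|P. complex_of_real (x p) * \<Phi> 0 x) - complex_of_real (LINT x|\<mu>. x\<^sup>2) * (LINT x|P. \<Phi> 1 x)
      - complex_of_real (((LINT x|\<mu>. x ^ 4) - 3 * (LINT x|\<mu>. x\<^sup>2)\<^sup>2) / 6) * (LINT x|P. \<Phi> 3 x)) \<le> cumulant_const \<mu> * B 5"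
proof -
  interpret \<mu>: real_distribution \<mu> by fact
  interpret product_prob_space "\<lambda>_. \<mu>" I ..
  interpret PQ: prob_space P unfolding P_def by (rule prob_space_PiM) (rule \<mu>.prob_space_axioms)
  interpret J: prob_space "PiM (I - {p}) (\<lambda>_. \<mu>)" by (rule prob_space_PiM) (rule \<mu>.prob_space_axioms)
  have [measurable]: "\<Phi> k \<in> borel_measurable P" for k using m by (simp add: P_def)
  have xp: "(\<lambda>x. x p) \<in> measurable P \<mu>" unfolding P_def using I by (intro measurable_component_singleton)
  then have [measurable]: "(\<lambda>x. x p) \<in> borel_measurable P"
    by (simp cong: measurable_cong_sets add: \<mu>.events_eq_borel)
  have ip: "integrable P (\<lambda>x. x p)"
  proof -
    have "integrable (distr P \<mu> (\<lambda>x. x p)) (\<lambda>s. s)"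
      using PiM_component[OF I(2)] integrable_abs_power_le(2)[OF \<mu>, of 3 1] i6 by (simp add: P_def)
    then show ?thesis using xp by (simp add: integrable_distr_eq)
  qed
  show i0: "integrable P (\<lambda>x. complex_of_real (x p) * \<Phi> 0 x)"
  proof (rule Bochner_Integration.integrable_bound)
    show "integrable P (\<lambda>x. B 0 * x p)" using ip by simp
    show "AE x in P. norm (complex_of_real (x p) * \<Phi> 0 x) \<le> norm (B 0 * x p)"
    proof (rule AE_I2)
      fix x
      have "cmod (\<Phi> 0 x) * \<bar>x p\<bar> \<le> \<bar>B 0\<bar> * \<bar>x p\<bar>"
        by (intro mult_right_mono order_trans[OF b abs_ge_self]) auto
      then show "norm (complex_of_real (x p) * \<Phi> 0 x) \<le> norm (B 0 * x p)"
        by (simp add: norm_mult abs_mult mult.commute)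
    qed
  qed measurable
  have ik: "integrable P (\<Phi> k)" for k
    by (rule PQ.integrable_bounded[where B = "B k"]) (use b in auto)
  define c where "c = complex_of_real (((LINT x|\<mu>. x ^ 4) - 3 * (LINT x|\<mu>. x\<^sup>2)\<^sup>2) / 6)"
  define v where "v = complex_of_real (LINT x|\<mu>. x\<^sup>2)"
  define q where "q x = complex_of_real (x p) * \<Phi> 0 x - v * \<Phi> 1 x - c * \<Phi> 3 x" for x
  have iq: "integrable P q"
    unfolding q_def using i0 ik by (intro Bochner_Integration.integrable_diff integrable_mult_right) auto
  have "(LINT x|P. q x) = (LINT x|PiM (I - {p}) (\<lambda>_. \<mu>). LINT s|\<mu>. q (x(p := s)))"
    using product_integral_insert[of "I - {p}" p q] I iq by (simp add: insert_absorb P_def)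
  moreover have "cmod (LINT s|\<mu>. q (x(p := s))) \<le> cumulant_const \<mu> * B 5" for x
    unfolding q_def v_def c_def fun_upd_same
    by (rule cumulant_expansion[OF \<mu> sym i6, where \<psi> = "\<lambda>k s. \<Phi> k (x(p := s))"]) (rule d, rule b)
  ultimately have "cmod (LINT x|P. q x) \<le> cumulant_const \<mu> * B 5"
    using J.norm_integral_bounded by metis
  moreover have "(LINT x|P. q x) = (LINT x|P. complex_of_real (x p) * \<Phi> 0 x) - v * (LINT x|P. \<Phi> 1 x) - c * (LINT x|P. \<Phi> 3 x)"
    unfolding q_def using i0 ik by simp
  ultimately show "cmod ((LINT x|P. complex_of_real (x p) * \<Phi> 0 x) - complex_of_real (LINT x|\<mu>. x\<^sup>2) * (LINT x|P. \<Phi> 1 x)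
      - complex_of_real (((LINT x|\<mu>. x ^ 4) - 3 * (LINT x|\<mu>. x\<^sup>2)\<^sup>2) / 6) * (LINT x|P. \<Phi> 3 x)) \<le> cumulant_const \<mu> * B 5"
    by (simp add: v_def c_def)
qed

section \<open>Stieltjes transforms\<close>

lemma cmod_diff_real_ge: "\<bar>Im z\<bar> \<le> cmod (z - complex_of_real x)"
  using abs_Im_le_cmod[of "z - complex_of_real x"] by simp

lemma diff_real_nonzero: "Im z \<noteq> 0 \<Longrightarrow> z - complex_of_real x \<noteq> 0"
  by (auto simp: complex_eq_iff)

lemma cmod_kernel_le:
  assumes "Im z > 0" shows "cmod (1 / (z - complex_of_real x)) \<le> 1 / Im z"
proof -
  have "Im z \<le> cmod (z - complex_of_real x)" using cmod_diff_real_ge[of z x] assms by simp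
  then show ?thesis using assms by (simp add: norm_divide frac_le)
qed

context real_distribution
begin

lemma kernel_integrable: "Im z > 0 \<Longrightarrow> integrable M (\<lambda>x. 1 / (z - complex_of_real x))"
  by (rule integrable_bounded[OF _ cmod_kernel_le]) auto

lemma kernel2_bound:
  assumes "Im z > 0" "Im w > 0"
  shows "cmod (1 / ((z - complex_of_real x) * (w - complex_of_real x))) \<le> 1 / (Im z * Im w)"
proof -
  have "cmod (1 / (z - complex_of_real x)) * cmod (1 / (w - complex_of_real x)) \<le> (1 / Im z) * (1 / Im w)"
    using assms by (intro mult_mono cmod_kernel_le) auto
  then show ?thesis by (simp add: norm_divide norm_mult)
qed

lemma kernel2_integrable:
  "Im z > 0 \<Longrightarrow> Im w > 0 \<Longrightarrow> integrable M (\<lambda>x. 1 / ((z - complex_of_real x) * (w - complex_of_real x)))"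
  by (rule integrable_bounded[OF _ kernel2_bound]) auto

lemma stieltjes_bound: "Im z > 0 \<Longrightarrow> cmod (stieltjes M z) \<le> 1 / Im z"
  unfolding stieltjes_def by (rule norm_integral_bounded[OF cmod_kernel_le])

lemma stieltjes_diff:
  assumes "Im z > 0" "Im w > 0"
  shows "stieltjes M z - stieltjes M w = (w - z) * (LINT x|M. 1 / ((z - complex_of_real x) * (w - complex_of_real x)))"
proof -
  have "stieltjes M z - stieltjes M w = (LINT x|M. 1 / (z - complex_of_real x) - 1 / (w - complex_of_real x))"
    unfolding stieltjes_def using assms by (simp add: kernel_integrable)
  also have "\<dots> = (LINT x|M. (w - z) * (1 / ((z - complex_of_real x) * (w - complex_of_real x))))"
    using assms diff_real_nonzero[of z] diff_real_nonzero[of w]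
    by (intro Bochner_Integration.integral_cong) (auto simp: field_simps)
  finally show ?thesis by (simp only: integral_mult_right_zero)
qed

lemma stieltjes_lipschitz:
  assumes "Im z > 0" "Im w > 0"
  shows "cmod (stieltjes M z - stieltjes M w) \<le> cmod (z - w) / (Im z * Im w)"
proof -
  have "cmod (LINT x|M. 1 / ((z - complex_of_real x) * (w - complex_of_real x))) \<le> 1 / (Im z * Im w)"
    by (rule norm_integral_bounded[OF kernel2_bound[OF assms]])
  then show ?thesis
    unfolding stieltjes_diff[OF assms] norm_mult
    using mult_left_mono[of _ _ "cmod (w - z)"] by (simp add: norm_minus_commute) fastforce
qed

text \<open>The second-order remainder of the kernel is exactly h^2 / ((z - x)^2 (z + h - x)). The
  condition on h keeps Im (z + h) above Im z / 2, whence the factor 2.\<close>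

lemma stieltjes_taylor:
  assumes z: "Im z > 0" and h: "cmod h \<le> Im z / 2"
  shows "cmod (stieltjes M (z + h) - stieltjes M z - h * (- (LINT x|M. 1 / (z - complex_of_real x)\<^sup>2)))
    \<le> 2 * (cmod h)\<^sup>2 / (Im z) ^ 3"
proof -
  have "\<bar>Im h\<bar> \<le> Im z / 2" using abs_Im_le_cmod[of h] h by linarith
  then have zh: "Im (z + h) \<ge> Im z / 2" "Im (z + h) > 0" using z by auto
  have i2: "integrable M (\<lambda>x. 1 / (z - complex_of_real x)\<^sup>2)"
    unfolding power2_eq_square by (rule kernel2_integrable[OF z z])
  let ?r = "\<lambda>x. h\<^sup>2 / ((z - complex_of_real x)\<^sup>2 * (z + h - complex_of_real x))"
  have "stieltjes M (z + h) - stieltjes M z - h * (- (LINT x|M. 1 / (z - complex_of_real x)\<^sup>2))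
    = (LINT x|M. 1 / (z + h - complex_of_real x) - 1 / (z - complex_of_real x) + h * (1 / (z - complex_of_real x)\<^sup>2))"
    unfolding stieltjes_def using kernel_integrable[OF z] kernel_integrable[OF zh(2)] integrable_mult_right[OF i2, of h]
    by (simp del: times_divide_eq_right)
  also have "\<dots> = (LINT x|M. ?r x)"
  proof (intro Bochner_Integration.integral_cong refl)
    fix x
    define a b where "a = z - complex_of_real x" and "b = z + h - complex_of_real x"
    have nz: "a \<noteq> 0" "b \<noteq> 0" "b = a + h"
      using diff_real_nonzero[of z x] diff_real_nonzero[of "z + h" x] z zh by (auto simp: a_def b_def)
    have "1 / b - 1 / a + h * (1 / a\<^sup>2) = h\<^sup>2 / (a\<^sup>2 * b)"
    proof -
      have "1 / b - 1 / a + h * (1 / a\<^sup>2) = (a * a - a * b + h * b) / (a\<^sup>2 * b)"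
        using nz(1,2) by (simp add: divide_simps power2_eq_square) (simp add: algebra_simps)
      also have "a * a - a * b + h * b = h\<^sup>2" unfolding nz(3) by (simp add: algebra_simps power2_eq_square)
      finally show ?thesis .
    qed
    then show "1 / (z + h - complex_of_real x) - 1 / (z - complex_of_real x) + h * (1 / (z - complex_of_real x)\<^sup>2) = ?r x"
      by (simp add: a_def b_def)
  qed
  also have "cmod \<dots> \<le> 2 * (cmod h)\<^sup>2 / (Im z) ^ 3"
  proof (rule norm_integral_bounded)
    fix x
    have "cmod (?r x) = (cmod h)\<^sup>2 * (cmod (1 / (z - complex_of_real x)))\<^sup>2 * cmod (1 / (z + h - complex_of_real x))"
      by (simp add: norm_divide norm_mult norm_power power_divide)
    also have "\<dots> \<le> (cmod h)\<^sup>2 * (1 / Im z)\<^sup>2 * (1 / (Im z / 2))"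
    proof (intro mult_mono power_mono cmod_kernel_le z order_refl)
      have "1 / Im (z + h) \<le> 1 / (Im z / 2)" using zh z by (intro frac_le) auto
      then show "cmod (1 / (z + h - complex_of_real x)) \<le> 1 / (Im z / 2)"
        using cmod_kernel_le[OF zh(2), of x] by linarith
    qed (use z in auto)
    finally show "cmod (?r x) \<le> 2 * (cmod h)\<^sup>2 / (Im z) ^ 3"
      by (simp add: power_divide power2_eq_square power3_eq_cube mult_ac)
  qed
  finally show ?thesis .
qed

lemma stieltjes_has_deriv:
  assumes z: "Im z > 0"
  shows "(stieltjes M has_field_derivative (- (LINT x|M. 1 / (z - complex_of_real x)\<^sup>2))) (at z)"
proof -
  let ?d = "- (LINT x|M. 1 / (z - complex_of_real x)\<^sup>2)"
  have "((\<lambda>h. (stieltjes M (z + h) - stieltjes M z) / h - ?d) \<longlongrightarrow> 0) (at 0)"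
  proof (rule Lim_null_comparison)
    have "\<forall>\<^sub>F h in at (0::complex). cmod h < Im z / 2"
      by (rule order_tendstoD) (use z in \<open>auto intro!: tendsto_norm_zero tendsto_ident_at\<close>)
    then show "\<forall>\<^sub>F h in at 0. norm ((stieltjes M (z + h) - stieltjes M z) / h - ?d) \<le> 2 / (Im z) ^ 3 * cmod h"
      using eventually_neq_at_within[of 0]
    proof eventually_elim
      case (elim h)
      have "(stieltjes M (z + h) - stieltjes M z) / h - ?d = (stieltjes M (z + h) - stieltjes M z - h * ?d) / h"
        using elim by (simp add: field_simps)
      then have "norm ((stieltjes M (z + h) - stieltjes M z) / h - ?d)
        = cmod (stieltjes M (z + h) - stieltjes M z - h * ?d) / cmod h"
        by (simp only: norm_divide)
      also have "\<dots> \<le> (2 * (cmod h)\<^sup>2 / (Im z) ^ 3) / cmod h"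
        by (intro divide_right_mono stieltjes_taylor[OF z]) (use elim in auto)
      also have "\<dots> = 2 / (Im z) ^ 3 * cmod h" using elim by (simp add: power2_eq_square)
      finally show ?case .
    qed
    show "((\<lambda>h. 2 / (Im z) ^ 3 * cmod h) \<longlongrightarrow> 0) (at 0)"
      by (intro tendsto_mult_right_zero tendsto_norm_zero tendsto_ident_at)
  qed
  then show ?thesis unfolding DERIV_def by (rule LIM_zero_cancel)
qed

lemma deriv_stieltjes: "Im z > 0 \<Longrightarrow> deriv (stieltjes M) z = - (LINT x|M. 1 / (z - complex_of_real x)\<^sup>2)"
  by (rule DERIV_imp_deriv[OF stieltjes_has_deriv])

lemma deriv_stieltjes_bound: "Im z > 0 \<Longrightarrow> cmod (deriv (stieltjes M) z) \<le> 1 / (Im z)\<^sup>2"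
  unfolding deriv_stieltjes norm_minus_cancel power2_eq_square
  by (rule norm_integral_bounded[OF kernel2_bound])

lemma stieltjes_holomorphic: "stieltjes M holomorphic_on {z. Im z > 0}"
  by (subst holomorphic_on_open) (auto simp: open_halfspace_Im_gt intro: stieltjes_has_deriv)

lemma stieltjes_continuous: "continuous_on {z. Im z > 0} (stieltjes M)"
  by (rule holomorphic_on_imp_continuous_on[OF stieltjes_holomorphic])

lemma poisson_integrable: "Im z > 0 \<Longrightarrow> integrable M (\<lambda>x. 1 / (cmod (z - complex_of_real x))\<^sup>2)"
  using kernel2_bound[of z z]
  by (intro integrable_bounded[where B = "1 / (Im z * Im z)"]) (auto simp: norm_divide norm_mult power2_eq_square)

lemma Im_stieltjes:
  assumes z: "Im z > 0"
  shows "Im (stieltjes M z) = - Im z * (LINT x|M. 1 / (cmod (z - complex_of_real x))\<^sup>2)"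
proof -
  have "Im (stieltjes M z) = (LINT x|M. Im (1 / (z - complex_of_real x)))"
    unfolding stieltjes_def by (rule integral_Im[symmetric, OF kernel_integrable[OF z]])
  also have "\<dots> = (LINT x|M. - Im z * (1 / (cmod (z - complex_of_real x))\<^sup>2))"
    by (intro Bochner_Integration.integral_cong refl) (simp add: Im_divide cmod_power2)
  finally show ?thesis by (simp only: integral_mult_right_zero)
qed

lemma Im_stieltjes_nonpos: "Im z > 0 \<Longrightarrow> Im (stieltjes M z) \<le> 0"
  by (simp add: Im_stieltjes mult_nonneg_nonneg)

text \<open>The map z - \<sigma>^2 g(z) never lowers the imaginary part, so every bound in terms of
  1 / Im z also holds at the subordination point.\<close>

lemma Im_subordination: "Im z > 0 \<Longrightarrow> Im z \<le> Im (z - (complex_of_real \<sigma>)\<^sup>2 * stieltjes M z)"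
  using Im_stieltjes_nonpos[of z] by (simp add: mult_nonneg_nonpos flip: of_real_power)

text \<open>
  If \<open>w + \<sigma>\<^sup>2 g(w)\<close> lies in the upper half-plane, then \<open>\<sigma>\<^sup>2 \<integral> |w - x|\<^sup>-\<^sup>2 < 1\<close>; two different such
  points with the same image would violate this by the Cauchy-Schwarz inequality.
\<close>
lemma subordination_unique:
  assumes w: "Im w1 > 0" "Im w2 > 0" and \<sigma>: "\<sigma> > 0"
    and eq: "w1 + (complex_of_real \<sigma>)\<^sup>2 * stieltjes M w1 = w2 + (complex_of_real \<sigma>)\<^sup>2 * stieltjes M w2"
    and im: "Im (w1 + (complex_of_real \<sigma>)\<^sup>2 * stieltjes M w1) > 0"
  shows "w1 = w2"
proof (rule ccontr)
  assume ne: "w1 \<noteq> w2"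
  define I where "I w = (LINT x|M. 1 / (cmod (w - complex_of_real x))\<^sup>2)" for w
  have lt: "\<sigma>\<^sup>2 * I w < 1" if "Im w > 0" "Im (w + (complex_of_real \<sigma>)\<^sup>2 * stieltjes M w) > 0" for w
  proof -
    have "Im (w + (complex_of_real \<sigma>)\<^sup>2 * stieltjes M w) = Im w * (1 - \<sigma>\<^sup>2 * I w)"
      using Im_stieltjes[OF that(1)] by (simp add: I_def algebra_simps flip: of_real_power)
    then show ?thesis using that by (simp add: zero_less_mult_iff)
  qed
  define K where "K = (LINT x|M. 1 / ((w1 - complex_of_real x) * (w2 - complex_of_real x)))"
  have "(w1 - w2) = (complex_of_real \<sigma>)\<^sup>2 * (stieltjes M w2 - stieltjes M w1)"
    using eq by (simp add: algebra_simps)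
  also have "\<dots> = (complex_of_real \<sigma>)\<^sup>2 * ((w1 - w2) * K)"
    using stieltjes_diff[OF w(2,1)] by (simp add: K_def mult.commute)
  finally have "(w1 - w2) * (1 - (complex_of_real \<sigma>)\<^sup>2 * K) = 0" by (simp add: algebra_simps)
  then have "(complex_of_real \<sigma>)\<^sup>2 * K = 1" using ne by simp
  then have "1 = cmod ((complex_of_real \<sigma>)\<^sup>2 * K)" by simp
  also have "\<dots> = \<sigma>\<^sup>2 * cmod K" by (simp add: norm_mult norm_power)
  also have "cmod K \<le> (LINT x|M. cmod (1 / ((w1 - complex_of_real x) * (w2 - complex_of_real x))))"
    unfolding K_def by (rule integral_norm_bound)
  also have "\<dots> \<le> (LINT x|M. (1 / (cmod (w1 - complex_of_real x))\<^sup>2 + 1 / (cmod (w2 - complex_of_real x))\<^sup>2) / 2)"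
  proof (intro integral_mono integrable_norm kernel2_integrable w)
    show "integrable M (\<lambda>x. (1 / (cmod (w1 - complex_of_real x))\<^sup>2 + 1 / (cmod (w2 - complex_of_real x))\<^sup>2) / 2)"
      using poisson_integrable w by auto
    fix x
    define a b where "a = 1 / cmod (w1 - complex_of_real x)" and "b = 1 / cmod (w2 - complex_of_real x)"
    have "0 \<le> (a - b)\<^sup>2" by simp
    then have "a * b \<le> (a\<^sup>2 + b\<^sup>2) / 2" by (simp add: power2_eq_square algebra_simps)
    then show "cmod (1 / ((w1 - complex_of_real x) * (w2 - complex_of_real x)))
      \<le> (1 / (cmod (w1 - complex_of_real x))\<^sup>2 + 1 / (cmod (w2 - complex_of_real x))\<^sup>2) / 2"
      by (simp add: a_def b_def norm_divide norm_mult power_divide)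
  qed
  also have "\<dots> = (I w1 + I w2) / 2" using poisson_integrable w by (simp add: I_def)
  finally have "1 \<le> \<sigma>\<^sup>2 * ((I w1 + I w2) / 2)" using \<sigma> by (simp add: mult_left_mono)
  moreover have "\<sigma>\<^sup>2 * I w1 < 1" by (rule lt[OF w(1) im])
  moreover have "\<sigma>\<^sup>2 * I w2 < 1" by (rule lt[OF w(2) im[unfolded eq]])
  ultimately show False by (simp add: algebra_simps)
qed

section \<open>Injectivity and range of the Stieltjes transform far from the real axis\<close>

context
  fixes m2 m :: real
  assumes i2: "integrable M (\<lambda>x. x\<^sup>2)"
  defines "m2 \<equiv> LINT x|M. x\<^sup>2" and "m \<equiv> 1 + 2 * m2"
begin

lemma m2_nonneg: "m2 \<ge> 0" unfolding m2_def by simp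

lemma abs_moment: "integrable M (\<lambda>x. \<bar>x\<bar>)" "(LINT x|M. \<bar>x\<bar>) \<le> 1 + m2"
proof -
  have le: "\<bar>x\<bar> \<le> 1 + x\<^sup>2" for x :: real
  proof -
    have "0 \<le> (\<bar>x\<bar> - 1)\<^sup>2" by simp
    then have "2 * \<bar>x\<bar> \<le> 1 + x\<^sup>2" by (simp add: power2_diff)
    then show ?thesis using zero_le_power2[of x] by linarith
  qed
  have i: "integrable M (\<lambda>x. 1 + x\<^sup>2)" using i2 by simp
  show "integrable M (\<lambda>x. \<bar>x\<bar>)"
    by (rule Bochner_Integration.integrable_bound[OF i]) (auto intro!: AE_I2 order_trans[OF le])
  then have "(LINT x|M. \<bar>x\<bar>) \<le> (LINT x|M. 1 + x\<^sup>2)" by (rule integral_mono[OF _ i le])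
  then show "(LINT x|M. \<bar>x\<bar>) \<le> 1 + m2" using i2 by (simp add: m2_def prob_space[unfolded space_eq_univ])
qed

lemma kernel_ratio_bound:
  assumes "Im z > 0"
  shows "cmod (complex_of_real x / (z - complex_of_real x)) \<le> \<bar>x\<bar> / Im z"
  using mult_left_mono[OF cmod_kernel_le[OF assms, of x], of "\<bar>x\<bar>"] by (simp add: norm_divide)

text \<open>If the transforms agree at z \<noteq> w, then z w / ((z - x) (w - x)) has integral 0.
  This integrand is a product (1 + f) (1 + g) with |f| and |g| at most |x| / b, so its integral
  differs from 1 by at most 2m / b + m / (4b) = 9/16 for b = 4m.\<close>

lemma stieltjes_inj_far:
  assumes z: "Im z > 4 * m" "Im w > 4 * m" and eq: "stieltjes M z = stieltjes M w"
  shows "z = w"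
proof (rule ccontr)
  assume ne: "z \<noteq> w"
  have m: "m \<ge> 1" "1 + m2 \<le> m" using m2_nonneg by (auto simp: m_def)
  define b where "b = 4 * m"
  have b: "b \<ge> 4" "b > 0" "Im z > b" "Im w > b" using z m by (auto simp: b_def)
  then have zw: "Im z > 0" "Im w > 0" by auto
  define f where "f x = complex_of_real x / (z - complex_of_real x)" for x
  define g where "g x = complex_of_real x / (w - complex_of_real x)" for x
  have [measurable]: "f \<in> borel_measurable borel" "g \<in> borel_measurable borel" unfolding f_def g_def by measurable
  have fb: "cmod (f x) \<le> \<bar>x\<bar> / b" for x
    using kernel_ratio_bound[OF zw(1), of x] b frac_le[of "\<bar>x\<bar>" "\<bar>x\<bar>" b "Im z"] unfolding f_def by linarith
  have gb: "cmod (g x) \<le> \<bar>x\<bar> / b" for x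
    using kernel_ratio_bound[OF zw(2), of x] b frac_le[of "\<bar>x\<bar>" "\<bar>x\<bar>" b "Im w"] unfolding g_def by linarith
  have le: "cmod (f x + g x + f x * g x) \<le> 2 / b * \<bar>x\<bar> + 1 / b\<^sup>2 * x\<^sup>2" for x
  proof -
    have "cmod (f x + g x + f x * g x) \<le> cmod (f x) + cmod (g x) + cmod (f x) * cmod (g x)"
      by (metis norm_triangle_mono norm_mult order_refl)
    also have "\<dots> \<le> \<bar>x\<bar> / b + \<bar>x\<bar> / b + (\<bar>x\<bar> / b) * (\<bar>x\<bar> / b)"
      using b by (intro add_mono mult_mono fb gb) auto
    finally show ?thesis by (simp add: power2_eq_square)
  qed
  have ib: "integrable M (\<lambda>x. 2 / b * \<bar>x\<bar> + 1 / b\<^sup>2 * x\<^sup>2)" using i2 abs_moment(1) by simp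
  have ifg: "integrable M (\<lambda>x. f x + g x + f x * g x)"
    by (rule Bochner_Integration.integrable_bound[OF ib]) (auto intro!: AE_I2 order_trans[OF le])
  have "0 = (z * w) * (LINT x|M. 1 / ((z - complex_of_real x) * (w - complex_of_real x)))"
    using stieltjes_diff[OF zw] eq ne by simp
  also have "\<dots> = (LINT x|M. (z * w) * (1 / ((z - complex_of_real x) * (w - complex_of_real x))))"
    by (simp only: integral_mult_right_zero)
  also have "\<dots> = (LINT x|M. 1 + (f x + g x + f x * g x))"
  proof (intro Bochner_Integration.integral_cong refl)
    fix x
    have "1 + f x = z / (z - complex_of_real x)" "1 + g x = w / (w - complex_of_real x)"
      using zw diff_real_nonzero[of z x] diff_real_nonzero[of w x] by (auto simp: f_def g_def field_simps)
    then have "(1 + f x) * (1 + g x) = (z * w) * (1 / ((z - complex_of_real x) * (w - complex_of_real x)))" by simp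
    then show "(z * w) * (1 / ((z - complex_of_real x) * (w - complex_of_real x))) = 1 + (f x + g x + f x * g x)"
      by (simp add: algebra_simps)
  qed
  also have "\<dots> = 1 + (LINT x|M. f x + g x + f x * g x)"
    using ifg by (simp add: prob_space[unfolded space_eq_univ])
  finally have "(LINT x|M. f x + g x + f x * g x) = -1" by (simp add: eq_neg_iff_add_eq_0 add.commute)
  then have "1 = cmod (LINT x|M. f x + g x + f x * g x)" by simp
  also have "\<dots> \<le> (LINT x|M. cmod (f x + g x + f x * g x))" by (rule integral_norm_bound)
  also have "\<dots> \<le> (LINT x|M. 2 / b * \<bar>x\<bar> + 1 / b\<^sup>2 * x\<^sup>2)"
    by (intro integral_mono integrable_norm ifg ib le)
  also have "\<dots> = 2 / b * (LINT x|M. \<bar>x\<bar>) + 1 / b\<^sup>2 * m2"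
    using i2 abs_moment(1) by (simp add: m2_def)
  also have "\<dots> \<le> 2 / b * m + 1 / (b * 4) * m"
    using abs_moment(2) m b m2_nonneg by (intro add_mono mult_mono) (auto simp: power2_eq_square frac_le)
  also have "\<dots> < 1" using m by (simp add: b_def field_simps)
  finally show False by simp
qed

text \<open>A solution of 1 / g(z) = \<zeta>, with g the transform, is a fixed point of T z =
  \<zeta> + z - 1 / g(z). Writing z g(z) = 1 + e gives z - 1 / g(z) = z e / (1 + e), of modulus at
  most 2m because |z e| \<le> m and |e| \<le> 1/2. So T maps the disc of radius 2m around \<zeta>
  into itself and Brouwer's theorem applies.\<close>

lemma stieltjes_surj_far:
  assumes \<zeta>: "Im \<zeta> > 4 * m"
  obtains z where "cmod (z - \<zeta>) \<le> 2 * m" "stieltjes M z = inverse \<zeta>"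
proof -
  have m: "m \<ge> 1" "1 + m2 \<le> m" "1 + m2 + m2 \<le> m" using m2_nonneg by (auto simp: m_def)
  let ?S = "cball \<zeta> (2 * m)"
  have Im: "Im z \<ge> 2 * m" "Im z > 0" "Im z \<ge> 1" if "z \<in> ?S" for z
  proof -
    have "\<bar>Im z - Im \<zeta>\<bar> \<le> 2 * m"
      using abs_Im_le_cmod[of "\<zeta> - z"] that by (simp add: dist_norm)
    then show "Im z \<ge> 2 * m" "Im z > 0" "Im z \<ge> 1" using \<zeta> m by linarith+
  qed
  define e where "e z = (LINT x|M. complex_of_real x / (z - complex_of_real x))" for z
  have key: "z * stieltjes M z = 1 + e z" "cmod (e z) \<le> 1 / 2" "cmod (z * e z) \<le> m" if zS: "z \<in> ?S" for z
  proof -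
    note z = Im[OF zS]
    have ie: "integrable M (\<lambda>x. complex_of_real x / (z - complex_of_real x))"
      by (rule Bochner_Integration.integrable_bound[of _ "\<lambda>x. \<bar>x\<bar> / Im z"])
        (use kernel_ratio_bound[OF z(2)] abs_moment(1) z(2) in auto)
    have "z * stieltjes M z = (LINT x|M. z * (1 / (z - complex_of_real x)))"
      by (simp only: stieltjes_def integral_mult_right_zero)
    also have "\<dots> = (LINT x|M. 1 + complex_of_real x / (z - complex_of_real x))"
      using z diff_real_nonzero[of z] by (intro Bochner_Integration.integral_cong refl) (simp add: field_simps)
    finally show "z * stieltjes M z = 1 + e z" using ie by (simp add: e_def prob_space[unfolded space_eq_univ])
    have "cmod (e z) \<le> (LINT x|M. cmod (complex_of_real x / (z - complex_of_real x)))"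
      unfolding e_def by (rule integral_norm_bound)
    also have "\<dots> \<le> (LINT x|M. \<bar>x\<bar> / Im z)"
      by (intro integral_mono integrable_norm ie kernel_ratio_bound z) (use abs_moment(1) in simp)
    also have "\<dots> \<le> m / Im z"
      using abs_moment m z by (simp add: divide_right_mono)
    also have "\<dots> \<le> 1 / 2" using z m by (simp add: field_simps)
    finally show "cmod (e z) \<le> 1 / 2" .
    have b2: "cmod (z * (complex_of_real x / (z - complex_of_real x))) \<le> \<bar>x\<bar> + x\<^sup>2" for x
    proof -
      have "z * (complex_of_real x / (z - complex_of_real x))
        = complex_of_real x + complex_of_real x * (complex_of_real x / (z - complex_of_real x))"
        using diff_real_nonzero[of z x] z by (simp add: field_simps)
      also have "cmod \<dots> \<le> \<bar>x\<bar> + \<bar>x\<bar> * cmod (complex_of_real x / (z - complex_of_real x))"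
        by (rule order_trans[OF norm_triangle_ineq]) (simp only: norm_mult norm_of_real order_refl)
      also have "\<dots> \<le> \<bar>x\<bar> + \<bar>x\<bar> * (\<bar>x\<bar> / 1)"
        using kernel_ratio_bound[OF z(2), of x] z(3) frac_le[of "\<bar>x\<bar>" "\<bar>x\<bar>" 1 "Im z"]
        by (intro add_left_mono mult_left_mono) auto
      finally show ?thesis by (simp add: power2_eq_square)
    qed
    have "cmod (z * e z) = cmod (LINT x|M. z * (complex_of_real x / (z - complex_of_real x)))"
      by (simp only: e_def integral_mult_right_zero)
    also have "\<dots> \<le> (LINT x|M. cmod (z * (complex_of_real x / (z - complex_of_real x))))"
      by (rule integral_norm_bound)
    also have "\<dots> \<le> (LINT x|M. \<bar>x\<bar> + x\<^sup>2)"
      by (intro integral_mono integrable_norm integrable_mult_right ie b2) (use abs_moment(1) i2 in simp)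
    also have "\<dots> \<le> m" using abs_moment i2 m by (simp add: m2_def)
    finally show "cmod (z * e z) \<le> m" .
  qed
  have ne: "cmod (1 + e z) \<ge> 1 / 2" "stieltjes M z \<noteq> 0" if "z \<in> ?S" for z
  proof -
    show "cmod (1 + e z) \<ge> 1 / 2"
      using key(2)[OF that] norm_triangle_ineq4[of "1 + e z" "e z"] by simp
    then show "stieltjes M z \<noteq> 0" using key(1)[OF that] by force
  qed
  define T where "T z = \<zeta> + z - inverse (stieltjes M z)" for z
  have "continuous_on ?S (stieltjes M)"
    by (rule continuous_on_subset[OF stieltjes_continuous]) (use Im in auto)
  then have cont: "continuous_on ?S T"
    unfolding T_def using ne(2) by (intro continuous_intros) auto
  have map: "T \<in> ?S \<rightarrow> ?S"
  proof
    fix z assume z: "z \<in> ?S"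
    have "z - inverse (stieltjes M z) = (z * e z) / (1 + e z)"
    proof -
      have "z \<noteq> 0" using Im(2)[OF z] by auto
      then have "stieltjes M z = (1 + e z) / z" using key(1)[OF z] \<open>z \<noteq> 0\<close> by (metis nonzero_mult_div_cancel_left)
      then have "inverse (stieltjes M z) = z / (1 + e z)" by simp
      moreover have "1 + e z \<noteq> 0" using ne(1)[OF z] by force
      ultimately show ?thesis by (simp add: field_simps)
    qed
    then have "cmod (T z - \<zeta>) = cmod (z * e z) / cmod (1 + e z)" by (simp add: T_def norm_divide)
    also have "\<dots> \<le> m / (1 / 2)" using key(3)[OF z] ne(1)[OF z] m by (intro frac_le) auto
    finally show "T z \<in> ?S" by (simp add: dist_norm norm_minus_commute)
  qed
  obtain z where z: "z \<in> ?S" "T z = z"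
    using brouwer[OF compact_cball convex_cball _ cont map] m by force
  then have "inverse (stieltjes M z) = \<zeta>" by (simp add: T_def algebra_simps)
  then have "stieltjes M z = inverse \<zeta>" using inverse_inverse_eq by metis
  then show ?thesis using that z(1) by (simp add: dist_norm norm_minus_commute)
qed

end

end

section \<open>The semicircle distribution\<close>

context
  fixes \<sigma> :: real
  assumes \<sigma>: "\<sigma> > 0"
begin

abbreviation (input) sc where "sc \<equiv> semicircle \<sigma>"

definition "half x = sqrt (4 * \<sigma>\<^sup>2 - x\<^sup>2)"

lemma half_cont: "continuous_on S half"
  unfolding half_def[abs_def] by (intro continuous_intros)

lemma half_pos: "x \<in> {- 2 * \<sigma><..<2 * \<sigma>} \<Longrightarrow> 4 * \<sigma>\<^sup>2 - x\<^sup>2 > 0"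
proof -
  assume "x \<in> {- 2 * \<sigma><..<2 * \<sigma>}"
  then have "0 < (2 * \<sigma> - x) * (2 * \<sigma> + x)" by (intro mult_pos_pos) auto
  then show ?thesis by (simp add: algebra_simps power2_eq_square)
qed

lemma half_nonneg: "x \<in> {- 2 * \<sigma>..2 * \<sigma>} \<Longrightarrow> half x \<ge> 0"
proof -
  assume "x \<in> {- 2 * \<sigma>..2 * \<sigma>}"
  then have "0 \<le> (2 * \<sigma> - x) * (2 * \<sigma> + x)" by (intro mult_nonneg_nonneg) auto
  then show ?thesis by (simp add: half_def algebra_simps power2_eq_square)
qed

lemma half_deriv:
  assumes "x \<in> {- 2 * \<sigma><..<2 * \<sigma>}"
  shows "(half has_real_derivative (- x / half x)) (at x)" "half x > 0" "(half x)\<^sup>2 = 4 * \<sigma>\<^sup>2 - x\<^sup>2"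
proof -
  note p = half_pos[OF assms]
  show "(half has_real_derivative (- x / half x)) (at x)"
    unfolding half_def[abs_def] using p by (auto intro!: derivative_eq_intros simp: divide_simps)
  show "half x > 0" "(half x)\<^sup>2 = 4 * \<sigma>\<^sup>2 - x\<^sup>2" using p by (auto simp: half_def)
qed

text \<open>Passes to gauge integrals over the compact support, where antiderivatives can be
  used.\<close>

lemma semicircle_integral:
  fixes h :: "real \<Rightarrow> 'b::euclidean_space"
  assumes h: "continuous_on UNIV h"
  shows "integrable sc h"
    and "(LINT x|sc. h x) = (1 / (2 * pi * \<sigma>\<^sup>2)) *\<^sub>R integral {- 2 * \<sigma>..2 * \<sigma>} (\<lambda>x. half x *\<^sub>R h x)"
proof -
  let ?S = "{- 2 * \<sigma>..2 * \<sigma>}"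
  define f where "f x = indicator ?S x * half x / (2 * pi * \<sigma>\<^sup>2)" for x
  have [measurable]: "h \<in> borel_measurable borel" using h by (rule borel_measurable_continuous_onI)
  have [measurable]: "half \<in> borel_measurable borel" by (rule borel_measurable_continuous_onI[OF half_cont])
  have [measurable]: "f \<in> borel_measurable lborel" unfolding f_def by measurable
  have f0: "f x \<ge> 0" for x
    using half_nonneg[of x] by (auto simp: f_def indicator_def)
  have sc: "sc = density lborel (\<lambda>x. ennreal (f x))"
    by (simp add: semicircle_def f_def half_def)
  have eq: "f x *\<^sub>R h x = indicator ?S x *\<^sub>R ((1 / (2 * pi * \<sigma>\<^sup>2)) *\<^sub>R (half x *\<^sub>R h x))" for x
    by (simp add: f_def)
  have i: "integrable lborel (\<lambda>x. indicator ?S x *\<^sub>R ((1 / (2 * pi * \<sigma>\<^sup>2)) *\<^sub>R (half x *\<^sub>R h x)))"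
    by (rule borel_integrable_compact) (use \<sigma> in \<open>auto intro!: continuous_intros half_cont continuous_on_subset[OF h]\<close>)
  show "integrable sc h"
    unfolding sc using i f0 by (subst integrable_density) (auto simp: eq)
  have "(LINT x|sc. h x) = (LINT x|lborel. f x *\<^sub>R h x)"
    unfolding sc using f0 by (subst integral_density) auto
  also have "\<dots> = (LINT x:?S|lborel. (1 / (2 * pi * \<sigma>\<^sup>2)) *\<^sub>R (half x *\<^sub>R h x))"
    by (simp add: eq set_lebesgue_integral_def)
  also have "\<dots> = integral ?S (\<lambda>x. (1 / (2 * pi * \<sigma>\<^sup>2)) *\<^sub>R (half x *\<^sub>R h x))"
    by (rule set_borel_integral_eq_integral) (use i in \<open>simp add: set_integrable_def\<close>)
  finally show "(LINT x|sc. h x) = (1 / (2 * pi * \<sigma>\<^sup>2)) *\<^sub>R integral {- 2 * \<sigma>..2 * \<sigma>} (\<lambda>x. half x *\<^sub>R h x)"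
    by (simp only: integral_cmul)
qed

lemma integral_half: "integral {- 2 * \<sigma>..2 * \<sigma>} half = 2 * pi * \<sigma>\<^sup>2"
proof -
  \<comment> \<open>The classical antiderivative; the interior form of the fundamental theorem is
    used because \<open>half\<close> has no derivative at the end points.\<close>
  define F where "F x = x * half x / 2 + 2 * \<sigma>\<^sup>2 * arcsin (x / (2 * \<sigma>))" for x
  have "(half has_integral (F (2 * \<sigma>) - F (- 2 * \<sigma>))) {- 2 * \<sigma>..2 * \<sigma>}"
  proof (rule fundamental_theorem_of_calculus_interior)
    show "continuous_on {- 2 * \<sigma>..2 * \<sigma>} F"
      unfolding F_def using \<sigma> by (intro continuous_intros half_cont) (auto simp: field_simps)
    fix x assume x: "x \<in> {- 2 * \<sigma><..<2 * \<sigma>}"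
    note hd = half_deriv[OF x]
    have ar: "-1 < x / (2 * \<sigma>)" "x / (2 * \<sigma>) < 1" using x \<sigma> by (auto simp: field_simps)
    have sq: "sqrt (1 - (x / (2 * \<sigma>))\<^sup>2) = half x / (2 * \<sigma>)"
    proof -
      have "1 - (x / (2 * \<sigma>))\<^sup>2 = (4 * \<sigma>\<^sup>2 - x\<^sup>2) / (2 * \<sigma>)\<^sup>2" using \<sigma> by (simp add: field_simps power2_eq_square)
      then show ?thesis by (simp only: half_def real_sqrt_divide real_sqrt_abs) (use \<sigma> in simp)
    qed
    have "((\<lambda>x. x / (2 * \<sigma>)) has_real_derivative 1 / (2 * \<sigma>)) (at x)"
      using \<sigma> by (auto intro!: derivative_eq_intros)
    from DERIV_chain2[OF DERIV_arcsin[OF ar] this]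
    have d2: "((\<lambda>x. arcsin (x / (2 * \<sigma>))) has_real_derivative 1 / half x) (at x)"
      unfolding sq using \<sigma> by (simp add: field_simps)
    have "(F has_real_derivative (1 * half x + (- x / half x) * x) / 2 + 2 * \<sigma>\<^sup>2 * (1 / half x)) (at x)"
      unfolding F_def by (intro DERIV_add DERIV_cdivide DERIV_mult DERIV_cmult DERIV_ident hd d2)
    also have "(1 * half x + (- x / half x) * x) / 2 + 2 * \<sigma>\<^sup>2 * (1 / half x) = ((half x)\<^sup>2 - x\<^sup>2 + 4 * \<sigma>\<^sup>2) / (2 * half x)"
      using hd(2) by (simp add: field_simps power2_eq_square)
    also have "\<dots> = half x"
      using hd(2,3) by (simp add: field_simps power2_eq_square)
    finally show "(F has_vector_derivative half x) (at x)"
      by (simp add: has_real_derivative_iff_has_vector_derivative)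
  qed (use \<sigma> in simp)
  moreover have "F (2 * \<sigma>) - F (- 2 * \<sigma>) = 2 * pi * \<sigma>\<^sup>2"
    using \<sigma> by (simp add: F_def half_def power_mult_distrib)
  ultimately show ?thesis by (simp add: integral_unique)
qed

lemma real_distribution_semicircle: "real_distribution sc"
proof -
  have "emeasure sc (space sc) < \<infinity>"
    using semicircle_integral(1)[of "\<lambda>_. 1 :: real"] by (simp add: integrable_iff_bounded)
  then interpret finite_measure sc by (intro finite_measureI) auto
  have "measure sc (space sc) = (LINT x|sc. (1 :: real))" by simp
  also have "\<dots> = 1"
    using semicircle_integral(2)[of "\<lambda>_. 1 :: real"] integral_half \<sigma> by simp
  finally have "emeasure sc (space sc) = 1" by (simp add: emeasure_eq_measure)
  then interpret prob_space sc by (rule prob_spaceI)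
  show ?thesis by unfold_locales (simp add: semicircle_def)
qed

interpretation sc: real_distribution sc by (rule real_distribution_semicircle)

lemma semicircle_second_moment: "integrable sc (\<lambda>x. x\<^sup>2)"
  by (rule semicircle_integral) (intro continuous_intros)

text \<open>H(x) = (4 \<sigma>^2 - x^2)^(3/2) / (z - x) vanishes at both ends of the support, and
  its derivative is \<open>half x\<close> times \<open>k x\<close>. So \<open>k\<close> has integral
  0 under the semicircle law, and this is the equation.\<close>

lemma semicircle_ode:
  assumes z: "Im z > 0"
  shows "(z\<^sup>2 - 4 * (complex_of_real \<sigma>)\<^sup>2) * deriv (stieltjes sc) z = z * stieltjes sc z - 2"
proof -
  define k where "k x = (4 * (complex_of_real \<sigma>)\<^sup>2 - z\<^sup>2) * (1 / (z - complex_of_real x)\<^sup>2) - z * (1 / (z - complex_of_real x)) + 2" for x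
  have nz: "z - complex_of_real x \<noteq> 0" for x using diff_real_nonzero[of z x] z by simp
  then have nz': "z \<noteq> complex_of_real x" for x by (metis right_minus_eq)
  have kc: "continuous_on UNIV k"
    unfolding k_def using nz' by (intro continuous_intros) auto
  define H where "H x = complex_of_real ((half x) ^ 3) / (z - complex_of_real x)" for x
  have "((\<lambda>x. half x *\<^sub>R k x) has_integral (H (2 * \<sigma>) - H (- 2 * \<sigma>))) {- 2 * \<sigma>..2 * \<sigma>}"
  proof (rule fundamental_theorem_of_calculus_interior)
    show "continuous_on {- 2 * \<sigma>..2 * \<sigma>} H"
      unfolding H_def using nz' by (intro continuous_intros half_cont) auto
    fix x assume x: "x \<in> {- 2 * \<sigma><..<2 * \<sigma>}"
    note hd = half_deriv[OF x]
    define s where "s = complex_of_real (half x)"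
    define u where "u = z - complex_of_real x"
    have u: "u \<noteq> 0" "complex_of_real x = z - u" using nz[of x] by (auto simp: u_def)
    have s2: "s\<^sup>2 = 4 * (complex_of_real \<sigma>)\<^sup>2 - (z - u)\<^sup>2"
      unfolding s_def u(2)[symmetric] using arg_cong[OF hd(3), of complex_of_real] by simp
    have "((\<lambda>x. (half x) ^ 3) has_real_derivative (of_nat 3 * (- x / half x) * half x ^ (3 - 1))) (at x)"
      using DERIV_power[OF hd(1), of 3] by (simp add: mult_ac)
    also have "of_nat 3 * (- x / half x) * half x ^ (3 - 1) = - 3 * x * half x"
      using hd(2) by (simp add: power2_eq_square)
    finally have d1: "((\<lambda>x. complex_of_real ((half x) ^ 3)) has_vector_derivative complex_of_real (- 3 * x * half x)) (at x)"
      by (intro has_vector_derivative_of_real) (simp only: has_real_derivative_iff_has_vector_derivative)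
    have d2: "((\<lambda>x. inverse (z - complex_of_real x)) has_vector_derivative (inverse u * inverse u)) (at x)"
    proof -
      have "((\<lambda>x. z - complex_of_real x) has_vector_derivative (- 1)) (at x)"
        by (auto intro!: derivative_eq_intros)
      moreover have "(inverse has_field_derivative - (inverse u * 1 * inverse u)) (at (z - complex_of_real x))"
        using DERIV_inverse'[OF DERIV_ident, of u] u(1) by (simp add: u_def)
      ultimately have "((inverse \<circ> (\<lambda>x. z - complex_of_real x)) has_vector_derivative (- 1) * (- (inverse u * 1 * inverse u))) (at x)"
        by (intro field_vector_diff_chain_at) auto
      then show ?thesis by (simp add: comp_def)
    qed
    have "((\<lambda>x. complex_of_real ((half x) ^ 3) * inverse (z - complex_of_real x)) has_vector_derivative
       (s ^ 3 * (inverse u * inverse u) + complex_of_real (- 3 * x * half x) * inverse u)) (at x)"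
      using has_vector_derivative_mult[OF d1 d2] by (simp add: s_def u_def)
    moreover have "s ^ 3 * (inverse u * inverse u) + complex_of_real (- 3 * x * half x) * inverse u = half x *\<^sub>R k x"
    proof -
      have "s ^ 3 * (inverse u * inverse u) + complex_of_real (- 3 * x * half x) * inverse u
        = s * (s\<^sup>2 * (inverse u * inverse u) - 3 * (z - u) * inverse u)"
        by (simp add: s_def u(2)[symmetric] power2_eq_square power3_eq_cube algebra_simps)
      also have "\<dots> = s * ((4 * (complex_of_real \<sigma>)\<^sup>2 - z\<^sup>2) * (1 / u\<^sup>2) - z * (1 / u) + 2)"
        unfolding s2 using u(1) by (simp add: field_simps power2_eq_square)
      finally show ?thesis by (simp add: k_def s_def u_def scaleR_conv_of_real)
    qed
    ultimately show "(H has_vector_derivative half x *\<^sub>R k x) (at x)"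
      unfolding H_def[abs_def] divide_inverse by simp
  qed (use \<sigma> in simp)
  moreover have "H (2 * \<sigma>) - H (- 2 * \<sigma>) = 0" by (simp add: H_def half_def power_mult_distrib)
  ultimately have "integral {- 2 * \<sigma>..2 * \<sigma>} (\<lambda>x. half x *\<^sub>R k x) = 0" by (simp add: integral_unique)
  then have "(LINT x|sc. k x) = 0" by (simp add: semicircle_integral(2)[OF kc])
  moreover have "(LINT x|sc. k x) = (4 * (complex_of_real \<sigma>)\<^sup>2 - z\<^sup>2) * (LINT x|sc. 1 / (z - complex_of_real x)\<^sup>2)
      - z * stieltjes sc z + 2"
  proof -
    have "integrable sc (\<lambda>x. 1 / (z - complex_of_real x)\<^sup>2)"
      unfolding power2_eq_square by (rule sc.kernel2_integrable[OF z z])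
    from integrable_mult_right[OF this] integrable_mult_right[OF sc.kernel_integrable[OF z]]
    show ?thesis
      unfolding k_def stieltjes_def
      by (simp add: sc.prob_space[unfolded sc.space_eq_univ] del: times_divide_eq_right flip: integral_mult_right_zero)
  qed
  ultimately show ?thesis unfolding sc.deriv_stieltjes[OF z] by (simp add: algebra_simps)
qed

text \<open>
  By the differential equation, \<open>(\<sigma>\<^sup>2 g\<^sup>2 - z g + 1) / (z\<^sup>2 - 4 \<sigma>\<^sup>2)\<close> is constant, and it tends to 0 at \<open>\<i>\<infinity>\<close>.
\<close>
lemma semicircle_quadratic:
  assumes z: "Im z > 0"
  shows "(complex_of_real \<sigma>)\<^sup>2 * (stieltjes sc z)\<^sup>2 - z * stieltjes sc z + 1 = 0"
proof -
  let ?g = "stieltjes sc"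
  let ?s = "(complex_of_real \<sigma>)\<^sup>2"
  define q where "q z = ?s * (?g z)\<^sup>2 - z * ?g z + 1" for z
  define \<phi> where "\<phi> z = q z / (z\<^sup>2 - 4 * ?s)" for z
  have nz: "z\<^sup>2 - 4 * ?s \<noteq> 0" if "Im z > 0" for z
  proof
    assume "z\<^sup>2 - 4 * ?s = 0"
    then have "(z - complex_of_real (2 * \<sigma>)) * (z - complex_of_real (- 2 * \<sigma>)) = 0"
      by (simp add: power2_eq_square algebra_simps)
    then show False using diff_real_nonzero[of z] that by (metis less_irrefl mult_eq_0_iff)
  qed
  have d: "(\<phi> has_field_derivative 0) (at z)" if z: "Im z > 0" for z
  proof -
    define g' where "g' = deriv ?g z"
    have gd: "(?g has_field_derivative g') (at z)"
      unfolding g'_def sc.deriv_stieltjes[OF z] by (rule sc.stieltjes_has_deriv[OF z])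
    define D where "D = z\<^sup>2 - 4 * ?s"
    have ode: "D * g' = z * ?g z - 2" unfolding g'_def D_def by (rule semicircle_ode[OF z])
    have qd: "(q has_field_derivative (?s * (2 * ?g z * g') - (?g z + z * g'))) (at z)"
      unfolding q_def[abs_def] by (auto intro!: derivative_eq_intros gd)
    have "(\<phi> has_field_derivative ((?s * (2 * ?g z * g') - (?g z + z * g')) * D - q z * (2 * z)) / (D * D)) (at z)"
    proof -
      have "((\<lambda>z. z\<^sup>2 - 4 * ?s) has_field_derivative (2 * z)) (at z)"
        by (auto intro!: derivative_eq_intros)
      from DERIV_divide[OF qd this nz[OF z]] show ?thesis unfolding \<phi>_def[abs_def] D_def .
    qed
    moreover have "(?s * (2 * ?g z * g') - (?g z + z * g')) * D - q z * (2 * z)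
      = 2 * ?s * ?g z * (D * g') - ?g z * D - z * (D * g') - q z * (2 * z)"
      by (simp add: algebra_simps)
    moreover have "\<dots> = 0"
      unfolding ode by (simp add: D_def q_def algebra_simps power2_eq_square)
    ultimately show ?thesis by simp
  qed
  have "\<exists>c. \<forall>z\<in>{z. Im z > 0}. \<phi> z = c"
    by (rule has_field_derivative_zero_constant)
      (auto simp: convex_halfspace_Im_gt intro: has_field_derivative_at_within d)
  then obtain c where c: "\<And>z. Im z > 0 \<Longrightarrow> \<phi> z = c" by auto
  \<comment> \<open>On the imaginary axis q stays bounded while |z^2 - 4 \<sigma>^2| = y^2 + 4
    \<sigma>^2 \<ge> y.\<close>
  have cb: "cmod c \<le> (\<sigma>\<^sup>2 + 2) / y" if y: "y \<ge> 1" for y :: real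
  proof -
    let ?z = "\<i> * complex_of_real y"
    have z: "Im ?z > 0" using y by simp
    have g: "cmod (?g ?z) \<le> 1 / y" using sc.stieltjes_bound[OF z] by simp
    have "cmod (q ?z) \<le> cmod (?s * (?g ?z)\<^sup>2) + cmod (?z * ?g ?z) + 1"
      unfolding q_def
      using norm_triangle_ineq[of "?s * (?g ?z)\<^sup>2 - ?z * ?g ?z" 1] norm_triangle_ineq4[of "?s * (?g ?z)\<^sup>2" "?z * ?g ?z"]
      by simp
    also have "\<dots> \<le> \<sigma>\<^sup>2 * (1 / y)\<^sup>2 + y * (1 / y) + 1"
      unfolding norm_mult norm_power using g y \<sigma> by (intro add_mono mult_mono power_mono) auto
    also have "\<dots> \<le> \<sigma>\<^sup>2 * 1 + 1 + 1"
      using y by (intro add_mono mult_left_mono) (auto simp: power_le_one)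
    finally have qb: "cmod (q ?z) \<le> \<sigma>\<^sup>2 + 2" by simp
    have "?z\<^sup>2 - 4 * ?s = complex_of_real (- (y\<^sup>2 + 4 * \<sigma>\<^sup>2))" by (simp add: power_mult_distrib)
    then have "cmod (?z\<^sup>2 - 4 * ?s) = y\<^sup>2 + 4 * \<sigma>\<^sup>2" using zero_le_power2[of y] zero_le_power2[of \<sigma>] by (simp only: norm_of_real)
    moreover have "y \<le> y\<^sup>2 + 4 * \<sigma>\<^sup>2" 
    proof -
      have "y * 1 \<le> y * y" using y by (intro mult_left_mono) auto
      then show ?thesis using zero_le_power2[of \<sigma>] unfolding power2_eq_square by linarith
    qed
    ultimately have "cmod (\<phi> ?z) \<le> (\<sigma>\<^sup>2 + 2) / y"
      unfolding \<phi>_def norm_divide using qb y by (intro frac_le) auto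
    then show ?thesis using c[OF z] by simp
  qed
  have "cmod c \<le> 0"
  proof (rule field_le_epsilon)
    fix e :: real assume e: "e > 0"
    define y where "y = max 1 ((\<sigma>\<^sup>2 + 2) / e)"
    have "(\<sigma>\<^sup>2 + 2) / y \<le> e" using e by (simp add: y_def field_simps max_def)
    then show "cmod c \<le> 0 + e" using cb[of y] by (simp add: y_def)
  qed
  then have "\<phi> z = 0" using c[OF z] by simp
  then show ?thesis using nz[OF z] by (simp add: \<phi>_def q_def)
qed

end

section \<open>Free convolution with the semicircle distribution\<close>

text \<open>
  The imaginary part of \<open>F(z) = z - c - \<sigma>\<^sup>2 g(z)\<close> has the sign of \<open>Im z\<close> and \<open>F' \<ge> 1\<close> on the real axis. So the
  poles of the rational function \<open>1 / F\<close> are real and simple, with residues in \<open>(0, 1]\<close>.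
\<close>
lemma rational_step:
  fixes p :: "real pmf" and c \<sigma> :: real
  assumes fin: "finite (set_pmf p)" and \<sigma>: "\<sigma> > 0"
  shows "\<exists>q :: real pmf. finite (set_pmf q) \<and> (\<forall>z. Im z > 0 \<longrightarrow>
    measure_pmf.expectation q (\<lambda>x. 1 / (z - complex_of_real x))
     = 1 / (z - complex_of_real c - (complex_of_real \<sigma>)\<^sup>2 * measure_pmf.expectation p (\<lambda>x. 1 / (z - complex_of_real x))))"
proof -
  let ?r = complex_of_real
  define D where "D = set_pmf p"
  define n where "n = card D"
  have D: "finite D" "D \<noteq> {}" using fin by (auto simp: D_def set_pmf_not_empty)
  define w where "w d = pmf p d" for d
  have w: "w d > 0" if "d \<in> D" for d using that by (simp add: w_def D_def pmf_positive_iff)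
  define h where "h z = (\<Sum>d\<in>D. ?r (w d) / (z - ?r d))" for z
  have hE: "measure_pmf.expectation p (\<lambda>x. 1 / (z - ?r x)) = h z" for z
    unfolding h_def w_def by (subst integral_measure_pmf[OF D(1)]) (auto simp: D_def scaleR_conv_of_real)
  define F where "F z = z - ?r c - (?r \<sigma>)\<^sup>2 * h z" for z
  define Q where "Q = (\<Prod>d\<in>D. [:- ?r d, 1:])"
  define Q' where "Q' d = (\<Prod>d\<in>D - {d}. [:- ?r d, 1:])" for d
  have Qsplit: "Q = [:- ?r d, 1:] * Q' d" if "d \<in> D" for d
    unfolding Q_def Q'_def using D(1) that by (rule prod.remove)
  have degQ: "degree Q = n" "lead_coeff Q = 1"
    unfolding Q_def n_def by (subst degree_prod_sum_eq; simp) (simp add: lead_coeff_prod)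
  have degQ': "degree (Q' d) = n - 1" if "d \<in> D" for d
    unfolding Q'_def n_def using that D by (subst degree_prod_sum_eq) auto
  \<comment> \<open>F with its denominators cleared: P = F Q away from \<open>D\<close>, monic of
    degree n + 1, and nonzero at the poles of F.\<close>
  define P where "P = [:- ?r c, 1:] * Q - (\<Sum>d\<in>D. Polynomial.smult ((?r \<sigma>)\<^sup>2 * ?r (w d)) (Q' d))"
  have PF: "poly P z = F z * poly Q z" if "\<And>d. d \<in> D \<Longrightarrow> z \<noteq> ?r d" for z
  proof -
    have "poly (Q' d) z = poly Q z / (z - ?r d)" if "d \<in> D" for d
    proof -
      have "poly Q z = (z - ?r d) * poly (Q' d) z"
        by (subst Qsplit[OF that]) (simp add: algebra_simps)
      moreover have "z - ?r d \<noteq> 0" using \<open>\<And>d. d \<in> D \<Longrightarrow> z \<noteq> ?r d\<close>[OF that] by simp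
      ultimately show ?thesis by simp
    qed
    then have "(\<Sum>d\<in>D. (?r \<sigma>)\<^sup>2 * ?r (w d) * poly (Q' d) z) = (?r \<sigma>)\<^sup>2 * h z * poly Q z"
      unfolding h_def sum_distrib_left sum_distrib_right by (intro sum.cong) auto
    then show ?thesis by (simp add: P_def F_def poly_sum algebra_simps)
  qed
  have Qnz: "poly Q z \<noteq> 0" if "\<And>d. d \<in> D \<Longrightarrow> z \<noteq> ?r d" for z
    using D that by (auto simp: Q_def poly_prod)
  have PD: "poly P (?r d) \<noteq> 0" if d: "d \<in> D" for d
  proof -
    have "poly (Q' e) (?r d) = 0" if "e \<in> D" "e \<noteq> d" for e
      using D d that by (auto simp: Q'_def poly_prod)
    then have "(\<Sum>e\<in>D. (?r \<sigma>)\<^sup>2 * ?r (w e) * poly (Q' e) (?r d)) = (?r \<sigma>)\<^sup>2 * ?r (w d) * poly (Q' d) (?r d)"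
      using D d by (subst sum.remove[of D d]) auto
    moreover have "poly (Q' d) (?r d) \<noteq> 0" using D by (auto simp: Q'_def poly_prod)
    moreover have "poly Q (?r d) = 0" using Qsplit[OF d] by simp
    ultimately show ?thesis using \<sigma> w[OF d] by (simp add: P_def poly_sum)
  qed
  have ImF: "Im (F z) = Im z * (1 + \<sigma>\<^sup>2 * (\<Sum>d\<in>D. w d / (cmod (z - ?r d))\<^sup>2))" for z
  proof -
    have "Im (h z) = (\<Sum>d\<in>D. - Im z * (w d / (cmod (z - ?r d))\<^sup>2))"
      unfolding h_def Im_sum by (intro sum.cong refl) (simp add: Im_divide cmod_power2)
    also have "\<dots> = - Im z * (\<Sum>d\<in>D. w d / (cmod (z - ?r d))\<^sup>2)" by (rule sum_distrib_left[symmetric])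
    finally show ?thesis by (simp add: F_def algebra_simps flip: of_real_power)
  qed
  have pos: "(\<Sum>d\<in>D. w d / (cmod (z - ?r d))\<^sup>2) \<ge> 0" for z
    using w by (intro sum_nonneg divide_nonneg_nonneg) (auto intro: less_imp_le)
  have rootD: "z \<noteq> ?r d" if "poly P z = 0" "d \<in> D" for z d using PD that by auto
  have root: "F z = 0" "Im z = 0" if z: "poly P z = 0" for z
  proof -
    show "F z = 0" using PF[of z] Qnz[of z] rootD[OF z] z by auto
    then have "Im z * (1 + \<sigma>\<^sup>2 * (\<Sum>d\<in>D. w d / (cmod (z - ?r d))\<^sup>2)) = 0" using ImF[of z] by simp
    moreover have "1 + \<sigma>\<^sup>2 * (\<Sum>d\<in>D. w d / (cmod (z - ?r d))\<^sup>2) > 0"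
      using mult_nonneg_nonneg[OF zero_le_power2 pos] by (simp add: add_pos_nonneg)
    ultimately show "Im z = 0" by simp
  qed
  define L where "L = {x. poly P (?r x) = 0}"
  \<comment> \<open>The derivative of F on the real axis; 1 / s x will be the mass at the root
    x.\<close>
  define s where "s x = 1 + \<sigma>\<^sup>2 * (\<Sum>d\<in>D. w d / (x - d)\<^sup>2)" for x
  have s: "s x \<ge> 1" for x
  proof -
    have "(\<Sum>d\<in>D. w d / (x - d)\<^sup>2) \<ge> 0"
      using w by (intro sum_nonneg divide_nonneg_nonneg) (auto intro: less_imp_le)
    then show ?thesis by (simp add: s_def)
  qed
  have LP: "{z. poly P z = 0} = ?r ` L"
  proof (rule equalityI; rule subsetI)
    fix z assume "z \<in> {z. poly P z = 0}"
    then have P: "poly P z = 0" by simp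
    have e: "z = ?r (Re z)" using root(2)[OF P] by (simp add: complex_eq_iff)
    then have "Re z \<in> L" unfolding L_def using P by simp
    then show "z \<in> ?r ` L" using e by blast
  next
    fix z assume "z \<in> ?r ` L"
    then show "z \<in> {z. poly P z = 0}" unfolding L_def by blast
  qed
  have degP: "degree P = Suc n" "lead_coeff P = 1"
  proof -
    have n: "n > 0" using D by (simp add: n_def card_gt_0_iff)
    define R where "R = (\<Sum>d\<in>D. Polynomial.smult ((?r \<sigma>)\<^sup>2 * ?r (w d)) (Q' d))"
    have "degree R \<le> n - 1"
      unfolding R_def using degQ' D by (intro degree_sum_le) (auto intro: order_trans[OF degree_smult_le])
    then have dR: "degree R < Suc n" by simp
    have Q0: "Q \<noteq> 0" using degQ(2) by auto
    have d1: "degree ([:- ?r c, 1:] * Q) = Suc n"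
      using degQ(1) Q0 by (subst degree_mult_eq) auto
    have l1: "lead_coeff ([:- ?r c, 1:] * Q) = 1"
      using degQ(2) by (simp only: lead_coeff_mult) simp
    show d2: "degree P = Suc n"
      unfolding P_def R_def[symmetric] using degree_add_eq_left[of "- R" "[:- ?r c, 1:] * Q"] d1 dR by simp
    have "coeff R (Suc n) = 0" using dR by (rule coeff_eq_0)
    then show "lead_coeff P = 1" using l1 unfolding d2 d1 by (simp add: P_def R_def[symmetric])
  qed
  have P0: "P \<noteq> 0" using degP(2) by auto
  have Lfin: "finite L"
    using poly_roots_finite[OF P0] unfolding LP by (rule finite_imageD) (simp add: inj_on_def)
  have dP: "poly (pderiv P) (?r x) = ?r (s x) * poly Q (?r x)" if x: "x \<in> L" for x
  proof -
    have x': "poly P (?r x) = 0" using x by (simp add: L_def)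
    have nx: "?r x \<noteq> ?r d" if "d \<in> D" for d using rootD[OF x' that] .
    have "(h has_field_derivative (\<Sum>d\<in>D. - (?r (w d) / (?r x - ?r d)\<^sup>2))) (at (?r x))"
      unfolding h_def[abs_def]
    proof (rule DERIV_sum)
      fix d assume "d \<in> D"
      then have "?r x - ?r d \<noteq> 0" using nx by auto
      then show "((\<lambda>z. ?r (w d) / (z - ?r d)) has_field_derivative - (?r (w d) / (?r x - ?r d)\<^sup>2)) (at (?r x))"
        by (auto intro!: derivative_eq_intros simp: power2_eq_square)
    qed
    then have "(F has_field_derivative (1 - (?r \<sigma>)\<^sup>2 * (\<Sum>d\<in>D. - (?r (w d) / (?r x - ?r d)\<^sup>2)))) (at (?r x))"
      unfolding F_def[abs_def] by (auto intro!: derivative_eq_intros)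
    also have "1 - (?r \<sigma>)\<^sup>2 * (\<Sum>d\<in>D. - (?r (w d) / (?r x - ?r d)\<^sup>2)) = ?r (s x)"
      by (simp add: s_def sum_negf)
    finally have dF: "(F has_field_derivative ?r (s x)) (at (?r x))" .
    have "((\<lambda>z. F z * poly Q z) has_field_derivative ?r (s x) * poly Q (?r x) + poly (pderiv Q) (?r x) * F (?r x)) (at (?r x))"
      by (rule DERIV_mult[OF dF poly_DERIV])
    then have "((\<lambda>z. F z * poly Q z) has_field_derivative ?r (s x) * poly Q (?r x)) (at (?r x))"
      using root(1)[OF x'] by simp
    moreover have "open (- (?r ` D))" using D(1) by (intro open_Compl finite_imp_closed) auto
    ultimately have "(poly P has_field_derivative ?r (s x) * poly Q (?r x)) (at (?r x))"
    proof (rule has_field_derivative_transform_within_open)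
      show "?r x \<in> - (?r ` D)" using nx by blast
      show "F z * poly Q z = poly P z" if "z \<in> - (?r ` D)" for z
        by (rule PF[symmetric]) (use that in blast)
    qed
    then show ?thesis using poly_DERIV DERIV_unique by blast
  qed
  \<comment> \<open>At a root, P' = F' Q is nonzero, so all n + 1 roots are simple.\<close>
  have "rsquarefree P"
    unfolding rsquarefree_roots
  proof safe
    fix z assume z: "poly P z = 0" "poly (pderiv P) z = 0"
    then obtain x where x: "x \<in> L" "z = ?r x" using LP by blast
    have "poly Q z \<noteq> 0" using Qnz[of z] rootD[OF z(1)] by blast
    moreover have "s x \<noteq> 0" using s[of x] by linarith
    ultimately show False using dP[OF x(1)] z(2) x(2) by simp
  qed
  then have "P = (\<Prod>z\<in>?r ` L. [:- z, 1:])"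
    using complex_poly_decompose_rsquarefree[of P] degP(2) LP by simp
  then have Pprod: "P = (\<Prod>x\<in>L. [:- ?r x, 1:])"
    by (simp add: prod.reindex inj_on_def)
  define R where "R x = (\<Prod>x\<in>L - {x}. [:- ?r x, 1:])" for x
  have Psplit: "P = [:- ?r x, 1:] * R x" if "x \<in> L" for x
    unfolding Pprod R_def using Lfin that by (rule prod.remove)
  have cardL: "card L = Suc n"
    using degP(1) unfolding Pprod by (subst (asm) degree_prod_sum_eq) auto
  have degR: "degree (R x) = n" "coeff (R x) n = 1" if "x \<in> L" for x
  proof -
    show 1: "degree (R x) = n"
      unfolding R_def using that Lfin cardL by (subst degree_prod_sum_eq) auto
    have "lead_coeff (R x) = 1" unfolding R_def by (simp add: lead_coeff_prod)
    then show "coeff (R x) n = 1" using 1 by simp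
  qed
  have Rx: "poly (R x) (?r x) = ?r (s x) * poly Q (?r x)" if "x \<in> L" for x
    using dP[OF that] unfolding Psplit[OF that] pderiv_mult by (simp add: pderiv_pCons)
  have QL: "poly Q (?r x) \<noteq> 0" if "x \<in> L" for x
  proof (rule Qnz)
    show "?r x \<noteq> ?r d" if "d \<in> D" for d using rootD[of "?r x" d] \<open>x \<in> L\<close> that by (simp add: L_def)
  qed
  \<comment> \<open>Partial fractions by interpolation: both sides have degree at most n and agree
    at the n + 1 roots of P.\<close>
  have pf: "Q = (\<Sum>x\<in>L. Polynomial.smult (?r (1 / s x)) (R x))" (is "_ = ?S")
  proof (rule ccontr)
    assume ne: "Q \<noteq> ?S"
    have dle: "degree (Q - ?S) \<le> n"
      using degQ degR Lfin by (intro degree_diff_le degree_sum_le) (auto intro: order_trans[OF degree_smult_le])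
    have "poly (Q - ?S) (?r x) = 0" if x: "x \<in> L" for x
    proof -
      have "poly (R y) (?r x) = 0" if "y \<in> L" "y \<noteq> x" for y
        unfolding R_def poly_prod by (rule prod_zero) (use Lfin x that in auto)
      then have "poly ?S (?r x) = ?r (1 / s x) * poly (R x) (?r x)"
        unfolding poly_sum using Lfin x by (subst sum.remove[of L x]) auto
      also have "\<dots> = poly Q (?r x)" using Rx[OF x] s[of x] by simp
      finally show ?thesis by simp
    qed
    then have "?r ` L \<subseteq> {z. poly (Q - ?S) z = 0}" by auto
    then have "card (?r ` L) \<le> card {z. poly (Q - ?S) z = 0}"
      using ne by (intro card_mono poly_roots_finite) auto
    also have "\<dots> \<le> degree (Q - ?S)" using ne by (intro card_poly_roots_bound) auto
    finally have "card (?r ` L) \<le> degree (Q - ?S)" .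
    moreover have "card (?r ` L) = Suc n" using cardL by (subst card_image) (auto simp: inj_on_def)
    ultimately show False using dle by simp
  qed
  \<comment> \<open>Total mass 1, by comparing the coefficients of degree n of monic
    polynomials.\<close>
  have sum1: "(\<Sum>x\<in>L. 1 / s x) = 1"
  proof -
    have "?r (\<Sum>x\<in>L. 1 / s x) = (\<Sum>x\<in>L. ?r (1 / s x) * coeff (R x) n)" using degR(2) by simp
    also have "\<dots> = coeff Q n" by (subst pf) (simp add: coeff_sum)
    also have "\<dots> = 1" using degQ by simp
    finally show ?thesis by (simp only: of_real_eq_1_iff)
  qed
  define f where "f x = (if x \<in> L then 1 / s x else 0)" for x
  have f0: "f x \<ge> 0" for x using s[of x] by (simp add: f_def)
  have "(\<integral>\<^sup>+ x. ennreal (f x) \<partial>count_space UNIV) = (\<Sum>x\<in>L. ennreal (f x))"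
    using Lfin by (intro nn_integral_count_space') (auto simp: f_def)
  also have "\<dots> = ennreal (\<Sum>x\<in>L. f x)" using f0 by (simp add: sum_ennreal)
  also have "(\<Sum>x\<in>L. f x) = 1" using sum1 by (simp add: f_def)
  finally have f1: "(\<integral>\<^sup>+ x. ennreal (f x) \<partial>count_space UNIV) = 1" by simp
  define q where "q = embed_pmf f"
  have pq: "pmf q x = f x" for x unfolding q_def by (rule pmf_embed_pmf[OF f0 f1])
  have setq: "set_pmf q \<subseteq> L" by (auto simp: set_pmf_eq pq f_def split: if_splits)
  have "measure_pmf.expectation q (\<lambda>x. 1 / (z - ?r x)) = 1 / F z" if z: "Im z > 0" for z
  proof -
    have zL: "z - ?r x \<noteq> 0" for x using diff_real_nonzero[of z x] z by simp
    then have zD: "z \<noteq> ?r d" for d by auto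
    have "measure_pmf.expectation q (\<lambda>x. 1 / (z - ?r x)) = (\<Sum>x\<in>L. ?r (1 / s x) / (z - ?r x))"
      using setq by (subst integral_measure_pmf[OF Lfin]) (auto simp: pq f_def scaleR_conv_of_real)
    also have "\<dots> = (\<Sum>x\<in>L. ?r (1 / s x) * poly (R x) z / poly P z)"
    proof (intro sum.cong refl)
      fix x assume x: "x \<in> L"
      have PP: "poly P z = (z - ?r x) * poly (R x) z" by (subst Psplit[OF x]) (simp add: algebra_simps)
      have "poly P z \<noteq> 0" using root(2)[of z] z by auto
      then have "poly (R x) z \<noteq> 0" using PP by auto
      then show "?r (1 / s x) / (z - ?r x) = ?r (1 / s x) * poly (R x) z / poly P z"
        unfolding PP using zL[of x] by simp
    qed
    also have "\<dots> = poly Q z / poly P z"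
    proof -
      have "poly Q z = poly (\<Sum>x\<in>L. Polynomial.smult (?r (1 / s x)) (R x)) z" using pf by (rule arg_cong)
      also have "\<dots> = (\<Sum>x\<in>L. ?r (1 / s x) * poly (R x) z)" by (simp only: poly_sum poly_smult)
      finally show ?thesis by (simp only: sum_divide_distrib)
    qed
    also have "\<dots> = 1 / F z" using PF[of z] Qnz[of z] zD by simp
    finally show ?thesis .
  qed
  then show ?thesis
    using finite_subset[OF setq Lfin] unfolding hE F_def by blast
qed

section \<open>One step of the iteration on finitely supported measures\<close>

definition pmf_dist :: "real pmf \<Rightarrow> real measure" where
  "pmf_dist p = distr (measure_pmf p) borel (\<lambda>x. x)"

lemma real_distribution_pmf_dist: "real_distribution (pmf_dist p)"
proof -
  interpret prob_space "pmf_dist p"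
    unfolding pmf_dist_def by (rule measure_pmf.prob_space_distr) simp
  show ?thesis by unfold_locales (simp add: pmf_dist_def)
qed

lemma stieltjes_pmf_dist: "stieltjes (pmf_dist p) z = measure_pmf.expectation p (\<lambda>x. 1 / (z - complex_of_real x))"
  unfolding stieltjes_def pmf_dist_def by (subst integral_distr) auto

text \<open>The measures given by \<open>rational_step\<close> for c = \<gamma> i are mixed
  uniformly over i. Stieltjes transforms are affine in the measure, so this is one application of
  the iteration map.\<close>

lemma pmf_step:
  fixes \<gamma> :: "nat \<Rightarrow> real" and \<sigma> :: real
  assumes N: "N \<ge> 1" and \<sigma>: "\<sigma> > 0" and fin: "finite (set_pmf p)"
  shows "\<exists>q. finite (set_pmf q) \<and> (\<forall>z. Im z > 0 \<longrightarrow> stieltjes (pmf_dist q) z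
    = (\<Sum>i<N. 1 / (z - complex_of_real (\<gamma> i) - (complex_of_real \<sigma>)\<^sup>2 * stieltjes (pmf_dist p) z)) / of_nat N)"
proof -
  have "\<forall>i. \<exists>q. finite (set_pmf q) \<and> (\<forall>z. Im z > 0 \<longrightarrow> stieltjes (pmf_dist q) z
    = 1 / (z - complex_of_real (\<gamma> i) - (complex_of_real \<sigma>)\<^sup>2 * stieltjes (pmf_dist p) z))"
    unfolding stieltjes_pmf_dist using rational_step[OF fin \<sigma>] by blast
  then obtain Q where Q: "\<And>i. finite (set_pmf (Q i))" "\<And>i z. Im z > 0 \<Longrightarrow> stieltjes (pmf_dist (Q i)) z
    = 1 / (z - complex_of_real (\<gamma> i) - (complex_of_real \<sigma>)\<^sup>2 * stieltjes (pmf_dist p) z)"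
    by metis
  define q where "q = bind_pmf (pmf_of_set {..<N}) Q"
  have ne: "{..<N} \<noteq> {}" using N by (auto simp: lessThan_empty_iff)
  have "finite (set_pmf q)" using Q(1) ne by (simp add: q_def)
  moreover have "stieltjes (pmf_dist q) z
    = (\<Sum>i<N. 1 / (z - complex_of_real (\<gamma> i) - (complex_of_real \<sigma>)\<^sup>2 * stieltjes (pmf_dist p) z)) / of_nat N"
    if z: "Im z > 0" for z
  proof -
    have "stieltjes (pmf_dist q) z = (\<Sum>i<N. pmf (pmf_of_set {..<N}) i *\<^sub>R stieltjes (pmf_dist (Q i)) z)"
      unfolding stieltjes_pmf_dist q_def using Q(1) ne by (intro pmf_expectation_bind) auto
    also have "\<dots> = (\<Sum>i<N. stieltjes (pmf_dist (Q i)) z) / of_nat N"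
      using ne by (simp add: scaleR_conv_of_real divide_inverse sum_distrib_left mult.commute)
    finally show ?thesis using Q(2)[OF z] by simp
  qed
  ultimately show ?thesis by blast
qed

section \<open>The R-transform relation and the subordination equation\<close>

lemma trunc_cone_open: "open (trunc_cone a b)"
  unfolding trunc_cone_def by (intro open_Collect_conj open_Collect_less continuous_intros)

lemma trunc_cone_upper: "b > 0 \<Longrightarrow> trunc_cone a b \<subseteq> {z. Im z > 0}"
  by (auto simp: trunc_cone_def)

lemma open_inverse_trunc_cone: "d > 0 \<Longrightarrow> open (inverse ` trunc_cone c d)"
proof -
  assume d: "d > 0"
  have "inverse ` trunc_cone c d = {u \<in> - {0}. inverse u \<in> trunc_cone c d}"
    using trunc_cone_upper[OF d, of c] by (auto simp: image_iff) (metis inverse_inverse_eq)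
  moreover have "open (- {0 :: complex} \<inter> inverse -` trunc_cone c d)"
    by (rule continuous_open_preimage[OF _ _ trunc_cone_open]) (auto intro!: continuous_intros)
  then have "open {u \<in> - {0 :: complex}. inverse u \<in> trunc_cone c d}"
    by (simp only: vimage_def Int_def mem_Collect_eq)
  ultimately show ?thesis by simp
qed

text \<open>The quadratic equation solved for z: the R-transform of the semicircle law is \<sigma>^2
  u.\<close>

lemma semicircle_inverse:
  assumes "\<sigma> > 0" "Im z > 0" "stieltjes (semicircle \<sigma>) z = u" "u \<noteq> 0"
  shows "z = (complex_of_real \<sigma>)\<^sup>2 * u + 1 / u"
proof -
  have "(complex_of_real \<sigma>)\<^sup>2 * u\<^sup>2 - z * u + 1 = 0"
    using semicircle_quadratic[OF assms(1,2)] assms(3) by simp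
  then have "z * u = (complex_of_real \<sigma>)\<^sup>2 * u * u + 1" by (simp add: algebra_simps power2_eq_square)
  then show ?thesis using assms(4) by (simp add: field_simps)
qed

text \<open>
  The definition of \<open>\<boxplus>\<close> gives the subordination equation only near infinity; both sides are
  holomorphic on the upper half-plane.
\<close>
lemma free_convolution_semicircle_imp:
  assumes \<tau>: "real_distribution \<tau>" and \<sigma>: "\<sigma> > 0"
    and fc: "is_free_convolution (semicircle \<sigma>) \<tau> \<rho>" and z: "Im z > 0"
  shows "stieltjes \<rho> z = stieltjes \<tau> (z - (complex_of_real \<sigma>)\<^sup>2 * stieltjes \<rho> z)"
proof -
  let ?s = "(complex_of_real \<sigma>)\<^sup>2" and ?g = "stieltjes \<rho>"
  interpret \<tau>: real_distribution \<tau> by fact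
  interpret \<rho>: real_distribution \<rho> using fc by (simp add: is_free_convolution_def)
  obtain a b c d where A1: "\<forall>X\<in>{semicircle \<sigma>, \<tau>, \<rho>}. inj_on (stieltjes X) (trunc_cone a b) \<and>
           inverse ` trunc_cone c d \<subseteq> stieltjes X ` trunc_cone a b"
    and A2: "\<forall>u\<in>inverse ` trunc_cone c d.
       R_transform \<rho> a b u = R_transform (semicircle \<sigma>) a b u + R_transform \<tau> a b u"
    and pos: "a > 0" "b > 0" "c > 0" "d > 0"
    using fc unfolding is_free_convolution_def by (elim conjE exE) (rule that)
  have inj: "inj_on (stieltjes X) (trunc_cone a b)"
    and im: "inverse ` trunc_cone c d \<subseteq> stieltjes X ` trunc_cone a b" if "X \<in> {semicircle \<sigma>, \<tau>, \<rho>}" for X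
    using bspec[OF A1 that] by auto
  note R = bspec[OF A2]
  define V where "V = inverse ` trunc_cone c d"
  \<comment> \<open>The open set on which the R-transform relation can be read off directly.\<close>
  define U where "U = trunc_cone a b \<inter> ?g -` V"
  have up: "trunc_cone a b \<subseteq> {z. Im z > 0}" by (rule trunc_cone_upper[OF pos(2)])
  have Uo: "open U"
    unfolding U_def
    by (rule continuous_open_preimage[OF continuous_on_subset[OF \<rho>.stieltjes_continuous up] trunc_cone_open])
      (unfold V_def, rule open_inverse_trunc_cone[OF pos(4)])
  \<comment> \<open>The point i (d + 1) lies in the cone and provides an element of
    \<open>U\<close>.\<close>
  have "inverse (\<i> * complex_of_real (d + 1)) \<in> V"
    unfolding V_def using pos by (intro imageI) (auto simp: trunc_cone_def)
  then have "inverse (\<i> * complex_of_real (d + 1)) \<in> ?g ` trunc_cone a b"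
    using im[of \<rho>] unfolding V_def by (meson insertCI subsetD)
  then obtain z0 where "z0 \<in> trunc_cone a b" "?g z0 = inverse (\<i> * complex_of_real (d + 1))"
    by (metis imageE)
  with \<open>inverse (\<i> * complex_of_real (d + 1)) \<in> V\<close> have "z0 \<in> U" by (simp add: U_def)
  then have Une: "U \<noteq> {}" by (rule ex_in_conv[THEN iffD1, OF exI])
  define f where "f z = stieltjes \<tau> (z - ?s * ?g z)" for z
  have "stieltjes \<tau> \<circ> (\<lambda>z. z - ?s * ?g z) holomorphic_on {z. Im z > 0}"
  proof (rule holomorphic_on_compose_gen[OF _ \<tau>.stieltjes_holomorphic])
    show "(\<lambda>z. z - ?s * ?g z) holomorphic_on {z. Im z > 0}"
      by (intro holomorphic_intros \<rho>.stieltjes_holomorphic)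
    show "(\<lambda>z. z - ?s * ?g z) ` {z. Im z > 0} \<subseteq> {z. Im z > 0}"
    proof safe
      fix z assume "0 < Im z"
      then show "0 < Im (z - ?s * ?g z)" using \<rho>.Im_subordination[of z \<sigma>] by linarith
    qed
  qed
  then have fh: "f holomorphic_on {z. Im z > 0}" by (simp add: f_def[abs_def] comp_def)
  have eq: "?g z = f z" if zU: "z \<in> U" for z
  proof -
    define u where "u = ?g z"
    have u: "u \<in> V" "z \<in> trunc_cone a b" using zU by (auto simp: U_def u_def)
    then have u0: "u \<noteq> 0" using trunc_cone_upper[OF pos(4), of c] by (auto simp: V_def)
    have pre: "inv_into (trunc_cone a b) (stieltjes X) u \<in> trunc_cone a b"
      "stieltjes X (inv_into (trunc_cone a b) (stieltjes X) u) = u" if "X \<in> {semicircle \<sigma>, \<tau>, \<rho>}" for X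
      using im[OF that] u(1) unfolding V_def by (auto intro!: inv_into_into f_inv_into_f)
    have z\<rho>: "inv_into (trunc_cone a b) ?g u = z"
      unfolding u_def using inj[of \<rho>] u(2) by (intro inv_into_f_f) auto
    have zs: "inv_into (trunc_cone a b) (stieltjes (semicircle \<sigma>)) u = ?s * u + 1 / u"
      by (rule semicircle_inverse[OF \<sigma> _ _ u0]) (use pre[of "semicircle \<sigma>"] up in auto)
    \<comment> \<open>For the local inverses K the relation reads K_\<rho>(u) = \<sigma>^2 u +
      K_\<tau>(u), the terms 1 / u being matched; and K_\<rho>(u) = z.\<close>
    have "z = ?s * u + inv_into (trunc_cone a b) (stieltjes \<tau>) u"
      using R[OF u(1)[unfolded V_def]] unfolding R_transform_def z\<rho> zs by (simp add: algebra_simps)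
    then have "inv_into (trunc_cone a b) (stieltjes \<tau>) u = z - ?s * u" by simp
    then show ?thesis using pre(2)[of \<tau>] by (simp add: f_def u_def)
  qed
  have "?g z = f z"
  proof (rule analytic_continuation_open[OF Uo _ Une _ _ \<rho>.stieltjes_holomorphic fh eq])
    show "open {z. Im z > 0}" by (rule open_halfspace_Im_gt)
    show "connected {z. Im z > 0}" by (rule convex_connected) (rule convex_halfspace_Im_gt)
    show "U \<subseteq> {z. Im z > 0}" using up by (auto simp: U_def)
  qed (use z in auto)
  then show ?thesis by (simp add: f_def)
qed

text \<open>The converse, for measures with second moments: these give injectivity and sufficient
  range of the three transforms far from the axis, where the subordination equation is the
  R-transform relation. The equation is assumed only above the height \<open>b0\<close>, since a
  contraction argument yields it only there.\<close>

lemma is_free_convolution_semicircleI: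
  assumes \<tau>: "real_distribution \<tau>" "integrable \<tau> (\<lambda>x. x\<^sup>2)" and \<rho>: "real_distribution \<rho>" "integrable \<rho> (\<lambda>x. x\<^sup>2)"
    and \<sigma>: "\<sigma> > 0"
    and eq: "\<And>z. Im z > b0 \<Longrightarrow> Im z > 0 \<Longrightarrow> stieltjes \<rho> z = stieltjes \<tau> (z - (complex_of_real \<sigma>)\<^sup>2 * stieltjes \<rho> z)"
  shows "is_free_convolution (semicircle \<sigma>) \<tau> \<rho>"
proof -
  let ?S = "{semicircle \<sigma>, \<tau>, \<rho>}"
  interpret \<rho>: real_distribution \<rho> by fact
  have S: "real_distribution X" "integrable X (\<lambda>x. x\<^sup>2)" if "X \<in> ?S" for X
    using that \<tau> \<rho> real_distribution_semicircle[OF \<sigma>] semicircle_second_moment[OF \<sigma>] by auto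
  define mX where "mX X = 1 + 2 * (LINT x|X. x\<^sup>2)" for X :: "real measure"
  define m where "m = max (mX (semicircle \<sigma>)) (max (mX \<tau>) (mX \<rho>))"
  have m: "mX X \<le> m" if "X \<in> ?S" for X using that by (auto simp: m_def)
  have m1: "m \<ge> 1" unfolding m_def mX_def by (auto simp: le_max_iff_disj)
  \<comment> \<open>High enough for injectivity of all three transforms and for \<open>eq\<close>;
    \<open>d\<close> leaves room for the displacement 2m of
    \<open>stieltjes_surj_far\<close>.\<close>
  define b where "b = 4 * m + \<bar>b0\<bar>"
  define d where "d = b + 4 * m"
  have b: "b > 0" "b \<ge> 4 * m" "b \<ge> b0" "d > 0" "d \<ge> b + 2 * m" "d \<ge> 4 * m" using m1 by (auto simp: b_def d_def)
  have far: "stieltjes X z = stieltjes X w \<Longrightarrow> z = w" if "X \<in> ?S" "Im z > b" "Im w > b" for X z w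
  proof (rule real_distribution.stieltjes_inj_far[OF S[OF that(1)]])
    have "4 * mX X \<le> b" using m[OF that(1)] b(2) by linarith
    then show "4 * (1 + 2 * (LINT x|X. x\<^sup>2)) < Im z" "4 * (1 + 2 * (LINT x|X. x\<^sup>2)) < Im w"
      using that(2,3) by (auto simp: mX_def)
  qed
  have inj: "inj_on (stieltjes X) (trunc_cone 3 b)" if "X \<in> ?S" for X
    using far[OF that] by (auto simp: inj_on_def trunc_cone_def)
  \<comment> \<open>A point of aperture 1 above \<open>d\<close> moves by at most 2m, so its
    preimage stays within aperture 3 above \<open>b\<close>.\<close>
  have im: "inverse ` trunc_cone 1 d \<subseteq> stieltjes X ` trunc_cone 3 b" if X: "X \<in> ?S" for X
  proof safe
    fix \<zeta> assume \<zeta>: "\<zeta> \<in> trunc_cone 1 d"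
    then have "Im \<zeta> > d" "\<bar>Re \<zeta>\<bar> < Im \<zeta>" by (auto simp: trunc_cone_def)
    moreover have "4 * mX X \<le> d" using m[OF X] b by linarith
    ultimately have "4 * (1 + 2 * (LINT x|X. x\<^sup>2)) < Im \<zeta>" by (simp add: mX_def)
    then obtain z where z: "cmod (z - \<zeta>) \<le> 2 * mX X" "stieltjes X z = inverse \<zeta>"
      using real_distribution.stieltjes_surj_far[OF S[OF X], of \<zeta>] unfolding mX_def by metis
    have "\<bar>Im z - Im \<zeta>\<bar> \<le> 2 * m" "\<bar>Re z - Re \<zeta>\<bar> \<le> 2 * m"
      using abs_Im_le_cmod[of "z - \<zeta>"] abs_Re_le_cmod[of "z - \<zeta>"] z(1) m[OF X] by auto
    then have "z \<in> trunc_cone 3 b"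
      using \<open>Im \<zeta> > d\<close> \<open>\<bar>Re \<zeta>\<bar> < Im \<zeta>\<close> b m1 unfolding trunc_cone_def mem_Collect_eq by linarith
    then show "inverse \<zeta> \<in> stieltjes X ` trunc_cone 3 b" using z(2) by (metis image_eqI)
  qed
  have R: "R_transform \<rho> 3 b u = R_transform (semicircle \<sigma>) 3 b u + R_transform \<tau> 3 b u"
    if u: "u \<in> inverse ` trunc_cone 1 d" for u
  proof -
    have u0: "u \<noteq> 0" using u trunc_cone_upper[OF b(4), of 1] by auto
    define Z where "Z X = inv_into (trunc_cone 3 b) (stieltjes X) u" for X
    have Z: "Z X \<in> trunc_cone 3 b" "stieltjes X (Z X) = u" if "X \<in> ?S" for X
      using im[OF that] u unfolding Z_def by (auto intro!: inv_into_into f_inv_into_f)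
    have Zb: "Im (Z X) > b" if "X \<in> ?S" for X using Z(1)[OF that] by (simp add: trunc_cone_def)
    have Zs: "Z (semicircle \<sigma>) = (complex_of_real \<sigma>)\<^sup>2 * u + 1 / u"
      by (rule semicircle_inverse[OF \<sigma> _ _ u0]) (use Z[of "semicircle \<sigma>"] Zb[of "semicircle \<sigma>"] b in auto)
    have z: "Im (Z \<rho>) > b" "stieltjes \<rho> (Z \<rho>) = u" using Z[of \<rho>] Zb[of \<rho>] by auto
    then have pz: "Im (Z \<rho>) > 0" "Im (Z \<rho>) > b0" using b by auto
    \<comment> \<open>Subtracting \<sigma>^2 u raises the imaginary part, so the point remains where
      the transform of \<tau> is injective and must be \<open>Z \<tau>\<close>.\<close>
    have "Im (Z \<rho> - (complex_of_real \<sigma>)\<^sup>2 * u) > b"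
      using \<rho>.Im_subordination[OF pz(1), of \<sigma>] z by simp
    moreover have "stieltjes \<tau> (Z \<rho> - (complex_of_real \<sigma>)\<^sup>2 * u) = stieltjes \<tau> (Z \<tau>)"
      using eq[OF pz(2,1)] z(2) Z(2)[of \<tau>] by simp
    ultimately have "Z \<rho> - (complex_of_real \<sigma>)\<^sup>2 * u = Z \<tau>"
      using far[of \<tau>] Zb[of \<tau>] by auto
    then have "Z \<rho> = (complex_of_real \<sigma>)\<^sup>2 * u + Z \<tau>" by (simp add: algebra_simps)
    then show ?thesis
      unfolding R_transform_def Z_def[symmetric] Zs by simp
  qed
  show ?thesis
    unfolding is_free_convolution_def
    apply (rule conjI[OF \<rho>(1)])
    apply (rule exI[of _ 3], rule conjI[OF zero_less_numeral])
    apply (rule exI[of _ b], rule conjI[OF b(1)])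
    apply (rule exI[of _ 1], rule conjI, simp)
    apply (rule exI[of _ d], rule conjI[OF b(4)])
    apply (intro conjI ballI inj im R; assumption)
    done
qed

section \<open>Tail control from the imaginary axis and existence of the free convolution\<close>

text \<open>The integrand is at least 1/2 for |x| \<ge> y, and y^2 times it tends to x^2 as y grows.
  One estimate along the imaginary axis therefore yields both tightness and a second moment.\<close>

lemma (in real_distribution) stieltjes_imaginary_axis:
  assumes y: "y > 0"
  shows "(LINT x|M. x\<^sup>2 / (x\<^sup>2 + y\<^sup>2)) = 1 - Re (\<i> * complex_of_real y * stieltjes M (\<i> * complex_of_real y))"
    and "integrable M (\<lambda>x. x\<^sup>2 / (x\<^sup>2 + y\<^sup>2))"
proof -
  let ?z = "\<i> * complex_of_real y"
  have z: "Im ?z > 0" using y by simp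
  show i: "integrable M (\<lambda>x. x\<^sup>2 / (x\<^sup>2 + y\<^sup>2))"
  proof (rule integrable_bounded[where B = 1])
    fix x
    have "x\<^sup>2 + y\<^sup>2 > 0" using y by (simp add: add_nonneg_pos)
    then show "norm (x\<^sup>2 / (x\<^sup>2 + y\<^sup>2)) \<le> 1" by (simp add: divide_le_eq_1)
  qed measurable
  have "Re (?z * stieltjes M ?z) = Re (LINT x|M. ?z * (1 / (?z - complex_of_real x)))"
    unfolding stieltjes_def by (simp only: integral_mult_right_zero)
  also have "\<dots> = (LINT x|M. Re (?z * (1 / (?z - complex_of_real x))))"
    by (rule integral_Re[symmetric]) (intro integrable_mult_right kernel_integrable z)
  also have "\<dots> = (LINT x|M. 1 - x\<^sup>2 / (x\<^sup>2 + y\<^sup>2))"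
  proof (intro Bochner_Integration.integral_cong refl)
    fix x
    have "x\<^sup>2 + y\<^sup>2 > 0" using y by (simp add: add_nonneg_pos)
    then show "Re (?z * (1 / (?z - complex_of_real x))) = 1 - x\<^sup>2 / (x\<^sup>2 + y\<^sup>2)"
      by (simp add: Re_divide power2_eq_square eq_diff_eq flip: add_divide_distrib) auto
  qed
  also have "\<dots> = 1 - (LINT x|M. x\<^sup>2 / (x\<^sup>2 + y\<^sup>2))"
    using i by (simp add: prob_space[unfolded space_eq_univ])
  finally show "(LINT x|M. x\<^sup>2 / (x\<^sup>2 + y\<^sup>2)) = 1 - Re (?z * stieltjes M ?z)" by simp
qed

text \<open>With z = i y, 1 - z / (z - a) = - a / (z - a) has real part (|a|^2 - y Im a) / |z -
  a|^2. Here |z - a| \<ge> y since Im a \<le> 0, and - y Im a \<le> s.\<close>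

lemma imaginary_axis_estimate:
  assumes y: "y > 0" and a: "Im a \<le> 0" "- Im a \<le> s / y" "cmod a \<le> k" and s: "s \<ge> 0"
  shows "1 - Re (\<i> * complex_of_real y * (1 / (\<i> * complex_of_real y - a))) \<le> (s + k\<^sup>2) / y\<^sup>2"
proof -
  let ?z = "\<i> * complex_of_real y"
  have "y \<le> Im (?z - a)" using a(1) by simp
  also have "\<dots> \<le> cmod (?z - a)" using abs_Im_le_cmod[of "?z - a"] by simp
  finally have ge: "y \<le> cmod (?z - a)" .
  then have nz: "?z - a \<noteq> 0" using y by auto
  have "1 - Re (?z * (1 / (?z - a))) = Re (1 - ?z * (1 / (?z - a)))" by simp
  also have "1 - ?z * (1 / (?z - a)) = - a / (?z - a)" using nz by (simp add: field_simps)
  also have "Re (- a / (?z - a)) = Re (- a * cnj (?z - a)) / (cmod (?z - a))\<^sup>2"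
    by (subst complex_div_cnj) (metis Re_divide_of_real of_real_power)
  also have "Re (- a * cnj (?z - a)) = (cmod a)\<^sup>2 - y * Im a"
    unfolding cmod_power2 by (simp add: power2_eq_square algebra_simps)
  also have "((cmod a)\<^sup>2 - y * Im a) / (cmod (?z - a))\<^sup>2 \<le> (s + k\<^sup>2) / y\<^sup>2"
  proof (rule frac_le)
    have "y * (- Im a) \<le> y * (s / y)" using a(2) y by (intro mult_left_mono) auto
    then have "- (y * Im a) \<le> s" using y by simp
    moreover have "(cmod a)\<^sup>2 \<le> k\<^sup>2" using a(3) by (intro power_mono) auto
    ultimately show "(cmod a)\<^sup>2 - y * Im a \<le> s + k\<^sup>2" by simp
    show "y\<^sup>2 \<le> (cmod (?z - a))\<^sup>2" using ge y by (intro power_mono) auto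
  qed (use y s in auto)
  finally show ?thesis .
qed

text \<open>
  The iteration \<open>g \<mapsto> g\<^sub>\<tau>(z - \<sigma>\<^sup>2 g)\<close> started at a point mass stays in the Stieltjes transforms of finitely
  supported measures. These are tight, and a weak limit satisfies the subordination equation because the
  iteration contracts for \<open>Im z > 2 \<sigma>\<close>.
\<close>
lemma free_convolution_exists:
  assumes \<sigma>: "\<sigma> > 0" and A: "A \<in> herm_mats N" and N: "N \<ge> 1"
  shows "\<exists>\<rho>. is_free_convolution (semicircle \<sigma>) (spectral_measure A) \<rho>"
proof -
  let ?r = complex_of_real and ?s = "(complex_of_real \<sigma>)\<^sup>2"
  define \<tau> where "\<tau> = spectral_measure A"
  obtain \<gamma> where \<gamma>: "\<tau> = pmf_dist (map_pmf \<gamma> (pmf_of_set {..<N}))"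
    "\<And>z. Im z \<noteq> 0 \<Longrightarrow> mat_trace (resolvent A z) = (\<Sum>i<N. 1 / (z - ?r (\<gamma> i)))"
    using spectral_measure_pmf[OF A N] unfolding \<tau>_def pmf_dist_def by metis
  have \<tau>: "real_distribution \<tau>" unfolding \<gamma>(1) by (rule real_distribution_pmf_dist)
  interpret \<tau>: real_distribution \<tau> by fact
  have g\<tau>: "stieltjes \<tau> z = (\<Sum>i<N. 1 / (z - ?r (\<gamma> i))) / of_nat N" if "Im z > 0" for z
    unfolding \<tau>_def using stieltjes_spectral_measure[OF A N, of z] \<gamma>(2)[of z] that by simp
  have \<tau>2: "integrable \<tau> (\<lambda>x. x\<^sup>2)"
  proof -
    have "finite (set_pmf (map_pmf \<gamma> (pmf_of_set {..<N})))" using N by (simp add: lessThan_empty_iff)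
    then have "integrable (measure_pmf (map_pmf \<gamma> (pmf_of_set {..<N}))) (\<lambda>x. x\<^sup>2)"
      by (rule integrable_measure_pmf_finite)
    then show ?thesis unfolding \<gamma>(1) pmf_dist_def by (subst integrable_distr_eq) auto
  qed
  have "\<forall>p. \<exists>q. finite (set_pmf p) \<longrightarrow> finite (set_pmf q) \<and> (\<forall>z. Im z > 0 \<longrightarrow> stieltjes (pmf_dist q) z
    = (\<Sum>i<N. 1 / (z - ?r (\<gamma> i) - ?s * stieltjes (pmf_dist p) z)) / of_nat N)"
    using pmf_step[OF N \<sigma>] by blast
  then obtain S where S: "\<And>p. finite (set_pmf p) \<Longrightarrow> finite (set_pmf (S p))"
    "\<And>p z. finite (set_pmf p) \<Longrightarrow> Im z > 0 \<Longrightarrow> stieltjes (pmf_dist (S p)) z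
      = (\<Sum>i<N. 1 / (z - ?r (\<gamma> i) - ?s * stieltjes (pmf_dist p) z)) / of_nat N"
    by metis
  define p where "p k = (S ^^ k) (return_pmf 0)" for k
  have pfin: "finite (set_pmf (p k))" for k by (induction k) (auto simp: p_def S(1))
  define g where "g k z = stieltjes (pmf_dist (p k)) z" for k z
  have rd: "real_distribution (pmf_dist (p k))" for k by (rule real_distribution_pmf_dist)
  have gS: "g (Suc k) z = (\<Sum>i<N. 1 / (z - ?r (\<gamma> i) - ?s * g k z)) / of_nat N" if "Im z > 0" for k z
    using S(2)[OF pfin that, of k] by (simp add: g_def p_def)
  have sub: "Im z \<le> Im (z - ?s * g k z)" if "Im z > 0" for k z
    unfolding g_def by (rule real_distribution.Im_subordination[OF rd that])
  have grec: "g (Suc k) z = stieltjes \<tau> (z - ?s * g k z)" if z: "Im z > 0" for k z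
  proof -
    have "Im (z - ?s * g k z) > 0" using sub[OF z, of k] z by linarith
    then show ?thesis unfolding gS[OF z] by (subst g\<tau>) (simp_all add: algebra_simps)
  qed
  define L where "L = (\<Sum>i<N. \<bar>\<gamma> i\<bar>)"
  have L: "\<bar>\<gamma> i\<bar> \<le> L" if "i < N" for i unfolding L_def using that by (intro member_le_sum) auto
  \<comment> \<open>Independent of the iteration index: for y \<ge> 1 the shift a = \<gamma> i +
    \<sigma>^2 g has modulus at most L + \<sigma>^2, and - Im a \<le> \<sigma>^2 / y.\<close>
  define K where "K = \<sigma>\<^sup>2 + (L + \<sigma>\<^sup>2)\<^sup>2"
  have K: "K > 0" using \<sigma> by (simp add: K_def add_pos_nonneg)
  have axis: "(LINT x|pmf_dist (p (Suc k)). x\<^sup>2 / (x\<^sup>2 + y\<^sup>2)) \<le> K / y\<^sup>2" if y: "y \<ge> 1" for k y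
  proof -
    let ?z = "\<i> * ?r y"
    have z: "Im ?z > 0" "y > 0" using y by auto
    define a where "a i = ?r (\<gamma> i) + ?s * g k ?z" for i
    have gb: "cmod (g k ?z) \<le> 1 / y"
      using real_distribution.stieltjes_bound[OF rd z(1), of k] by (simp add: g_def)
    have ai: "Im (a i) \<le> 0" "- Im (a i) \<le> \<sigma>\<^sup>2 / y" for i
    proof -
      have I: "Im (a i) = \<sigma>\<^sup>2 * Im (g k ?z)" by (simp add: a_def flip: of_real_power)
      show "Im (a i) \<le> 0" using real_distribution.Im_stieltjes_nonpos[OF rd z(1), of k] I by (simp add: g_def mult_nonneg_nonpos)
      have "- Im (g k ?z) \<le> 1 / y" using abs_Im_le_cmod[of "g k ?z"] gb by linarith
      from mult_left_mono[OF this, of "\<sigma>\<^sup>2"] show "- Im (a i) \<le> \<sigma>\<^sup>2 / y" using I by simp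
    qed
    have ak: "cmod (a i) \<le> L + \<sigma>\<^sup>2" if "i < N" for i
    proof -
      have "cmod (a i) \<le> \<bar>\<gamma> i\<bar> + \<sigma>\<^sup>2 * cmod (g k ?z)"
        unfolding a_def by (rule order_trans[OF norm_triangle_ineq]) (simp add: norm_mult norm_power)
      also have "\<dots> \<le> L + \<sigma>\<^sup>2 * 1"
      proof (intro add_mono mult_left_mono L that)
        have "1 / y \<le> 1" using y by simp
        then show "cmod (g k ?z) \<le> 1" using gb by linarith
      qed simp
      finally show ?thesis by simp
    qed
    have "?z * g (Suc k) ?z = (\<Sum>i<N. ?z * (1 / (?z - a i))) / of_nat N"
      unfolding gS[OF z(1)] a_def by (simp add: sum_distrib_left algebra_simps)
    then have "1 - Re (?z * g (Suc k) ?z) = 1 - (\<Sum>i<N. Re (?z * (1 / (?z - a i)))) / N"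
      by (simp only: Re_divide_of_nat Re_sum)
    also have "\<dots> = (\<Sum>i<N. 1 - Re (?z * (1 / (?z - a i)))) / N"
      using N by (simp add: sum_subtractf field_simps)
    also have "\<dots> \<le> (\<Sum>i<N. K / y\<^sup>2) / N"
      unfolding K_def
      by (intro divide_right_mono sum_mono imaginary_axis_estimate z(2) ai ak) auto
    also have "\<dots> = K / y\<^sup>2" using N by simp
    finally show ?thesis
      using real_distribution.stieltjes_imaginary_axis(1)[OF rd z(2), of "Suc k"] by (simp add: g_def)
  qed
  \<comment> \<open>The starting point mass is skipped because \<open>axis\<close> speaks of the
    iterates after it.\<close>
  define \<mu> where "\<mu> k = pmf_dist (p (Suc k))" for k
  have rd\<mu>: "real_distribution (\<mu> k)" for k unfolding \<mu>_def by (rule rd)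
  have "tight \<mu>"
    unfolding tight_def
  proof (intro conjI allI impI rd\<mu>)
    fix \<epsilon> :: real assume \<epsilon>: "\<epsilon> > 0"
    \<comment> \<open>This makes the tail bound 2 K / y^2 at most \<epsilon> / 2; y \<ge> 1 is
      required by \<open>axis\<close>.\<close>
    define y where "y = max 1 (sqrt (4 * K / \<epsilon>))"
    have y: "y \<ge> 1" "y > 0" by (auto simp: y_def)
    have "4 * K / \<epsilon> \<le> y\<^sup>2"
    proof -
      have "4 * K / \<epsilon> = (sqrt (4 * K / \<epsilon>))\<^sup>2" using K \<epsilon> by simp
      also have "\<dots> \<le> y\<^sup>2" using K \<epsilon> by (intro power_mono) (auto simp: y_def)
      finally show ?thesis .
    qed
    then have small: "2 * (K / y\<^sup>2) < \<epsilon>" using \<epsilon> K y by (simp add: field_simps)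
    have "measure (\<mu> k) {- y<..y} > 1 - \<epsilon>" for k
    proof -
      interpret real_distribution "\<mu> k" by (rule rd\<mu>)
      have "prob (UNIV - {- y<..y}) = (LINT x|\<mu> k. indicator (UNIV - {- y<..y}) x)" by simp
      also have "\<dots> \<le> (LINT x|\<mu> k. 2 * (x\<^sup>2 / (x\<^sup>2 + y\<^sup>2)))"
      proof (rule integral_mono)
        show "integrable (\<mu> k) (\<lambda>x. 2 * (x\<^sup>2 / (x\<^sup>2 + y\<^sup>2)))"
          by (intro integrable_mult_right stieltjes_imaginary_axis(2)[OF y(2)])
        show "integrable (\<mu> k) (indicator (UNIV - {- y<..y}) :: real \<Rightarrow> real)"
          by (rule integrable_bounded[where B = 1]) (auto simp: indicator_def)
        fix x
        show "indicator (UNIV - {- y<..y}) x \<le> 2 * (x\<^sup>2 / (x\<^sup>2 + y\<^sup>2))"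
        proof (cases "x \<in> {- y<..y}")
          case False
          then have "\<bar>y\<bar> \<le> \<bar>x\<bar>" using y by auto
          then have "y\<^sup>2 \<le> x\<^sup>2" by (simp add: abs_le_square_iff)
          moreover have "y\<^sup>2 > 0" using y by simp
          ultimately have "1 \<le> 2 * (x\<^sup>2 / (x\<^sup>2 + y\<^sup>2))" by (simp add: pos_le_divide_eq add_nonneg_pos)
          then show ?thesis using False by simp
        qed simp
      qed
      also have "\<dots> \<le> 2 * (K / y\<^sup>2)"
        unfolding integral_mult_right_zero \<mu>_def using axis[OF y(1), of k] by (intro mult_left_mono) auto
      finally have "prob (UNIV - {- y<..y}) < \<epsilon>" using small by linarith
      moreover have "prob (UNIV - {- y<..y}) = 1 - prob {- y<..y}"
        using prob_compl[of "{- y<..y}"] by simp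
      ultimately show ?thesis by linarith
    qed
    then show "\<exists>a b. a < b \<and> (\<forall>n. 1 - \<epsilon> < measure (\<mu> n) {a<..b})"
      using y(2) by (intro exI[of _ "- y"] exI[of _ y]) auto
  qed
  then obtain r \<rho> where r: "strict_mono (r :: nat \<Rightarrow> nat)" and \<rho>: "real_distribution \<rho>" and wc: "weak_conv_m (\<mu> \<circ> id \<circ> r) \<rho>"
    using tight_imp_convergent_subsubsequence[OF _ strict_mono_id] by blast
  interpret \<rho>: real_distribution \<rho> by fact
  have wc': "weak_conv_m (\<lambda>j. \<mu> (r j)) \<rho>" using wc by (simp add: comp_def)
  have lim: "(\<lambda>j. g (Suc (r j)) z) \<longlonglongrightarrow> stieltjes \<rho> z" if z: "Im z > 0" for z
  proof -
    have "isCont (\<lambda>x. 1 / (z - ?r x)) x" for x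
      using diff_real_nonzero[of z x] z by (intro continuous_intros) auto
    from weak_conv_imp_integral_bdd_continuous_conv[OF rd\<mu> \<rho> wc' this cmod_kernel_le[OF z]]
    show ?thesis by (simp add: g_def \<mu>_def stieltjes_def)
  qed
  have eq: "stieltjes \<rho> z = stieltjes \<tau> (z - ?s * stieltjes \<rho> z)" if zb: "Im z > 2 * \<sigma>" and z: "Im z > 0" for z
  proof -
    \<comment> \<open>The transform of \<tau> has Lipschitz constant at most 1 / (Im z)^2 at the
      shifted points, and \<sigma>^2 / (Im z)^2 \<le> 1/4 in this range.\<close>
    have step: "cmod (g (Suc (Suc k)) z - g (Suc k) z) \<le> (1 / 4) * cmod (g (Suc k) z - g k z)" for k
    proof -
      let ?w = "\<lambda>k. z - ?s * g k z"
      have w: "Im (?w k) \<ge> Im z" "Im (?w k) > 0" for k using sub[OF z, of k] z by auto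
      have "cmod (g (Suc (Suc k)) z - g (Suc k) z) \<le> cmod (?w (Suc k) - ?w k) / (Im (?w (Suc k)) * Im (?w k))"
        unfolding grec[OF z, of "Suc k"] grec[OF z, of k] by (rule \<tau>.stieltjes_lipschitz) (use w(2)[of "Suc k"] w(2)[of k] in \<open>simp_all add: grec[OF z, of k]\<close>)
      also have "\<dots> \<le> cmod (?w (Suc k) - ?w k) / (Im z * Im z)"
        using w(1)[of "Suc k"] w(1)[of k] w(2)[of "Suc k"] w(2)[of k] z
        by (intro divide_left_mono mult_mono mult_pos_pos) (simp_all only: norm_ge_zero less_imp_le)
      also have "?w (Suc k) - ?w k = - (?s * (g (Suc k) z - g k z))" by (simp add: algebra_simps)
      also have "cmod \<dots> / (Im z * Im z) = (\<sigma>\<^sup>2 / (Im z * Im z)) * cmod (g (Suc k) z - g k z)"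
        by (simp add: norm_mult norm_power)
      also have "\<dots> \<le> (1 / 4) * cmod (g (Suc k) z - g k z)"
      proof (rule mult_right_mono)
        have "(2 * \<sigma>) * (2 * \<sigma>) \<le> Im z * Im z" using zb \<sigma> by (intro mult_mono) auto
        then show "\<sigma>\<^sup>2 / (Im z * Im z) \<le> 1 / 4" using z by (simp add: field_simps power2_eq_square)
      qed simp
      finally show ?thesis .
    qed
    have "cmod (g (Suc k) z - g k z) \<le> (1 / 4) ^ k * cmod (g 1 z - g 0 z)" for k
    proof (induction k)
      case (Suc k)
      then show ?case using step[of k] by simp
    qed simp
    then have le: "\<forall>k. norm (g (Suc k) z - g k z) \<le> (1 / 4) ^ k * cmod (g 1 z - g 0 z)" by blast
    have "(\<lambda>k. (1 / 4 :: real) ^ k * cmod (g 1 z - g 0 z)) \<longlonglongrightarrow> 0 * cmod (g 1 z - g 0 z)"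
      by (intro tendsto_mult LIMSEQ_realpow_zero tendsto_const) auto
    then have "(\<lambda>k. (1 / 4 :: real) ^ k * cmod (g 1 z - g 0 z)) \<longlonglongrightarrow> 0"
      unfolding mult_zero_left .
    from Lim_null_comparison[OF always_eventually[OF le] this]
    have "(\<lambda>k. g (Suc k) z - g k z) \<longlonglongrightarrow> 0" .
    \<comment> \<open>Consecutive iterates approach each other, so the subsequence shifted by one
      has the same limit.\<close>
    from LIMSEQ_subseq_LIMSEQ[OF LIMSEQ_Suc[OF this] r]
    have "(\<lambda>j. (g (Suc (Suc (r j))) z - g (Suc (r j)) z) + g (Suc (r j)) z) \<longlonglongrightarrow> 0 + stieltjes \<rho> z"
      by (intro tendsto_add lim[OF z]) (simp add: comp_def)
    then have l1: "(\<lambda>j. g (Suc (Suc (r j))) z) \<longlonglongrightarrow> stieltjes \<rho> z" by simp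
    have "Im (z - ?s * stieltjes \<rho> z) > 0" using \<rho>.Im_subordination[OF z, of \<sigma>] z by linarith
    then have "isCont (stieltjes \<tau>) (z - ?s * stieltjes \<rho> z)"
      by (rule DERIV_isCont[OF \<tau>.stieltjes_has_deriv])
    moreover have "(\<lambda>j. z - ?s * g (Suc (r j)) z) \<longlonglongrightarrow> z - ?s * stieltjes \<rho> z"
      by (intro tendsto_intros lim[OF z])
    ultimately have "(\<lambda>j. stieltjes \<tau> (z - ?s * g (Suc (r j)) z)) \<longlonglongrightarrow> stieltjes \<tau> (z - ?s * stieltjes \<rho> z)"
      by (rule isCont_tendsto_compose)
    then show ?thesis
      using l1 unfolding grec[OF z, of "Suc _"] by (rule LIMSEQ_unique[rotated])
  qed
  have axis\<rho>: "(LINT x|\<rho>. x\<^sup>2 / (x\<^sup>2 + y\<^sup>2)) \<le> K / y\<^sup>2" if y: "y \<ge> 1" for y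
  proof -
    have y0: "y > 0" using y by simp
    then have z: "Im (\<i> * ?r y) > 0" by simp
    have "(\<lambda>j. 1 - Re (\<i> * ?r y * g (Suc (r j)) (\<i> * ?r y))) \<longlonglongrightarrow> 1 - Re (\<i> * ?r y * stieltjes \<rho> (\<i> * ?r y))"
      by (intro tendsto_intros lim[OF z])
    then have "1 - Re (\<i> * ?r y * stieltjes \<rho> (\<i> * ?r y)) \<le> K / y\<^sup>2"
    proof (rule LIMSEQ_le_const2, intro exI allI impI)
      fix j
      show "1 - Re (\<i> * ?r y * g (Suc (r j)) (\<i> * ?r y)) \<le> K / y\<^sup>2"
        using axis[OF y, of "r j"] real_distribution.stieltjes_imaginary_axis(1)[OF rd y0, of "Suc (r j)"]
        by (simp add: g_def)
    qed
    then show ?thesis using \<rho>.stieltjes_imaginary_axis(1)[OF y0] by simp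
  qed
  have \<rho>2: "integrable \<rho> (\<lambda>x. x\<^sup>2)"
  proof -
    \<comment> \<open>These functions tend to x^2 and have integrals at most K by
      \<open>axis\<rho>\<close>, so Fatou's lemma gives the second moment.\<close>
    define u where "u n x = (real (Suc n))\<^sup>2 * (x\<^sup>2 / (x\<^sup>2 + (real (Suc n))\<^sup>2))" for n x
    have u0: "u n x \<ge> 0" for n x by (simp add: u_def)
    have ulim: "(\<lambda>n. u n x) \<longlonglongrightarrow> x\<^sup>2" for x
    proof -
      have e: "u n x = x\<^sup>2 / (x\<^sup>2 * (inverse (real (Suc n)))\<^sup>2 + 1)" for n
        by (simp add: u_def field_simps del: of_nat_Suc)
      have "(\<lambda>n. x\<^sup>2 / (x\<^sup>2 * (inverse (real (Suc n)))\<^sup>2 + 1)) \<longlonglongrightarrow> x\<^sup>2 / (x\<^sup>2 * 0\<^sup>2 + 1)"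
        by (intro tendsto_intros LIMSEQ_inverse_real_of_nat) simp
      then show ?thesis unfolding e by simp
    qed
    have "(\<integral>\<^sup>+ x. ennreal (x\<^sup>2) \<partial>\<rho>) = (\<integral>\<^sup>+ x. liminf (\<lambda>n. ennreal (u n x)) \<partial>\<rho>)"
      by (intro nn_integral_cong lim_imp_Liminf[symmetric] tendsto_ennrealI ulim) auto
    also have "\<dots> \<le> liminf (\<lambda>n. \<integral>\<^sup>+ x. ennreal (u n x) \<partial>\<rho>)"
      by (rule nn_integral_liminf) (simp add: u_def)
    also have "\<dots> \<le> limsup (\<lambda>n. \<integral>\<^sup>+ x. ennreal (u n x) \<partial>\<rho>)"
      by (rule Liminf_le_Limsup) simp
    also have "\<dots> \<le> ennreal K"
    proof (rule Limsup_bounded, rule always_eventually, rule allI)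
      fix n
      have n: "real (Suc n) \<ge> 1" "real (Suc n) > 0" by auto
      have "(\<integral>\<^sup>+ x. ennreal (u n x) \<partial>\<rho>) = ennreal (LINT x|\<rho>. u n x)"
      proof (rule nn_integral_eq_integral)
        show "integrable \<rho> (u n)"
          unfolding u_def[abs_def] by (intro integrable_mult_right \<rho>.stieltjes_imaginary_axis(2)[OF n(2)])
      qed (use u0 in simp)
      also have "(LINT x|\<rho>. u n x) = (real (Suc n))\<^sup>2 * (LINT x|\<rho>. x\<^sup>2 / (x\<^sup>2 + (real (Suc n))\<^sup>2))"
        unfolding u_def by (rule integral_mult_right_zero)
      also have "\<dots> \<le> (real (Suc n))\<^sup>2 * (K / (real (Suc n))\<^sup>2)"
        by (intro mult_left_mono axis\<rho> n) simp
      also have "\<dots> = K" by (simp del: of_nat_Suc)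
      finally show "(\<integral>\<^sup>+ x. ennreal (u n x) \<partial>\<rho>) \<le> ennreal K" by (simp add: ennreal_leI)
    qed
    finally have "(\<integral>\<^sup>+ x. ennreal (x\<^sup>2) \<partial>\<rho>) < \<infinity>" by (auto simp: top_unique less_top[symmetric])
    then show ?thesis by (intro integrableI_bounded) auto
  qed
  have "is_free_convolution (semicircle \<sigma>) \<tau> \<rho>"
    by (rule is_free_convolution_semicircleI[OF \<tau> \<tau>2 \<rho> \<rho>2 \<sigma>, of "2 * \<sigma>"]) (rule eq)
  then show ?thesis unfolding \<tau>_def by blast
qed

text \<open>Existence makes the chosen measure a witness of the defining relation, and every witness
  satisfies the subordination equation.\<close>

lemma free_convolution_subordination:
  assumes \<sigma>: "\<sigma> > 0" and A: "A \<in> herm_mats N" and N: "N \<ge> 1"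
  shows "real_distribution (semicircle \<sigma> \<boxplus> spectral_measure A)"
    and "Im z > 0 \<Longrightarrow> g_tilde \<sigma> A z = stieltjes (spectral_measure A) (z - (complex_of_real \<sigma>)\<^sup>2 * g_tilde \<sigma> A z)"
    and "real_distribution (spectral_measure A)"
proof -
  have fc: "is_free_convolution (semicircle \<sigma>) (spectral_measure A) (semicircle \<sigma> \<boxplus> spectral_measure A)"
    unfolding free_convolution_def by (rule someI_ex[OF free_convolution_exists[OF \<sigma> A N]])
  then show "real_distribution (semicircle \<sigma> \<boxplus> spectral_measure A)"
    by (simp add: is_free_convolution_def)
  show sd: "real_distribution (spectral_measure A)"
    using spectral_measure_pmf[OF A N] real_distribution_pmf_dist unfolding pmf_dist_def by metis
  show "g_tilde \<sigma> A z = stieltjes (spectral_measure A) (z - (complex_of_real \<sigma>)\<^sup>2 * g_tilde \<sigma> A z)" if "Im z > 0"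
    unfolding g_tilde_def by (rule free_convolution_semicircle_imp[OF sd \<sigma> fc that])
qed

section \<open>Coordinates of a Wigner matrix\<close>

text \<open>
  The matrix \<open>wX N x\<close> is the Hermitian matrix with \<open>wigner_var (wX N x) = x\<close>, and \<open>wE N p\<close> is its derivative in
  the coordinate \<open>p\<close>. A diagonal coordinate enters its entry twice, hence the weight \<open>1 / 2\<close>.
\<close>
definition wal :: "nat \<times> nat \<Rightarrow> complex" where
  "wal p = (if fst p = snd p then 1 / 2 else if fst p < snd p then complex_of_real (1 / sqrt 2)
     else - \<i> * complex_of_real (1 / sqrt 2))"

definition wE :: "nat \<Rightarrow> nat \<times> nat \<Rightarrow> complex mat" where
  "wE N p = mat N N (\<lambda>q. (if q = p then wal p else 0) + (if prod.swap q = p then cnj (wal p) else 0))"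

definition wX :: "nat \<Rightarrow> (nat \<times> nat \<Rightarrow> real) \<Rightarrow> complex mat" where
  "wX N x = mat N N (\<lambda>q. wal q * x q + cnj (wal (prod.swap q)) * x (prod.swap q))"

lemma wal_norm: "cmod (wal p) \<le> 1"
  by (auto simp: wal_def norm_mult norm_divide real_le_rsqrt divide_le_eq_1)

lemma wE_carrier [simp]: "wE N p \<in> carrier_mat N N" by (simp add: wE_def)

lemma wX_carrier [simp]: "wX N x \<in> carrier_mat N N" by (simp add: wX_def)

lemma wE_entry: "a < N \<Longrightarrow> b < N \<Longrightarrow> wE N p $$ (a, b) =
    (if (a, b) = p then wal p else 0) + (if (b, a) = p then cnj (wal p) else 0)"
  by (simp add: wE_def)

lemma wX_entry: "a < N \<Longrightarrow> b < N \<Longrightarrow> wX N x $$ (a, b) = wal (a, b) * x (a, b) + cnj (wal (b, a)) * x (b, a)"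
  by (simp add: wX_def)

lemma wE_herm: "wE N p \<in> herm_mats N"
  unfolding herm_mats_iff by (auto simp: wE_entry)

lemma wX_herm: "wX N x \<in> herm_mats N"
  unfolding herm_mats_iff by (auto simp: wX_entry)

lemma sum_pair_delta:
  fixes f :: "nat \<Rightarrow> nat \<Rightarrow> complex"
  assumes "i < N" "j < N"
  shows "(\<Sum>a<N. \<Sum>b<N. (if (a, b) = (i, j) then c else 0) * f a b) = c * f i j"
proof -
  have "(\<Sum>b<N. (if (a, b) = (i, j) then c else 0) * f a b) = (if a = i then c * f i j else 0)" for a
  proof -
    have "(\<Sum>b<N. (if (a, b) = (i, j) then c else 0) * f a b) = (\<Sum>b<N. if b = j then (if a = i then c * f i j else 0) else 0)"
      by (intro sum.cong) auto
    then show ?thesis using assms(2) by simp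
  qed
  then show ?thesis using assms(1) by simp
qed

lemma wE_sum:
  fixes f :: "nat \<Rightarrow> nat \<Rightarrow> complex"
  assumes "i < N" "j < N"
  shows "(\<Sum>a<N. \<Sum>b<N. wE N (i, j) $$ (a, b) * f a b) = wal (i, j) * f i j + cnj (wal (i, j)) * f j i"
proof -
  have "(\<Sum>a<N. \<Sum>b<N. wE N (i, j) $$ (a, b) * f a b) = (\<Sum>a<N. \<Sum>b<N.
      (if (a, b) = (i, j) then wal (i, j) else 0) * f a b + (if (a, b) = (j, i) then cnj (wal (i, j)) else 0) * f a b)"
    by (intro sum.cong) (auto simp: wE_entry algebra_simps)
  then show ?thesis
    using assms by (simp only: sum.distrib sum_pair_delta)
qed

lemma wE_trace:
  assumes "H \<in> carrier_mat N N" "i < N" "j < N"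
  shows "mat_trace (wE N (i, j) * H) = wal (i, j) * H $$ (j, i) + cnj (wal (i, j)) * H $$ (i, j)"
  unfolding mat_trace_mult[OF wE_carrier assms(1)] by (rule wE_sum[OF assms(2,3)])

lemma wE_sandwich:
  assumes "U \<in> carrier_mat N N" "Y \<in> carrier_mat N N" "i < N" "j < N" "s < N" "t < N"
  shows "(U * wE N (i, j) * Y) $$ (s, t) = wal (i, j) * (U $$ (s, i) * Y $$ (j, t)) + cnj (wal (i, j)) * (U $$ (s, j) * Y $$ (i, t))"
proof -
  have "(U * wE N (i, j) * Y) $$ (s, t) = (\<Sum>a<N. \<Sum>b<N. U $$ (s, b) * wE N (i, j) $$ (b, a) * Y $$ (a, t))"
    by (rule mat_mult3_entry) (use assms in auto)
  also have "\<dots> = (\<Sum>b<N. \<Sum>a<N. wE N (i, j) $$ (b, a) * (U $$ (s, b) * Y $$ (a, t)))"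
    by (subst sum.swap) (simp add: mult_ac)
  also have "\<dots> = wal (i, j) * (U $$ (s, i) * Y $$ (j, t)) + cnj (wal (i, j)) * (U $$ (s, j) * Y $$ (i, t))"
    by (rule wE_sum[OF assms(3,4)])
  finally show ?thesis .
qed

lemma wX_trace:
  assumes "H \<in> carrier_mat N N"
  shows "mat_trace (wX N x * H) = (\<Sum>i<N. \<Sum>j<N. x (i, j) * mat_trace (wE N (i, j) * H))"
proof -
  have "mat_trace (wX N x * H) = (\<Sum>a<N. \<Sum>b<N. wal (a, b) * x (a, b) * H $$ (b, a))
      + (\<Sum>a<N. \<Sum>b<N. cnj (wal (b, a)) * x (b, a) * H $$ (b, a))"
    unfolding mat_trace_mult[OF wX_carrier assms] sum.distrib[symmetric]
    by (intro sum.cong) (auto simp: wX_entry algebra_simps)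
  also have "(\<Sum>a<N. \<Sum>b<N. cnj (wal (b, a)) * x (b, a) * H $$ (b, a)) = (\<Sum>a<N. \<Sum>b<N. cnj (wal (a, b)) * x (a, b) * H $$ (a, b))"
    by (rule sum.swap)
  also have "(\<Sum>a<N. \<Sum>b<N. wal (a, b) * x (a, b) * H $$ (b, a)) + \<dots> = (\<Sum>i<N. \<Sum>j<N. x (i, j) * mat_trace (wE N (i, j) * H))"
    unfolding sum.distrib[symmetric] by (intro sum.cong) (auto simp: wE_trace[OF assms] algebra_simps)
  finally show ?thesis .
qed

section \<open>Sums over all coordinate directions\<close>

text \<open>The coordinates (i, j) and (j, i) carry the real and the imaginary part of one entry.
  Closed forms appear only after both are added, hence a comparison of symmetrized summands.\<close>

lemma sum_pairs_cong:
  fixes f h :: "nat \<Rightarrow> nat \<Rightarrow> 'a::{field_char_0}"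
  assumes "\<And>i j. i < N \<Longrightarrow> j < N \<Longrightarrow> i \<le> j \<Longrightarrow> f i j + f j i = h i j + h j i"
  shows "(\<Sum>i<N. \<Sum>j<N. f i j) = (\<Sum>i<N. \<Sum>j<N. h i j)"
proof -
  have eq: "f i j + f j i = h i j + h j i" if "i < N" "j < N" for i j
    using assms[of i j] assms[of j i] that by (cases "i \<le> j") (auto simp: add.commute)
  have "2 * (\<Sum>i<N. \<Sum>j<N. f i j) = (\<Sum>i<N. \<Sum>j<N. f i j) + (\<Sum>i<N. \<Sum>j<N. f j i)"
    by (subst (2) sum.swap) simp
  also have "\<dots> = (\<Sum>i<N. \<Sum>j<N. h i j + h j i)"
    unfolding sum.distrib[symmetric] using eq by (intro sum.cong) auto
  also have "\<dots> = (\<Sum>i<N. \<Sum>j<N. h i j) + (\<Sum>i<N. \<Sum>j<N. h j i)"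
    by (simp add: sum.distrib)
  also have "\<dots> = 2 * (\<Sum>i<N. \<Sum>j<N. h i j)"
    by (subst (2) sum.swap) simp
  finally show ?thesis by simp
qed

lemma wal_simps:
  "wal (i, i) = 1 / 2" "i < j \<Longrightarrow> wal (i, j) = complex_of_real (1 / sqrt 2)"
  "i < j \<Longrightarrow> wal (j, i) = - \<i> * complex_of_real (1 / sqrt 2)"
  by (auto simp: wal_def)

text \<open>With E = \<open>wE N (i, j)\<close> the summand is Tr (E U E V). Off the diagonal, the
  terms with a^2 and b^2 cancel between the real and the imaginary coordinate, which reflects E
  W_ij^2 = 0; the mixed terms add up to Tr U Tr V.\<close>

lemma sum_wE_2:
  fixes U V :: "complex mat"
  defines "f \<equiv> \<lambda>i j. let a = wal (i, j); b = cnj (wal (i, j)) in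
     a * (a * (U $$ (j, i) * V $$ (j, i)) + b * (U $$ (j, j) * V $$ (i, i)))
   + b * (a * (U $$ (i, i) * V $$ (j, j)) + b * (U $$ (i, j) * V $$ (i, j)))"
  shows "(\<Sum>i<N. \<Sum>j<N. f i j) = (\<Sum>i<N. U $$ (i, i)) * (\<Sum>i<N. V $$ (i, i))"
proof -
  have "(\<Sum>i<N. \<Sum>j<N. f i j) = (\<Sum>i<N. \<Sum>j<N. U $$ (i, i) * V $$ (j, j))"
  proof (rule sum_pairs_cong)
    fix i j assume "i < N" "j < N" "i \<le> j"
    define c where "c = complex_of_real (1 / sqrt 2)"
    have c2: "c * c = 1 / 2" by (simp add: c_def flip: of_real_mult)
    have c2': "c * (c * u) = u / 2" for u using c2 by (simp flip: mult.assoc)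
    have i2: "\<i> * (\<i> * u) = - u" for u by (simp flip: mult.assoc)
    have cc: "cnj c = c" by (simp add: c_def)
    show "f i j + f j i = U $$ (i, i) * V $$ (j, j) + U $$ (j, j) * V $$ (i, i)"
    proof (cases "i = j")
      case True
      then show ?thesis by (simp add: f_def Let_def wal_simps)
    next
      case False
      with \<open>i \<le> j\<close> have ij: "i < j" by simp
      show ?thesis
        unfolding f_def Let_def wal_simps(2,3)[OF ij] c_def[symmetric]
        by (simp add: cc algebra_simps c2' i2)
    qed
  qed
  then show ?thesis by (simp add: sum_product)
qed

text \<open>
  One sixth of the third derivative of a resolvent trace in the coordinate \<open>(i, j)\<close>, up to scaling; \<open>a\<close> and \<open>b\<close> are
  the weights of the entries \<open>(i, j)\<close> and \<open>(j, i)\<close> in this direction.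
\<close>
definition word4 :: "complex \<Rightarrow> complex \<Rightarrow> (nat \<times> nat \<Rightarrow> complex) \<Rightarrow> (nat \<times> nat \<Rightarrow> complex) \<Rightarrow> nat \<Rightarrow> nat \<Rightarrow> complex" where
  "word4 a b u v i j =
    (let q1 = (\<lambda>s t. a * (u (s, i) * u (j, t)) + b * (u (s, j) * u (i, t)));
         q2 = (\<lambda>s t. a * (q1 s i * u (j, t)) + b * (q1 s j * u (i, t)));
         q3 = (\<lambda>s t. a * (q2 s i * v (j, t)) + b * (q2 s j * v (i, t)))
     in a * q3 j i + b * q3 i j)"

text \<open>For i \<noteq> j, the products with at least two off-diagonal factors. Frobenius and row
  norms will make their sum smaller than the leading one by a factor of order N.\<close>

definition word_off :: "(nat \<times> nat \<Rightarrow> complex) \<Rightarrow> (nat \<times> nat \<Rightarrow> complex) \<Rightarrow> nat \<Rightarrow> nat \<Rightarrow> complex" where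
  "word_off u v i j = u (j, i) ^ 3 * v (j, i) + u (j, i) * u (j, j) * u (i, j) * v (i, i) + u (j, j) * u (i, j) * u (i, i) * v (j, i)"

lemma word4_sym:
  assumes ij: "i < j"
  shows "2 * (word4 (wal (i, j)) (cnj (wal (i, j))) u v i j + word4 (wal (j, i)) (cnj (wal (j, i))) u v j i)
    = (u (j, j))\<^sup>2 * u (i, i) * v (i, i) + (u (i, i))\<^sup>2 * u (j, j) * v (j, j) + word_off u v i j + word_off u v j i"
proof -
  define c where "c = complex_of_real (1 / sqrt 2)"
  have c2: "c * c = 1 / 2" by (simp add: c_def flip: of_real_mult)
  have c2': "c * (c * u) = u / 2" for u using c2 by (simp flip: mult.assoc)
  have i2: "\<i> * (\<i> * u) = - u" for u by (simp flip: mult.assoc)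
  have cc: "cnj c = c" by (simp add: c_def)
  define A B X Y P Q R S where "A = u (i, i)" and "B = u (j, j)" and "X = u (i, j)" and "Y = u (j, i)"
    and "P = v (i, i)" and "Q = v (j, j)" and "R = v (i, j)" and "S = v (j, i)"
  show ?thesis
    unfolding word4_def word_off_def Let_def wal_simps(2,3)[OF ij] c_def[symmetric]
    unfolding A_def[symmetric] B_def[symmetric] X_def[symmetric] Y_def[symmetric]
      P_def[symmetric] Q_def[symmetric] R_def[symmetric] S_def[symmetric]
    by (simp add: cc algebra_simps c2' i2 power2_eq_square power3_eq_cube)
qed

lemma sum_wE_4:
  fixes u v :: "nat \<times> nat \<Rightarrow> complex"
  shows "(\<Sum>i<N. \<Sum>j<N. word4 (wal (i, j)) (cnj (wal (i, j))) u v i j)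
    = (\<Sum>i<N. \<Sum>j<N. (u (j, j))\<^sup>2 * u (i, i) * v (i, i)) / 2 + ((\<Sum>i<N. \<Sum>j<N. word_off u v i j) / 2 - (\<Sum>i<N. u (i, i) ^ 3 * v (i, i)))"
proof -
  \<comment> \<open>For j = i the first two terms give u^3 v / 2 + 3 u^3 v / 2 = 2 u^3 v, whereas
    the true summand is u^3 v; the last term corrects this.\<close>
  let ?h = "\<lambda>i j. (u (j, j))\<^sup>2 * u (i, i) * v (i, i) / 2 + (word_off u v i j / 2 - (if j = i then u (i, i) ^ 3 * v (i, i) else 0))"
  have "(\<Sum>i<N. \<Sum>j<N. word4 (wal (i, j)) (cnj (wal (i, j))) u v i j) = (\<Sum>i<N. \<Sum>j<N. ?h i j)"
  proof (rule sum_pairs_cong)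
    fix i j assume "i < N" "j < N" "i \<le> j"
    show "word4 (wal (i, j)) (cnj (wal (i, j))) u v i j + word4 (wal (j, i)) (cnj (wal (j, i))) u v j i = ?h i j + ?h j i"
    proof (cases "i = j")
      case True
      then show ?thesis
        by (simp add: word4_def word_off_def Let_def wal_simps power2_eq_square power3_eq_cube)
    next
      case False
      with \<open>i \<le> j\<close> have ij: "i < j" by simp
      have "word4 (wal (i, j)) (cnj (wal (i, j))) u v i j + word4 (wal (j, i)) (cnj (wal (j, i))) u v j i
        = ((u (j, j))\<^sup>2 * u (i, i) * v (i, i) + (u (i, i))\<^sup>2 * u (j, j) * v (j, j) + word_off u v i j + word_off u v j i) / 2"
        unfolding word4_sym[OF ij, of u v, symmetric] by simp
      then show ?thesis using False by (simp add: add_divide_distrib)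
    qed
  qed
  then show ?thesis by (simp add: sum.distrib sum_subtractf sum_divide_distrib)
qed

text \<open>By the parallelogram identity the coordinates are isometric for the Frobenius norm, so
  the squared length of a gradient in them is the \<open>fro2\<close> of a matrix.\<close>

lemma sum_wE_sq:
  fixes h :: "nat \<times> nat \<Rightarrow> complex"
  shows "(\<Sum>i<N. \<Sum>j<N. (cmod (wal (i, j) * h (j, i) + cnj (wal (i, j)) * h (i, j)))\<^sup>2) = (\<Sum>i<N. \<Sum>j<N. (cmod (h (i, j)))\<^sup>2)"
proof (rule sum_pairs_cong)
  fix i j assume "i < N" "j < N" "i \<le> j"
  show "(cmod (wal (i, j) * h (j, i) + cnj (wal (i, j)) * h (i, j)))\<^sup>2 + (cmod (wal (j, i) * h (i, j) + cnj (wal (j, i)) * h (j, i)))\<^sup>2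
     = (cmod (h (i, j)))\<^sup>2 + (cmod (h (j, i)))\<^sup>2"
  proof (cases "i = j")
    case True
    then show ?thesis by (simp add: wal_simps)
  next
    case False
    with \<open>i \<le> j\<close> have ij: "i < j" by simp
    define c where "c = 1 / sqrt 2"
    have c2: "c\<^sup>2 = 1 / 2" by (simp add: c_def power_divide)
    have n: "(cmod (complex_of_real c * u))\<^sup>2 = (cmod u)\<^sup>2 / 2" "(cmod (\<i> * complex_of_real c * u))\<^sup>2 = (cmod u)\<^sup>2 / 2" for u
      by (simp_all add: norm_mult power_mult_distrib c2)
    have e: "wal (i, j) * h (j, i) + cnj (wal (i, j)) * h (i, j) = complex_of_real c * (h (j, i) + h (i, j))"
      "wal (j, i) * h (i, j) + cnj (wal (j, i)) * h (j, i) = \<i> * complex_of_real c * (h (j, i) - h (i, j))"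
      unfolding wal_simps(2,3)[OF ij] by (simp_all add: c_def algebra_simps)
    have "(cmod (h (j, i) + h (i, j)))\<^sup>2 + (cmod (h (j, i) - h (i, j)))\<^sup>2 = 2 * ((cmod (h (i, j)))\<^sup>2 + (cmod (h (j, i)))\<^sup>2)"
      unfolding cmod_power2 by (simp add: power2_eq_square algebra_simps)
    then show ?thesis unfolding e n by simp
  qed
qed

section \<open>The deformed Wigner matrix\<close>

text \<open>All bounds below are polynomial in \<open>t\<close>, which dominates both \<open>1\<close> and \<open>1 / Im z\<close>.\<close>
locale deformed =
  fixes \<mu> :: "real measure" and \<sigma> Cp t :: real and N :: nat and A :: "complex mat" and z :: complex
  assumes rd: "real_distribution \<mu>" and sym: "distr \<mu> borel uminus = \<mu>"
    and m2: "(LINT x|\<mu>. x\<^sup>2) = \<sigma>\<^sup>2" and i6: "integrable \<mu> (\<lambda>x. x ^ 6)"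
    and pc: "poincare_const \<mu> Cp" and \<sigma>: "\<sigma> > 0" and N: "N \<ge> 1" and A: "A \<in> herm_mats N"
    and z: "Im z > 0" and t: "t \<ge> 1" "1 / Im z \<le> t"
begin

definition "I = {..<N} \<times> {..<N}"
definition "P = PiM I (\<lambda>_. \<mu>)"
definition "h = 1 / sqrt (real N)"
definition "M x = A + complex_of_real h \<cdot>\<^sub>m wX N x"
definition "E p = complex_of_real h \<cdot>\<^sub>m wE N p"
definition "G x = resolvent (M x) z"
definition "\<kappa> = (LINT x|\<mu>. x ^ 4) - 3 * (LINT x|\<mu>. x\<^sup>2)\<^sup>2"

sublocale \<mu>: real_distribution \<mu> by (rule rd)

sublocale PP: prob_space P
  unfolding P_def by (rule prob_space_PiM) (rule \<mu>.prob_space_axioms)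

lemma h: "h > 0" "h \<le> 1" "h * h = 1 / N" "h ^ 6 = 1 / real N ^ 3"
proof -
  show "h > 0" "h \<le> 1" using N by (auto simp: h_def)
  show hh: "h * h = 1 / N" using N by (simp add: h_def)
  have "h ^ 6 = (h * h) ^ 3" by (simp add: power_mult_distrib flip: power_add)
  then show "h ^ 6 = 1 / real N ^ 3" unfolding hh by (simp add: power_divide)
qed

lemma finite_I: "finite I" by (simp add: I_def)

lemma t0: "t > 0" using t by simp

lemma Im_z_t: "1 / (Im z)\<^sup>2 \<le> t\<^sup>2"
  using power_mono[OF t(2), of 2] z by (simp add: power_divide)

lemma M_herm: "M x \<in> herm_mats N"
proof -
  have "M x = mat_line A (wX N x) h" by (simp add: M_def mat_line_def)
  then show ?thesis using A wX_herm by simp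
qed

lemma E_herm: "E p \<in> herm_mats N"
proof -
  have "E p = mat_line (0\<^sub>m N N) (wE N p) h"
    by (rule eq_matI) (auto simp: E_def mat_line_def wE_def)
  moreover have "0\<^sub>m N N \<in> herm_mats N" by (simp add: herm_mats_iff)
  ultimately show ?thesis using wE_herm by simp
qed

lemma carrier [simp]: "M x \<in> carrier_mat N N" "E p \<in> carrier_mat N N" "A \<in> carrier_mat N N"
  using M_herm E_herm A by (auto intro: herm_mats_carrier)

lemma G_carrier [simp]: "G x \<in> carrier_mat N N"
  unfolding G_def by (rule resolvent_carrier[OF M_herm]) (use z in simp)

text \<open>M is affine in each coordinate; basing the line at \<open>x(p := 0)\<close> makes its
  parameter the coordinate itself.\<close>

lemma M_upd: "M (x(p := s)) = mat_line (M (x(p := 0))) (E p) s"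
proof (rule eq_matI)
  fix i j assume "i < dim_row (mat_line (M (x(p := 0))) (E p) s)" "j < dim_col (mat_line (M (x(p := 0))) (E p) s)"
  then have ij: "i < N" "j < N" by (auto simp: mat_line_def carrier_matD[OF carrier(2)])
  have e: "M y $$ (i, j) = A $$ (i, j) + h * (wal (i, j) * y (i, j) + cnj (wal (j, i)) * y (j, i))" for y
    using ij by (simp add: M_def wX_entry carrier_matD[OF carrier(3)] carrier_matD[OF wX_carrier])
  have e2: "E p $$ (i, j) = h * ((if (i, j) = p then wal p else 0) + (if (j, i) = p then cnj (wal p) else 0))"
    using ij by (simp add: E_def wE_entry carrier_matD[OF wE_carrier])
  show "M (x(p := s)) $$ (i, j) = mat_line (M (x(p := 0))) (E p) s $$ (i, j)"
    unfolding mat_line_entry[OF carrier(2) ij carrier(1)] e e2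
    by (auto simp: algebra_simps)
qed (auto simp: mat_line_def carrier_matD[OF carrier(1)] carrier_matD[OF carrier(2)])

lemma G_upd: "G (x(p := s)) = line_res (M (x(p := 0))) (E p) z s"
  using arg_cong[OF M_upd[of x p s], of "\<lambda>m. resolvent m z"]
  by (simp only: G_def line_res_def[OF M_herm E_herm z])

lemma G_measurable: "i < N \<Longrightarrow> j < N \<Longrightarrow> (\<lambda>x. G x $$ (i, j)) \<in> borel_measurable P"
  unfolding G_def
proof (rule borel_measurable_resolvent[OF M_herm])
  fix i j assume ij: "i < N" "j < N"
  have [measurable]: "(\<lambda>x. x (a, b)) \<in> borel_measurable P" if "a < N" "b < N" for a b
  proof -
    have "(\<lambda>x. x (a, b)) \<in> measurable P \<mu>"
      unfolding P_def using that by (intro measurable_component_singleton) (simp add: I_def)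
    then show ?thesis by (simp cong: measurable_cong_sets add: \<mu>.events_eq_borel)
  qed
  have "(\<lambda>x. A $$ (i, j) + h * (wal (i, j) * complex_of_real (x (i, j)) + cnj (wal (j, i)) * complex_of_real (x (j, i)))) \<in> borel_measurable P"
    using ij by measurable
  then show "(\<lambda>x. M x $$ (i, j)) \<in> borel_measurable P"
    using ij by (simp add: M_def wX_entry carrier_matD[OF carrier(3)] carrier_matD[OF wX_carrier])
qed (use z in auto)

lemma G_entry: "i < N \<Longrightarrow> j < N \<Longrightarrow> cmod (G x $$ (i, j)) \<le> t"
  using resolvent_entry[OF M_herm z, of i j x] t(2) by (simp add: G_def)

text \<open>Works with the norm of a column of C; summing over its entries would lose a power of
  N.\<close>

lemma G_mult_entry:
  assumes "C \<in> carrier_mat N N" "i < N" "b < N" "c \<ge> 0" "(\<Sum>a<N. (cmod (C $$ (a, b)))\<^sup>2) \<le> c\<^sup>2"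
  shows "cmod ((G x * C) $$ (i, b)) \<le> t * c"
proof -
  have "cmod ((G x * C) $$ (i, b)) \<le> sqrt (\<Sum>a<N. (cmod (C $$ (a, b)))\<^sup>2) / Im z"
    unfolding G_def by (rule resolvent_mult_entry[OF M_herm z assms(1,3,2)])
  also have "\<dots> \<le> sqrt (c\<^sup>2) * (1 / Im z)"
    using divide_right_mono[OF real_sqrt_le_mono[OF assms(5)], of "Im z"] z by simp
  also have "\<dots> \<le> c * t" using assms(4) mult_left_mono[OF t(2) assms(4)] by simp
  finally show ?thesis by (simp add: mult.commute)
qed

section \<open>Derivatives of the resolvent in one coordinate\<close>

abbreviation "T p k x \<equiv> res_pow (G x) (E p) k"

lemma T_carrier: "T p k x \<in> carrier_mat N N" by simp

lemma E_sandwich: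
  assumes "U \<in> carrier_mat N N" "Y \<in> carrier_mat N N" "i < N" "j < N" "s < N" "u < N"
  shows "(U * E (i, j) * Y) $$ (s, u) = h * (wal (i, j) * (U $$ (s, i) * Y $$ (j, u)) + cnj (wal (i, j)) * (U $$ (s, j) * Y $$ (i, u)))"
proof -
  have "U * E (i, j) * Y = complex_of_real h \<cdot>\<^sub>m (U * wE N (i, j) * Y)"
    unfolding E_def mult_smult_distrib[OF assms(1) wE_carrier]
    by (rule mult_smult_assoc_mat[of _ N N _ N]) (use assms in \<open>auto intro!: mult_carrier_mat[of _ N N _ N]\<close>)
  then show ?thesis
    using wE_sandwich[OF assms] assms by (simp add: carrier_matD[OF assms(1)] carrier_matD[OF assms(2)])
qed

lemma T_Suc:
  assumes "i < N" "j < N" "s < N" "u < N"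
  shows "T (i, j) (Suc k) x $$ (s, u) = h * (wal (i, j) * (T (i, j) k x $$ (s, i) * G x $$ (j, u)) + cnj (wal (i, j)) * (T (i, j) k x $$ (s, j) * G x $$ (i, u)))"
  unfolding res_pow.simps by (rule E_sandwich[OF T_carrier G_carrier assms])

lemma T_Suc_mult:
  assumes "C \<in> carrier_mat N N" "i < N" "j < N" "s < N" "u < N"
  shows "(T (i, j) (Suc k) x * C) $$ (s, u)
    = h * (wal (i, j) * (T (i, j) k x $$ (s, i) * (G x * C) $$ (j, u)) + cnj (wal (i, j)) * (T (i, j) k x $$ (s, j) * (G x * C) $$ (i, u)))"
proof -
  have "T (i, j) (Suc k) x * C = T (i, j) k x * E (i, j) * (G x * C)"
    unfolding res_pow.simps
    by (rule assoc_mult_mat[of _ N N _ N _ N]) (use assms(1) in \<open>auto intro!: mult_carrier_mat[of _ N N _ N]\<close>)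
  then show ?thesis
    by (simp only: E_sandwich[OF T_carrier mult_carrier_mat[OF G_carrier assms(1)] assms(2-5)])
qed

lemma h_comb_bound:
  assumes "cmod a \<le> 1" "cmod b \<le> 1" "cmod p \<le> q" "cmod p' \<le> q" "cmod r \<le> w" "cmod r' \<le> w"
  shows "cmod (complex_of_real h * (a * (p * r) + b * (p' * r'))) \<le> q * (2 * h * w)"
proof -
  have nn: "q \<ge> 0" "w \<ge> 0" using assms norm_ge_zero order_trans by blast+
  have "cmod (a * (p * r) + b * (p' * r')) \<le> cmod a * (cmod p * cmod r) + cmod b * (cmod p' * cmod r')"
    by (rule order_trans[OF norm_triangle_ineq]) (simp add: norm_mult)
  also have "\<dots> \<le> 1 * (q * w) + 1 * (q * w)"
    using assms nn by (intro add_mono mult_mono) auto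
  finally have "h * cmod (a * (p * r) + b * (p' * r')) \<le> h * (2 * (q * w))"
    using h(1) by (intro mult_left_mono) auto
  then show ?thesis using h(1) by (simp add: norm_mult mult_ac)
qed

text \<open>Each factor E contributes h = N^(-1/2), two terms, and one more resolvent entry bounded
  by t.\<close>

lemma T_bound:
  assumes "i < N" "j < N" "s < N" "u < N"
  shows "cmod (T (i, j) k x $$ (s, u)) \<le> t * (2 * h * t) ^ k"
  using assms(3,4)
proof (induction k arbitrary: s u)
  case 0
  then show ?case by (simp add: G_entry)
next
  case (Suc k)
  have "cmod (T (i, j) (Suc k) x $$ (s, u)) \<le> (t * (2 * h * t) ^ k) * (2 * h * t)"
    unfolding T_Suc[OF assms(1,2) Suc.prems]
    by (rule h_comb_bound) (use Suc assms wal_norm G_entry in auto)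
  then show ?case by (simp add: mult_ac)
qed

text \<open>The k-th derivative in coordinate p of Tr (C E G), with E = \<open>wE N p\<close> not
  yet scaled by h. The cumulant expansion is applied to the product of \<open>x p\<close> and this
  function for k = 0.\<close>

definition "\<Phi> C p k x = fact k * mat_trace ((C * wE N p) * T p k x)"

lemma \<Phi>_eq:
  assumes C: "C \<in> carrier_mat N N" and ij: "i < N" "j < N"
  shows "\<Phi> C (i, j) k x = fact k * (wal (i, j) * (T (i, j) k x * C) $$ (j, i) + cnj (wal (i, j)) * (T (i, j) k x * C) $$ (i, j))"
proof -
  have "mat_trace ((C * wE N (i, j)) * T (i, j) k x) = mat_trace (C * (wE N (i, j) * T (i, j) k x))"
    by (subst assoc_mult_mat[of _ N N _ N _ N]) (use C in auto)
  also have "\<dots> = mat_trace ((wE N (i, j) * T (i, j) k x) * C)"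
    by (rule mat_trace_comm[of _ N N]) (use C in \<open>auto intro!: mult_carrier_mat[of _ N N _ N]\<close>)
  also have "(wE N (i, j) * T (i, j) k x) * C = wE N (i, j) * (T (i, j) k x * C)"
    by (rule assoc_mult_mat[of _ N N _ N _ N]) (use C in auto)
  also have "mat_trace \<dots> = wal (i, j) * (T (i, j) k x * C) $$ (j, i) + cnj (wal (i, j)) * (T (i, j) k x * C) $$ (i, j)"
    by (rule wE_trace[OF _ ij]) (use C in \<open>auto intro!: mult_carrier_mat[of _ N N _ N]\<close>)
  finally show ?thesis by (simp add: \<Phi>_def)
qed

lemma T_entry_measurable: "i < N \<Longrightarrow> j < N \<Longrightarrow> s < N \<Longrightarrow> u < N \<Longrightarrow> (\<lambda>x. T (i, j) k x $$ (s, u)) \<in> borel_measurable P"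
proof (induction k arbitrary: s u)
  case 0
  then show ?case by (simp add: G_measurable)
next
  case (Suc k)
  show ?case
    unfolding T_Suc[OF Suc.prems]
    by (intro borel_measurable_times borel_measurable_add borel_measurable_const Suc.IH G_measurable Suc.prems)
qed

lemma trace_measurable:
  fixes D :: "complex mat" and H :: "(nat \<times> nat \<Rightarrow> real) \<Rightarrow> complex mat"
  assumes "D \<in> carrier_mat N N" "\<And>x. H x \<in> carrier_mat N N" "\<And>a b. a < N \<Longrightarrow> b < N \<Longrightarrow> (\<lambda>x. H x $$ (a, b)) \<in> borel_measurable P"
  shows "(\<lambda>x. mat_trace (D * H x)) \<in> borel_measurable P"
  unfolding mat_trace_mult[OF assms(1,2)]
proof (rule borel_measurable_sum, rule borel_measurable_sum)
  fix i k assume "i \<in> {..<N}" "k \<in> {..<N}"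
  then have "(\<lambda>x. H x $$ (k, i)) \<in> borel_measurable P" by (intro assms(3)) auto
  then show "(\<lambda>x. D $$ (i, k) * H x $$ (k, i)) \<in> borel_measurable P" by measurable
qed

lemma trace_bound:
  assumes D: "D \<in> carrier_mat N N" and H: "H \<in> carrier_mat N N" and b: "\<And>a b. a < N \<Longrightarrow> b < N \<Longrightarrow> cmod (H $$ (a, b)) \<le> c"
  shows "cmod (mat_trace (D * H)) \<le> (\<Sum>i<N. \<Sum>j<N. cmod (D $$ (i, j))) * c"
proof -
  have "cmod (mat_trace (D * H)) \<le> (\<Sum>i<N. \<Sum>j<N. cmod (D $$ (i, j) * H $$ (j, i)))"
    unfolding mat_trace_mult[OF D H] by (intro order_trans[OF norm_sum] sum_mono norm_sum)
  also have "\<dots> \<le> (\<Sum>i<N. \<Sum>j<N. cmod (D $$ (i, j)) * c)"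
    unfolding norm_mult by (intro sum_mono mult_left_mono b) auto
  finally show ?thesis by (simp add: sum_distrib_right)
qed

lemma \<Phi>_deriv:
  assumes C: "C \<in> carrier_mat N N"
  shows "((\<lambda>s. \<Phi> C p k (x(p := s))) has_vector_derivative \<Phi> C p (Suc k) (x(p := s))) (at s)"
proof -
  have CE: "C * wE N p \<in> carrier_mat N N" using C by simp
  have "((\<lambda>s. fact k * mat_trace ((C * wE N p) * T p k (x(p := s)))) has_vector_derivative
     fact k * (of_nat (Suc k) * mat_trace ((C * wE N p) * T p (Suc k) (x(p := s))))) (at s)"
    unfolding G_upd by (rule has_vector_derivative_mult_right[OF trace_res_pow_deriv[OF M_herm E_herm z CE]])
  then show ?thesis by (simp add: \<Phi>_def mult_ac del: res_pow.simps)
qed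

lemma \<Phi>_measurable:
  assumes C: "C \<in> carrier_mat N N" and p: "p \<in> I"
  shows "\<Phi> C p k \<in> borel_measurable P"
proof -
  obtain i j where ij: "p = (i, j)" "i < N" "j < N" using p by (auto simp: I_def)
  have "(\<lambda>x. fact k * mat_trace ((C * wE N p) * T p k x)) \<in> borel_measurable P"
    by (intro borel_measurable_times borel_measurable_const trace_measurable T_carrier)
      (use C ij T_entry_measurable in auto)
  then show ?thesis by (simp add: \<Phi>_def[abs_def])
qed

text \<open>A crude bound that serves integrability. The fifth derivative, which enters the error,
  is estimated by column norms in the next lemma.\<close>

lemma \<Phi>_bound:
  assumes C: "C \<in> carrier_mat N N" and p: "p \<in> I"
  shows "cmod (\<Phi> C p k x) \<le> fact k * ((\<Sum>i<N. \<Sum>j<N. cmod ((C * wE N p) $$ (i, j))) * (t * (2 * h * t) ^ k))"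
proof -
  obtain i j where ij: "p = (i, j)" "i < N" "j < N" using p by (auto simp: I_def)
  have "cmod (mat_trace ((C * wE N p) * T p k x)) \<le> (\<Sum>i<N. \<Sum>j<N. cmod ((C * wE N p) $$ (i, j))) * (t * (2 * h * t) ^ k)"
    by (rule trace_bound) (use C ij T_bound in auto)
  then show ?thesis by (simp add: \<Phi>_def norm_mult)
qed

text \<open>Detaching the last factor leaves an entry of \<open>T\<close> times an entry of G C,
  controlled by the column bound \<open>c\<close>. Only columns i and j occur, so the sum over all
  coordinates costs 2N times the sum of \<open>c\<close>.\<close>

lemma \<Phi>_5_bound:
  assumes C: "C \<in> carrier_mat N N" and ij: "i < N" "j < N"
    and c: "\<And>b. b < N \<Longrightarrow> c b \<ge> 0" "\<And>b. b < N \<Longrightarrow> (\<Sum>a<N. (cmod (C $$ (a, b)))\<^sup>2) \<le> (c b)\<^sup>2"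
  shows "cmod (\<Phi> C (i, j) 5 x) \<le> 120 * (t * (2 * h * t) ^ 5 * (c i + c j))"
proof -
  have Z: "cmod ((T (i, j) (Suc 4) x * C) $$ (s, u)) \<le> t * (2 * h * t) ^ 5 * c u" if su: "s < N" "u < N" for s u
  proof -
    have "cmod ((T (i, j) (Suc 4) x * C) $$ (s, u)) \<le> (t * (2 * h * t) ^ 4) * (2 * h * (t * c u))"
      unfolding T_Suc_mult[OF C ij su]
      by (rule h_comb_bound) (use wal_norm T_bound[OF ij su(1)] ij su c C G_mult_entry in auto)
    then show ?thesis by (simp add: mult_ac eval_nat_numeral)
  qed
  have "cmod (\<Phi> C (i, j) 5 x) = 120 * cmod (wal (i, j) * (T (i, j) 5 x * C) $$ (j, i) + cnj (wal (i, j)) * (T (i, j) 5 x * C) $$ (i, j))"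
    unfolding \<Phi>_eq[OF C ij] norm_mult by (simp add: fact_numeral)
  also have "\<dots> \<le> 120 * (t * (2 * h * t) ^ 5 * c i + t * (2 * h * t) ^ 5 * c j)"
  proof (rule mult_left_mono)
    have "cmod (wal (i, j) * (T (i, j) 5 x * C) $$ (j, i) + cnj (wal (i, j)) * (T (i, j) 5 x * C) $$ (i, j))
      \<le> cmod (wal (i, j)) * cmod ((T (i, j) 5 x * C) $$ (j, i)) + cmod (wal (i, j)) * cmod ((T (i, j) 5 x * C) $$ (i, j))"
      by (rule order_trans[OF norm_triangle_ineq]) (simp add: norm_mult)
    also have "\<dots> \<le> 1 * (t * (2 * h * t) ^ 5 * c i) + 1 * (t * (2 * h * t) ^ 5 * c j)"
      using Z[OF ij(2,1)] Z[OF ij] wal_norm[of "(i, j)"] c(1)[OF ij(1)] c(1)[OF ij(2)] t0 h(1)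
      by (intro add_mono mult_mono) (auto simp: numeral_eq_Suc)
    finally show "cmod (wal (i, j) * (T (i, j) 5 x * C) $$ (j, i) + cnj (wal (i, j)) * (T (i, j) 5 x * C) $$ (i, j))
      \<le> t * (2 * h * t) ^ 5 * c i + t * (2 * h * t) ^ 5 * c j" by simp
  qed simp
  finally show ?thesis by (simp add: distrib_left)
qed

text \<open>\<open>S2\<close> is Tr G Tr (G C), the sum of the first derivatives up to h;
  \<open>S4\<close> is the sum of the third derivatives divided by 6 h^3.\<close>

definition "S2 C x = (\<Sum>i<N. G x $$ (i, i)) * (\<Sum>i<N. (G x * C) $$ (i, i))"
definition "S4 C x = (\<Sum>i<N. \<Sum>j<N. word4 (wal (i, j)) (cnj (wal (i, j))) (\<lambda>q. G x $$ q) (\<lambda>q. (G x * C) $$ q) i j)"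

lemma sum_\<Phi>_1:
  assumes C: "C \<in> carrier_mat N N"
  shows "(\<Sum>i<N. \<Sum>j<N. \<Phi> C (i, j) 1 x) = h * S2 C x"
proof -
  have "(\<Sum>i<N. \<Sum>j<N. \<Phi> C (i, j) 1 x) = (\<Sum>i<N. \<Sum>j<N. h * (let a = wal (i, j); b = cnj (wal (i, j)) in
     a * (a * (G x $$ (j, i) * (G x * C) $$ (j, i)) + b * (G x $$ (j, j) * (G x * C) $$ (i, i)))
   + b * (a * (G x $$ (i, i) * (G x * C) $$ (j, j)) + b * (G x $$ (i, j) * (G x * C) $$ (i, j)))))"
  proof (intro sum.cong refl)
    fix i j assume "i \<in> {..<N}" "j \<in> {..<N}"
    then have ij: "i < N" "j < N" by auto
    show "\<Phi> C (i, j) 1 x = h * (let a = wal (i, j); b = cnj (wal (i, j)) in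
     a * (a * (G x $$ (j, i) * (G x * C) $$ (j, i)) + b * (G x $$ (j, j) * (G x * C) $$ (i, i)))
   + b * (a * (G x $$ (i, i) * (G x * C) $$ (j, j)) + b * (G x $$ (i, j) * (G x * C) $$ (i, j))))"
      unfolding \<Phi>_eq[OF C ij] One_nat_def T_Suc_mult[OF C ij ij(2,1)] T_Suc_mult[OF C ij ij] Let_def
      by (simp add: algebra_simps)
  qed
  also have "\<dots> = h * S2 C x"
    unfolding sum_distrib_left[symmetric] S2_def by (subst sum_wE_2) simp
  finally show ?thesis .
qed

lemma sum_\<Phi>_3:
  assumes C: "C \<in> carrier_mat N N"
  shows "(\<Sum>i<N. \<Sum>j<N. \<Phi> C (i, j) 3 x) = 6 * h ^ 3 * S4 C x"
  unfolding S4_def sum_distrib_left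
proof (intro sum.cong refl)
  fix i j assume "i \<in> {..<N}" "j \<in> {..<N}"
  then have ij: "i < N" "j < N" by auto
  have 3: "(3::nat) = Suc (Suc (Suc 0))" by simp
  show "\<Phi> C (i, j) 3 x = complex_of_real (6 * h ^ 3) * word4 (wal (i, j)) (cnj (wal (i, j))) (\<lambda>q. G x $$ q) (\<lambda>q. (G x * C) $$ q) i j"
    unfolding \<Phi>_eq[OF C ij] 3 T_Suc_mult[OF C ij ij(2,1)] T_Suc_mult[OF C ij ij] T_Suc[OF ij ij(2,1)] T_Suc[OF ij ij]
      T_Suc[OF ij ij(1,1)] T_Suc[OF ij ij(2,2)] res_pow.simps(1) word4_def Let_def
    by (simp add: algebra_simps fact_numeral power3_eq_cube)
qed

end

lemma mat_trace_add:
  "A \<in> carrier_mat n n \<Longrightarrow> B \<in> carrier_mat n n \<Longrightarrow> mat_trace (A + B) = mat_trace A + mat_trace (B :: complex mat)"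
  by (simp add: mat_trace_def sum.distrib carrier_matD)

lemma mat_trace_minus:
  "A \<in> carrier_mat n n \<Longrightarrow> B \<in> carrier_mat n n \<Longrightarrow> mat_trace (A - B) = mat_trace A - mat_trace (B :: complex mat)"
  by (simp add: mat_trace_def sum_subtractf carrier_matD)

lemma mat_trace_smult: "A \<in> carrier_mat n n \<Longrightarrow> mat_trace (a \<cdot>\<^sub>m A) = a * mat_trace (A :: complex mat)"
  by (simp add: mat_trace_def sum_distrib_left carrier_matD)

lemma fro2_sum: "B \<in> carrier_mat n m \<Longrightarrow> fro2 B = (\<Sum>i<n. \<Sum>j<m. (cmod (B $$ (i, j)))\<^sup>2)"
  by (simp add: fro2_def carrier_matD)

lemma mult_le_half_squares: "a * b \<le> (a\<^sup>2 + b\<^sup>2) / (2 :: real)"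
proof -
  have "0 \<le> (a - b)\<^sup>2" by simp
  then show ?thesis by (simp add: power2_diff)
qed

lemma integral_double_sum:
  fixes f :: "nat \<Rightarrow> nat \<Rightarrow> 'a \<Rightarrow> complex"
  assumes "\<And>i j. i < n \<Longrightarrow> j < m \<Longrightarrow> integrable M (f i j)"
  shows "(LINT x|M. (\<Sum>i<n. \<Sum>j<m. f i j x)) = (\<Sum>i<n. \<Sum>j<m. (LINT x|M. f i j x))"
    and "integrable M (\<lambda>x. \<Sum>i<n. \<Sum>j<m. f i j x)"
proof -
  show "integrable M (\<lambda>x. \<Sum>i<n. \<Sum>j<m. f i j x)"
    by (intro Bochner_Integration.integrable_sum assms) auto
  have "(LINT x|M. (\<Sum>i<n. \<Sum>j<m. f i j x)) = (\<Sum>i<n. (LINT x|M. (\<Sum>j<m. f i j x)))"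
    by (intro Bochner_Integration.integral_sum Bochner_Integration.integrable_sum assms) auto
  also have "\<dots> = (\<Sum>i<n. \<Sum>j<m. (LINT x|M. f i j x))"
    by (intro sum.cong refl Bochner_Integration.integral_sum assms) auto
  finally show "(LINT x|M. (\<Sum>i<n. \<Sum>j<m. f i j x)) = (\<Sum>i<n. \<Sum>j<m. (LINT x|M. f i j x))" .
qed

text \<open>Cauchy-Schwarz in the form of Young's inequality, which keeps square roots of variances
  out.\<close>

lemma (in prob_space) covariance_bound:
  fixes f g :: "'a \<Rightarrow> complex"
  assumes [measurable]: "f \<in> borel_measurable M" "g \<in> borel_measurable M"
    and B: "\<And>x. cmod (f x) \<le> B" "\<And>x. cmod (g x) \<le> B'" and l: "l > 0"
  shows "cmod ((LINT x|M. f x * g x) - (LINT x|M. f x) * (LINT x|M. g x))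
    \<le> (l * (LINT x|M. (cmod (f x - (LINT x|M. f x)))\<^sup>2) + (LINT x|M. (cmod (g x - (LINT x|M. g x)))\<^sup>2) / l) / 2"
proof -
  define a where "a = (LINT x|M. f x)"
  define b where "b = (LINT x|M. g x)"
  have i: "integrable M f" "integrable M g"
    using integrable_bounded[of f B] integrable_bounded[of g B'] B by auto
  have ifg: "integrable M (\<lambda>x. f x * g x)"
    by (rule integrable_bounded[where B = "B * B'"])
      (use B order_trans[OF norm_ge_zero B(1)] in \<open>auto simp: norm_mult intro!: mult_mono\<close>)
  have sq: "integrable M (\<lambda>x. (cmod (f x - a))\<^sup>2)" "integrable M (\<lambda>x. (cmod (g x - b))\<^sup>2)"
  proof -
    show "integrable M (\<lambda>x. (cmod (f x - a))\<^sup>2)"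
      by (rule integrable_bounded[where B = "(2 * B)\<^sup>2"])
        (use cmod_diff_sq_le[OF B(1) norm_integral_bounded[OF B(1)]] in \<open>auto simp: a_def\<close>)
    show "integrable M (\<lambda>x. (cmod (g x - b))\<^sup>2)"
      by (rule integrable_bounded[where B = "(2 * B')\<^sup>2"])
        (use cmod_diff_sq_le[OF B(2) norm_integral_bounded[OF B(2)]] in \<open>auto simp: b_def\<close>)
  qed
  have "(LINT x|M. (f x - a) * (g x - b)) = (LINT x|M. f x * g x - f x * b - a * g x + a * b)"
    by (simp add: algebra_simps)
  also have "\<dots> = (LINT x|M. f x * g x) - a * b"
    using i ifg by (simp add: a_def[symmetric] b_def[symmetric] prob_space)
  finally have "cmod ((LINT x|M. f x * g x) - a * b) = cmod (LINT x|M. (f x - a) * (g x - b))" by simp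
  also have "\<dots> \<le> (LINT x|M. cmod ((f x - a) * (g x - b)))" by (rule integral_norm_bound)
  also have "\<dots> \<le> (LINT x|M. (l * (cmod (f x - a))\<^sup>2 + (cmod (g x - b))\<^sup>2 / l) / 2)"
  proof (rule integral_mono')
    show "integrable M (\<lambda>x. (l * (cmod (f x - a))\<^sup>2 + (cmod (g x - b))\<^sup>2 / l) / 2)" using sq by auto
    fix x
    have "(sqrt l * cmod (f x - a)) * (cmod (g x - b) / sqrt l) \<le> ((sqrt l * cmod (f x - a))\<^sup>2 + (cmod (g x - b) / sqrt l)\<^sup>2) / 2"
      by (rule mult_le_half_squares)
    then show "cmod ((f x - a) * (g x - b)) \<le> (l * (cmod (f x - a))\<^sup>2 + (cmod (g x - b))\<^sup>2 / l) / 2"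
      using l by (simp add: norm_mult power_mult_distrib power_divide)
  qed (use l in \<open>simp add: add_nonneg_nonneg\<close>)
  also have "\<dots> = (l * (LINT x|M. (cmod (f x - a))\<^sup>2) + (LINT x|M. (cmod (g x - b))\<^sup>2) / l) / 2"
    using sq by simp
  finally show ?thesis by (simp add: a_def b_def)
qed

section \<open>Expectation and variance of linear statistics\<close>

context deformed
begin

definition "K0 = cumulant_const \<mu>"

lemma K0_nonneg: "K0 \<ge> 0"
proof -
  have "(LINT x|\<mu>. x ^ k) \<ge> 0" if "even k" for k
    using that by (intro Bochner_Integration.integral_nonneg) (auto simp: zero_le_even_power)
  from this[of 2] this[of 4] this[of 6] show ?thesis
    unfolding K0_def cumulant_const_def by (intro mult_nonneg_nonneg add_nonneg_nonneg divide_nonneg_nonneg) auto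
qed

lemma Cp_pos: "Cp > 0" using pc by (simp add: poincare_const_def)

lemma smult_wX_carrier [simp]: "complex_of_real h \<cdot>\<^sub>m wX N x \<in> carrier_mat N N" by simp

lemma mult_carrier [simp]: "U \<in> carrier_mat N N \<Longrightarrow> V \<in> carrier_mat N N \<Longrightarrow> U * V \<in> carrier_mat N N"
  by (rule mult_carrier_mat)

lemma G_mult_measurable:
  assumes C: "C \<in> carrier_mat N N" and ij: "i < N" "j < N"
  shows "(\<lambda>x. (G x * C) $$ (i, j)) \<in> borel_measurable P"
  unfolding mat_mult_entry[OF G_carrier C ij]
  by (intro borel_measurable_sum borel_measurable_times borel_measurable_const G_measurable ij) auto

lemma G_mult_bound:
  assumes C: "C \<in> carrier_mat N N" and ij: "i < N" "j < N"
  shows "cmod ((G x * C) $$ (i, j)) \<le> t * (\<Sum>k<N. cmod (C $$ (k, j)))"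
proof -
  have "cmod ((G x * C) $$ (i, j)) \<le> (\<Sum>k<N. cmod (G x $$ (i, k)) * cmod (C $$ (k, j)))"
    unfolding mat_mult_entry[OF G_carrier C ij] by (rule order_trans[OF norm_sum]) (simp add: norm_mult)
  also have "\<dots> \<le> (\<Sum>k<N. t * cmod (C $$ (k, j)))"
    by (intro sum_mono mult_right_mono G_entry ij) auto
  finally show ?thesis by (simp add: sum_distrib_left)
qed

lemma integrable_trace:
  assumes C: "C \<in> carrier_mat N N"
  shows "integrable P (\<lambda>x. mat_trace (G x * C))"
proof (rule PP.integrable_bounded[where B = "(\<Sum>i<N. \<Sum>j<N. cmod (C $$ (i, j))) * t"])
  have e: "mat_trace (G x * C) = mat_trace (C * G x)" for x by (rule mat_trace_comm[OF G_carrier C])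
  show "(\<lambda>x. mat_trace (G x * C)) \<in> borel_measurable P"
    unfolding e by (rule trace_measurable[OF C G_carrier G_measurable])
  show "norm (mat_trace (G x * C)) \<le> (\<Sum>i<N. \<Sum>j<N. cmod (C $$ (i, j))) * t" for x
    unfolding e by (rule trace_bound[OF C G_carrier G_entry])
qed

text \<open>The cumulant expansion summed over N^2 coordinates. With the outer h, the second
  cumulant carries h^2 = 1 / N and the fourth carries (\<kappa> / 6) 6 h^4 = \<kappa> / N^2. The
  remainder has h^6 = N^(-3) against 2N times the sum of \<open>c\<close>; 7680 = 120 * 2^5 *
  2.\<close>

lemma trace_expectation:
  assumes C: "C \<in> carrier_mat N N"
    and c: "\<And>b. b < N \<Longrightarrow> c b \<ge> 0" "\<And>b. b < N \<Longrightarrow> (\<Sum>a<N. (cmod (C $$ (a, b)))\<^sup>2) \<le> (c b)\<^sup>2"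
  shows "integrable P (\<lambda>x. mat_trace (complex_of_real h \<cdot>\<^sub>m wX N x * (G x * C)))"
    and "cmod ((LINT x|P. mat_trace (complex_of_real h \<cdot>\<^sub>m wX N x * (G x * C)))
      - complex_of_real (\<sigma>\<^sup>2 / N) * (LINT x|P. S2 C x) - complex_of_real (\<kappa> / (real N)\<^sup>2) * (LINT x|P. S4 C x))
     \<le> 7680 * K0 * t ^ 6 * (\<Sum>b<N. c b) / (real N)\<^sup>2"
proof -
  note [simp] = C
  have hh: "complex_of_real h \<noteq> 0" using h(1) by simp
  have tr: "mat_trace (complex_of_real h \<cdot>\<^sub>m wX N x * (G x * C)) = h * (\<Sum>i<N. \<Sum>j<N. x (i, j) * \<Phi> C (i, j) 0 x)" for x
  proof -
    have "complex_of_real h \<cdot>\<^sub>m wX N x * (G x * C) = complex_of_real h \<cdot>\<^sub>m (wX N x * (G x * C))"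
      by (rule mult_smult_assoc_mat[of _ N N _ N]) simp_all
    then have "mat_trace (complex_of_real h \<cdot>\<^sub>m wX N x * (G x * C)) = h * mat_trace (wX N x * (G x * C))"
      by (simp add: mat_trace_smult[of _ N])
    also have "mat_trace (wX N x * (G x * C)) = (\<Sum>i<N. \<Sum>j<N. x (i, j) * mat_trace (wE N (i, j) * (G x * C)))"
      by (rule wX_trace) simp
    also have "\<dots> = (\<Sum>i<N. \<Sum>j<N. x (i, j) * \<Phi> C (i, j) 0 x)"
    proof (intro sum.cong refl)
      fix i j assume "i \<in> {..<N}" "j \<in> {..<N}"
      then have ij: "i < N" "j < N" by auto
      have "mat_trace (wE N (i, j) * (G x * C)) = \<Phi> C (i, j) 0 x"
        unfolding \<Phi>_eq[OF C ij] by (subst wE_trace[OF _ ij]) simp_all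
      then show "x (i, j) * mat_trace (wE N (i, j) * (G x * C)) = x (i, j) * \<Phi> C (i, j) 0 x" by simp
    qed
    finally show ?thesis .
  qed
  \<comment> \<open>Only order 5 gets the sharp bound; the other orders just ensure
    integrability.\<close>
  define Bd where "Bd p k = (if k = 5 then 120 * (t * (2 * h * t) ^ 5 * (c (fst p) + c (snd p)))
     else fact k * ((\<Sum>i<N. \<Sum>j<N. cmod ((C * wE N p) $$ (i, j))) * (t * (2 * h * t) ^ k)))" for p k
  have Bd: "cmod (\<Phi> C p k x) \<le> Bd p k" if pI: "p \<in> I" for p k x
  proof (cases "k = 5")
    case True
    obtain i j where ij: "p = (i, j)" "i < N" "j < N" using pI by (auto simp: I_def)
    show ?thesis unfolding Bd_def True ij(1) using \<Phi>_5_bound[OF C ij(2,3) c] by simp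
  next
    case False
    then show ?thesis using \<Phi>_bound[OF C pI] by (simp add: Bd_def)
  qed
  have pI: "(i, j) \<in> I" if "i < N" "j < N" for i j using that by (simp add: I_def)
  have i0: "integrable P (\<lambda>x. complex_of_real (x p) * \<Phi> C p 0 x)"
    and ce: "cmod ((LINT x|P. complex_of_real (x p) * \<Phi> C p 0 x) - complex_of_real (LINT x|\<mu>. x\<^sup>2) * (LINT x|P. \<Phi> C p 1 x)
      - complex_of_real (((LINT x|\<mu>. x ^ 4) - 3 * (LINT x|\<mu>. x\<^sup>2)\<^sup>2) / 6) * (LINT x|P. \<Phi> C p 3 x)) \<le> cumulant_const \<mu> * Bd p 5"
    if p: "p \<in> I" for p
    unfolding P_def
    by (rule cumulant_expansion_PiM[OF rd sym i6 finite_I p, of "\<Phi> C p" "Bd p"];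
        rule \<Phi>_deriv[OF C] Bd[OF p] \<Phi>_measurable[OF C p, unfolded P_def])+
  have ik: "integrable P (\<Phi> C (i, j) k)" if "i < N" "j < N" for i j k
    by (rule PP.integrable_bounded[OF \<Phi>_measurable[OF C pI[OF that]] Bd[OF pI[OF that]]])
  show i1: "integrable P (\<lambda>x. mat_trace (complex_of_real h \<cdot>\<^sub>m wX N x * (G x * C)))"
    unfolding tr by (intro integrable_mult_right Bochner_Integration.integrable_sum i0 pI) auto
  define a where "a i j = (LINT x|P. x (i, j) * \<Phi> C (i, j) 0 x)" for i j
  define b where "b i j = complex_of_real (LINT x|\<mu>. x\<^sup>2) * (LINT x|P. \<Phi> C (i, j) 1 x) + complex_of_real (\<kappa> / 6) * (LINT x|P. \<Phi> C (i, j) 3 x)" for i j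
  have ab: "cmod (a i j - b i j) \<le> K0 * (120 * (t * (2 * h * t) ^ 5 * (c i + c j)))" if "i < N" "j < N" for i j
  proof -
    have Bd5: "Bd (i, j) 5 = 120 * (t * (2 * h * t) ^ 5 * (c i + c j))" by (simp add: Bd_def)
    show ?thesis
      using ce[OF pI[OF that]] unfolding a_def b_def K0_def \<kappa>_def Bd5 diff_diff_eq .
  qed
  have "(LINT x|P. mat_trace (complex_of_real h \<cdot>\<^sub>m wX N x * (G x * C))) = h * (\<Sum>i<N. \<Sum>j<N. a i j)"
    unfolding tr a_def integral_mult_right_zero
    by (subst integral_double_sum(1)) (use i0[OF pI] in simp_all)
  moreover have "complex_of_real (\<sigma>\<^sup>2 / N) * (LINT x|P. S2 C x) + complex_of_real (\<kappa> / (real N)\<^sup>2) * (LINT x|P. S4 C x)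
     = h * (\<Sum>i<N. \<Sum>j<N. b i j)"
  proof -
    have sw: "(\<Sum>i<N. \<Sum>j<N. (LINT x|P. \<Phi> C (i, j) k x)) = (LINT x|P. (\<Sum>i<N. \<Sum>j<N. \<Phi> C (i, j) k x))" for k
      by (rule integral_double_sum(1)[symmetric]) (rule ik)
    have "(\<Sum>i<N. \<Sum>j<N. b i j) = complex_of_real (\<sigma>\<^sup>2) * (\<Sum>i<N. \<Sum>j<N. (LINT x|P. \<Phi> C (i, j) 1 x))
       + complex_of_real (\<kappa> / 6) * (\<Sum>i<N. \<Sum>j<N. (LINT x|P. \<Phi> C (i, j) 3 x))"
      unfolding b_def m2 by (simp add: sum.distrib sum_distrib_left)
    also have "\<dots> = complex_of_real (\<sigma>\<^sup>2) * (h * (LINT x|P. S2 C x)) + complex_of_real (\<kappa> / 6) * (6 * h ^ 3 * (LINT x|P. S4 C x))"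
      unfolding sw sum_\<Phi>_1[OF C] sum_\<Phi>_3[OF C] integral_mult_right_zero by simp
    finally have "h * (\<Sum>i<N. \<Sum>j<N. b i j) = complex_of_real (\<sigma>\<^sup>2 * (h * h)) * (LINT x|P. S2 C x)
       + complex_of_real (\<kappa> * ((h * h) * (h * h))) * (LINT x|P. S4 C x)"
      by (simp add: algebra_simps power3_eq_cube)
    then show ?thesis unfolding h(3) by (simp add: power2_eq_square)
  qed
  ultimately have "cmod ((LINT x|P. mat_trace (complex_of_real h \<cdot>\<^sub>m wX N x * (G x * C)))
      - complex_of_real (\<sigma>\<^sup>2 / N) * (LINT x|P. S2 C x) - complex_of_real (\<kappa> / (real N)\<^sup>2) * (LINT x|P. S4 C x))
    = cmod (h * (\<Sum>i<N. \<Sum>j<N. a i j) - h * (\<Sum>i<N. \<Sum>j<N. b i j))"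
    by (simp only: diff_diff_eq)
  also have "\<dots> = h * cmod (\<Sum>i<N. \<Sum>j<N. a i j - b i j)"
    using h(1) by (simp add: sum_subtractf norm_mult flip: right_diff_distrib)
  also have "\<dots> \<le> h * (\<Sum>i<N. \<Sum>j<N. K0 * (120 * (t * (2 * h * t) ^ 5 * (c i + c j))))"
    using h(1) by (intro mult_left_mono order_trans[OF norm_sum] sum_mono order_trans[OF norm_sum] ab) auto
  also have "\<dots> = K0 * 120 * t * (2 * h * t) ^ 5 * h * (\<Sum>i<N. \<Sum>j<N. c i + c j)"
  proof -
    have e: "K0 * (120 * (t * (2 * h * t) ^ 5 * (c i + c j))) = (K0 * 120 * t * (2 * h * t) ^ 5) * (c i + c j)" for i j
      by (simp only: mult_ac)
    show ?thesis unfolding e sum_distrib_left[symmetric] by (simp only: mult_ac)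
  qed
  also have "(\<Sum>i<N. \<Sum>j<N. c i + c j) = 2 * real N * (\<Sum>b<N. c b)"
    by (simp add: sum.distrib flip: sum_distrib_left)
  also have "K0 * 120 * t * (2 * h * t) ^ 5 * h * (2 * real N * (\<Sum>b<N. c b)) = 7680 * K0 * t ^ 6 * (\<Sum>b<N. c b) * (h ^ 6 * real N)"
    by (simp add: power_mult_distrib eval_nat_numeral)
  also have "h ^ 6 * real N = 1 / (real N)\<^sup>2" unfolding h(4) using N by (simp add: eval_nat_numeral)
  finally show "cmod ((LINT x|P. mat_trace (complex_of_real h \<cdot>\<^sub>m wX N x * (G x * C)))
      - complex_of_real (\<sigma>\<^sup>2 / N) * (LINT x|P. S2 C x) - complex_of_real (\<kappa> / (real N)\<^sup>2) * (LINT x|P. S4 C x))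
     \<le> 7680 * K0 * t ^ 6 * (\<Sum>b<N. c b) / (real N)\<^sup>2" by simp
qed

text \<open>The partial derivatives of Tr (G C) are h Tr (\<open>wE\<close> H) with H = G C G. As
  the coordinates are isometric, their squares sum to h^2 \<open>fro2 H\<close>, at most t^4
  \<open>fro2 C\<close> / N.\<close>

lemma trace_variance:
  assumes C: "C \<in> carrier_mat N N"
  shows "(LINT x|P. (cmod (mat_trace (G x * C) - (LINT x|P. mat_trace (G x * C))))\<^sup>2) \<le> Cp * t ^ 4 * fro2 C / N"
proof -
  note [simp] = C
  define F where "F x = mat_trace (C * G x)" for x
  define D where "D p x = mat_trace (C * T p 1 x)" for p x
  define S where "S = (\<Sum>i<N. \<Sum>j<N. cmod (C $$ (i, j)))"
  have S0: "S \<ge> 0" by (simp add: S_def sum_nonneg)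
  have e: "mat_trace (G x * C) = F x" for x unfolding F_def by (rule mat_trace_comm[OF G_carrier C])
  have Fm: "F \<in> borel_measurable P"
    unfolding F_def[abs_def] by (rule trace_measurable[OF C G_carrier G_measurable])
  have Dm: "D p \<in> borel_measurable P" if pI: "p \<in> I" for p
  proof -
    obtain i j where ij: "p = (i, j)" "i < N" "j < N" using pI by (auto simp: I_def)
    show ?thesis
      unfolding D_def[abs_def] ij(1) by (rule trace_measurable[OF C T_carrier T_entry_measurable[OF ij(2,3)]])
  qed
  have FB: "cmod (F x) \<le> S * (t + 2 * h * t * t)" for x
  proof -
    have "cmod (F x) \<le> S * t" unfolding F_def S_def by (rule trace_bound[OF C G_carrier G_entry])
    also have "\<dots> \<le> S * (t + 2 * h * t * t)" using S0 h(1) t0 by (intro mult_left_mono) auto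
    finally show ?thesis .
  qed
  have DB: "cmod (D p x) \<le> S * (t + 2 * h * t * t)" if pI: "p \<in> I" for p x
  proof -
    obtain i j where ij: "p = (i, j)" "i < N" "j < N" using pI by (auto simp: I_def)
    have "cmod (D p x) \<le> S * (t * (2 * h * t) ^ 1)"
      unfolding D_def S_def ij(1) by (rule trace_bound[OF C T_carrier T_bound[OF ij(2,3)]])
    also have "\<dots> \<le> S * (t + 2 * h * t * t)" using S0 h(1) t0 by (intro mult_left_mono) auto
    finally show ?thesis .
  qed
  have FD: "((\<lambda>s. F (x(p := s))) has_vector_derivative D p (x(p := s))) (at s)" for p x s
    unfolding F_def D_def G_upd
    using trace_res_pow_deriv[OF M_herm E_herm z C, of "x(p := 0)" p 0 s] by simp
  have DC: "continuous_on UNIV (\<lambda>s. D p (x(p := s)))" for p x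
  proof (intro continuous_at_imp_continuous_on ballI)
    fix s
    show "isCont (\<lambda>s. D p (x(p := s))) s"
      unfolding D_def G_upd
      by (rule has_vector_derivative_continuous[OF trace_res_pow_deriv[OF M_herm E_herm z C]])
  qed
  have Dsum: "(\<Sum>p\<in>I. (cmod (D p x))\<^sup>2) \<le> t ^ 4 * fro2 C / N" for x
  proof -
    define H where "H = G x * (C * G x)"
    have H: "H \<in> carrier_mat N N" by (simp add: H_def)
    have De: "D (i, j) x = h * (wal (i, j) * H $$ (j, i) + cnj (wal (i, j)) * H $$ (i, j))" if ij: "i < N" "j < N" for i j
    proof -
      have "D (i, j) x = mat_trace ((C * G x) * (E (i, j) * G x))"
        unfolding D_def One_nat_def res_pow.simps by (simp add: assoc_mult_mat[of _ N N _ N _ N])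
      also have "\<dots> = mat_trace ((E (i, j) * G x) * (C * G x))"
        by (rule mat_trace_comm[of _ N N]) simp_all
      also have "(E (i, j) * G x) * (C * G x) = E (i, j) * H"
        unfolding H_def by (rule assoc_mult_mat[of _ N N _ N _ N]) simp_all
      also have "\<dots> = complex_of_real h \<cdot>\<^sub>m (wE N (i, j) * H)"
        unfolding E_def by (rule mult_smult_assoc_mat[of _ N N _ N]) (simp_all add: H)
      finally show ?thesis using H by (simp add: mat_trace_smult[of _ N] wE_trace[OF H ij])
    qed
    have "(\<Sum>p\<in>I. (cmod (D p x))\<^sup>2) = (\<Sum>i<N. \<Sum>j<N. (cmod (D (i, j) x))\<^sup>2)"
      unfolding I_def by (simp add: sum.cartesian_product)
    also have "\<dots> = (\<Sum>i<N. \<Sum>j<N. (h * h) * (cmod (wal (i, j) * H $$ (j, i) + cnj (wal (i, j)) * H $$ (i, j)))\<^sup>2)"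
      using h(1) by (intro sum.cong refl) (simp add: De norm_mult power_mult_distrib power2_eq_square)
    also have "\<dots> = (h * h) * (\<Sum>i<N. \<Sum>j<N. (cmod (wal (i, j) * H $$ (j, i) + cnj (wal (i, j)) * H $$ (i, j)))\<^sup>2)"
      by (simp add: sum_distrib_left)
    also have "(\<Sum>i<N. \<Sum>j<N. (cmod (wal (i, j) * H $$ (j, i) + cnj (wal (i, j)) * H $$ (i, j)))\<^sup>2) = fro2 H"
      unfolding fro2_sum[OF H] by (rule sum_wE_sq)
    also have "(h * h) * fro2 H \<le> (h * h) * (t ^ 4 * fro2 C)"
    proof (rule mult_left_mono)
      have "fro2 H \<le> fro2 (C * G x) / (Im z)\<^sup>2"
        unfolding H_def by (subst (1) G_def, rule fro2_resolvent_mult[OF M_herm z, where m = N]) simp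
      also have "\<dots> = fro2 (C * G x) * (1 / (Im z)\<^sup>2)" by simp
      also have "\<dots> \<le> fro2 (C * G x) * t\<^sup>2" by (intro mult_left_mono Im_z_t fro2_nonneg)
      also have "fro2 (C * G x) \<le> fro2 C / (Im z)\<^sup>2"
        unfolding G_def by (rule fro2_mult_resolvent[OF M_herm z C])
      also have "\<dots> = fro2 C * (1 / (Im z)\<^sup>2)" by simp
      also have "\<dots> \<le> fro2 C * t\<^sup>2" by (intro mult_left_mono Im_z_t fro2_nonneg)
      finally have "fro2 H \<le> (fro2 C * t\<^sup>2) * t\<^sup>2" by (simp add: mult_right_mono)
      then show "fro2 H \<le> t ^ 4 * fro2 C" by (simp add: mult_ac flip: power_add)
    qed (use h in simp)
    also have "\<dots> = t ^ 4 * fro2 C / N" unfolding h(3) by simp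
    finally show ?thesis .
  qed
  have "(LINT x|P. (cmod (F x - (LINT x|P. F x)))\<^sup>2) \<le> Cp * (\<Sum>p\<in>I. (LINT x|P. (cmod (D p x))\<^sup>2))"
    unfolding P_def
    by (rule tensor_poincare[OF rd pc finite_I Fm[unfolded P_def] Dm[unfolded P_def] FB DB FD DC]) auto
  also have "(\<Sum>p\<in>I. (LINT x|P. (cmod (D p x))\<^sup>2)) = (LINT x|P. (\<Sum>p\<in>I. (cmod (D p x))\<^sup>2))"
  proof (rule Bochner_Integration.integral_sum[symmetric])
    fix p assume p: "p \<in> I"
    show "integrable P (\<lambda>x. (cmod (D p x))\<^sup>2)"
      by (rule PP.integrable_bounded[where B = "(S * (t + 2 * h * t * t))\<^sup>2"])
        (use Dm[OF p] power_mono[OF DB[OF p] norm_ge_zero, where n = 2] in simp_all)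
  qed
  also have "\<dots> \<le> (LINT x|P. t ^ 4 * fro2 C / N)"
    by (rule integral_mono') (use Dsum t0 fro2_nonneg[of C] in simp_all)
  also have "\<dots> = t ^ 4 * fro2 C / N" by (simp add: PP.prob_space)
  finally show ?thesis
    unfolding e using Cp_pos by (simp add: mult_ac mult_left_mono)
qed

section \<open>The subordination point of the mean and the exact resolvent identity\<close>

text \<open>The expectation is over the coordinate space \<open>P\<close>;
  \<open>mean_stieltjes_deformed\<close> identifies it with the original one.\<close>

definition "gN = (LINT x|P. mat_trace (G x)) / N"
definition "w = z - (complex_of_real \<sigma>)\<^sup>2 * gN"
definition "R = resolvent A w"

lemma trace_one: "mat_trace (G x * 1\<^sub>m N) = mat_trace (G x)" by (simp add: right_mult_one_mat[OF G_carrier])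

lemma Im_gN: "Im gN \<le> 0"
proof -
  have i: "integrable P (\<lambda>x. mat_trace (G x))" using integrable_trace[OF one_carrier_mat] by (simp add: trace_one)
  have "Im (mat_trace (G x)) \<le> 0" for x
  proof -
    have "mat_trace (G x) = (\<Sum>i<N. G x $$ (i, i))" unfolding mat_trace_def carrier_matD[OF G_carrier] ..
    then show ?thesis using resolvent_trace_Im[OF M_herm z] by (auto simp: G_def Im_sum intro!: sum_nonpos)
  qed
  then have "(LINT x|P. Im (mat_trace (G x))) \<le> (LINT x|P. 0)"
    by (intro integral_mono integrable_Im i) auto
  then have "Im (LINT x|P. mat_trace (G x)) \<le> 0" using i by simp
  then show ?thesis by (simp add: gN_def divide_nonpos_nonneg)
qed

lemma Im_w: "Im z \<le> Im w" "Im w > 0" "1 / Im w \<le> t"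
proof -
  show 1: "Im z \<le> Im w" using Im_gN by (simp add: w_def mult_nonneg_nonpos flip: of_real_power)
  then show "Im w > 0" using z by linarith
  then show "1 / Im w \<le> t" using 1 z t(2) frac_le[of 1 1 "Im z" "Im w"] by linarith
qed

lemma Im_w_t: "1 / (Im w)\<^sup>2 \<le> t\<^sup>2"
  using power_mono[OF Im_w(3), of 2] Im_w(2) by (simp add: power_divide)

lemma R_carrier [simp]: "R \<in> carrier_mat N N"
  unfolding R_def by (rule resolvent_carrier[OF A]) (use Im_w in simp)

lemma R_entry: "i < N \<Longrightarrow> j < N \<Longrightarrow> cmod (R $$ (i, j)) \<le> t"
  using resolvent_entry[OF A Im_w(2), of i j] Im_w(3) by (simp add: R_def)

lemma R_col: "j < N \<Longrightarrow> (\<Sum>i<N. (cmod (R $$ (i, j)))\<^sup>2) \<le> t\<^sup>2"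
  using resolvent_col[OF A Im_w(2), of j] Im_w_t by (simp add: R_def)

lemma R_row: "i < N \<Longrightarrow> (\<Sum>j<N. (cmod (R $$ (i, j)))\<^sup>2) \<le> t\<^sup>2"
  using resolvent_row[OF A Im_w(2), of i] Im_w_t by (simp add: R_def)

lemma G_col: "j < N \<Longrightarrow> (\<Sum>i<N. (cmod (G x $$ (i, j)))\<^sup>2) \<le> t\<^sup>2"
  using resolvent_col[OF M_herm z, of j x] Im_z_t by (simp add: G_def)

lemma G_row: "i < N \<Longrightarrow> (\<Sum>j<N. (cmod (G x $$ (i, j)))\<^sup>2) \<le> t\<^sup>2"
  using resolvent_row[OF M_herm z, of i x] Im_z_t by (simp add: G_def)

text \<open>From w - A = (z - M) + X - s, with X the scaled random part and s = \<sigma>^2 g_N,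
  multiplication by R on the left and G on the right gives G = R + R X G - s R G, without
  error.\<close>

lemma trace_identity:
  assumes D: "D \<in> carrier_mat N N"
  shows "mat_trace (G x * D) = mat_trace (R * D) + mat_trace (complex_of_real h \<cdot>\<^sub>m wX N x * (G x * (D * R)))
     - (complex_of_real \<sigma>)\<^sup>2 * gN * mat_trace (G x * (D * R))"
proof -
  note [simp] = D
  define s where "s = (complex_of_real \<sigma>)\<^sup>2 * gN"
  define X where "X = complex_of_real h \<cdot>\<^sub>m wX N x"
  have X [simp]: "X \<in> carrier_mat N N" by (simp add: X_def)
  have SA [simp]: "shifted A w \<in> carrier_mat N N" and SM [simp]: "shifted (M x) z \<in> carrier_mat N N" by simp_all
  have sh: "shifted A w = shifted (M x) z + X - s \<cdot>\<^sub>m 1\<^sub>m N"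
    by (rule eq_matI) (auto simp: shifted_def M_def X_def s_def w_def carrier_matD[OF carrier(3)] carrier_matD[OF wX_carrier])
  have GM: "shifted (M x) z * G x = 1\<^sub>m N" unfolding G_def by (rule shifted_resolvent[OF M_herm]) (use z in simp)
  have RA: "R * shifted A w = 1\<^sub>m N" unfolding R_def by (rule resolvent_shifted[OF A]) (use Im_w in simp)
  have K: "shifted A w * G x = 1\<^sub>m N + X * G x - s \<cdot>\<^sub>m G x"
  proof -
    have "shifted A w * G x = (shifted (M x) z + X) * G x - (s \<cdot>\<^sub>m 1\<^sub>m N) * G x"
      unfolding sh by (rule minus_mult_distrib_mat[of _ N N _ _ N]) simp_all
    also have "(shifted (M x) z + X) * G x = 1\<^sub>m N + X * G x"
      using add_mult_distrib_mat[OF SM X G_carrier] GM by simp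
    also have "(s \<cdot>\<^sub>m 1\<^sub>m N) * G x = s \<cdot>\<^sub>m G x"
      using mult_smult_assoc_mat[OF one_carrier_mat G_carrier, of s x] by (simp add: left_mult_one_mat[OF G_carrier])
    finally show ?thesis .
  qed
  have "G x = R * (shifted A w * G x)"
    using assoc_mult_mat[OF R_carrier SA G_carrier, of x] RA by (simp add: left_mult_one_mat[OF G_carrier])
  then have "mat_trace (G x * D) = mat_trace (R * (shifted A w * G x) * D)" by simp
  also have "\<dots> = mat_trace (D * (R * (shifted A w * G x)))"
    by (rule mat_trace_comm[of _ N N]) simp_all
  also have "D * (R * (shifted A w * G x)) = (D * R) * (shifted A w * G x)"
    by (rule assoc_mult_mat[of _ N N _ N _ N, symmetric]) simp_all
  also have "\<dots> = (D * R) * (1\<^sub>m N + X * G x) - (D * R) * (s \<cdot>\<^sub>m G x)"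
    unfolding K by (rule mult_minus_distrib_mat[of _ N N _ N]) simp_all
  also have "(D * R) * (1\<^sub>m N + X * G x) = D * R + (D * R) * (X * G x)"
    by (subst mult_add_distrib_mat[of _ N N _ N]) (simp_all add: right_mult_one_mat[OF mult_carrier])
  also have "(D * R) * (s \<cdot>\<^sub>m G x) = s \<cdot>\<^sub>m ((D * R) * G x)"
    by (rule mult_smult_distrib[of _ N N _ N]) simp_all
  also have "mat_trace (D * R + (D * R) * (X * G x) - s \<cdot>\<^sub>m ((D * R) * G x))
     = mat_trace (D * R) + mat_trace ((D * R) * (X * G x)) - s * mat_trace ((D * R) * G x)"
    by (simp add: mat_trace_add[of _ N] mat_trace_minus[of _ N] mat_trace_smult[of _ N])
  also have "mat_trace (D * R) = mat_trace (R * D)" by (rule mat_trace_comm[of _ N N]) simp_all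
  also have "mat_trace ((D * R) * G x) = mat_trace (G x * (D * R))" by (rule mat_trace_comm[of _ N N]) simp_all
  also have "mat_trace ((D * R) * (X * G x)) = mat_trace ((X * G x) * (D * R))" by (rule mat_trace_comm[of _ N N]) simp_all
  also have "(X * G x) * (D * R) = X * (G x * (D * R))" by (rule assoc_mult_mat[of _ N N _ N _ N]) simp_all
  finally show ?thesis by (simp add: X_def s_def)
qed

end

lemma fro2_one: "fro2 (1\<^sub>m n) = real n"
proof -
  have "fro2 (1\<^sub>m n) = (\<Sum>j<n. \<Sum>i<n. (cmod (1\<^sub>m n $$ (i, j)))\<^sup>2)"
    unfolding fro2_sum[OF one_carrier_mat] by (rule sum.swap)
  also have "\<dots> = (\<Sum>j<n. 1)" by (intro sum.cong refl sum_delta_entry) simp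
  finally show ?thesis by simp
qed

section \<open>The quartic term and the main estimate\<close>

context deformed
begin

text \<open>Half of this is the part of \<open>S4\<close> without off-diagonal factors, up to the
  correction on the diagonal.\<close>

definition "leading C x = (\<Sum>i<N. \<Sum>j<N. (G x $$ (j, j) * G x $$ (j, j)) * (G x $$ (i, i) * (G x * C) $$ (i, i)))"

lemma fro2_G: "fro2 (G x) \<le> N * t\<^sup>2"
proof -
  have "fro2 (G x) \<le> real N / (Im z)\<^sup>2" unfolding G_def by (rule fro2_resolvent[OF M_herm z])
  also have "\<dots> \<le> N * t\<^sup>2" using mult_left_mono[OF Im_z_t, of "real N"] by simp
  finally show ?thesis .
qed

lemma fro2_G_mult: "C \<in> carrier_mat N N \<Longrightarrow> fro2 (G x * C) \<le> t\<^sup>2 * fro2 C"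
  using fro2_resolvent_mult[OF M_herm z, of C N x] mult_left_mono[OF Im_z_t fro2_nonneg, of C]
  by (simp add: G_def mult.commute)

text \<open>Two off-diagonal factors are paired by a b \<le> (a^2 + b^2) / 2 and summed with
  Frobenius or row norms, so N^2 words cost only order N when \<open>fro2 C\<close> is of that
  order. \<open>SY\<close> takes care of the diagonal entries of G C.\<close>

lemma S4_leading:
  assumes C: "C \<in> carrier_mat N N" and SY: "(\<Sum>i<N. cmod ((G x * C) $$ (i, i))) \<le> SY"
  shows "cmod (S4 C x - leading C x / 2) \<le> t\<^sup>2 * (N * t\<^sup>2 + t\<^sup>2 * fro2 C) + 2 * t ^ 3 * SY"
proof -
  define Y where "Y = G x * C"
  have Yc: "Y \<in> carrier_mat N N" using C by (simp add: Y_def)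
  define g where "g q = cmod (G x $$ q)" for q
  define y where "y q = cmod (Y $$ q)" for q
  have g: "g (i, j) \<le> t" "g (i, j) \<ge> 0" if "i < N" "j < N" for i j using G_entry[OF that] by (auto simp: g_def)
  have y0: "y q \<ge> 0" for q by (simp add: y_def)
  define o4 where "o4 i j = word_off (\<lambda>q. G x $$ q) (\<lambda>q. Y $$ q) i j" for i j
  define d4 where "d4 i = (G x $$ (i, i)) ^ 3 * Y $$ (i, i)" for i
  have e: "S4 C x - leading C x / 2 = (\<Sum>i<N. \<Sum>j<N. o4 i j) / 2 - (\<Sum>i<N. d4 i)"
    unfolding S4_def leading_def sum_wE_4 o4_def d4_def Y_def by (simp add: power2_eq_square mult.assoc)
  have o: "cmod (o4 i j) \<le> t\<^sup>2 / 2 * ((g (j, i))\<^sup>2 + (g (i, j))\<^sup>2 + 2 * (y (j, i))\<^sup>2) + t / 2 * (y (i, i) * ((g (j, i))\<^sup>2 + (g (i, j))\<^sup>2))"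
    if ij: "i < N" "j < N" for i j
  proof -
    have "cmod (o4 i j) \<le> g (j, i) ^ 3 * y (j, i) + g (j, i) * g (j, j) * g (i, j) * y (i, i) + g (j, j) * g (i, j) * g (i, i) * y (j, i)"
      unfolding o4_def word_off_def g_def y_def
      by (rule order_trans[OF norm_triangle_ineq] add_mono)+ (simp_all add: norm_mult norm_power)
    also have "g (j, i) ^ 3 * y (j, i) \<le> t\<^sup>2 * (((g (j, i))\<^sup>2 + (y (j, i))\<^sup>2) / 2)"
    proof -
      have "g (j, i) ^ 3 * y (j, i) = (g (j, i))\<^sup>2 * (g (j, i) * y (j, i))" by (simp add: power2_eq_square power3_eq_cube)
      also have "\<dots> \<le> t\<^sup>2 * (((g (j, i))\<^sup>2 + (y (j, i))\<^sup>2) / 2)"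
        using g[OF ij(2,1)] y0 by (intro mult_mono power_mono mult_le_half_squares) auto
      finally show ?thesis .
    qed
    also have "g (j, i) * g (j, j) * g (i, j) * y (i, i) \<le> t * (y (i, i) * (((g (j, i))\<^sup>2 + (g (i, j))\<^sup>2) / 2))"
    proof -
      have "g (j, i) * g (j, j) * g (i, j) * y (i, i) = g (j, j) * (y (i, i) * (g (j, i) * g (i, j)))" by (simp add: mult_ac)
      also have "\<dots> \<le> t * (y (i, i) * (((g (j, i))\<^sup>2 + (g (i, j))\<^sup>2) / 2))"
        using g ij y0 t0 by (intro mult_mono mult_le_half_squares mult_nonneg_nonneg) auto
      finally show ?thesis .
    qed
    also have "g (j, j) * g (i, j) * g (i, i) * y (j, i) \<le> t\<^sup>2 * (((g (i, j))\<^sup>2 + (y (j, i))\<^sup>2) / 2)"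
    proof -
      have "g (j, j) * g (i, j) * g (i, i) * y (j, i) = (g (j, j) * g (i, i)) * (g (i, j) * y (j, i))" by (simp add: mult_ac)
      also have "\<dots> \<le> (t * t) * (((g (i, j))\<^sup>2 + (y (j, i))\<^sup>2) / 2)"
        using g ij y0 t0 by (intro mult_mono mult_le_half_squares mult_nonneg_nonneg) auto
      finally show ?thesis by (simp add: power2_eq_square)
    qed
    finally show ?thesis by (simp add: algebra_simps add_divide_distrib)
  qed
  have d: "cmod (d4 i) \<le> t ^ 3 * y (i, i)" if "i < N" for i
    unfolding d4_def y_def norm_mult norm_power using G_entry[OF that that] by (intro mult_right_mono power_mono) auto
  have gr: "(\<Sum>j<N. (g (i, j))\<^sup>2) \<le> t\<^sup>2" "(\<Sum>j<N. (g (j, i))\<^sup>2) \<le> t\<^sup>2" if "i < N" for i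
    using G_row[OF that] G_col[OF that] by (simp_all add: g_def)
  have fG: "(\<Sum>i<N. \<Sum>j<N. (g (i, j))\<^sup>2) \<le> N * t\<^sup>2"
    using fro2_G unfolding fro2_sum[OF G_carrier] g_def .
  have fG': "(\<Sum>i<N. \<Sum>j<N. (g (j, i))\<^sup>2) \<le> N * t\<^sup>2" using fG by (subst sum.swap)
  have fY: "(\<Sum>i<N. \<Sum>j<N. (y (j, i))\<^sup>2) \<le> t\<^sup>2 * fro2 C"
    using fro2_G_mult[OF C, of x] unfolding Y_def[symmetric] fro2_sum[OF Yc] y_def by (subst sum.swap)
  have SY': "(\<Sum>i<N. y (i, i)) \<le> SY" using SY by (simp add: y_def Y_def)
  have SY0: "SY \<ge> 0" using SY' sum_nonneg[of "{..<N}" "\<lambda>i. y (i, i)"] y0 by fastforce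
  have "cmod (\<Sum>i<N. \<Sum>j<N. o4 i j)
     \<le> (\<Sum>i<N. \<Sum>j<N. t\<^sup>2 / 2 * ((g (j, i))\<^sup>2 + (g (i, j))\<^sup>2 + 2 * (y (j, i))\<^sup>2) + t / 2 * (y (i, i) * ((g (j, i))\<^sup>2 + (g (i, j))\<^sup>2)))"
    by (intro order_trans[OF norm_sum] sum_mono o) auto
  also have "\<dots> = t\<^sup>2 / 2 * ((\<Sum>i<N. \<Sum>j<N. (g (j, i))\<^sup>2) + (\<Sum>i<N. \<Sum>j<N. (g (i, j))\<^sup>2) + 2 * (\<Sum>i<N. \<Sum>j<N. (y (j, i))\<^sup>2))
      + t / 2 * (\<Sum>i<N. y (i, i) * ((\<Sum>j<N. (g (j, i))\<^sup>2) + (\<Sum>j<N. (g (i, j))\<^sup>2)))"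
    by (simp only: sum.distrib sum_distrib_left distrib_left)
  also have "\<dots> \<le> t\<^sup>2 / 2 * (N * t\<^sup>2 + N * t\<^sup>2 + 2 * (t\<^sup>2 * fro2 C)) + t / 2 * (\<Sum>i<N. y (i, i) * (t\<^sup>2 + t\<^sup>2))"
    using fG fG' fY gr y0 t0 by (intro add_mono mult_left_mono sum_mono mult_left_mono) auto
  also have "\<dots> = t\<^sup>2 * (N * t\<^sup>2 + t\<^sup>2 * fro2 C) + t ^ 3 * (\<Sum>i<N. y (i, i))"
    unfolding sum_distrib_right[symmetric] by (simp add: algebra_simps power2_eq_square power3_eq_cube)
  also have "\<dots> \<le> t\<^sup>2 * (N * t\<^sup>2 + t\<^sup>2 * fro2 C) + t ^ 3 * SY"
    using SY' t0 by (intro add_left_mono mult_left_mono) auto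
  finally have o': "cmod (\<Sum>i<N. \<Sum>j<N. o4 i j) \<le> t\<^sup>2 * (N * t\<^sup>2 + t\<^sup>2 * fro2 C) + t ^ 3 * SY" .
  have "cmod (\<Sum>i<N. d4 i) \<le> (\<Sum>i<N. t ^ 3 * y (i, i))"
    by (intro order_trans[OF norm_sum] sum_mono d) auto
  also have "\<dots> \<le> t ^ 3 * SY" unfolding sum_distrib_left[symmetric] using SY' t0 by (intro mult_left_mono) auto
  finally have d': "cmod (\<Sum>i<N. d4 i) \<le> t ^ 3 * SY" .
  have "cmod (S4 C x - leading C x / 2) \<le> cmod (\<Sum>i<N. \<Sum>j<N. o4 i j) / 2 + cmod (\<Sum>i<N. d4 i)"
    unfolding e by (rule order_trans[OF norm_triangle_ineq4]) simp
  also have "\<dots> \<le> (t\<^sup>2 * (N * t\<^sup>2 + t\<^sup>2 * fro2 C) + t ^ 3 * SY) + t ^ 3 * SY"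
    using o' d' norm_ge_zero[of "\<Sum>i<N. \<Sum>j<N. o4 i j"] by linarith
  finally show ?thesis by (simp add: algebra_simps)
qed

lemma integrable_entry_products:
  assumes C: "C \<in> carrier_mat N N"
  shows "integrable P (leading C)" "integrable P (S4 C)"
proof -
  define B where "B = (\<Sum>i<N. \<Sum>j<N. t * (\<Sum>k<N. cmod (C $$ (k, j))))"
  have Gi: "cmod (G x $$ (i, j)) \<le> t" if "i < N" "j < N" for i j x by (rule G_entry[OF that])
  have Yi: "cmod ((G x * C) $$ (i, j)) \<le> B" if "i < N" "j < N" for i j x
  proof -
    have "t * (\<Sum>k<N. cmod (C $$ (k, j))) \<le> (\<Sum>j<N. t * (\<Sum>k<N. cmod (C $$ (k, j))))"
      using that t0 by (intro member_le_sum[of j "{..<N}" "\<lambda>j. t * (\<Sum>k<N. cmod (C $$ (k, j)))"]) (auto intro!: sum_nonneg mult_nonneg_nonneg)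
    also have "\<dots> \<le> B"
      unfolding B_def using that t0
      by (intro member_le_sum[of i "{..<N}" "\<lambda>i. \<Sum>j<N. t * (\<Sum>k<N. cmod (C $$ (k, j)))"]) (auto intro!: sum_nonneg mult_nonneg_nonneg)
    finally show ?thesis using G_mult_bound[OF C that, of x] by linarith
  qed
  have B0: "B \<ge> 0" using t0 by (auto simp: B_def intro!: sum_nonneg mult_nonneg_nonneg)
  have p4: "integrable P (\<lambda>x. a x * b x * (c x * d x))"
    if "a \<in> borel_measurable P" "b \<in> borel_measurable P" "c \<in> borel_measurable P" "d \<in> borel_measurable P"
      "\<And>x. cmod (a x) \<le> t" "\<And>x. cmod (b x) \<le> t" "\<And>x. cmod (c x) \<le> t" "\<And>x. cmod (d x) \<le> B" for a b c d
  proof (rule PP.integrable_bounded[where B = "t * t * (t * B)"])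
    show "norm (a x * b x * (c x * d x)) \<le> t * t * (t * B)" for x
      unfolding norm_mult using t0 B0 that(5-8)[of x] by (intro mult_mono mult_nonneg_nonneg) auto
  qed (use that(1-4) in measurable)
  show "integrable P (leading C)"
    unfolding leading_def[abs_def]
    by (intro integral_double_sum(2) p4 G_measurable G_mult_measurable[OF C] Gi Yi)
  have S4e: "S4 C x = leading C x / 2 + ((\<Sum>i<N. \<Sum>j<N.
        (G x $$ (j, i) * G x $$ (j, i) * (G x $$ (j, i) * (G x * C) $$ (j, i))
         + G x $$ (j, i) * G x $$ (j, j) * (G x $$ (i, j) * (G x * C) $$ (i, i)))
         + G x $$ (j, j) * G x $$ (i, j) * (G x $$ (i, i) * (G x * C) $$ (j, i))) / 2
       - (\<Sum>i<N. G x $$ (i, i) * G x $$ (i, i) * (G x $$ (i, i) * (G x * C) $$ (i, i))))" for x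
    unfolding S4_def leading_def sum_wE_4 word_off_def by (simp add: power2_eq_square power3_eq_cube mult.assoc)
  show "integrable P (S4 C)"
    unfolding S4e[abs_def]
    by (intro Bochner_Integration.integrable_add Bochner_Integration.integrable_diff integrable_divide_zero \<open>integrable P (leading C)\<close>
        integral_double_sum(2) Bochner_Integration.integrable_sum p4 G_measurable G_mult_measurable[OF C] Gi Yi) auto
qed

lemma trace_GC_bound:
  assumes C: "C \<in> carrier_mat N N"
  shows "cmod (mat_trace (G x * C)) \<le> (\<Sum>i<N. \<Sum>j<N. cmod (C $$ (i, j))) * t"
  unfolding mat_trace_comm[OF G_carrier C] by (rule trace_bound[OF C G_carrier G_entry])

text \<open>E Tr G = N g_N, so the difference is a covariance of two linear statistics, and both
  variances come from the Poincare inequality.\<close>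

lemma covariance_trace:
  assumes C: "C \<in> carrier_mat N N"
  shows "cmod ((LINT x|P. S2 C x) - N * gN * (LINT x|P. mat_trace (G x * C))) \<le> Cp * t ^ 4 * (1 + fro2 C / N) / 2"
proof -
  have N0: "real N > 0" using N by simp
  have S2e: "S2 C x = mat_trace (G x) * mat_trace (G x * C)" for x
    unfolding S2_def mat_trace_def carrier_matD[OF G_carrier] carrier_matD[OF mult_carrier[OF G_carrier C]] ..
  have m: "(\<lambda>x. mat_trace (G x * D)) \<in> borel_measurable P" if "D \<in> carrier_mat N N" for D
    using integrable_trace[OF that] by (rule borel_measurable_integrable)
  have "cmod ((LINT x|P. S2 C x) - (LINT x|P. mat_trace (G x)) * (LINT x|P. mat_trace (G x * C)))
    \<le> (1 * (LINT x|P. (cmod (mat_trace (G x) - (LINT x|P. mat_trace (G x))))\<^sup>2)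
     + (LINT x|P. (cmod (mat_trace (G x * C) - (LINT x|P. mat_trace (G x * C))))\<^sup>2) / 1) / 2"
    unfolding S2e
    by (rule PP.covariance_bound[OF m[OF one_carrier_mat, unfolded trace_one] m[OF C]
          trace_GC_bound[OF one_carrier_mat, unfolded trace_one] trace_GC_bound[OF C]]) simp
  also have "\<dots> \<le> (1 * (Cp * t ^ 4) + (Cp * t ^ 4 * fro2 C / N) / 1) / 2"
    using trace_variance[OF C] trace_variance[OF one_carrier_mat, unfolded trace_one fro2_one] N0
    by (intro divide_right_mono add_mono mult_left_mono) (auto simp: divide_right_mono)
  also have "\<dots> = Cp * t ^ 4 * (1 + fro2 C / N) / 2" by (simp add: algebra_simps)
  finally show ?thesis using N0 by (simp add: gN_def)
qed

text \<open>The mean of - \<sigma>^2 g_N Tr (G C) cancels the product of means in \<sigma>^2 E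
  \<open>S2\<close> / N, leaving a covariance. The bounds \<open>c\<close> and \<open>SY\<close> are
  parameters so that rank-one D and D = 1 are both covered.\<close>

lemma master_bound:
  assumes D: "D \<in> carrier_mat N N" and C_def: "C = D * R"
    and c: "\<And>b. b < N \<Longrightarrow> c b \<ge> 0" "\<And>b. b < N \<Longrightarrow> (\<Sum>a<N. (cmod (C $$ (a, b)))\<^sup>2) \<le> (c b)\<^sup>2"
    and SY: "\<And>x. (\<Sum>i<N. cmod ((G x * C) $$ (i, i))) \<le> SY"
  shows "cmod ((LINT x|P. mat_trace (G x * D)) - mat_trace (R * D) - complex_of_real (\<kappa> / (2 * (real N)\<^sup>2)) * (LINT x|P. leading C x))
    \<le> \<sigma>\<^sup>2 / N * (Cp * t ^ 4 * (1 + fro2 C / N) / 2)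
      + \<bar>\<kappa>\<bar> / (real N)\<^sup>2 * (t\<^sup>2 * (N * t\<^sup>2 + t\<^sup>2 * fro2 C) + 2 * t ^ 3 * SY)
      + 7680 * K0 * t ^ 6 * (\<Sum>b<N. c b) / (real N)\<^sup>2"
proof -
  have N0: "real N > 0" using N by simp
  have C: "C \<in> carrier_mat N N" unfolding C_def using D by simp
  define e2 where "e2 = (LINT x|P. S2 C x)"
  define e4 where "e4 = (LINT x|P. S4 C x)"
  define em where "em = (LINT x|P. leading C x)"
  define eX where "eX = (LINT x|P. mat_trace (complex_of_real h \<cdot>\<^sub>m wX N x * (G x * C)))"
  define eC where "eC = (LINT x|P. mat_trace (G x * C))"
  have "(LINT x|P. mat_trace (G x * D)) = (LINT x|P. mat_trace (R * D) + mat_trace (complex_of_real h \<cdot>\<^sub>m wX N x * (G x * C))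
     - (complex_of_real \<sigma>)\<^sup>2 * gN * mat_trace (G x * C))"
    unfolding trace_identity[OF D] C_def ..
  also have "\<dots> = mat_trace (R * D) + eX - (complex_of_real \<sigma>)\<^sup>2 * gN * eC"
    using trace_expectation(1)[OF C c] integrable_trace[OF C]
    by (simp add: eX_def eC_def PP.prob_space del: of_real_power)
  finally have E: "(LINT x|P. mat_trace (G x * D)) = mat_trace (R * D) + eX - (complex_of_real \<sigma>)\<^sup>2 * gN * eC" .
  have X: "cmod (eX - complex_of_real (\<sigma>\<^sup>2 / N) * e2 - complex_of_real (\<kappa> / (real N)\<^sup>2) * e4) \<le> 7680 * K0 * t ^ 6 * (\<Sum>b<N. c b) / (real N)\<^sup>2"
    unfolding eX_def e2_def e4_def by (rule trace_expectation(2)[OF C c])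
  have c2: "cmod (e2 - N * gN * eC) \<le> Cp * t ^ 4 * (1 + fro2 C / N) / 2"
    unfolding e2_def eC_def by (rule covariance_trace[OF C])
  have m4: "cmod (e4 - em / 2) \<le> t\<^sup>2 * (N * t\<^sup>2 + t\<^sup>2 * fro2 C) + 2 * t ^ 3 * SY"
  proof -
    have "e4 - em / 2 = (LINT x|P. S4 C x - leading C x / 2)"
      using integrable_entry_products[OF C] by (simp add: e4_def em_def)
    then show ?thesis using PP.norm_integral_bounded[OF S4_leading[OF C SY]] by simp
  qed
  have "(LINT x|P. mat_trace (G x * D)) - mat_trace (R * D) - complex_of_real (\<kappa> / (2 * (real N)\<^sup>2)) * em
     = complex_of_real (\<sigma>\<^sup>2 / N) * (e2 - N * gN * eC) + complex_of_real (\<kappa> / (real N)\<^sup>2) * (e4 - em / 2)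
       + (eX - complex_of_real (\<sigma>\<^sup>2 / N) * e2 - complex_of_real (\<kappa> / (real N)\<^sup>2) * e4)"
    unfolding E using N0 by (simp add: field_simps)
  also have "cmod \<dots> \<le> \<sigma>\<^sup>2 / N * cmod (e2 - N * gN * eC) + \<bar>\<kappa>\<bar> / (real N)\<^sup>2 * cmod (e4 - em / 2)
       + cmod (eX - complex_of_real (\<sigma>\<^sup>2 / N) * e2 - complex_of_real (\<kappa> / (real N)\<^sup>2) * e4)"
    by (rule order_trans[OF norm_triangle_ineq] add_mono)+ (simp_all add: norm_mult norm_divide norm_power)
  also have "\<dots> \<le> \<sigma>\<^sup>2 / N * (Cp * t ^ 4 * (1 + fro2 C / N) / 2)
      + \<bar>\<kappa>\<bar> / (real N)\<^sup>2 * (t\<^sup>2 * (N * t\<^sup>2 + t\<^sup>2 * fro2 C) + 2 * t ^ 3 * SY)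
      + 7680 * K0 * t ^ 6 * (\<Sum>b<N. c b) / (real N)\<^sup>2"
    using X c2 m4 by (intro add_mono mult_left_mono) auto
  finally show ?thesis unfolding em_def .
qed

end

section \<open>Approximation of the resolvent entries\<close>

context deformed
begin

definition "K1 = \<sigma>\<^sup>2 * Cp + 5 * \<bar>\<kappa>\<bar> + 7680 * K0"

lemma K1_nonneg: "K1 \<ge> 0"
  using K0_nonneg Cp_pos by (auto simp: K1_def intro!: add_nonneg_nonneg)

lemma t_power_mono: "a \<le> b \<Longrightarrow> t ^ a \<le> t ^ b"
  using t(1) by (rule power_increasing[rotated])

lemma leading_bound:
  assumes C: "C \<in> carrier_mat N N" and SY: "(\<Sum>i<N. cmod ((G x * C) $$ (i, i))) \<le> SY"
  shows "cmod (leading C x) \<le> N * t ^ 3 * SY"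
proof -
  have "cmod (leading C x) \<le> (\<Sum>i<N. \<Sum>j<N. (t * t) * (t * cmod ((G x * C) $$ (i, i))))"
    unfolding leading_def using t0
    by (intro order_trans[OF norm_sum] sum_mono) (auto simp: norm_mult intro!: mult_mono G_entry)
  also have "\<dots> = N * t ^ 3 * (\<Sum>i<N. cmod ((G x * C) $$ (i, i)))"
    by (simp add: sum_distrib_left power3_eq_cube mult_ac)
  also have "\<dots> \<le> N * t ^ 3 * SY" using SY t0 by (intro mult_left_mono) auto
  finally show ?thesis .
qed

text \<open>A common simplification for both choices of D. The exponent 8 is the largest that
  occurs; t \<ge> 1 absorbs the others.\<close>

lemma trace_error_bound:
  assumes fC: "fro2 C \<le> N * t ^ 4" and SY: "SY \<le> N * t ^ 4" "SY \<ge> 0" and c: "(\<Sum>b<N. c b) \<le> N * t\<^sup>2"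
  shows "\<sigma>\<^sup>2 / N * (Cp * t ^ 4 * (1 + fro2 C / N) / 2)
      + \<bar>\<kappa>\<bar> / (real N)\<^sup>2 * (t\<^sup>2 * (N * t\<^sup>2 + t\<^sup>2 * fro2 C) + 2 * t ^ 3 * SY)
      + 7680 * K0 * t ^ 6 * (\<Sum>b<N. c b) / (real N)\<^sup>2 \<le> (\<sigma>\<^sup>2 * Cp + 4 * \<bar>\<kappa>\<bar> + 7680 * K0) * t ^ 8 / N"
proof -
  have N0: "real N > 0" using N by simp
  have f: "fro2 C / N \<le> t ^ 4" using fC N0 by (simp add: field_simps)
  have t1: "1 \<le> t ^ 4" using t_power_mono[of 0 4] by simp
  have "Cp * t ^ 4 * (1 + fro2 C / N) / 2 \<le> Cp * t ^ 4 * (2 * t ^ 4) / 2"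
    using f t1 Cp_pos t0 by (intro divide_right_mono mult_left_mono) auto
  then have 1: "\<sigma>\<^sup>2 / N * (Cp * t ^ 4 * (1 + fro2 C / N) / 2) \<le> \<sigma>\<^sup>2 / N * (Cp * t ^ 8)"
    by (intro mult_left_mono) (auto simp: mult_ac simp flip: power_add)
  have "t\<^sup>2 * (N * t\<^sup>2 + t\<^sup>2 * fro2 C) + 2 * t ^ 3 * SY \<le> t\<^sup>2 * (N * t\<^sup>2 + t\<^sup>2 * (N * t ^ 4)) + 2 * t ^ 3 * (N * t ^ 4)"
    using fC SY t0 by (intro add_mono mult_left_mono) auto
  also have "\<dots> = N * (t ^ 4 + t ^ 8 + 2 * t ^ 7)" by (simp add: algebra_simps flip: power_add)
  also have "\<dots> \<le> N * (t ^ 8 + t ^ 8 + 2 * t ^ 8)"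
    by (intro mult_left_mono add_mono t_power_mono) auto
  finally have 2: "\<bar>\<kappa>\<bar> / (real N)\<^sup>2 * (t\<^sup>2 * (N * t\<^sup>2 + t\<^sup>2 * fro2 C) + 2 * t ^ 3 * SY) \<le> \<bar>\<kappa>\<bar> / (real N)\<^sup>2 * (N * (4 * t ^ 8))"
    by (intro mult_left_mono) auto
  have "7680 * K0 * t ^ 6 * (\<Sum>b<N. c b) \<le> 7680 * K0 * t ^ 6 * (N * t\<^sup>2)"
    using c K0_nonneg t0 by (intro mult_left_mono) auto
  then have 3: "7680 * K0 * t ^ 6 * (\<Sum>b<N. c b) / (real N)\<^sup>2 \<le> 7680 * K0 * t ^ 6 * (N * t\<^sup>2) / (real N)\<^sup>2"
    by (rule divide_right_mono) simp
  have "\<sigma>\<^sup>2 / N * (Cp * t ^ 8) + \<bar>\<kappa>\<bar> / (real N)\<^sup>2 * (N * (4 * t ^ 8)) + 7680 * K0 * t ^ 6 * (N * t\<^sup>2) / (real N)\<^sup>2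
    = (\<sigma>\<^sup>2 * Cp + 4 * \<bar>\<kappa>\<bar> + 7680 * K0) * t ^ 8 / N"
  proof -
    have "t ^ 6 * t\<^sup>2 = t ^ 8" by (simp flip: power_add)
    then show ?thesis using N0 by (simp add: field_simps power2_eq_square)
  qed
  then show ?thesis using 1 2 3 by linarith
qed

section \<open>Rank-one test matrices and concentration of diagonal entries\<close>

text \<open>The rank-one matrix B e_k e_k^T: as a test matrix it turns a trace against H into the
  entry (H B)_kk.\<close>

definition "column_mat B k = mat N N (\<lambda>(a, b). if b = k then B $$ (a, k) else (0 :: complex))"

lemma column_mat_carrier [simp]: "column_mat B k \<in> carrier_mat N N" by (simp add: column_mat_def)

lemma trace_column_mat:
  assumes H: "H \<in> carrier_mat N N" and B: "B \<in> carrier_mat N N" and k: "k < N"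
  shows "mat_trace (H * column_mat B k) = (H * B) $$ (k, k)"
proof -
  have "mat_trace (H * column_mat B k) = (\<Sum>i<N. \<Sum>a<N. if i = k then H $$ (i, a) * B $$ (a, k) else 0)"
    unfolding mat_trace_mult[OF H column_mat_carrier]
    by (intro sum.cong refl) (simp add: column_mat_def)
  also have "\<dots> = (\<Sum>i<N. if i = k then (\<Sum>a<N. H $$ (i, a) * B $$ (a, k)) else 0)"
    by (intro sum.cong refl) simp
  finally show ?thesis using k by (simp add: mat_mult_entry[OF H B k k])
qed

lemma fro2_column_mat: "k < N \<Longrightarrow> fro2 (column_mat B k) = (\<Sum>a<N. (cmod (B $$ (a, k)))\<^sup>2)"
proof -
  assume k: "k < N"
  have "fro2 (column_mat B k) = (\<Sum>a<N. \<Sum>b<N. if b = k then (cmod (B $$ (a, k)))\<^sup>2 else 0)"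
    unfolding fro2_sum[OF column_mat_carrier] by (intro sum.cong refl) (simp add: column_mat_def)
  then show ?thesis using k by simp
qed

lemma column_mat_mult_R: 
  assumes k: "k < N" and ab: "a < N" "b < N"
  shows "(column_mat B k * R) $$ (a, b) = B $$ (a, k) * R $$ (k, b)"
proof -
  have "(column_mat B k * R) $$ (a, b) = (\<Sum>m<N. if m = k then B $$ (a, k) * R $$ (k, b) else 0)"
    unfolding mat_mult_entry[OF column_mat_carrier R_carrier ab]
    by (intro sum.cong refl) (use ab in \<open>simp add: column_mat_def\<close>)
  then show ?thesis using k by simp
qed

lemma G_mult_col:
  assumes B: "B \<in> carrier_mat N N" and k: "k < N"
  shows "(\<Sum>i<N. (cmod ((G x * B) $$ (i, k)))\<^sup>2) \<le> t\<^sup>2 * (\<Sum>a<N. (cmod (B $$ (a, k)))\<^sup>2)"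
proof -
  have "(\<Sum>i<N. (cmod ((G x * B) $$ (i, k)))\<^sup>2) \<le> (\<Sum>a<N. (cmod (B $$ (a, k)))\<^sup>2) * (1 / (Im z)\<^sup>2)"
    using resolvent_mult_col[OF M_herm z B k, of x] by (simp add: G_def)
  also have "\<dots> \<le> (\<Sum>a<N. (cmod (B $$ (a, k)))\<^sup>2) * t\<^sup>2"
    by (intro mult_left_mono Im_z_t sum_nonneg) auto
  finally show ?thesis by (simp add: mult.commute)
qed

text \<open>C is the outer product of column k of B and row k of R, so \<open>fro2 C\<close> and the
  diagonal sum of G C are bounded without N. The quartic term is then itself O(1 / N) and joins the
  error, which explains 5 instead of 4 in \<open>K1\<close>.\<close>

lemma entry_bias:
  assumes B: "B \<in> carrier_mat N N" and k: "k < N" and Bk: "(\<Sum>a<N. (cmod (B $$ (a, k)))\<^sup>2) \<le> t\<^sup>2"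
  shows "cmod ((LINT x|P. (G x * B) $$ (k, k)) - (R * B) $$ (k, k)) \<le> K1 * t ^ 8 / N"
proof -
  have N0: "real N > 0" using N by simp
  define C where "C = column_mat B k * R"
  have C: "C \<in> carrier_mat N N" by (simp add: C_def)
  have Ce: "C $$ (a, b) = B $$ (a, k) * R $$ (k, b)" if "a < N" "b < N" for a b
    unfolding C_def by (rule column_mat_mult_R[OF k that])
  define c where "c b = t * cmod (R $$ (k, b))" for b
  have c0: "c b \<ge> 0" for b using t0 by (simp add: c_def)
  have cb: "(\<Sum>a<N. (cmod (C $$ (a, b)))\<^sup>2) \<le> (c b)\<^sup>2" if b: "b < N" for b
  proof -
    have "(\<Sum>a<N. (cmod (C $$ (a, b)))\<^sup>2) = (\<Sum>a<N. (cmod (B $$ (a, k)))\<^sup>2) * (cmod (R $$ (k, b)))\<^sup>2"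
      unfolding sum_distrib_right by (intro sum.cong refl) (simp add: Ce b norm_mult power_mult_distrib)
    also have "\<dots> \<le> t\<^sup>2 * (cmod (R $$ (k, b)))\<^sup>2" by (intro mult_right_mono Bk) auto
    finally show ?thesis by (simp add: c_def power_mult_distrib)
  qed
  have sc: "(\<Sum>b<N. c b) \<le> N * t\<^sup>2"
    using sum_bounded_above[of "{..<N}" c "t * t"] R_entry[OF k] t0 by (simp add: c_def power2_eq_square)
  have fC: "fro2 C \<le> t ^ 4"
  proof -
    have "fro2 C = (\<Sum>b<N. \<Sum>a<N. (cmod (C $$ (a, b)))\<^sup>2)" unfolding fro2_sum[OF C] by (rule sum.swap)
    also have "\<dots> \<le> (\<Sum>b<N. (c b)\<^sup>2)" by (intro sum_mono cb) auto
    also have "\<dots> = t\<^sup>2 * (\<Sum>b<N. (cmod (R $$ (k, b)))\<^sup>2)" by (simp add: c_def power_mult_distrib sum_distrib_left)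
    also have "\<dots> \<le> t\<^sup>2 * t\<^sup>2" by (intro mult_left_mono R_row k) auto
    finally show ?thesis by (simp flip: power_add)
  qed
  have SY: "(\<Sum>i<N. cmod ((G x * C) $$ (i, i))) \<le> t ^ 4" for x
  proof -
    have e: "(G x * C) $$ (i, i) = (G x * B) $$ (i, k) * R $$ (k, i)" if i: "i < N" for i
      unfolding mat_mult_entry[OF G_carrier C i i] mat_mult_entry[OF G_carrier B i k] sum_distrib_right
      by (intro sum.cong refl) (simp add: Ce i)
    have "(\<Sum>i<N. cmod ((G x * C) $$ (i, i))) \<le> (\<Sum>i<N. ((cmod ((G x * B) $$ (i, k)))\<^sup>2 + (cmod (R $$ (k, i)))\<^sup>2) / 2)"
      by (rule sum_mono) (simp only: e norm_mult mult_le_half_squares lessThan_iff)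
    also have "\<dots> = ((\<Sum>i<N. (cmod ((G x * B) $$ (i, k)))\<^sup>2) + (\<Sum>i<N. (cmod (R $$ (k, i)))\<^sup>2)) / 2"
      by (simp add: sum.distrib flip: sum_divide_distrib)
    also have "\<dots> \<le> (t\<^sup>2 * t\<^sup>2 + t\<^sup>2) / 2"
      using order_trans[OF G_mult_col[OF B k] mult_left_mono[OF Bk]] R_row[OF k] by (intro divide_right_mono add_mono) auto
    also have "\<dots> \<le> t ^ 4" using t_power_mono[of 2 4] by (simp flip: power_add)
    finally show ?thesis .
  qed
  have t4: "t ^ 4 \<le> N * t ^ 4" using N t0 mult_right_mono[of 1 "real N" "t ^ 4"] by simp
  have "cmod ((LINT x|P. mat_trace (G x * column_mat B k)) - mat_trace (R * column_mat B k) - complex_of_real (\<kappa> / (2 * (real N)\<^sup>2)) * (LINT x|P. leading C x))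
     \<le> (\<sigma>\<^sup>2 * Cp + 4 * \<bar>\<kappa>\<bar> + 7680 * K0) * t ^ 8 / N"
    by (rule order_trans[OF master_bound[OF column_mat_carrier C_def c0 cb SY] trace_error_bound])
      (use fC t4 sc t0 order_trans[OF fC t4] in auto)
  then have 1: "cmod ((LINT x|P. (G x * B) $$ (k, k)) - (R * B) $$ (k, k) - complex_of_real (\<kappa> / (2 * (real N)\<^sup>2)) * (LINT x|P. leading C x))
     \<le> (\<sigma>\<^sup>2 * Cp + 4 * \<bar>\<kappa>\<bar> + 7680 * K0) * t ^ 8 / N"
    by (simp only: trace_column_mat[OF G_carrier B k] trace_column_mat[OF R_carrier B k])
  have "cmod (complex_of_real (\<kappa> / (2 * (real N)\<^sup>2)) * (LINT x|P. leading C x)) = \<bar>\<kappa>\<bar> / (2 * (real N)\<^sup>2) * cmod (LINT x|P. leading C x)"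
    by (simp add: norm_mult norm_divide norm_power)
  also have "\<dots> \<le> \<bar>\<kappa>\<bar> / (2 * (real N)\<^sup>2) * (N * t ^ 3 * t ^ 4)"
    by (intro mult_left_mono PP.norm_integral_bounded leading_bound[OF C SY]) auto
  also have "\<dots> = \<bar>\<kappa>\<bar> * t ^ 7 / N / 2" using N0 by (simp add: field_simps power2_eq_square flip: power_add)
  also have "\<dots> \<le> \<bar>\<kappa>\<bar> * t ^ 7 / N" using t0 N0 by (simp add: field_simps)
  also have "\<dots> \<le> \<bar>\<kappa>\<bar> * t ^ 8 / N"
    by (intro divide_right_mono mult_left_mono t_power_mono) auto
  finally have 2: "cmod (complex_of_real (\<kappa> / (2 * (real N)\<^sup>2)) * (LINT x|P. leading C x)) \<le> \<bar>\<kappa>\<bar> * t ^ 8 / N" .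
  have "K1 * t ^ 8 / N = (\<sigma>\<^sup>2 * Cp + 4 * \<bar>\<kappa>\<bar> + 7680 * K0) * t ^ 8 / N + \<bar>\<kappa>\<bar> * t ^ 8 / N"
    by (simp add: K1_def algebra_simps add_divide_distrib)
  moreover have "cmod ((LINT x|P. (G x * B) $$ (k, k)) - (R * B) $$ (k, k))
    \<le> cmod ((LINT x|P. (G x * B) $$ (k, k)) - (R * B) $$ (k, k) - complex_of_real (\<kappa> / (2 * (real N)\<^sup>2)) * (LINT x|P. leading C x))
      + cmod (complex_of_real (\<kappa> / (2 * (real N)\<^sup>2)) * (LINT x|P. leading C x))"
    by (rule order_trans[OF _ norm_triangle_ineq]) simp
  ultimately show ?thesis using 1 2 by linarith
qed

lemma entry_variance:
  assumes B: "B \<in> carrier_mat N N" and k: "k < N" and Bk: "(\<Sum>a<N. (cmod (B $$ (a, k)))\<^sup>2) \<le> t\<^sup>2"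
  shows "(LINT x|P. (cmod ((G x * B) $$ (k, k) - (LINT x|P. (G x * B) $$ (k, k))))\<^sup>2) \<le> Cp * t ^ 6 / N"
proof -
  have "(LINT x|P. (cmod ((G x * B) $$ (k, k) - (LINT x|P. (G x * B) $$ (k, k))))\<^sup>2) \<le> Cp * t ^ 4 * (\<Sum>a<N. (cmod (B $$ (a, k)))\<^sup>2) / N"
    using trace_variance[OF column_mat_carrier, of B k] unfolding trace_column_mat[OF G_carrier B k] fro2_column_mat[OF k] .
  also have "\<dots> \<le> Cp * t ^ 4 * t\<^sup>2 / N"
    using Cp_pos t0 by (intro divide_right_mono mult_left_mono Bk) auto
  finally show ?thesis by (simp add: mult.assoc flip: power_add)
qed

text \<open>D = 1 and C = R. Here the quartic term is of order 1 and has to be kept.\<close>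

lemma trace_bias:
  "cmod (N * gN - mat_trace R - complex_of_real (\<kappa> / (2 * (real N)\<^sup>2)) * (LINT x|P. leading R x)) \<le> K1 * t ^ 8 / N"
proof -
  have N0: "real N > 0" using N by simp
  have t12: "t \<le> t\<^sup>2" "t\<^sup>2 \<le> t ^ 4" using t_power_mono[of 1 2] t_power_mono[of 2 4] by auto
  have R1: "R = 1\<^sub>m N * R" by (simp add: left_mult_one_mat[OF R_carrier])
  have f: "fro2 R \<le> N * t ^ 4"
  proof -
    have "fro2 R \<le> (\<Sum>i<N. t\<^sup>2)" unfolding fro2_sum[OF R_carrier] by (intro sum_mono R_row) auto
    also have "\<dots> \<le> N * t ^ 4" using mult_left_mono[OF t12(2), of "real N"] by simp
    finally show ?thesis .
  qed
  have Y: "(\<Sum>i<N. cmod ((G x * R) $$ (i, i))) \<le> N * t\<^sup>2" for x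
  proof -
    have "cmod ((G x * R) $$ (i, i)) \<le> t\<^sup>2" if "i < N" for i
      using G_mult_entry[OF R_carrier that that less_imp_le[OF t0] R_col[OF that]] by (simp add: power2_eq_square)
    then show ?thesis using sum_bounded_above[of "{..<N}" "\<lambda>i. cmod ((G x * R) $$ (i, i))" "t\<^sup>2"] by simp
  qed
  have "cmod ((LINT x|P. mat_trace (G x * 1\<^sub>m N)) - mat_trace (R * 1\<^sub>m N) - complex_of_real (\<kappa> / (2 * (real N)\<^sup>2)) * (LINT x|P. leading R x))
    \<le> (\<sigma>\<^sup>2 * Cp + 4 * \<bar>\<kappa>\<bar> + 7680 * K0) * t ^ 8 / N"
    by (rule order_trans[OF master_bound[OF one_carrier_mat R1, of "\<lambda>_. t", OF _ R_col Y] trace_error_bound])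
      (use f t12 t0 mult_left_mono[OF t12(2), of "real N"] mult_left_mono[OF t12(1), of "real N"] in auto)
  also have "\<dots> \<le> K1 * t ^ 8 / N" using t0 by (intro divide_right_mono mult_right_mono) (auto simp: K1_def)
  finally show ?thesis
    using N0 by (simp only: trace_one right_mult_one_mat[OF R_carrier]) (simp add: gN_def)
qed

text \<open>Concentration at \<open>r\<close> at rate \<open>1 / N\<close>, in a form that is stable under products.\<close>
definition near :: "real \<Rightarrow> ((nat \<times> nat \<Rightarrow> real) \<Rightarrow> complex) \<Rightarrow> complex \<Rightarrow> bool" where
  "near c X r \<longleftrightarrow> X \<in> borel_measurable P \<and> (\<forall>x. cmod (X x) \<le> c) \<and> cmod r \<le> c
     \<and> cmod ((LINT x|P. X x) - r) \<le> c / N \<and> (LINT x|P. (cmod (X x - r))\<^sup>2) \<le> c / N"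

text \<open>X Y - r s = (X - r) (Y - s) + r (Y - s) + s (X - r). The mean of the first term is
  controlled by the second moments, that of the others by the biases, so both must be carried
  along.\<close>

lemma near_mult:
  assumes X: "near c X r" and Y: "near c Y s" and c: "c \<ge> 1"
  shows "near (4 * c ^ 3) (\<lambda>x. X x * Y x) (r * s)"
  unfolding near_def
proof (intro conjI allI)
  have N0: "real N > 0" using N by simp
  have [measurable]: "X \<in> borel_measurable P" "Y \<in> borel_measurable P" using X Y by (auto simp: near_def)
  have Xb: "cmod (X x) \<le> c" and Yb: "cmod (Y x) \<le> c" and rb: "cmod r \<le> c" and sb: "cmod s \<le> c" for x
    using X Y by (auto simp: near_def)
  have EX: "cmod ((LINT x|P. X x) - r) \<le> c / N" "(LINT x|P. (cmod (X x - r))\<^sup>2) \<le> c / N"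
    and EY: "cmod ((LINT x|P. Y x) - s) \<le> c / N" "(LINT x|P. (cmod (Y x - s))\<^sup>2) \<le> c / N" using X Y by (auto simp: near_def)
  have c23: "c\<^sup>2 \<le> 4 * c ^ 3" "3 * c\<^sup>2 \<le> 4 * c ^ 3" "c \<le> c\<^sup>2"
    using power_increasing[of 2 3 c] power_increasing[of 1 2 c] c by auto
  show "(\<lambda>x. X x * Y x) \<in> borel_measurable P" by measurable
  show "cmod (X x * Y x) \<le> 4 * c ^ 3" for x
  proof -
    have "cmod (X x * Y x) \<le> c * c" unfolding norm_mult using Xb Yb c by (intro mult_mono) auto
    then show ?thesis using c23 by (simp add: power2_eq_square)
  qed
  show "cmod (r * s) \<le> 4 * c ^ 3"
  proof -
    have "cmod (r * s) \<le> c * c" unfolding norm_mult using rb sb c by (intro mult_mono) auto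
    then show ?thesis using c23 by (simp add: power2_eq_square)
  qed
  have iX: "integrable P X" and iY: "integrable P Y" by (rule PP.integrable_bounded[where B = c]; use Xb Yb in simp)+
  have sX: "integrable P (\<lambda>x. (cmod (X x - r))\<^sup>2)"
    by (rule PP.integrable_bounded[where B = "(2 * c)\<^sup>2"]) (use cmod_diff_sq_le[OF Xb rb] in auto)
  have sY: "integrable P (\<lambda>x. (cmod (Y x - s))\<^sup>2)"
    by (rule PP.integrable_bounded[where B = "(2 * c)\<^sup>2"]) (use cmod_diff_sq_le[OF Yb sb] in auto)
  have db: "cmod (X x - r) \<le> 2 * c" "cmod (Y x - s) \<le> 2 * c" for x
    using norm_triangle_ineq4[of "X x" r] norm_triangle_ineq4[of "Y x" s] Xb[of x] Yb[of x] rb sb by linarith+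
  have iXY: "integrable P (\<lambda>x. (X x - r) * (Y x - s))"
  proof (rule PP.integrable_bounded[where B = "(2 * c) * (2 * c)"])
    show "norm ((X x - r) * (Y x - s)) \<le> (2 * c) * (2 * c)" for x
      unfolding norm_mult using db c by (intro mult_mono) auto
  qed simp
  show "cmod ((LINT x|P. X x * Y x) - r * s) \<le> 4 * c ^ 3 / N"
  proof -
    have "(LINT x|P. X x * Y x) = (LINT x|P. (X x - r) * (Y x - s) + (r * (Y x - s) + s * (X x - r)) + r * s)"
      by (rule Bochner_Integration.integral_cong[OF refl]) (simp add: algebra_simps)
    also have "\<dots> = (LINT x|P. (X x - r) * (Y x - s)) + (r * ((LINT x|P. Y x) - s) + s * ((LINT x|P. X x) - r)) + r * s"
      using iX iY iXY by (simp add: PP.prob_space)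
    finally have "cmod ((LINT x|P. X x * Y x) - r * s)
      \<le> cmod (LINT x|P. (X x - r) * (Y x - s)) + (cmod r * cmod ((LINT x|P. Y x) - s) + cmod s * cmod ((LINT x|P. X x) - r))"
      by simp (rule order_trans[OF norm_triangle_ineq] add_mono order_refl | simp add: norm_mult)+
    also have "\<dots> \<le> c / N + (c * (c / N) + c * (c / N))"
    proof (intro add_mono mult_mono EX EY rb sb)
      have "cmod (LINT x|P. (X x - r) * (Y x - s)) \<le> (LINT x|P. cmod ((X x - r) * (Y x - s)))" by (rule integral_norm_bound)
      also have "\<dots> \<le> (LINT x|P. ((cmod (X x - r))\<^sup>2 + (cmod (Y x - s))\<^sup>2) / 2)"
        by (rule integral_mono') (use sX sY mult_le_half_squares in \<open>auto simp: norm_mult\<close>)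
      also have "\<dots> \<le> c / N" using sX sY add_mono[OF EX(2) EY(2)] by (simp add: mult.commute)
      finally show "cmod (LINT x|P. (X x - r) * (Y x - s)) \<le> c / N" .
    qed (use c N0 in auto)
    also have "\<dots> = (c + 2 * c\<^sup>2) / N" by (simp add: power2_eq_square add_divide_distrib)
    also have "\<dots> \<le> 4 * c ^ 3 / N" using c23 by (intro divide_right_mono) auto
    finally show ?thesis .
  qed
  show "(LINT x|P. (cmod (X x * Y x - r * s))\<^sup>2) \<le> 4 * c ^ 3 / N"
  proof -
    have "(LINT x|P. (cmod (X x * Y x - r * s))\<^sup>2) \<le> (LINT x|P. 2 * c\<^sup>2 * ((cmod (X x - r))\<^sup>2 + (cmod (Y x - s))\<^sup>2))"
    proof (rule integral_mono')
      fix x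
      have "cmod (X x * Y x - r * s) = cmod ((X x - r) * Y x + r * (Y x - s))" by (simp add: algebra_simps)
      also have "\<dots> \<le> cmod (X x - r) * c + c * cmod (Y x - s)"
        by (rule order_trans[OF norm_triangle_ineq]) (use Yb rb in \<open>auto simp: norm_mult intro!: add_mono mult_left_mono mult_right_mono\<close>)
      finally have "(cmod (X x * Y x - r * s))\<^sup>2 \<le> (c * (cmod (X x - r) + cmod (Y x - s)))\<^sup>2"
        by (intro power_mono) (auto simp: algebra_simps)
      also have "\<dots> = c\<^sup>2 * (cmod (X x - r) + cmod (Y x - s))\<^sup>2" by (rule power_mult_distrib)
      also have "\<dots> \<le> c\<^sup>2 * (2 * ((cmod (X x - r))\<^sup>2 + (cmod (Y x - s))\<^sup>2))"
        using mult_le_half_squares[of "cmod (X x - r)" "cmod (Y x - s)"]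
        by (intro mult_left_mono) (auto simp: power2_sum)
      finally show "(cmod (X x * Y x - r * s))\<^sup>2 \<le> 2 * c\<^sup>2 * ((cmod (X x - r))\<^sup>2 + (cmod (Y x - s))\<^sup>2)" by (simp add: algebra_simps)
    qed (use sX sY in auto)
    also have "\<dots> = 2 * c\<^sup>2 * ((LINT x|P. (cmod (X x - r))\<^sup>2) + (LINT x|P. (cmod (Y x - s))\<^sup>2))" using sX sY by simp
    also have "\<dots> \<le> 2 * c\<^sup>2 * (c / N + c / N)" by (intro mult_left_mono add_mono EX EY) auto
    also have "\<dots> = 4 * c ^ 3 / N" by (simp add: power2_eq_square power3_eq_cube)
    finally show ?thesis .
  qed
qed

definition "K2 = 2 + Cp + 2 * K1"

lemma K2_ge: "K2 \<ge> 1" "Cp + 2 * K1 \<le> K2" "K1 \<le> K2" using K1_nonneg Cp_pos by (auto simp: K2_def)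

text \<open>B = 1 gives the diagonal of G and B = R that of G R. The second moment around the
  deterministic value is variance plus squared bias; the latter is at most the trivial bound 2 t^2
  times the bias bound with t^8, which produces t^10.\<close>

lemma near_entry:
  assumes B: "B \<in> carrier_mat N N" and k: "k < N" and Bk: "(\<Sum>a<N. (cmod (B $$ (a, k)))\<^sup>2) \<le> t\<^sup>2"
  shows "near (K2 * t ^ 10) (\<lambda>x. (G x * B) $$ (k, k)) ((R * B) $$ (k, k))"
  unfolding near_def
proof (intro conjI allI)
  have N0: "real N > 0" using N by simp
  have t2: "t\<^sup>2 \<le> K2 * t ^ 10"
    using mult_mono[OF K2_ge(1) t_power_mono[of 2 10]] t0 K2_ge by simp
  show m: "(\<lambda>x. (G x * B) $$ (k, k)) \<in> borel_measurable P" by (rule G_mult_measurable[OF B k k])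
  have Gb: "cmod ((G x * B) $$ (k, k)) \<le> t\<^sup>2" for x
    using G_mult_entry[OF B k k less_imp_le[OF t0] Bk] by (simp add: power2_eq_square)
  have Rb: "cmod ((R * B) $$ (k, k)) \<le> t\<^sup>2"
  proof -
    have "cmod ((R * B) $$ (k, k)) \<le> sqrt (\<Sum>a<N. (cmod (B $$ (a, k)))\<^sup>2) / Im w"
      unfolding R_def by (rule resolvent_mult_entry[OF A Im_w(2) B k k])
    also have "\<dots> \<le> sqrt (t\<^sup>2) * (1 / Im w)"
      using divide_right_mono[OF real_sqrt_le_mono[OF Bk], of "Im w"] Im_w(2) by simp
    also have "\<dots> \<le> t * t" using t0 mult_left_mono[OF Im_w(3), of t] by simp
    finally show ?thesis by (simp add: power2_eq_square)
  qed
  show "cmod ((G x * B) $$ (k, k)) \<le> K2 * t ^ 10" for x using Gb t2 by (rule order_trans)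
  show "cmod ((R * B) $$ (k, k)) \<le> K2 * t ^ 10" using Rb t2 by (rule order_trans)
  define b where "b = cmod ((LINT x|P. (G x * B) $$ (k, k)) - (R * B) $$ (k, k))"
  have b1: "b \<le> K1 * t ^ 8 / N" unfolding b_def by (rule entry_bias[OF B k Bk])
  also have "\<dots> \<le> K2 * t ^ 10 / N"
    using K1_nonneg K2_ge t0 by (intro divide_right_mono mult_mono t_power_mono) auto
  finally show "b \<le> K2 * t ^ 10 / N" .
  have b2: "b \<le> 2 * t\<^sup>2"
    using norm_triangle_ineq4[of "LINT x|P. (G x * B) $$ (k, k)" "(R * B) $$ (k, k)"] Rb PP.norm_integral_bounded[of "\<lambda>x. (G x * B) $$ (k, k)", OF Gb]
    unfolding b_def by linarith
  have "b\<^sup>2 \<le> (2 * t\<^sup>2) * (K1 * t ^ 8 / N)"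
    unfolding power2_eq_square[of b] using b1 b2 t0 by (intro mult_mono) (auto simp: b_def)
  also have "\<dots> = 2 * K1 * t ^ 10 / N" by (simp add: mult_ac flip: power_add)
  finally have b3: "b\<^sup>2 \<le> 2 * K1 * t ^ 10 / N" .
  have "(LINT x|P. (cmod ((G x * B) $$ (k, k) - (R * B) $$ (k, k)))\<^sup>2)
     = (LINT x|P. (cmod ((G x * B) $$ (k, k) - (LINT x|P. (G x * B) $$ (k, k))))\<^sup>2) + b\<^sup>2"
    unfolding b_def by (rule PP.second_moment_shift[OF m Gb])
  also have "\<dots> \<le> Cp * t ^ 6 / N + 2 * K1 * t ^ 10 / N" by (intro add_mono entry_variance[OF B k Bk] b3)
  also have "\<dots> \<le> Cp * t ^ 10 / N + 2 * K1 * t ^ 10 / N"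
    using Cp_pos by (intro add_right_mono divide_right_mono mult_left_mono t_power_mono) auto
  also have "\<dots> = (Cp + 2 * K1) * t ^ 10 / N" by (simp add: algebra_simps add_divide_distrib)
  also have "\<dots> \<le> K2 * t ^ 10 / N" using K2_ge t0 by (intro divide_right_mono mult_right_mono) auto
  finally show "(LINT x|P. (cmod ((G x * B) $$ (k, k) - (R * B) $$ (k, k)))\<^sup>2) \<le> K2 * t ^ 10 / N" .
qed

definition "L_sum = (\<Sum>i<N. \<Sum>j<N. (R $$ (j, j) * R $$ (j, j)) * (R $$ (i, i) * (R * R) $$ (i, i)))"

text \<open>\<open>near_mult\<close> in two rounds on four factors: c becomes 4 c^3, then 4 (4
  c^3)^3 = 256 c^9, and c = K2 t^10 yields t^90. Each of the N^2 products has bias of order 1 /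
  N.\<close>

lemma leading_expectation: "cmod ((LINT x|P. leading R x) - L_sum) \<le> 256 * K2 ^ 9 * t ^ 90 * N"
proof -
  have N0: "real N > 0" using N by simp
  define c where "c = K2 * t ^ 10"
  have c1: "c \<ge> 1" unfolding c_def using mult_mono[OF K2_ge(1) t_power_mono[of 0 10]] t0 K2_ge by simp
  have nG: "near c (\<lambda>x. G x $$ (k, k)) (R $$ (k, k))" if k: "k < N" for k
  proof -
    have "(\<Sum>a<N. (cmod (1\<^sub>m N $$ (a, k)))\<^sup>2) \<le> t\<^sup>2"
      unfolding sum_delta_entry[OF k] using t_power_mono[of 0 2] by simp
    from near_entry[OF one_carrier_mat k this] show ?thesis
      by (simp add: c_def right_mult_one_mat[OF G_carrier] right_mult_one_mat[OF R_carrier])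
  qed
  have nR: "near c (\<lambda>x. (G x * R) $$ (k, k)) ((R * R) $$ (k, k))" if k: "k < N" for k
    unfolding c_def by (rule near_entry[OF R_carrier k R_col[OF k]])
  have c3: "4 * c ^ 3 \<ge> 1" using one_le_power[OF c1, of 3] by simp
  have n4: "near (256 * c ^ 9) (\<lambda>x. (G x $$ (j, j) * G x $$ (j, j)) * (G x $$ (i, i) * (G x * R) $$ (i, i)))
     ((R $$ (j, j) * R $$ (j, j)) * (R $$ (i, i) * (R * R) $$ (i, i)))" if "i < N" "j < N" for i j
    using near_mult[OF near_mult[OF nG[OF that(2)] nG[OF that(2)] c1] near_mult[OF nG[OF that(1)] nR[OF that(1)] c1] c3]
    by (simp add: power_mult_distrib flip: power_mult)
  define p where "p i j x = (G x $$ (j, j) * G x $$ (j, j)) * (G x $$ (i, i) * (G x * R) $$ (i, i))" for i j x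
  define q where "q i j = (R $$ (j, j) * R $$ (j, j)) * (R $$ (i, i) * (R * R) $$ (i, i))" for i j
  have n4': "near (256 * c ^ 9) (p i j) (q i j)" if "i < N" "j < N" for i j
    using n4[OF that] unfolding p_def[abs_def] q_def .
  have pq: "p i j \<in> borel_measurable P" "cmod (p i j x) \<le> 256 * c ^ 9" "cmod ((LINT x|P. p i j x) - q i j) \<le> 256 * c ^ 9 / N"
    if "i < N" "j < N" for i j x
    using n4'[OF that] unfolding near_def by blast+
  have int: "integrable P (p i j)" if "i < N" "j < N" for i j
    by (rule PP.integrable_bounded[OF pq(1,2)[OF that]])
  have "(LINT x|P. leading R x) = (\<Sum>i<N. \<Sum>j<N. (LINT x|P. p i j x))"
    unfolding leading_def p_def[symmetric] by (rule integral_double_sum(1)[OF int])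
  then have "(LINT x|P. leading R x) - L_sum = (\<Sum>i<N. \<Sum>j<N. (LINT x|P. p i j x) - q i j)"
    unfolding L_sum_def q_def[symmetric] by (simp only: sum_subtractf)
  also have "cmod \<dots> \<le> (\<Sum>i<N. \<Sum>j<N. 256 * c ^ 9 / N)"
    by (rule order_trans[OF norm_sum], rule sum_mono, rule order_trans[OF norm_sum], rule sum_mono, rule pq(3)) simp_all
  also have "\<dots> = 256 * c ^ 9 * N" using N0 by simp
  finally show ?thesis by (simp add: c_def power_mult_distrib mult_ac flip: power_mult)
qed

definition "K3 = 128 * \<bar>\<kappa>\<bar> * K2 ^ 9 + K1"

lemma K3_nonneg: "K3 \<ge> 0" using K1_nonneg K2_ge by (auto simp: K3_def intro!: add_nonneg_nonneg mult_nonneg_nonneg)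

theorem gN_expansion:
  "cmod (gN - mat_trace R / N - complex_of_real \<kappa> / (2 * of_nat N ^ 2) * L_sum / N) \<le> K3 * t ^ 90 / (real N)\<^sup>2"
proof -
  have N0: "real N > 0" using N by simp
  define q where "q = complex_of_real (\<kappa> / (2 * (real N)\<^sup>2))"
  have "cmod (q * ((LINT x|P. leading R x) - L_sum)) \<le> \<bar>\<kappa>\<bar> / (2 * (real N)\<^sup>2) * (256 * K2 ^ 9 * t ^ 90 * N)"
    unfolding norm_mult q_def norm_of_real by (intro mult_mono leading_expectation) auto
  also have "\<dots> = 128 * \<bar>\<kappa>\<bar> * K2 ^ 9 * t ^ 90 / N" using N0 by (simp add: field_simps power2_eq_square)
  finally have 1: "cmod (q * ((LINT x|P. leading R x) - L_sum)) \<le> 128 * \<bar>\<kappa>\<bar> * K2 ^ 9 * t ^ 90 / N" .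
  have 2: "cmod (N * gN - mat_trace R - q * (LINT x|P. leading R x)) \<le> K1 * t ^ 90 / N"
    by (rule order_trans[OF trace_bias[folded q_def]])
      (intro divide_right_mono mult_left_mono t_power_mono K1_nonneg, auto)
  have "cmod (N * gN - mat_trace R - q * L_sum) \<le> cmod (N * gN - mat_trace R - q * (LINT x|P. leading R x)) + cmod (q * ((LINT x|P. leading R x) - L_sum))"
    by (rule order_trans[OF _ norm_triangle_ineq]) (simp add: algebra_simps)
  also have "\<dots> \<le> K1 * t ^ 90 / N + 128 * \<bar>\<kappa>\<bar> * K2 ^ 9 * t ^ 90 / N" by (intro add_mono 1 2)
  also have "\<dots> = K3 * t ^ 90 / N" by (simp add: K3_def algebra_simps add_divide_distrib)
  finally have 3: "cmod (N * gN - mat_trace R - q * L_sum) \<le> K3 * t ^ 90 / N" .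
  have "gN - mat_trace R / N - complex_of_real \<kappa> / (2 * of_nat N ^ 2) * L_sum / N = (N * gN - mat_trace R - q * L_sum) / N"
    unfolding q_def using N0 by (simp add: field_simps)
  also have "cmod \<dots> \<le> K3 * t ^ 90 / N / N"
    using divide_right_mono[OF 3, of "real N"] by (simp add: norm_divide)
  finally show ?thesis by (simp add: power2_eq_square)
qed

end

section \<open>Comparison with the free convolution\<close>

definition quartic_sum :: "nat \<Rightarrow> complex mat \<Rightarrow> complex" where
  "quartic_sum N G = (\<Sum>i<N. \<Sum>l<N. (G * G) $$ (i, i) * G $$ (i, i) * (G $$ (l, l))\<^sup>2)"

lemma double_sum_bound:
  assumes "\<And>i l. i < N \<Longrightarrow> l < N \<Longrightarrow> cmod (f i l) \<le> c"
  shows "cmod (\<Sum>i<N. \<Sum>l<N. f i l) \<le> (real N)\<^sup>2 * c"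
proof -
  have "cmod (\<Sum>i<N. \<Sum>l<N. f i l) \<le> (\<Sum>i<N. \<Sum>l<N. c)"
    by (intro order_trans[OF norm_sum] sum_mono) (use assms in auto)
  then show ?thesis by (simp add: power2_eq_square mult_ac)
qed

text \<open>The first claim reproduces its hypothesis with t s in place of s, so products of
  resolvents are handled by repetition, without factors of N.\<close>

lemma resolvent_prod_bound:
  assumes A: "A \<in> herm_mats N" and w: "Im w > 0" "1 / Im w \<le> t"
    and B: "B \<in> carrier_mat N N" and j: "j < N" and s: "s \<ge> 0" "(\<Sum>i<N. (cmod (B $$ (i, j)))\<^sup>2) \<le> s\<^sup>2"
  shows "(\<Sum>i<N. (cmod ((resolvent A w * B) $$ (i, j)))\<^sup>2) \<le> (t * s)\<^sup>2"
    and "i < N \<Longrightarrow> cmod ((resolvent A w * B) $$ (i, j)) \<le> t * s"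
proof -
  have t0: "t \<ge> 0" using w by (smt (verit) divide_nonneg_nonneg)
  have "(\<Sum>i<N. (cmod ((resolvent A w * B) $$ (i, j)))\<^sup>2) \<le> (\<Sum>i<N. (cmod (B $$ (i, j)))\<^sup>2) * (1 / Im w)\<^sup>2"
    using resolvent_mult_col[OF A w(1) B j] by (simp add: power_divide)
  also have "\<dots> \<le> s\<^sup>2 * t\<^sup>2" using w by (intro mult_mono s power_mono) auto
  finally show 1: "(\<Sum>i<N. (cmod ((resolvent A w * B) $$ (i, j)))\<^sup>2) \<le> (t * s)\<^sup>2"
    by (simp add: power_mult_distrib mult.commute)
  assume i: "i < N"
  have "(cmod ((resolvent A w * B) $$ (i, j)))\<^sup>2 \<le> (\<Sum>i<N. (cmod ((resolvent A w * B) $$ (i, j)))\<^sup>2)"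
    using i by (intro member_le_sum) auto
  then show "cmod ((resolvent A w * B) $$ (i, j)) \<le> t * s"
    using 1 t0 s(1) by (meson mult_nonneg_nonneg order_trans power2_le_imp_le)
qed

lemma resolvent_quartic_bound:
  assumes A: "A \<in> herm_mats N" and w: "Im w > 0" "1 / Im w \<le> t" and i: "i < N" and l: "l < N"
  defines "G \<equiv> resolvent A w"
  shows "cmod ((G * G) $$ (i, i) * G $$ (i, i) * (G $$ (l, l))\<^sup>2) \<le> t ^ 5"
proof -
  have t0: "t \<ge> 0" using w by (smt (verit) divide_nonneg_nonneg)
  have G: "G \<in> carrier_mat N N" unfolding G_def by (rule resolvent_carrier[OF A]) (use w in simp)
  have e: "cmod (G $$ (a, b)) \<le> t" if "a < N" "b < N" for a b
    using resolvent_entry[OF A w(1) that] w(2) by (simp add: G_def)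
  have c: "(\<Sum>a<N. (cmod (G $$ (a, b)))\<^sup>2) \<le> t\<^sup>2" if "b < N" for b
    using resolvent_col[OF A w(1) that] power_mono[OF w(2), of 2] w(1) by (simp add: G_def power_divide)
  have GG: "cmod ((G * G) $$ (i, i)) \<le> t * t"
    unfolding G_def by (rule resolvent_prod_bound(2)[OF A w G[unfolded G_def] i t0 c[OF i, unfolded G_def] i])
  have "cmod ((G * G) $$ (i, i) * G $$ (i, i) * (G $$ (l, l))\<^sup>2) \<le> (t * t) * t * t\<^sup>2"
    unfolding norm_mult norm_power using GG e i l t0 by (intro mult_mono power_mono) auto
  then show ?thesis by (simp add: eval_nat_numeral)
qed

text \<open>R - S = (v - w) R S. The five resolvent factors are exchanged one at a time, R R
  counting as two, and each exchange costs |w - v| t^6.\<close>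

lemma resolvent_quartic_diff:
  assumes A: "A \<in> herm_mats N" and w: "Im w > 0" "1 / Im w \<le> t" and v: "Im v > 0" "1 / Im v \<le> t"
    and i: "i < N" and l: "l < N"
  defines "R \<equiv> resolvent A w" and "S \<equiv> resolvent A v"
  shows "cmod ((R * R) $$ (i, i) * R $$ (i, i) * (R $$ (l, l))\<^sup>2 - (S * S) $$ (i, i) * S $$ (i, i) * (S $$ (l, l))\<^sup>2)
    \<le> 5 * cmod (w - v) * t ^ 6"
proof -
  have t0: "t \<ge> 0" using w by (smt (verit) divide_nonneg_nonneg)
  have R [simp]: "R \<in> carrier_mat N N" unfolding R_def by (rule resolvent_carrier[OF A]) (use w in simp)
  have S [simp]: "S \<in> carrier_mat N N" unfolding S_def by (rule resolvent_carrier[OF A]) (use v in simp)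
  have mc [simp]: "U \<in> carrier_mat N N \<Longrightarrow> V \<in> carrier_mat N N \<Longrightarrow> U * V \<in> carrier_mat N N" for U V :: "complex mat"
    by (rule mult_carrier_mat)
  have Re: "cmod (R $$ (a, b)) \<le> t" and Se: "cmod (S $$ (a, b)) \<le> t" if "a < N" "b < N" for a b
    using resolvent_entry[OF A w(1) that] resolvent_entry[OF A v(1) that] w(2) v(2) by (simp_all add: R_def S_def)
  have Rc: "(\<Sum>a<N. (cmod (R $$ (a, b)))\<^sup>2) \<le> t\<^sup>2" and Sc: "(\<Sum>a<N. (cmod (S $$ (a, b)))\<^sup>2) \<le> t\<^sup>2" if "b < N" for b
    using resolvent_col[OF A w(1) that] power_mono[OF w(2), of 2] w(1)
      resolvent_col[OF A v(1) that] power_mono[OF v(2), of 2] v(1) by (simp_all add: R_def S_def power_divide)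
  note Rp = resolvent_prod_bound[OF A w, folded R_def] and Sp = resolvent_prod_bound[OF A v, folded S_def]
  define d where "d = cmod (w - v)"
  have d0: "d \<ge> 0" by (simp add: d_def)
  have id: "R - S = (v - w) \<cdot>\<^sub>m (R * S)"
  proof -
    have "shifted A v - shifted A w = (v - w) \<cdot>\<^sub>m 1\<^sub>m N"
      using herm_mats_carrier[OF A] by (intro eq_matI) (auto simp: shifted_def)
    then have "R - S = R * ((v - w) \<cdot>\<^sub>m 1\<^sub>m N) * S"
      using resolvent_identity[OF A A, of w v] w v by (simp add: R_def S_def)
    also have "R * ((v - w) \<cdot>\<^sub>m 1\<^sub>m N) = (v - w) \<cdot>\<^sub>m R"
      using mult_smult_distrib[OF R one_carrier_mat, of "v - w"] by (simp add: right_mult_one_mat[OF R])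
    also have "(v - w) \<cdot>\<^sub>m R * S = (v - w) \<cdot>\<^sub>m (R * S)" by (rule mult_smult_assoc_mat[OF R S])
    finally show ?thesis .
  qed
  have ent: "R $$ (a, b) - S $$ (a, b) = (v - w) * (R * S) $$ (a, b)" if "a < N" "b < N" for a b
    using arg_cong[OF id, of "\<lambda>m. m $$ (a, b)"] that by (simp add: carrier_matD[OF R] carrier_matD[OF S])
  have D1: "cmod (R $$ (a, a) - S $$ (a, a)) \<le> d * t\<^sup>2" if a: "a < N" for a
    unfolding ent[OF a a] norm_mult using Rp(2)[OF S a t0 Sc[OF a] a] d0
    by (auto simp: d_def norm_minus_commute power2_eq_square intro!: mult_left_mono)
  have D2: "cmod ((R * R) $$ (i, i) - (S * S) $$ (i, i)) \<le> 2 * d * t ^ 3"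
  proof -
    have "(R * R) $$ (i, i) - (S * S) $$ (i, i) = (\<Sum>k<N. R $$ (i, k) * (R $$ (k, i) - S $$ (k, i))) + (\<Sum>k<N. (R $$ (i, k) - S $$ (i, k)) * S $$ (k, i))"
      unfolding mat_mult_entry[OF R R i i] mat_mult_entry[OF S S i i]
      by (simp add: algebra_simps flip: sum_subtractf sum.distrib)
    also have "\<dots> = (\<Sum>k<N. (v - w) * (R $$ (i, k) * (R * S) $$ (k, i))) + (\<Sum>k<N. (v - w) * ((R * S) $$ (i, k) * S $$ (k, i)))"
      using i by (intro arg_cong2[of _ _ _ _ "(+)"] sum.cong refl) (simp_all add: ent)
    also have "\<dots> = (v - w) * ((R * (R * S)) $$ (i, i) + (R * S * S) $$ (i, i))"
      unfolding sum_distrib_left[symmetric] distrib_left mat_mult_entry[OF R mc[OF R S] i i] mat_mult_entry[OF mc[OF R S] S i i] ..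
    also have "R * S * S = R * (S * S)" by (rule assoc_mult_mat[OF R S S])
    finally have "cmod ((R * R) $$ (i, i) - (S * S) $$ (i, i)) = d * cmod ((R * (R * S)) $$ (i, i) + (R * (S * S)) $$ (i, i))"
      by (simp add: norm_mult d_def norm_minus_commute)
    also have "\<dots> \<le> d * (t * (t * t) + t * (t * t))"
    proof (rule mult_left_mono[OF _ d0], rule order_trans[OF norm_triangle_ineq], rule add_mono)
      show "cmod ((R * (R * S)) $$ (i, i)) \<le> t * (t * t)"
        by (rule Rp(2)[OF mc[OF R S] i _ Rp(1)[OF S i t0 Sc[OF i]] i]) (use t0 in simp)
      show "cmod ((R * (S * S)) $$ (i, i)) \<le> t * (t * t)"
        by (rule Rp(2)[OF mc[OF S S] i _ Sp(1)[OF S i t0 Sc[OF i]] i]) (use t0 in simp)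
    qed
    finally show ?thesis by (simp add: power3_eq_cube algebra_simps)
  qed
  have RR: "cmod ((R * R) $$ (i, i)) \<le> t * t" by (rule Rp(2)[OF R i t0 Rc[OF i] i])
  have SS: "cmod ((S * S) $$ (i, i)) \<le> t * t" by (rule Sp(2)[OF S i t0 Sc[OF i] i])
  let ?a = "(R * R) $$ (i, i)" and ?a' = "(S * S) $$ (i, i)" and ?b = "R $$ (i, i)" and ?b' = "S $$ (i, i)"
    and ?c = "R $$ (l, l)" and ?c' = "S $$ (l, l)"
  have "?a * ?b * ?c\<^sup>2 - ?a' * ?b' * ?c'\<^sup>2
    = (?a - ?a') * (?b * (?c * ?c)) + ?a' * ((?b - ?b') * (?c * ?c)) + ?a' * (?b' * ((?c - ?c') * ?c)) + ?a' * (?b' * (?c' * (?c - ?c')))"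
    by (simp add: algebra_simps power2_eq_square)
  also have "cmod \<dots> \<le> (2 * d * t ^ 3) * (t * (t * t)) + (t * t) * ((d * t\<^sup>2) * (t * t)) + (t * t) * (t * ((d * t\<^sup>2) * t)) + (t * t) * (t * (t * (d * t\<^sup>2)))"
    by (intro order_trans[OF norm_triangle_ineq] add_mono; unfold norm_mult; intro mult_mono D1 D2 RR SS Re Se i l mult_nonneg_nonneg)
      (use t0 d0 in auto)
  also have "\<dots> = 5 * cmod (w - v) * t ^ 6" by (simp add: eval_nat_numeral d_def)
  finally show ?thesis .
qed

section \<open>From g_N to the free convolution\<close>

context deformed
begin

lemma L_sum_quartic: "L_sum = quartic_sum N R"
  unfolding L_sum_def quartic_sum_def by (intro sum.cong refl) (simp add: power2_eq_square)

text \<open>The correction with the resolvent at w; \<open>Lt\<close> below is the same expression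
  at v, the subordination point of the free convolution at z.\<close>

definition "L = complex_of_real \<kappa> / (2 * of_nat N ^ 2) * quartic_sum N R"

lemma L_bound_gen:
  assumes "cmod s \<le> (real N)\<^sup>2 * c"
  shows "cmod (complex_of_real \<kappa> / (2 * of_nat N ^ 2) * s) \<le> \<bar>\<kappa>\<bar> * c / 2"
proof -
  have N0: "real N > 0" using N by simp
  have "cmod (complex_of_real \<kappa> / (2 * of_nat N ^ 2) * s) = \<bar>\<kappa>\<bar> / (2 * (real N)\<^sup>2) * cmod s"
    by (simp add: norm_mult norm_divide norm_power)
  also have "\<dots> \<le> \<bar>\<kappa>\<bar> / (2 * (real N)\<^sup>2) * ((real N)\<^sup>2 * c)" by (intro mult_left_mono assms) auto
  also have "\<dots> = \<bar>\<kappa>\<bar> * c / 2" using N0 by simp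
  finally show ?thesis .
qed

definition "gt = g_tilde \<sigma> A"
definition "v = z - (complex_of_real \<sigma>)\<^sup>2 * gt z"
definition "Lt = L_tilde \<sigma> \<kappa> N A z"

lemma Lt_eq: "Lt = complex_of_real \<kappa> / (2 * of_nat N ^ 2) * quartic_sum N (resolvent A v)"
  by (simp add: Lt_def L_tilde_def Let_def quartic_sum_def v_def gt_def)

sublocale F: real_distribution "semicircle \<sigma> \<boxplus> spectral_measure A"
  by (rule free_convolution_subordination(1)[OF \<sigma> A N])

sublocale SA: real_distribution "spectral_measure A"
  by (rule free_convolution_subordination(3)[OF \<sigma> A N])

lemma gt_eq: "gt = stieltjes (semicircle \<sigma> \<boxplus> spectral_measure A)" by (simp add: gt_def g_tilde_def)

lemma Im_v: "Im v > 0" "1 / Im v \<le> t"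
proof -
  have 1: "Im z \<le> Im v" unfolding v_def gt_eq by (rule F.Im_subordination[OF z])
  then show "Im v > 0" using z by linarith
  show "1 / Im v \<le> t" using 1 z t(2) frac_le[of 1 1 "Im z" "Im v"] by linarith
qed

text \<open>The defect of w in the subordination equation: if it were 0, then g_N would be the
  transform of the free convolution at z.\<close>

definition "\<epsilon> = gN - mat_trace R / N"

lemma mat_trace_R: "mat_trace R / N = stieltjes (spectral_measure A) w"
  unfolding R_def using stieltjes_spectral_measure[OF A N, of w] Im_w(2) by simp

definition "K4 = K3 + \<bar>\<kappa>\<bar>"

lemma K4_nonneg: "K4 \<ge> 0" using K3_nonneg by (simp add: K4_def)

lemma \<epsilon>_L: "cmod (\<epsilon> - L / N) \<le> K3 * t ^ 90 / (real N)\<^sup>2"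
  using gN_expansion by (simp add: \<epsilon>_def L_def L_sum_quartic)

lemma \<epsilon>_bound: "cmod \<epsilon> \<le> K4 * t ^ 90 / N"
proof -
  have N0: "real N \<ge> 1" using N by simp
  have "cmod L \<le> \<bar>\<kappa>\<bar> * t ^ 5 / 2"
    unfolding L_def quartic_sum_def
    by (intro L_bound_gen double_sum_bound) (unfold R_def, rule resolvent_quartic_bound[OF A Im_w(2,3)])
  also have "\<dots> \<le> \<bar>\<kappa>\<bar> * t ^ 90 / 1" by (intro frac_le mult_left_mono t_power_mono) (use t0 in auto)
  finally have "cmod (L / N) \<le> \<bar>\<kappa>\<bar> * t ^ 90 / N" by (simp add: norm_divide divide_right_mono)
  moreover have "K3 * t ^ 90 / (real N)\<^sup>2 \<le> K3 * t ^ 90 / N"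
    using N0 K3_nonneg t0 by (intro divide_left_mono) (auto simp: power2_eq_square)
  moreover have "cmod \<epsilon> \<le> cmod (\<epsilon> - L / N) + cmod (L / N)"
    by (rule order_trans[OF _ norm_triangle_ineq]) simp
  moreover have "K4 * t ^ 90 / N = K3 * t ^ 90 / N + \<bar>\<kappa>\<bar> * t ^ 90 / N"
    by (simp add: K4_def algebra_simps add_divide_distrib)
  ultimately show ?thesis using \<epsilon>_L by linarith
qed

definition "K5 = (1 + \<sigma>\<^sup>2) * (K3 + 3 * \<bar>\<kappa>\<bar> * \<sigma>\<^sup>2 * (1 + 2 * \<sigma>\<^sup>2) * K4) + 2 * \<sigma> ^ 4 * K4\<^sup>2 + 4 * \<sigma> ^ 4 * K4\<^sup>2 * (2 + (1 + \<sigma>\<^sup>2) * \<bar>\<kappa>\<bar>)"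

lemma deriv_factor: "cmod (1 - (complex_of_real \<sigma>)\<^sup>2 * deriv gt z) \<le> (1 + \<sigma>\<^sup>2) * t\<^sup>2"
proof -
  have "cmod (deriv gt z) \<le> t\<^sup>2" unfolding gt_eq using F.deriv_stieltjes_bound[OF z] Im_z_t by linarith
  then have "\<sigma>\<^sup>2 * cmod (deriv gt z) \<le> \<sigma>\<^sup>2 * t\<^sup>2" by (rule mult_left_mono) simp
  moreover have "cmod (1 - (complex_of_real \<sigma>)\<^sup>2 * deriv gt z) \<le> 1 + \<sigma>\<^sup>2 * cmod (deriv gt z)"
    by (rule order_trans[OF norm_triangle_ineq4]) (simp add: norm_mult norm_power)
  ultimately show ?thesis using t_power_mono[of 0 2] by (simp add: algebra_simps)
qed

lemma Lt_bound: "cmod Lt \<le> \<bar>\<kappa>\<bar> * t ^ 5 / 2"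
  unfolding Lt_eq quartic_sum_def by (intro L_bound_gen double_sum_bound resolvent_quartic_bound[OF A Im_v])

lemma gN_bound: "cmod gN \<le> t"
proof -
  have N0: "real N > 0" using N by simp
  have "cmod (mat_trace (G x)) \<le> N * t" for x
  proof -
    have "cmod (mat_trace (G x)) \<le> (\<Sum>i<N. t)"
      unfolding mat_trace_def carrier_matD[OF G_carrier] by (intro order_trans[OF norm_sum] sum_mono G_entry) auto
    then show ?thesis by simp
  qed
  then have "cmod (LINT x|P. mat_trace (G x)) \<le> N * t" by (rule PP.norm_integral_bounded)
  then show ?thesis using N0 by (simp add: gN_def norm_divide field_simps)
qed

text \<open>The condition keeps z + \<delta>, with \<delta> = - \<sigma>^2 \<epsilon>, in the upper
  half-plane at height at least Im z / 2, where the transform of the convolution and its Taylor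
  bound are available.\<close>

lemma expansion_near:
  assumes small: "\<sigma>\<^sup>2 * cmod \<epsilon> \<le> Im z / 2"
  shows "cmod (gN - gt z + ((complex_of_real \<sigma>)\<^sup>2 * deriv gt z - 1) * Lt / N)
    \<le> ((1 + \<sigma>\<^sup>2) * (K3 + 3 * \<bar>\<kappa>\<bar> * \<sigma>\<^sup>2 * (1 + 2 * \<sigma>\<^sup>2) * K4) + 2 * \<sigma> ^ 4 * K4\<^sup>2) * t ^ 189 / (real N)\<^sup>2"
proof -
  have N0: "real N \<ge> 1" using N by simp
  define s where "s = (complex_of_real \<sigma>)\<^sup>2"
  define \<delta> where "\<delta> = - s * \<epsilon>"
  have cs: "cmod s = \<sigma>\<^sup>2" by (simp add: s_def norm_power)
  have c\<delta>: "cmod \<delta> = \<sigma>\<^sup>2 * cmod \<epsilon>" by (simp add: \<delta>_def norm_mult cs)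
  have Im\<delta>: "\<bar>Im \<delta>\<bar> \<le> Im z / 2" using abs_Im_le_cmod[of \<delta>] small c\<delta> by linarith
  then have z': "Im (z + \<delta>) \<ge> Im z / 2" "Im (z + \<delta>) > 0" using z by auto
  define w' where "w' = z + \<delta> - s * gt (z + \<delta>)"
  have gt': "gt (z + \<delta>) = stieltjes (spectral_measure A) w'"
    unfolding w'_def s_def gt_def by (rule free_convolution_subordination(2)[OF \<sigma> A N z'(2)])
  have ww: "w + s * stieltjes (spectral_measure A) w = z + \<delta>"
    unfolding mat_trace_R[symmetric] unfolding \<delta>_def \<epsilon>_def w_def s_def[symmetric] by (simp add: algebra_simps)
  have ww': "w' + s * stieltjes (spectral_measure A) w' = z + \<delta>"
    unfolding gt'[symmetric] by (simp add: w'_def)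
  have "Im w' > 0"
    using F.Im_subordination[OF z'(2), of \<sigma>] z'(2) unfolding w'_def s_def gt_eq by linarith
  \<comment> \<open>Both points solve the same equation with right-hand side z + \<delta>, so
    uniqueness makes the value at z + \<delta> exactly Tr R / N.\<close>
  then have "w = w'"
    by (rule SA.subordination_unique[OF Im_w(2) _ \<sigma>]) (use ww ww' z'(2) in \<open>simp_all add: s_def\<close>)
  then have gtR: "gt (z + \<delta>) = mat_trace R / N" by (simp add: gt' mat_trace_R)
  have tay: "cmod (gt (z + \<delta>) - gt z - \<delta> * deriv gt z) \<le> 2 * (cmod \<delta>)\<^sup>2 * t ^ 3"
  proof -
    have "cmod (gt (z + \<delta>) - gt z - \<delta> * deriv gt z) \<le> 2 * (cmod \<delta>)\<^sup>2 * (1 / Im z) ^ 3"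
      using F.stieltjes_taylor[OF z, of \<delta>] small c\<delta> by (simp add: gt_eq F.deriv_stieltjes[OF z] power_divide)
    also have "\<dots> \<le> 2 * (cmod \<delta>)\<^sup>2 * t ^ 3" using z by (intro mult_left_mono power_mono t) auto
    finally show ?thesis .
  qed
  have \<epsilon>b: "cmod \<epsilon> \<le> K4 * t ^ 90 / N" by (rule \<epsilon>_bound)
  have tay': "cmod (gt (z + \<delta>) - gt z - \<delta> * deriv gt z) \<le> 2 * (\<sigma>\<^sup>2 * (K4 * t ^ 90 / N))\<^sup>2 * t ^ 3"
  proof (rule order_trans[OF tay], intro mult_right_mono mult_left_mono power_mono)
    show "cmod \<delta> \<le> \<sigma>\<^sup>2 * (K4 * t ^ 90 / N)" unfolding c\<delta> by (rule mult_left_mono[OF \<epsilon>b]) simp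
  qed (use t0 in auto)
  \<comment> \<open>A first-order bound suffices: it serves only to replace w by v in L, where w - v
    = - \<sigma>^2 (g_N - \<open>gt z\<close>), and L is divided by N.\<close>
  have gg: "cmod (gN - gt z) \<le> (1 + 2 * \<sigma>\<^sup>2) * t\<^sup>2 * cmod \<epsilon>"
  proof -
    have "cmod (gt (z + \<delta>) - gt z) \<le> cmod \<delta> / (Im (z + \<delta>) * Im z)"
      using F.stieltjes_lipschitz[OF z'(2) z] by (simp add: gt_eq)
    also have "\<dots> \<le> cmod \<delta> / (Im z / 2 * Im z)"
      using z z' by (intro divide_left_mono mult_right_mono) auto
    also have "\<dots> = 2 * cmod \<delta> * (1 / (Im z)\<^sup>2)" by (simp add: power2_eq_square)
    also have "\<dots> \<le> 2 * cmod \<delta> * t\<^sup>2" by (intro mult_left_mono Im_z_t) auto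
    finally have 1: "cmod (gt (z + \<delta>) - gt z) \<le> 2 * \<sigma>\<^sup>2 * cmod \<epsilon> * t\<^sup>2" by (simp add: c\<delta>)
    have "gN - gt z = \<epsilon> + (gt (z + \<delta>) - gt z)" unfolding gtR \<epsilon>_def by simp
    then have "cmod (gN - gt z) \<le> cmod \<epsilon> + cmod (gt (z + \<delta>) - gt z)" by (metis norm_triangle_ineq)
    also have "\<dots> \<le> t\<^sup>2 * cmod \<epsilon> + 2 * \<sigma>\<^sup>2 * cmod \<epsilon> * t\<^sup>2"
      using 1 mult_right_mono[OF t_power_mono[of 0 2] norm_ge_zero[of \<epsilon>]] by simp
    finally show ?thesis by (simp add: algebra_simps)
  qed
  have LL: "cmod (L - Lt) \<le> 3 * \<bar>\<kappa>\<bar> * \<sigma>\<^sup>2 * (1 + 2 * \<sigma>\<^sup>2) * K4 * t ^ 98 / N"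
  proof -
    have "L - Lt = complex_of_real \<kappa> / (2 * of_nat N ^ 2) * (quartic_sum N R - quartic_sum N (resolvent A v))"
      unfolding L_def Lt_eq by (simp add: right_diff_distrib)
    also have "quartic_sum N R - quartic_sum N (resolvent A v) = (\<Sum>i<N. \<Sum>l<N. (R * R) $$ (i, i) * R $$ (i, i) * (R $$ (l, l))\<^sup>2
       - (resolvent A v * resolvent A v) $$ (i, i) * resolvent A v $$ (i, i) * (resolvent A v $$ (l, l))\<^sup>2)"
      unfolding quartic_sum_def by (simp only: sum_subtractf)
    finally have "cmod (L - Lt) \<le> \<bar>\<kappa>\<bar> * (5 * cmod (w - v) * t ^ 6) / 2"
      by (simp only:) (intro L_bound_gen double_sum_bound, unfold R_def, rule resolvent_quartic_diff[OF A Im_w(2,3) Im_v])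
    also have "cmod (w - v) = \<sigma>\<^sup>2 * cmod (gN - gt z)"
    proof -
      have "w - v = - s * (gN - gt z)" by (simp add: w_def v_def s_def algebra_simps)
      then show ?thesis by (simp add: norm_mult cs)
    qed
    also have "\<bar>\<kappa>\<bar> * (5 * (\<sigma>\<^sup>2 * cmod (gN - gt z)) * t ^ 6) / 2 \<le> \<bar>\<kappa>\<bar> * (5 * (\<sigma>\<^sup>2 * ((1 + 2 * \<sigma>\<^sup>2) * t\<^sup>2 * (K4 * t ^ 90 / N))) * t ^ 6) / 2"
      using gg \<epsilon>b t0 
      by (intro divide_right_mono mult_left_mono mult_right_mono order_trans[OF gg]) auto
    also have "\<dots> = (5 / 2) * (\<bar>\<kappa>\<bar> * \<sigma>\<^sup>2 * (1 + 2 * \<sigma>\<^sup>2) * K4 * (t\<^sup>2 * t ^ 90 * t ^ 6) / N)" by (simp only: divide_inverse mult_ac)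
    also have "t\<^sup>2 * t ^ 90 * t ^ 6 = t ^ 98" by (simp flip: power_add)
    also have "(5 / 2) * (\<bar>\<kappa>\<bar> * \<sigma>\<^sup>2 * (1 + 2 * \<sigma>\<^sup>2) * K4 * t ^ 98 / N) \<le> 3 * (\<bar>\<kappa>\<bar> * \<sigma>\<^sup>2 * (1 + 2 * \<sigma>\<^sup>2) * K4 * t ^ 98 / N)"
      using K4_nonneg t0 by (intro mult_right_mono divide_nonneg_nonneg mult_nonneg_nonneg) auto
    finally show ?thesis by simp
  qed
  \<comment> \<open>The three errors, each of order N^(-2): the expansion of \<epsilon>, the change
    from L to \<open>Lt\<close> divided by N, and the Taylor remainder.\<close>
  have "gN - gt z + (s * deriv gt z - 1) * Lt / N
     = (1 - s * deriv gt z) * ((\<epsilon> - L / N) + (L - Lt) / N) + (gt (z + \<delta>) - gt z - \<delta> * deriv gt z)"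
  proof -
    have "gN - gt z = \<epsilon> + gt (z + \<delta>) - gt z" unfolding gtR \<epsilon>_def by simp
    then show ?thesis by (simp add: \<delta>_def algebra_simps diff_divide_distrib)
  qed
  also have "cmod \<dots> \<le> cmod (1 - s * deriv gt z) * (cmod (\<epsilon> - L / N) + cmod (L - Lt) / N) + cmod (gt (z + \<delta>) - gt z - \<delta> * deriv gt z)"
    using norm_triangle_ineq[of "\<epsilon> - L / N" "(L - Lt) / N"]
    by (intro order_trans[OF norm_triangle_ineq] add_mono order_refl) (auto simp: norm_mult norm_divide intro!: mult_left_mono)
  also have "\<dots> \<le> ((1 + \<sigma>\<^sup>2) * t\<^sup>2) * (K3 * t ^ 90 / (real N)\<^sup>2 + (3 * \<bar>\<kappa>\<bar> * \<sigma>\<^sup>2 * (1 + 2 * \<sigma>\<^sup>2) * K4 * t ^ 98 / N) / N)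
       + 2 * (\<sigma>\<^sup>2 * (K4 * t ^ 90 / N))\<^sup>2 * t ^ 3"
    by (intro add_mono mult_mono deriv_factor[folded s_def] \<epsilon>_L divide_right_mono LL tay') (use t0 in auto)
  also have "\<dots> = (1 + \<sigma>\<^sup>2) * K3 * (t\<^sup>2 * t ^ 90) / (real N)\<^sup>2 + (1 + \<sigma>\<^sup>2) * (3 * \<bar>\<kappa>\<bar> * \<sigma>\<^sup>2 * (1 + 2 * \<sigma>\<^sup>2) * K4) * (t\<^sup>2 * t ^ 98) / (real N)\<^sup>2
       + 2 * \<sigma> ^ 4 * K4\<^sup>2 * (t ^ 90 * t ^ 90 * t ^ 3) / (real N)\<^sup>2"
  proof -
    have s4: "\<sigma> ^ 4 = \<sigma>\<^sup>2 * \<sigma>\<^sup>2" by (simp flip: power_add)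
    define a where "a = t ^ 90"
    define b where "b = t ^ 98"
    show ?thesis
      unfolding a_def[symmetric] b_def[symmetric] s4 by (simp add: power2_eq_square distrib_left divide_inverse mult_ac)
  qed
  also have "\<dots> \<le> (1 + \<sigma>\<^sup>2) * K3 * t ^ 189 / (real N)\<^sup>2 + (1 + \<sigma>\<^sup>2) * (3 * \<bar>\<kappa>\<bar> * \<sigma>\<^sup>2 * (1 + 2 * \<sigma>\<^sup>2) * K4) * t ^ 189 / (real N)\<^sup>2
       + 2 * \<sigma> ^ 4 * K4\<^sup>2 * t ^ 189 / (real N)\<^sup>2"
    unfolding power_add[symmetric]
    by (intro add_mono divide_right_mono mult_left_mono t_power_mono mult_nonneg_nonneg add_nonneg_nonneg)
      (use K3_nonneg K4_nonneg in auto)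
  also have "\<dots> = ((1 + \<sigma>\<^sup>2) * (K3 + 3 * \<bar>\<kappa>\<bar> * \<sigma>\<^sup>2 * (1 + 2 * \<sigma>\<^sup>2) * K4) + 2 * \<sigma> ^ 4 * K4\<^sup>2) * t ^ 189 / (real N)\<^sup>2"
    unfolding add_divide_distrib[symmetric] distrib_right[symmetric] distrib_left[symmetric] by simp
  finally show ?thesis unfolding s_def .
qed

text \<open>The bound on \<epsilon> gives 1 \<le> q = 2 \<sigma>^2 (K4 t^90 / N) t, so multiplying
  the trivial bound of order t^7 by q^2 supplies N^(-2). The exponent 189 = 90 + 90 + 2 + 7 also
  dominates those of the near case.\<close>

lemma expansion_far:
  assumes large: "\<not> \<sigma>\<^sup>2 * cmod \<epsilon> \<le> Im z / 2"
  shows "cmod (gN - gt z + ((complex_of_real \<sigma>)\<^sup>2 * deriv gt z - 1) * Lt / N)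
    \<le> 4 * \<sigma> ^ 4 * K4\<^sup>2 * (2 + (1 + \<sigma>\<^sup>2) * \<bar>\<kappa>\<bar>) * t ^ 189 / (real N)\<^sup>2"
proof -
  have N0: "real N \<ge> 1" using N by simp
  define q where "q = 2 * \<sigma>\<^sup>2 * (K4 * t ^ 90 / N) * t"
  have "1 \<le> 2 * (\<sigma>\<^sup>2 * cmod \<epsilon>) * (1 / Im z)" using large z by (simp add: field_simps)
  also have "\<dots> \<le> 2 * (\<sigma>\<^sup>2 * (K4 * t ^ 90 / N)) * t"
    using \<epsilon>_bound t z K4_nonneg by (intro mult_mono mult_left_mono mult_nonneg_nonneg) auto
  finally have q: "1 \<le> q" by (simp add: q_def)
  then have q2: "1 \<le> q\<^sup>2" by (rule one_le_power)
  have "gN - gt z + ((complex_of_real \<sigma>)\<^sup>2 * deriv gt z - 1) * Lt / N = (gN - gt z) - (1 - (complex_of_real \<sigma>)\<^sup>2 * deriv gt z) * (Lt / N)"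
    by (simp add: algebra_simps diff_divide_distrib)
  also have "cmod \<dots> \<le> (cmod gN + cmod (gt z)) + cmod (1 - (complex_of_real \<sigma>)\<^sup>2 * deriv gt z) * (cmod Lt / N)"
    by (intro order_trans[OF norm_triangle_ineq4] add_mono norm_triangle_ineq4) (simp add: norm_mult norm_divide)
  also have "\<dots> \<le> (t + t) + ((1 + \<sigma>\<^sup>2) * t\<^sup>2) * (\<bar>\<kappa>\<bar> * t ^ 5)"
  proof (intro add_mono mult_mono gN_bound deriv_factor)
    show "cmod (gt z) \<le> t" unfolding gt_eq using F.stieltjes_bound[OF z] t(2) by linarith
    have "cmod Lt / N \<le> cmod Lt / 1" using N0 by (intro divide_left_mono) auto
    also have "\<dots> \<le> \<bar>\<kappa>\<bar> * t ^ 5 / 2" using Lt_bound by simp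
    also have "\<dots> \<le> \<bar>\<kappa>\<bar> * t ^ 5" using t0 by simp
    finally show "cmod Lt / N \<le> \<bar>\<kappa>\<bar> * t ^ 5" .
  qed (use t0 in auto)
  also have "\<dots> \<le> (t ^ 7 + t ^ 7) + (1 + \<sigma>\<^sup>2) * \<bar>\<kappa>\<bar> * t ^ 7"
  proof (intro add_mono)
    have "t\<^sup>2 * t ^ 5 = t ^ 7" by (simp flip: power_add)
    then show "((1 + \<sigma>\<^sup>2) * t\<^sup>2) * (\<bar>\<kappa>\<bar> * t ^ 5) \<le> (1 + \<sigma>\<^sup>2) * \<bar>\<kappa>\<bar> * t ^ 7" by (simp add: mult_ac)
  qed (use t_power_mono[of 1 7] in auto)
  also have "\<dots> = (2 + (1 + \<sigma>\<^sup>2) * \<bar>\<kappa>\<bar>) * t ^ 7" by (simp add: algebra_simps)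
  also have "\<dots> \<le> (2 + (1 + \<sigma>\<^sup>2) * \<bar>\<kappa>\<bar>) * t ^ 7 * q\<^sup>2"
    using mult_left_mono[OF q2, of "(2 + (1 + \<sigma>\<^sup>2) * \<bar>\<kappa>\<bar>) * t ^ 7"] t0 by simp
  also have "\<dots> = 4 * \<sigma> ^ 4 * K4\<^sup>2 * (2 + (1 + \<sigma>\<^sup>2) * \<bar>\<kappa>\<bar>) * (t ^ 90 * t ^ 90 * t\<^sup>2 * t ^ 7) / (real N)\<^sup>2"
  proof -
    have s4: "\<sigma> ^ 4 = (\<sigma>\<^sup>2)\<^sup>2" by (simp flip: power_mult)
    define a where "a = t ^ 90"
    define b where "b = 2 + (1 + \<sigma>\<^sup>2) * \<bar>\<kappa>\<bar>"
    show ?thesis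
      unfolding q_def a_def[symmetric] b_def[symmetric] s4 power_mult_distrib power_divide
      by (simp add: power2_eq_square divide_inverse mult_ac)
  qed
  also have "t ^ 90 * t ^ 90 * t\<^sup>2 * t ^ 7 = t ^ 189" by (simp flip: power_add)
  finally show ?thesis .
qed

theorem expansion:
  "cmod (gN - gt z + ((complex_of_real \<sigma>)\<^sup>2 * deriv gt z - 1) * Lt / N) \<le> K5 * t ^ 189 / (real N)\<^sup>2"
proof -
  let ?a = "(1 + \<sigma>\<^sup>2) * (K3 + 3 * \<bar>\<kappa>\<bar> * \<sigma>\<^sup>2 * (1 + 2 * \<sigma>\<^sup>2) * K4) + 2 * \<sigma> ^ 4 * K4\<^sup>2"
  let ?b = "4 * \<sigma> ^ 4 * K4\<^sup>2 * (2 + (1 + \<sigma>\<^sup>2) * \<bar>\<kappa>\<bar>)"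
  have s4: "\<sigma> ^ 4 \<ge> 0" by simp
  have a: "?a \<ge> 0" using K3_nonneg K4_nonneg s4 by (intro add_nonneg_nonneg mult_nonneg_nonneg) auto
  have b: "?b \<ge> 0" using s4 by (intro add_nonneg_nonneg mult_nonneg_nonneg) auto
  have K5: "K5 = ?a + ?b" by (simp only: K5_def)
  show ?thesis
  proof (cases "\<sigma>\<^sup>2 * cmod \<epsilon> \<le> Im z / 2")
    case True
    have "?a * t ^ 189 / (real N)\<^sup>2 \<le> K5 * t ^ 189 / (real N)\<^sup>2"
      unfolding K5 using b t0 by (intro divide_right_mono mult_right_mono) auto
    with expansion_near[OF True] show ?thesis by (rule order_trans)
  next
    case False
    have "?b * t ^ 189 / (real N)\<^sup>2 \<le> K5 * t ^ 189 / (real N)\<^sup>2"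
      unfolding K5 using a t0 by (intro divide_right_mono mult_right_mono) auto
    with expansion_far[OF False] show ?thesis by (rule order_trans)
  qed
qed


section \<open>Transfer to the given Wigner matrices and conclusion\<close>

text \<open>By independence the coordinate vector has law \<open>P\<close>, and \<open>wX\<close>
  rebuilds the matrix from its coordinates.\<close>

lemma mean_stieltjes_deformed:
  assumes W: "wigner \<Omega> \<mu> N W"
  shows "mean_stieltjes \<Omega> N (\<lambda>\<omega>. deformed_wigner N (W \<omega>) A) z = gN"
proof -
  interpret \<Omega>: prob_space \<Omega> using W by (simp add: wigner_def)
  \<comment> \<open>Restricted to \<open>I\<close> so that its values lie in the space of the
    product measure.\<close>
  define X where "X \<omega> = (\<lambda>p\<in>I. wigner_var (W \<omega>) p)" for \<omega>
  have ind: "\<Omega>.indep_vars (\<lambda>_. borel) (\<lambda>p \<omega>. wigner_var (W \<omega>) p) I" using W by (simp add: wigner_def I_def)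
  have rv: "(\<lambda>\<omega>. wigner_var (W \<omega>) p) \<in> borel_measurable \<Omega>" if "p \<in> I" for p
    using ind that by (simp add: \<Omega>.indep_vars_def)
  have d: "distr \<Omega> borel (\<lambda>\<omega>. wigner_var (W \<omega>) p) = \<mu>" if "p \<in> I" for p
    using W that unfolding wigner_def I_def by blast
  have I0: "I \<noteq> {}" using N by (auto simp: I_def lessThan_empty_iff)
  have "distr \<Omega> (PiM I (\<lambda>_. borel)) X = PiM I (\<lambda>p. distr \<Omega> borel (\<lambda>\<omega>. wigner_var (W \<omega>) p))"
    unfolding X_def[abs_def] using ind by (subst (asm) \<Omega>.indep_vars_iff_distr_eq_PiM'[OF I0 rv])
  also have "\<dots> = P" unfolding P_def by (rule PiM_cong) (simp_all add: d)
  finally have dX: "distr \<Omega> (PiM I (\<lambda>_. borel)) X = P" .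
  have Xm: "X \<in> measurable \<Omega> (PiM I (\<lambda>_. borel))"
    unfolding X_def[abs_def] by (rule measurable_restrict) (rule rv)
  have MX: "deformed_wigner N (W \<omega>) A = M (X \<omega>)" if "\<omega> \<in> space \<Omega>" for \<omega>
  proof -
    have Wc: "W \<omega> \<in> herm_mats N" using W that unfolding wigner_def herm_mats_def by blast
    have "W \<omega> = wX N (X \<omega>)"
    proof (rule eq_matI)
      fix a b assume "a < dim_row (wX N (X \<omega>))" "b < dim_col (wX N (X \<omega>))"
      then have ab: "a < N" "b < N" by (simp_all add: wX_def)
      have c: "W \<omega> $$ (b, a) = cnj (W \<omega> $$ (a, b))" using herm_entry[OF Wc ab] by simp
      have s2: "complex_of_real (sqrt 2) \<noteq> 0" by simp
      consider "a = b" | "a < b" | "b < a" by linarith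
      then show "W \<omega> $$ (a, b) = wX N (X \<omega>) $$ (a, b)"
      proof cases
        case 1
        then have "Im (W \<omega> $$ (a, b)) = 0" using arg_cong[OF c, of Im] by simp
        then show ?thesis
          using 1 ab by (simp add: wX_entry X_def I_def wal_def wigner_var_def complex_eq_iff)
      next
        case 2
        then show ?thesis
          using ab s2 by (simp add: wX_entry X_def I_def wal_def wigner_var_def complex_eq_iff)
      next
        case 3
        then show ?thesis
          using ab s2 c by (simp add: wX_entry X_def I_def wal_def wigner_var_def complex_eq_iff)
      qed
    qed (use herm_mats_carrier[OF Wc] in \<open>auto simp: wX_def\<close>)
    then show ?thesis
      unfolding deformed_wigner_def M_def h_def
      by (simp add: comm_add_mat[of _ N N])
  qed
  have Fm: "(\<lambda>x. mat_trace (G x)) \<in> borel_measurable P"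
    using integrable_trace[OF one_carrier_mat] by (simp add: trace_one borel_measurable_integrable)
  have "mean_stieltjes \<Omega> N (\<lambda>\<omega>. deformed_wigner N (W \<omega>) A) z = (LINT \<omega>|\<Omega>. 1 / of_nat N * mat_trace (G (X \<omega>)))"
    unfolding mean_stieltjes_def G_def by (rule Bochner_Integration.integral_cong[OF refl]) (simp add: MX)
  also have "\<dots> = 1 / of_nat N * (LINT \<omega>|\<Omega>. mat_trace (G (X \<omega>)))" by (rule integral_mult_right_zero)
  also have "(LINT \<omega>|\<Omega>. mat_trace (G (X \<omega>))) = (LINT x|distr \<Omega> (PiM I (\<lambda>_. borel)) X. mat_trace (G x))"
    by (rule integral_distr[OF Xm, symmetric]) (use Fm in \<open>simp add: measurable_distr_eq1 flip: dX\<close>)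
  finally show ?thesis by (simp add: dX gN_def)
qed

end

theorem proposition4p1:
  fixes \<sigma> :: real and \<mu> \<nu> :: "real measure"
    and \<Omega> :: "nat \<Rightarrow> 'a measure" and W :: "nat \<Rightarrow> 'a \<Rightarrow> complex mat"
    and A :: "nat \<Rightarrow> complex mat"
    and r J :: nat and \<beta> :: "nat \<Rightarrow> nat \<Rightarrow> real" and \<theta> :: "nat \<Rightarrow> real" and k :: "nat \<Rightarrow> nat"
  assumes "\<sigma> > 0"
    and "real_distribution \<mu>"
    and "distr \<mu> borel uminus = \<mu>"
    and "integrable \<mu> (\<lambda>x. x)" and "(LINT x|\<mu>. x) = 0"
    and "integrable \<mu> (\<lambda>x. x\<^sup>2)" and "(LINT x|\<mu>. x\<^sup>2) = \<sigma>\<^sup>2"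
    and "satisfies_poincare \<mu>"
    and "\<And>N. N \<ge> 1 \<Longrightarrow> wigner (\<Omega> N) \<mu> N (W N)"
    and "\<And>N. N \<ge> 1 \<Longrightarrow> A N \<in> carrier_mat N N \<and> hermitian_mat (A N)"
    and "real_distribution \<nu>" and "compact (msupport \<nu>)"
    and "weak_conv_m (\<lambda>N. spectral_measure (A N)) \<nu>"
    and "\<And>N. N \<ge> 1 \<Longrightarrow> N \<ge> r \<Longrightarrow>
           proots (char_poly (A N)) =
             image_mset complex_of_real
               (image_mset (\<beta> N) (mset_set {..<N - r}) + (\<Sum>j<J. replicate_mset (k j) (\<theta> j)))"
    and "(\<lambda>N. MAX j\<in>{..<N - r}. infdist (\<beta> N j) (msupport \<nu>)) \<longlonglongrightarrow> 0"
    and "\<And>i j. i < j \<Longrightarrow> j < J \<Longrightarrow> \<theta> j < \<theta> i"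
    and "\<And>j. j < J \<Longrightarrow> \<theta> j \<notin> msupport \<nu>"
    and "\<And>j. j < J \<Longrightarrow> k j \<ge> 1"
    and "\<And>N j. N \<ge> 1 \<Longrightarrow> N \<ge> r \<Longrightarrow> j < J \<Longrightarrow>
           Polynomial.order (complex_of_real (\<theta> j)) (char_poly (A N)) = k j"
    and "(\<Sum>j<J. k j) = r"
  shows "bigO_upper 2 (\<lambda>N z.
           mean_stieltjes (\<Omega> N) N (\<lambda>\<omega>. deformed_wigner N (W N \<omega>) (A N)) z
           - g_tilde \<sigma> (A N) z
           + E_tilde \<sigma> (cumulant \<mu> 4) N (A N) z / of_nat N)"
proof -
  obtain C where C: "poincare_const \<mu> C" using satisfies_poincare_const[OF assms(2,8)] .
  have i6: "integrable \<mu> (\<lambda>x. x ^ 6)" by (rule poincare_moments[OF assms(2) C assms(6)])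
  have \<kappa>: "cumulant \<mu> 4 = deformed.\<kappa> \<mu>" if "deformed \<mu> \<sigma> C t N A z" for t N A z
    using cumulant_4[OF assms(2,5) odd_moment_zero[OF assms(2,3)]] by (simp add: deformed.\<kappa>_def[OF that])
  \<comment> \<open>\<open>K5\<close> depends only on \<mu>, \<sigma> and C, so one polynomial
    serves all N and z.\<close>
  define K where "K = deformed.K5 \<mu> \<sigma> C"
  \<comment> \<open>At 1 / Im z its base is 1 + 1 / Im z, the value of t chosen below, which is at
    least 1 and at least 1 / Im z. The absolute value makes the coefficients nonnegative.\<close>
  define Q where "Q = Polynomial.smult \<bar>K\<bar> ([:1, 1:] ^ 189)"
  show ?thesis
    unfolding bigO_upper_def
  proof (intro exI[of _ Q] conjI allI impI)
    have "coeff ([:1, 1:] ^ n :: real poly) i \<ge> 0" for n i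
    proof (induction n arbitrary: i)
      case (Suc n)
      then show ?case by (auto simp: coeff_pCons split: nat.split intro!: add_nonneg_nonneg)
    qed (simp add: coeff_1)
    then show "0 \<le> coeff Q i" for i by (simp add: Q_def)
    fix N :: nat and z :: complex
    assume N: "1 \<le> N" and z: "0 < Im z"
    define t where "t = 1 + 1 / Im z"
    have "A N \<in> herm_mats N" using assms(10)[OF N] unfolding herm_mats_def by blast
    then have dl: "deformed \<mu> \<sigma> C t N (A N) z"
      using assms(1-3,7) i6 C N z by (simp add: deformed_def t_def)
    then interpret deformed \<mu> \<sigma> C t N "A N" z .
    have "cmod (mean_stieltjes (\<Omega> N) N (\<lambda>\<omega>. deformed_wigner N (W N \<omega>) (A N)) z - g_tilde \<sigma> (A N) z
        + E_tilde \<sigma> (cumulant \<mu> 4) N (A N) z / of_nat N)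
      = cmod (gN - gt z + ((complex_of_real \<sigma>)\<^sup>2 * deriv gt z - 1) * Lt / N)"
      unfolding mean_stieltjes_deformed[OF assms(9)[OF N]] \<kappa>[OF dl] E_tilde_def gt_def Lt_def ..
    also have "\<dots> \<le> K * t ^ 189 / (real N)\<^sup>2" unfolding K_def by (rule expansion)
    also have "\<dots> \<le> \<bar>K\<bar> * t ^ 189 / (real N)\<^sup>2"
      using t0 by (intro divide_right_mono mult_right_mono) auto
    also have "\<bar>K\<bar> * t ^ 189 = poly Q (1 / \<bar>Im z\<bar>)" using z unfolding Q_def poly_smult poly_power t_def by simp
    finally show "cmod (mean_stieltjes (\<Omega> N) N (\<lambda>\<omega>. deformed_wigner N (W N \<omega>) (A N)) z - g_tilde \<sigma> (A N) z
        + E_tilde \<sigma> (cumulant \<mu> 4) N (A N) z / of_nat N) \<le> poly Q (1 / \<bar>Im z\<bar>) / real N ^ 2" .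
  qed
qed

end
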